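(* Let $\phi\in\operatorname{Aut}(\Gamma)$. Let $X\in\mathcal O(\Gamma)$ (regarded as a graph of groups) contain a proper $\phi$-invariant sub-graph $A$ such that $X_\infty=X/A\in\partial_\infty\Delta_X$, and let $C=\operatorname{core}(A)$. Then $$\lambda_{\phi|_C}(\Delta_C)\le\lambda_\phi(\Delta_X).$$ Moreover the following are equivalent: (1) $X_\infty$ has not jumped in $\Delta_X$; (2) $\lambda_\phi(X_\infty)\ge\lambda_\phi(\Delta_X)$; (3) $\lambda_\phi(X_\infty)\ge\lambda_{\phi|_C}(\Delta_C)$. In particular, $\lambda_\phi(X_\infty)$ cannot belong to the (potentially empty) interval $(\lambda_{\phi|_C}(\Delta_C),\lambda_\phi(\Delta_X))$. Moreover, points of $\overline{\Delta_X}^\infty$ at which $\lambda_\phi$ takes the value $\lambda_\phi(\Delta_X)$ have not jumped in $\Delta_X$.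
   Context: **Setting.** $\Gamma=\bigsqcup_{i=1}^k\Gamma_i$ is a finite disjoint union of connected finite graphs of groups with trivial edge groups and non-trivial fundamental groups $H_i=\pi_1(\Gamma_i)$ (as graphs of groups), each $H_i$ being equipped with the free splitting given by the vertex groups of $\Gamma_i$. $\mathcal O(\Gamma_i)$ is the set of equivariant isometry classes of minimal metric simplicial $H_i$-trees (simplicial isometric actions) with trivial edge stabilisers such that: for each non-trivial vertex group $V$ of $\Gamma_i$ there is exactly one orbit of vertices with stabiliser conjugate to $V$ (non-free vertices); every other vertex has trivial stabiliser (free vertices); no free vertex has valence two. (If $H_i$ is itself a vertex group, this is a single point.) $\mathcal O(\Gamma)=\prod_i\mathcal O(\Gamma_i)$; a point $X=(X_1,\dots,X_k)$ is regarded as the forest $\bigsqcup_i X_i$ and identified with the quotient metric graph of groups $\underline X=\bigsqcup_iH_i\backslash X_i$; subgraphs of $X$ mean subgraphs of $\underline X$. **Bordification.** $\overline{\mathcal O(\Gamma)}^\infty$ is the set of tuples of minimal metric simplicial $H_i$-trees with trivial edge stabilisers in which all vertex groups of $\Gamma_i$ are elliptic (possibly with more elliptic elements), up to equivariant isometry. An (open) simplex $\Delta_X$ is the set of points equivariantly homeomorphic to $X$, parametrised by positive edge lengths; for $\Delta=\Delta_X\subset\mathcal O(\Gamma)$, its closure $\overline\Delta^\infty$ in $\overline{\mathcal O(\Gamma)}^\infty$ is obtained by allowing the lengths of the edges of proper subgraphs of $\underline X$ to be zero (with Euclidean topology), and $\partial_\infty\Delta=\overline\Delta^\infty\setminus\mathcal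 O(\Gamma)$. For a proper subgraph $A$, $X/A$ is obtained by collapsing each component of $A$ to a vertex whose group is the fundamental group of the component; $X/A\in\partial_\infty\Delta_X$ if and only if some component of $A$ carries a hyperbolic element. $\mathcal O(X/A)$ denotes the outer space defined by the splitting given by the vertex groups of $X/A$. A core graph is a graph of groups all of whose valence-one vertices have non-trivial vertex group; $\operatorname{core}(A)$ is the maximal core subgraph of $A$, obtained by recursively cutting edges ending at leaves with trivial vertex group. **Automorphisms and displacement.** $\operatorname{Aut}(\Gamma)$ is the group of tuples $\phi=(\sigma,\phi_1,\dots,\phi_k)$ with $\sigma$ a permutation of $\{1,\dots,k\}$ and $\phi_i:H_i\to H_{\sigma(i)}$ an isomorphism mapping each vertex group to a conjugate of a vertex group. $\phi X=(\phi_1X_{\sigma(1)},\dots,\phi_kX_{\sigma(k)})$, where $\phi_iX_{\sigma(i)}$ is $X_{\sigma(i)}$ with $H_i$ acting through $\phi_i$. $\Lambda(X,Y)$ is the minimum of $\operatorname{Lip}(f)$ over tuples $f$ of Lipschitz $H_i$-equivariant maps $f_i:X_i\to Y_i$. For $X\in\mathcal O(\Gamma)$, $\lambda_\phi(X)=\Lambda(X,\phi X)$; for a simplex $\Delta$, $\lambda_\phi(\Delta)=\inf_{Y\in\Delta}\lambda_\phi(Y)$. A straight map $f:X\to X$ (constant speed on each edge) represents $\phi$ if it maps $X_i$ to $X_{\sigma(i)}$ with $f(hx)=\phi_i(h)f(x)$. A subgraph $A$ is $\phi$-invariant if some straight map representing $\phi$ maps (the full preimage in the forest of) $A$ into itself.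 For a boundary point $X/A$: if $A$ is $\phi$-invariant, $\phi$ induces an element of $\operatorname{Aut}(X/A)$, still denoted $\phi$, and $\lambda_\phi(X/A)=\Lambda(X/A,\phi (X/A))$ computed in $\mathcal O(X/A)$; otherwise $\lambda_\phi(X/A)=\infty$. For $C=\operatorname{core}(A)$ with $A$ $\phi$-invariant, $\phi|_C$ is the induced element of $\operatorname{Aut}(C)$ (up to $\operatorname{Inn}(C)$), $C$ being a disjoint union of graphs of groups; $\Delta_C$ is the simplex of $\mathcal O(C)$ containing $C$ (with the metric induced from $X$), and $\lambda_{\phi|_C}(\Delta_C)=\inf_{Y\in\Delta_C}\lambda_{\phi|_C}(Y)$. **Jumping.** $P\in\overline\Delta^\infty$ has not jumped in $\Delta$ if there are points $P_i\in\Delta$ with $P_i\to P$ and $\lambda_\phi(P_i)\to\lambda_\phi(P)$ (points of $\mathcal O(\Gamma)$ are by convention regarded as not having jumped). *)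

theory Defs
  imports
    "HOL-Analysis.Analysis"
    "HOL-Algebra.Group_Action"
    "Graph_Theory.Digraph_Component"
    "Graph_Theory.Bidirected_Digraph"
begin

section \<open>Graphs of groups with trivial edge groups\<close>

text \<open>
  Underlying graphs are graphs in the sense of Serre: every geometric edge is a pair of arcs
  exchanged by the fixed-point free involution \<open>grev\<close> (loops and multiple edges are allowed).
\<close>

record ('a, 'b, 'g) graph_of_groups =
  ggraph :: "('a, 'b) pre_digraph"
  grev :: "'b \<Rightarrow> 'b"
  vgroup :: "'a \<Rightarrow> 'g monoid"

definition connected_finite_gog :: "('a, 'b, 'g) graph_of_groups \<Rightarrow> bool" where
  "connected_finite_gog \<Gamma> \<longleftrightarrow>
     fin_digraph (ggraph \<Gamma>) \<and> bidirected_digraph (ggraph \<Gamma>) (grev \<Gamma>) \<and>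
     strongly_connected (ggraph \<Gamma>) \<and>
     (\<forall>v\<in>verts (ggraph \<Gamma>). group (vgroup \<Gamma> v))"

datatype ('a, 'b, 'g) letter = Elt 'a 'g | Arc 'b

fun gpath :: "('a, 'b, 'g) graph_of_groups \<Rightarrow> 'a \<Rightarrow> ('a, 'b, 'g) letter list \<Rightarrow> 'a \<Rightarrow> bool" where
  "gpath \<Gamma> u [] w \<longleftrightarrow> u \<in> verts (ggraph \<Gamma>) \<and> u = w"
| "gpath \<Gamma> u (Elt v g # xs) w \<longleftrightarrow>
     u \<in> verts (ggraph \<Gamma>) \<and> v = u \<and> g \<in> carrier (vgroup \<Gamma> v) \<and> gpath \<Gamma> u xs w"
| "gpath \<Gamma> u (Arc e # xs) w \<longleftrightarrow> e \<in> arcs (ggraph \<Gamma>) \<and> tail (ggraph \<Gamma>) e = u \<and> gpath \<Gamma> (head (ggraph \<Gamma>) e) xs w"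

fun inv_letter :: "('a, 'b, 'g) graph_of_groups \<Rightarrow> ('a, 'b, 'g) letter \<Rightarrow> ('a, 'b, 'g) letter" where
  "inv_letter \<Gamma> (Elt v g) = Elt v (inv\<^bsub>vgroup \<Gamma> v\<^esub> g)"
| "inv_letter \<Gamma> (Arc e) = Arc (grev \<Gamma> e)"

definition gpath_inv ::
  "('a, 'b, 'g) graph_of_groups \<Rightarrow> ('a, 'b, 'g) letter list \<Rightarrow> ('a, 'b, 'g) letter list" where
  "gpath_inv \<Gamma> xs = rev (map (inv_letter \<Gamma>) xs)"

definition gloops :: "('a, 'b, 'g) graph_of_groups \<Rightarrow> 'a \<Rightarrow> ('a, 'b, 'g) letter list set" where
  "gloops \<Gamma> b = {xs. gpath \<Gamma> b xs b}"

text \<open>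
  The defining relations of the fundamental group.  The relations attached to edge group elements
  are absent because the edge groups are trivial.
\<close>

definition gmoves ::
  "('a, 'b, 'g) graph_of_groups \<Rightarrow> (('a, 'b, 'g) letter list \<times> ('a, 'b, 'g) letter list) set" where
  "gmoves \<Gamma> =
     {(xs @ [Elt v \<one>\<^bsub>vgroup \<Gamma> v\<^esub>] @ ys, xs @ ys) | xs ys v. True} \<union>
     {(xs @ [Elt v g, Elt v h] @ ys, xs @ [Elt v (g \<otimes>\<^bsub>vgroup \<Gamma> v\<^esub> h)] @ ys) | xs ys v g h. True} \<union>
     {(xs @ [Arc e, Arc (grev \<Gamma> e)] @ ys, xs @ ys) | xs ys e. True}"

definition ghomotopy ::
  "('a, 'b, 'g) graph_of_groups \<Rightarrow> 'a \<Rightarrow>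
   (('a, 'b, 'g) letter list \<times> ('a, 'b, 'g) letter list) set" where
  "ghomotopy \<Gamma> b =
     (let R = gmoves \<Gamma> \<inter> (gloops \<Gamma> b \<times> gloops \<Gamma> b) in (R \<union> R\<inverse>)\<^sup>*)"

definition pi1 ::
  "('a, 'b, 'g) graph_of_groups \<Rightarrow> 'a \<Rightarrow> ('a, 'b, 'g) letter list set monoid" where
  "pi1 \<Gamma> b =
     \<lparr>carrier = gloops \<Gamma> b // ghomotopy \<Gamma> b,
      mult = \<lambda>P Q. \<Union>p\<in>P. \<Union>q\<in>Q. ghomotopy \<Gamma> b `` {p @ q},
      one = ghomotopy \<Gamma> b `` {[]}\<rparr>"

definition vertex_subgroup ::
  "('a, 'b, 'g) graph_of_groups \<Rightarrow> 'a \<Rightarrow> ('a, 'b, 'g) letter list \<Rightarrow> 'a \<Rightarrow>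
   ('a, 'b, 'g) letter list set set" where
  "vertex_subgroup \<Gamma> b p v =
     (\<lambda>g. ghomotopy \<Gamma> b `` {p @ [Elt v g] @ gpath_inv \<Gamma> p}) ` carrier (vgroup \<Gamma> v)"

text \<open>
  The data on which outer space depends: finitely many groups, each with its non-trivial vertex
  groups, viewed as subgroups.  These are only meaningful up to conjugacy; all conjugates
  obtained from different paths are included.
\<close>

record ('i, 'h) splitting =
  idx :: "'i set"
  grp :: "'i \<Rightarrow> 'h monoid"
  vgrps :: "'i \<Rightarrow> 'h set set"

definition gog_splitting ::
  "'i set \<Rightarrow> ('i \<Rightarrow> ('a, 'b, 'g) graph_of_groups) \<Rightarrow> ('i \<Rightarrow> 'a) \<Rightarrow>
   ('i, ('a, 'b, 'g) letter list set) splitting" where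
  "gog_splitting I \<Gamma> b =
     \<lparr>idx = I,
      grp = (\<lambda>i. pi1 (\<Gamma> i) (b i)),
      vgrps = (\<lambda>i. {vertex_subgroup (\<Gamma> i) (b i) p v | p v.
                 gpath (\<Gamma> i) (b i) p v \<and> carrier (vgroup (\<Gamma> i) v) \<noteq> {\<one>\<^bsub>vgroup (\<Gamma> i) v\<^esub>}})\<rparr>"

definition gog_system ::
  "'i set \<Rightarrow> ('i \<Rightarrow> ('a, 'b, 'g) graph_of_groups) \<Rightarrow> ('i \<Rightarrow> 'a) \<Rightarrow> bool" where
  "gog_system I \<Gamma> b \<longleftrightarrow> finite I \<and>
     (\<forall>i\<in>I. connected_finite_gog (\<Gamma> i) \<and> b i \<in> verts (ggraph (\<Gamma> i)) \<and>
            carrier (pi1 (\<Gamma> i) (b i)) \<noteq> {\<one>\<^bsub>pi1 (\<Gamma> i) (b i)\<^esub>})"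


section \<open>Metric simplicial trees with a group action\<close>

text \<open>
  Trees have neither loops nor multiple edges, so an edge is encoded as the set of its two
  endpoints.  The record \<open>sgraph\<close> is also used for subgraphs.
\<close>

record 'v sgraph =
  sverts :: "'v set"
  sedges :: "'v set set"

record ('h, 'v) mtree = "'v sgraph" +
  act :: "'h \<Rightarrow> 'v \<Rightarrow> 'v"
  len :: "'v set \<Rightarrow> real"

definition is_path :: "('v, 'z) sgraph_scheme \<Rightarrow> 'v \<Rightarrow> 'v list \<Rightarrow> 'v \<Rightarrow> bool" where
  "is_path T u p w \<longleftrightarrow> p \<noteq> [] \<and> hd p = u \<and> last p = w \<and> distinct p \<and> set p \<subseteq> sverts T \<and>
     successively (\<lambda>x y. {x, y} \<in> sedges T) p"

definition simplicial_tree :: "('v, 'z) sgraph_scheme \<Rightarrow> bool" where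
  "simplicial_tree T \<longleftrightarrow> sverts T \<noteq> {} \<and> (\<forall>e\<in>sedges T. e \<subseteq> sverts T \<and> card e = 2) \<and>
     (\<forall>u\<in>sverts T. \<forall>w\<in>sverts T. \<exists>!p. is_path T u p w)"

definition equivariant_length :: "'h monoid \<Rightarrow> ('h, 'v) mtree \<Rightarrow> bool" where
  "equivariant_length G T \<longleftrightarrow>
     (\<forall>e\<in>sedges T. 0 < len T e \<and> (\<forall>h\<in>carrier G. len T (act T h ` e) = len T e))"

text \<open>
  Edge stabilisers are setwise, so their triviality excludes inversions.
\<close>

definition metric_tree :: "'h monoid \<Rightarrow> ('h, 'v) mtree \<Rightarrow> bool" where
  "metric_tree G T \<longleftrightarrow> simplicial_tree T \<and> group_action G (sverts T) (act T) \<and>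
     (\<forall>h\<in>carrier G. \<forall>e\<in>sedges T. act T h ` e \<in> sedges T) \<and>
     equivariant_length G T \<and>
     (\<forall>e\<in>sedges T. \<forall>h\<in>carrier G. act T h ` e = e \<longrightarrow> h = \<one>\<^bsub>G\<^esub>)"

definition minimal_tree :: "'h monoid \<Rightarrow> ('h, 'v) mtree \<Rightarrow> bool" where
  "minimal_tree G T \<longleftrightarrow> metric_tree G T \<and>
     (\<forall>W \<subseteq> sverts T. W \<noteq> {} \<and> (\<forall>h\<in>carrier G. act T h ` W \<subseteq> W) \<and>
        (\<forall>u\<in>W. \<forall>w\<in>W. \<exists>p. is_path T u p w \<and> set p \<subseteq> W) \<longrightarrow> W = sverts T)"

abbreviation vstab :: "'h monoid \<Rightarrow> ('h, 'v) mtree \<Rightarrow> 'v \<Rightarrow> 'h set" where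
  "vstab G T v \<equiv> Group_Action.stabilizer G (act T) v"

abbreviation vorbit :: "'h monoid \<Rightarrow> ('h, 'v) mtree \<Rightarrow> 'v \<Rightarrow> 'v set" where
  "vorbit G T v \<equiv> Group_Action.orbit G (act T) v"

definition free_vertex :: "'h monoid \<Rightarrow> ('h, 'v) mtree \<Rightarrow> 'v \<Rightarrow> bool" where
  "free_vertex G T v \<longleftrightarrow> vstab G T v = {\<one>\<^bsub>G\<^esub>}"

definition valence :: "('v, 'z) sgraph_scheme \<Rightarrow> 'v \<Rightarrow> nat" where
  "valence T v = card {e \<in> sedges T. v \<in> e}"

definition conjugate_subgroup :: "'h monoid \<Rightarrow> 'h set \<Rightarrow> 'h set \<Rightarrow> bool" where
  "conjugate_subgroup G U V \<longleftrightarrow>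
     (\<exists>h\<in>carrier G. U = (\<lambda>x. h \<otimes>\<^bsub>G\<^esub> x \<otimes>\<^bsub>G\<^esub> inv\<^bsub>G\<^esub> h) ` V)"

text \<open>
  Geometric realisation in barycentric coordinates.  The realisation does not depend on the edge
  lengths, which enter through the path metric \<open>tdist\<close> (the infimum of the lengths of piecewise
  linear chains).
\<close>

definition closed_edge :: "'v set \<Rightarrow> ('v \<Rightarrow> real) set" where
  "closed_edge e = {p. (\<forall>v. 0 \<le> p v) \<and> (\<forall>v. v \<notin> e \<longrightarrow> p v = 0) \<and> (\<Sum>v\<in>e. p v) = 1}"

definition vpoint :: "'v \<Rightarrow> 'v \<Rightarrow> real" where
  "vpoint v = indicator {v}"

definition points :: "('v, 'z) sgraph_scheme \<Rightarrow> ('v \<Rightarrow> real) set" where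
  "points T = vpoint ` sverts T \<union> (\<Union>e\<in>sedges T. closed_edge e)"

definition point_act :: "('h, 'v) mtree \<Rightarrow> 'h \<Rightarrow> ('v \<Rightarrow> real) \<Rightarrow> 'v \<Rightarrow> real" where
  "point_act T h p =
     (\<lambda>w. if w \<in> sverts T then p (inv_into (sverts T) (act T h) w) else 0)"

definition tdist :: "('h, 'v) mtree \<Rightarrow> ('v \<Rightarrow> real) \<Rightarrow> ('v \<Rightarrow> real) \<Rightarrow> real" where
  "tdist T p q =
     Inf {(\<Sum>k<n. len T (e k) * ((\<Sum>v\<in>e k. \<bar>c k v - c (Suc k) v\<bar>) / 2)) | n c e.
       c 0 = p \<and> c n = q \<and>
       (\<forall>k<n. e k \<in> sedges T \<and> c k \<in> closed_edge (e k) \<and> c (Suc k) \<in> closed_edge (e k))}"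


section \<open>Outer space, automorphisms and displacement\<close>

type_synonym ('i, 'h, 'v) forest = "'i \<Rightarrow> ('h, 'v) mtree"

text \<open>
  Membership of representatives in the set of equivariant isometry classes.  A tree in which a free
  vertex of valence two has its orbit as the whole vertex set is a line on which the group acts
  freely; the quotient is a circle, which has to carry at least one vertex.  Apart from this
  case free vertices of valence two are excluded.
\<close>

definition outer_space :: "('i, 'h) splitting \<Rightarrow> ('i, 'h, 'v) forest set" where
  "outer_space S = {X. \<forall>i\<in>idx S.
     minimal_tree (grp S i) (X i) \<and>
     (\<forall>V\<in>vgrps S i. \<exists>v\<in>sverts (X i).
        {w \<in> sverts (X i). conjugate_subgroup (grp S i) (vstab (grp S i) (X i) w) V}
          = vorbit (grp S i) (X i) v) \<and>
     (\<forall>w\<in>sverts (X i). free_vertex (grp S i) (X i) w \<or>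
        (\<exists>V\<in>vgrps S i. conjugate_subgroup (grp S i) (vstab (grp S i) (X i) w) V)) \<and>
     (\<forall>w\<in>sverts (X i). free_vertex (grp S i) (X i) w \<and> valence (X i) w = 2 \<longrightarrow>
        sverts (X i) = vorbit (grp S i) (X i) w)}"

definition bordification :: "('i, 'h) splitting \<Rightarrow> ('i, 'h, 'v) forest set" where
  "bordification S = {X. \<forall>i\<in>idx S. minimal_tree (grp S i) (X i) \<and>
     (\<forall>V\<in>vgrps S i. \<exists>v\<in>sverts (X i). V \<subseteq> vstab (grp S i) (X i) v)}"

text \<open>
  The open simplex of \<open>X\<close>, in its parametrisation by positive edge lengths.
\<close>

definition open_simplex :: "('i, 'h) splitting \<Rightarrow> ('i, 'h, 'v) forest \<Rightarrow> ('i, 'h, 'v) forest set" where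
  "open_simplex S X = {Y. \<forall>i\<in>idx S.
     Y i = (X i)\<lparr>len := len (Y i)\<rparr> \<and> equivariant_length (grp S i) (Y i)}"

record ('i, 'h) system_map =
  perm :: "'i \<Rightarrow> 'i"
  maps :: "'i \<Rightarrow> 'h \<Rightarrow> 'h"

definition Aut :: "('i, 'h) splitting \<Rightarrow> ('i, 'h) system_map set" where
  "Aut S = {\<phi>. bij_betw (perm \<phi>) (idx S) (idx S) \<and>
     (\<forall>i\<in>idx S. maps \<phi> i \<in> iso (grp S i) (grp S (perm \<phi> i)) \<and>
        (\<forall>V\<in>vgrps S i. \<exists>W\<in>vgrps S (perm \<phi> i).
           conjugate_subgroup (grp S (perm \<phi> i)) (maps \<phi> i ` V) W))}"

text \<open>The forest \<open>\<phi>X\<close>.\<close>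

definition twist :: "('i, 'h) system_map \<Rightarrow> ('i, 'h, 'v) forest \<Rightarrow> ('i, 'h, 'v) forest" where
  "twist \<phi> X = (\<lambda>i. (X (perm \<phi> i))\<lparr>act := \<lambda>h. act (X (perm \<phi> i)) (maps \<phi> i h)\<rparr>)"

definition equivariant_maps ::
  "('i, 'h) splitting \<Rightarrow> ('i, 'h, 'v) forest \<Rightarrow> ('i, 'h, 'w) forest \<Rightarrow>
   ('i \<Rightarrow> ('v \<Rightarrow> real) \<Rightarrow> 'w \<Rightarrow> real) set" where
  "equivariant_maps S X Y = {f. \<forall>i\<in>idx S.
     f i \<in> points (X i) \<rightarrow> points (Y i) \<and>
     (\<forall>h\<in>carrier (grp S i). \<forall>p\<in>points (X i).
        f i (point_act (X i) h p) = point_act (Y i) h (f i p))}"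

definition Lip :: "('h, 'v) mtree \<Rightarrow> ('h, 'w) mtree \<Rightarrow> (('v \<Rightarrow> real) \<Rightarrow> 'w \<Rightarrow> real) \<Rightarrow> ereal" where
  "Lip T T' f = Inf {ereal L | L. 0 \<le> L \<and>
     (\<forall>p\<in>points T. \<forall>q\<in>points T. tdist T' (f p) (f q) \<le> L * tdist T p q)}"

text \<open>
  \<open>\<Lambda>(X,Y)\<close>.  The infimum is a minimum whenever a Lipschitz equivariant map exists; maps that are not
  Lipschitz have \<open>Lip = \<infinity>\<close> and do not contribute.
\<close>

definition stretch :: "('i, 'h) splitting \<Rightarrow> ('i, 'h, 'v) forest \<Rightarrow> ('i, 'h, 'w) forest \<Rightarrow> ereal" where
  "stretch S X Y = (INF f\<in>equivariant_maps S X Y. SUP i\<in>idx S. Lip (X i) (Y i) (f i))"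

definition displacement ::
  "('i, 'h) splitting \<Rightarrow> ('i, 'h) system_map \<Rightarrow> ('i, 'h, 'v) forest \<Rightarrow> ereal" where
  "displacement S \<phi> X = stretch S X (twist \<phi> X)"

definition simplex_displacement ::
  "('i, 'h) splitting \<Rightarrow> ('i, 'h) system_map \<Rightarrow> ('i, 'h, 'v) forest \<Rightarrow> ereal" where
  "simplex_displacement S \<phi> X = (INF Y\<in>open_simplex S X. displacement S \<phi> Y)"


section \<open>Subgraphs and collapses\<close>

text \<open>
  A subgraph of the quotient graph of groups is encoded by its full preimage in the forest, that
  is, by an invariant subgraph of each tree.
\<close>

definition subgraph_of :: "'h monoid \<Rightarrow> ('h, 'v) mtree \<Rightarrow> 'v sgraph \<Rightarrow> bool" where
  "subgraph_of G T A \<longleftrightarrow>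
     sverts A \<subseteq> sverts T \<and> sedges A \<subseteq> sedges T \<and> (\<forall>e\<in>sedges A. e \<subseteq> sverts A) \<and>
     (\<forall>h\<in>carrier G. act T h ` sverts A \<subseteq> sverts A \<and>
        (\<forall>e\<in>sedges A. act T h ` e \<in> sedges A))"

definition proper_subgraph ::
  "('i, 'h) splitting \<Rightarrow> ('i, 'h, 'v) forest \<Rightarrow> ('i \<Rightarrow> 'v sgraph) \<Rightarrow> bool" where
  "proper_subgraph S X A \<longleftrightarrow> (\<forall>i\<in>idx S. subgraph_of (grp S i) (X i) (A i)) \<and>
     (\<exists>i\<in>idx S. sverts (A i) \<noteq> sverts (X i) \<or> sedges (A i) \<noteq> sedges (X i))"

definition straight ::
  "('i, 'h) splitting \<Rightarrow> ('i, 'h, 'v) forest \<Rightarrow> ('i, 'h, 'w) forest \<Rightarrow>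
   ('i \<Rightarrow> ('v \<Rightarrow> real) \<Rightarrow> 'w \<Rightarrow> real) \<Rightarrow> bool" where
  "straight S X Y f \<longleftrightarrow> (\<forall>i\<in>idx S. \<forall>e\<in>sedges (X i). \<exists>c\<ge>0. \<forall>p\<in>closed_edge e. \<forall>q\<in>closed_edge e.
     tdist (Y i) (f i p) (f i q) = c * tdist (X i) p q)"

definition invariant_subgraph ::
  "('i, 'h) splitting \<Rightarrow> ('i, 'h) system_map \<Rightarrow> ('i, 'h, 'v) forest \<Rightarrow> ('i \<Rightarrow> 'v sgraph) \<Rightarrow> bool" where
  "invariant_subgraph S \<phi> X A \<longleftrightarrow>
     (\<exists>f\<in>equivariant_maps S X (twist \<phi> X). straight S X (twist \<phi> X) f \<and>
        (\<forall>i\<in>idx S. f i ` points (A i) \<subseteq> points (A (perm \<phi> i))))"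

text \<open>
  The vertex set of the component of \<open>v\<close>; this is \<open>{v}\<close> if \<open>v\<close> lies on no edge of \<open>A\<close>, and in
  particular if \<open>v\<close> is not a vertex of \<open>A\<close>.
\<close>

definition component :: "('v, 'z) sgraph_scheme \<Rightarrow> 'v \<Rightarrow> 'v set" where
  "component A v = {(x, y). {x, y} \<in> sedges A}\<^sup>* `` {v}"

definition collapse_tree :: "('h, 'v) mtree \<Rightarrow> 'v sgraph \<Rightarrow> ('h, 'v set) mtree" where
  "collapse_tree T A =
     \<lparr>sverts = component A ` sverts T,
      sedges = (\<lambda>e. component A ` e) ` (sedges T - sedges A),
      act = (\<lambda>h. restrict (\<lambda>P. act T h ` P) (component A ` sverts T)),
      len = (\<lambda>d. len T (THE e. e \<in> sedges T - sedges A \<and> component A ` e = d))\<rparr>"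

definition collapse ::
  "('i, 'h, 'v) forest \<Rightarrow> ('i \<Rightarrow> 'v sgraph) \<Rightarrow> ('i, 'h, 'v set) forest" where
  "collapse X A = (\<lambda>i. collapse_tree (X i) (A i))"

definition simplex_closure ::
  "('i, 'h) splitting \<Rightarrow> ('i, 'h, 'v) forest \<Rightarrow> ('i, 'h, 'v set) forest set" where
  "simplex_closure S X =
     {P \<in> bordification S. \<exists>Y\<in>open_simplex S X. \<exists>A. proper_subgraph S X A \<and> P = collapse Y A}"

definition simplex_boundary ::
  "('i, 'h) splitting \<Rightarrow> ('i, 'h, 'v) forest \<Rightarrow> ('i, 'h, 'v set) forest set" where
  "simplex_boundary S X = simplex_closure S X - outer_space S"

text \<open>
  \<open>\<lambda>\<^sub>\<phi>\<close> on the closure of the simplex of \<open>X\<close>.  Adding isolated vertices to \<open>A\<close> does not change \<open>Y/A\<close>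
  but may affect invariance, so the value at \<open>P\<close> is finite as soon as one subgraph \<open>A\<close> with
  \<open>P = Y/A\<close> is invariant.
\<close>

definition closure_displacement ::
  "('i, 'h) splitting \<Rightarrow> ('i, 'h) system_map \<Rightarrow> ('i, 'h, 'v) forest \<Rightarrow>
   ('i, 'h, 'v set) forest \<Rightarrow> ereal" where
  "closure_displacement S \<phi> X P =
     (if P \<in> outer_space S \<or>
         (\<exists>Y\<in>open_simplex S X. \<exists>A. proper_subgraph S X A \<and> P = collapse Y A \<and>
            invariant_subgraph S \<phi> Y A)
      then displacement S \<phi> P else \<infinity>)"

text \<open>
  Convergence in the Euclidean topology of the closed simplex; the coordinates of \<open>Y/A\<close> vanish on
  the edges of \<open>A\<close>.
\<close>

definition simplex_tendsto ::
  "('i, 'h) splitting \<Rightarrow> ('i, 'h, 'v) forest \<Rightarrow> (nat \<Rightarrow> ('i, 'h, 'v) forest) \<Rightarrow>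
   ('i, 'h, 'v set) forest \<Rightarrow> bool" where
  "simplex_tendsto S X Q P \<longleftrightarrow>
     (\<exists>Y\<in>open_simplex S X. \<exists>A. proper_subgraph S X A \<and> P = collapse Y A \<and>
        (\<forall>i\<in>idx S. \<forall>e\<in>sedges (X i).
           (\<lambda>n. len (Q n i) e) \<longlonglongrightarrow> (if e \<in> sedges (A i) then 0 else len (Y i) e)))"

definition not_jumped ::
  "('i, 'h) splitting \<Rightarrow> ('i, 'h) system_map \<Rightarrow> ('i, 'h, 'v) forest \<Rightarrow>
   ('i, 'h, 'v set) forest \<Rightarrow> bool" where
  "not_jumped S \<phi> X P \<longleftrightarrow> P \<in> outer_space S \<or>
     (\<exists>Q. (\<forall>n. Q n \<in> open_simplex S X) \<and> simplex_tendsto S X Q P \<and>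
        (\<lambda>n. displacement S \<phi> (Q n)) \<longlonglongrightarrow> closure_displacement S \<phi> X P)"


section \<open>The core of a subgraph and the induced automorphism\<close>

definition set_stab :: "'h monoid \<Rightarrow> ('h, 'v) mtree \<Rightarrow> 'v set \<Rightarrow> 'h set" where
  "set_stab G T P = {h \<in> carrier G. act T h ` P = P}"

text \<open>
  At a vertex with trivial stabiliser the valence in the tree equals the valence in the quotient
  graph of groups, and the setwise stabiliser of a component of the preimage is the fundamental group
  of its image.  Components with trivial fundamental group are not regarded as core graphs.
\<close>

definition core_graph :: "'h monoid \<Rightarrow> ('h, 'v) mtree \<Rightarrow> 'v sgraph \<Rightarrow> bool" where
  "core_graph G T C \<longleftrightarrow> subgraph_of G T C \<and>
     (\<forall>v\<in>sverts C. valence C v = 1 \<longrightarrow> \<not> free_vertex G T v) \<and>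
     (\<forall>v\<in>sverts C. set_stab G T (component C v) \<noteq> {\<one>\<^bsub>G\<^esub>})"

text \<open>
  The maximal core subgraph: a union of core subgraphs is again one.
\<close>

definition core :: "'h monoid \<Rightarrow> ('h, 'v) mtree \<Rightarrow> 'v sgraph \<Rightarrow> 'v sgraph" where
  "core G T A =
     (let \<C> = {C. core_graph G T C \<and> sverts C \<subseteq> sverts A \<and> sedges C \<subseteq> sedges A}
      in \<lparr>sverts = \<Union> (sverts ` \<C>), sedges = \<Union> (sedges ` \<C>)\<rparr>)"

definition core_components ::
  "('i, 'h) splitting \<Rightarrow> ('i, 'h, 'v) forest \<Rightarrow> ('i \<Rightarrow> 'v sgraph) \<Rightarrow> 'i \<Rightarrow> 'v set set" where
  "core_components S X A i =
     (let C = core (grp S i) (X i) (A i) in component C ` sverts C)"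

text \<open>
  The components of \<open>core(A)\<close> in the quotient are the orbits of components of its preimage, so they are
  indexed by a set \<open>J\<close> of representatives.
\<close>

definition core_representatives ::
  "('i, 'h) splitting \<Rightarrow> ('i, 'h, 'v) forest \<Rightarrow> ('i \<Rightarrow> 'v sgraph) \<Rightarrow> ('i \<times> 'v set) set \<Rightarrow> bool" where
  "core_representatives S X A J \<longleftrightarrow>
     J \<subseteq> Sigma (idx S) (core_components S X A) \<and>
     (\<forall>i\<in>idx S. \<forall>P\<in>core_components S X A i.
        \<exists>!Q. (i, Q) \<in> J \<and> (\<exists>h\<in>carrier (grp S i). act (X i) h ` P = Q))"

definition core_splitting ::
  "('i, 'h) splitting \<Rightarrow> ('i, 'h, 'v) forest \<Rightarrow> ('i \<times> 'v set) set \<Rightarrow>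
   ('i \<times> 'v set, 'h) splitting" where
  "core_splitting S X J =
     \<lparr>idx = J,
      grp = (\<lambda>(i, P). (grp S i)\<lparr>carrier := set_stab (grp S i) (X i) P\<rparr>),
      vgrps = (\<lambda>(i, P). {vstab (grp S i) (X i) v | v. v \<in> P \<and> \<not> free_vertex (grp S i) (X i) v})\<rparr>"

text \<open>
  A component of \<open>core(A)\<close> may have free vertices of valence two.  As a point of its outer space it
  carries the coarser simplicial structure in which they are no longer vertices; on a circle one of
  them is kept.
\<close>

definition essential_vertices :: "'h monoid \<Rightarrow> ('h, 'v) mtree \<Rightarrow> 'v set" where
  "essential_vertices G T =
     (let W = {v \<in> sverts T. \<not> (free_vertex G T v \<and> valence T v = 2)}
      in if W \<noteq> {} then W else vorbit G T (SOME v. v \<in> sverts T))"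

definition unsubdivide :: "'h monoid \<Rightarrow> ('h, 'v) mtree \<Rightarrow> ('h, 'v) mtree" where
  "unsubdivide G T =
     (let W = essential_vertices G T
      in \<lparr>sverts = W,
          sedges = {{u, w} | u w. u \<in> W \<and> w \<in> W \<and> u \<noteq> w \<and>
                      (\<exists>p. is_path T u p w \<and> set p \<inter> W = {u, w})},
          act = (\<lambda>h. restrict (act T h) W),
          len = (\<lambda>e. THE d. \<exists>u w. e = {u, w} \<and> d = tdist T (vpoint u) (vpoint w))\<rparr>)"

definition core_forest ::
  "('i, 'h) splitting \<Rightarrow> ('i, 'h, 'v) forest \<Rightarrow> ('i \<Rightarrow> 'v sgraph) \<Rightarrow> ('i \<times> 'v set) set \<Rightarrow>
   ('i \<times> 'v set, 'h, 'v) forest" where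
  "core_forest S X A J = (\<lambda>(i, P). unsubdivide (grp (core_splitting S X J) (i, P))
     \<lparr>sverts = P,
      sedges = {e \<in> sedges (core (grp S i) (X i) (A i)). e \<subseteq> P},
      act = (\<lambda>h. restrict (act (X i) h) P),
      len = len (X i)\<rparr>)"

text \<open>
  \<open>\<psi>\<close> represents the automorphism of \<open>core(A)\<close> induced by \<open>\<phi>\<close>.  Since a non-trivial subgroup
  stabilises at most one component, the conjugating elements are unique up to the component groups.
\<close>

definition induced_on_core ::
  "('i, 'h) splitting \<Rightarrow> ('i, 'h) system_map \<Rightarrow> ('i, 'h, 'v) forest \<Rightarrow> ('i \<times> 'v set) set \<Rightarrow>
   ('i \<times> 'v set, 'h) system_map \<Rightarrow> bool" where
  "induced_on_core S \<phi> X J \<psi> \<longleftrightarrow> \<psi> \<in> Aut (core_splitting S X J) \<and>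
     (\<forall>i P. (i, P) \<in> J \<longrightarrow> fst (perm \<psi> (i, P)) = perm \<phi> i \<and>
        (\<exists>h\<in>carrier (grp S (perm \<phi> i)). \<forall>g\<in>set_stab (grp S i) (X i) P.
           maps \<psi> (i, P) g =
             inv\<^bsub>grp S (perm \<phi> i)\<^esub> h \<otimes>\<^bsub>grp S (perm \<phi> i)\<^esub> maps \<phi> i g \<otimes>\<^bsub>grp S (perm \<phi> i)\<^esub> h))"

end

theory Submission
  imports Defs
begin

text \<open>
  Let \<open>Y\<^sub>\<tau>\<close> have the edge lengths of \<open>X\<close> outside \<open>A\<close> and \<open>\<tau>\<close> times a given metric on \<open>A\<close>.  A nearly
  optimal map of \<open>Y\<^sub>\<tau>\<close> descends to \<open>X/A\<close>, so the displacement is lower semicontinuous as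
  \<open>\<tau> \<longlonglongrightarrow> 0\<close>.  Conversely, an \<open>L\<close>-Lipschitz map of \<open>X/A\<close> lifts to \<open>Y\<^sub>\<tau>\<close> with constant close to \<open>L\<close>
  as soon as the components of \<open>A\<close> with non-trivial stabiliser admit an equivariant map of constant
  \<open>L\<close> for the given metric.  Such maps arise by projecting a map of a point of the simplex to the components of \<open>A\<close>,
  or from maps of the core, since \<open>A\<close> retracts onto it.  Projecting to the core also gives
  the inequality between the two infima.
\<close>

text \<open>What makes the boundary value accessible is rigidity: edge stabilisers are trivial, so a
  non-trivial element fixes at most one point of a tree. An equivariant map therefore has no choice
  at a vertex of \<open>X/A\<close> with non-trivial stabiliser, and two maps of different origin
  agree there; at the other vertices the action is free and values may be prescribed at will. This
  is why a map of \<open>X/A\<close> can be glued to a map of \<open>A\<close>. The factor \<tau>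
  applies to source and target alike, so the estimate inside \<open>A\<close> is the same for all
  \<tau>, while outside \<open>A\<close> lifting costs a multiple of \<tau>, absorbed by any gap
  between two constants. These multiples must be uniform over infinitely many edges; hence the
  finiteness of the orbits, extracted from the finite graph of groups. Distances and displacements
  are handled as infima: maps are built edge by edge from nearly shortest curves, with strict
  inequalities in place of optimal maps. The core is measured in its own outer space, where free
  vertices of valence two are forgotten; near-isometries in both directions join the two
  structures.\<close>

section \<open>Paths and separation in forests\<close>

definition adj :: "'v set set \<Rightarrow> ('v \<times> 'v) set" where
  "adj E = {(x, y). {x, y} \<in> E}"

lemma adj_iff [simp]: "(x, y) \<in> adj E \<longleftrightarrow> {x, y} \<in> E"
  by (simp add: adj_def)

abbreviation joined :: "'v set set \<Rightarrow> 'v \<Rightarrow> 'v \<Rightarrow> bool" where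
  "joined E u w \<equiv> (u, w) \<in> (adj E)\<^sup>*"

lemma component_adj: "component A v = (adj (sedges A))\<^sup>* `` {v}"
  by (simp add: component_def adj_def)

lemma in_component [simp]: "w \<in> component A v \<longleftrightarrow> joined (sedges A) v w"
  by (simp add: component_adj)

lemma adj_sym: "joined E u w \<Longrightarrow> joined E w u"
proof -
  have "sym (adj E)" by (auto simp: sym_def insert_commute)
  thus "joined E u w \<Longrightarrow> joined E w u" by (meson sym_rtrancl symD)
qed

lemma adj_mono: "joined E u w \<Longrightarrow> E \<subseteq> E' \<Longrightarrow> joined E' u w"
proof -
  assume a: "joined E u w" "E \<subseteq> E'"
  hence "adj E \<subseteq> adj E'" by auto
  with a(1) show ?thesis using rtrancl_mono by blast
qed

lemma component_eqI: "joined (sedges A) u w \<Longrightarrow> component A u = component A w"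
  unfolding component_adj using adj_sym by (fastforce intro: rtrancl_trans)

lemma component_eq_iff: "component A u = component A w \<longleftrightarrow> joined (sedges A) u w"
  using component_eqI in_component rtrancl.rtrancl_refl by metis

text \<open>Only the edges constrain the vertices, so one path can be read in several subgraphs of
  the same tree; \<open>is_path\<close> is tied to a vertex set.\<close>

definition epath :: "'v set set \<Rightarrow> 'v \<Rightarrow> 'v list \<Rightarrow> 'v \<Rightarrow> bool" where
  "epath E u p w \<longleftrightarrow> p \<noteq> [] \<and> hd p = u \<and> last p = w \<and> distinct p \<and>
     successively (\<lambda>x y. {x, y} \<in> E) p"

lemma rtrancl_epath: "joined E u w \<Longrightarrow> \<exists>p. epath E u p w"
proof (induction rule: rtrancl_induct)
  case base
  thus ?case by (intro exI[of _ "[u]"]) (simp add: epath_def)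
next
  case (step y z)
  then obtain p where p: "epath E u p y" by blast
  show ?case
  proof (cases "z \<in> set p")
    case True
    then obtain xs ys where "p = xs @ z # ys" by (meson split_list)
    hence "epath E u (xs @ [z]) z"
      using p by (auto simp: epath_def successively_append_iff hd_append split: if_splits)
    thus ?thesis by blast
  next
    case False
    hence "epath E u (p @ [z]) z"
      using p step by (auto simp: epath_def successively_append_iff)
    thus ?thesis by blast
  qed
qed

lemma epath_rtrancl: "epath E u p w \<Longrightarrow> joined E u w"
proof (induction p arbitrary: u)
  case Nil thus ?case by (simp add: epath_def)
next
  case (Cons a p)
  show ?case
  proof (cases p)
    case Nil thus ?thesis using Cons.prems by (auto simp: epath_def)
  next
    case (Cons b q)
    hence "epath E b p w" "{u, b} \<in> E" using Cons.prems by (auto simp: epath_def)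
    thus ?thesis using Cons.IH by (meson adj_iff converse_rtrancl_into_rtrancl)
  qed
qed

lemma rtrancl_walk:
  assumes "joined E u w"
  shows "\<exists>x n. x 0 = u \<and> x n = w \<and> inj_on x {..n} \<and> (\<forall>i<n. {x i, x (Suc i)} \<in> E)"
proof -
  obtain p where p: "epath E u p w" using rtrancl_epath[OF assms] by blast
  hence s: "\<forall>i. Suc i < length p \<longrightarrow> {p ! i, p ! Suc i} \<in> E"
    by (auto simp: epath_def successively_conv_nth)
  have "p \<noteq> []" using p by (auto simp: epath_def)
  hence l: "Suc (length p - 1) = length p" by simp
  have "inj_on (\<lambda>i. p ! i) {..length p - 1}"
    using p l by (auto simp: epath_def inj_on_def nth_eq_iff_index_eq less_Suc_eq_le[symmetric])
  thus ?thesis using p s l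
    by (intro exI[of _ "\<lambda>i. p ! i"] exI[of _ "length p - 1"])
      (auto simp: epath_def hd_conv_nth last_conv_nth)
qed

lemma walk_rtrancl:
  assumes "\<And>k. i \<le> k \<Longrightarrow> k < j \<Longrightarrow> {x k, x (Suc k)} \<in> E" "i \<le> j"
  shows "joined E (x i) (x j)"
  using assms(2,1)
proof (induction j rule: dec_induct)
  case base show ?case by simp
next
  case (step n)
  hence "joined E (x i) (x n)" "{x n, x (Suc n)} \<in> E" by auto
  thus ?case by (meson adj_iff rtrancl.rtrancl_into_rtrancl)
qed

lemma adj_vertex_transfer:
  assumes "joined E u w" "u \<in> V" "\<And>a b. a \<in> V \<Longrightarrow> {a, b} \<in> E \<Longrightarrow> b \<in> V"
  shows "w \<in> V"
  using assms(1)
proof (induction rule: rtrancl_induct)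
  case (step y z)
  thus ?case using assms(3)[of y z] by simp
qed (rule assms(2))

text \<open>At most one simple path between two vertices, so really a forest: the property passes to
  every set of edges, in particular to those of \<open>A\<close> and of the core.\<close>

definition edge_tree :: "'v set set \<Rightarrow> bool" where
  "edge_tree E \<longleftrightarrow> (\<forall>e\<in>E. card e = 2) \<and>
     (\<forall>u w p q. epath E u p w \<and> epath E u q w \<longrightarrow> p = q)"

lemma epath_mono: "epath E u p w \<Longrightarrow> E \<subseteq> E' \<Longrightarrow> epath E' u p w"
  unfolding epath_def by (auto elim: successively_mono)

lemma edge_tree_mono: "edge_tree E \<Longrightarrow> E' \<subseteq> E \<Longrightarrow> edge_tree E'"
  unfolding edge_tree_def by (meson epath_mono subsetD)

lemma edge_neq: "edge_tree E \<Longrightarrow> {u, w} \<in> E \<Longrightarrow> u \<noteq> w"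
  unfolding edge_tree_def by fastforce

text \<open>Both connections contain simple paths, which are paths in \<open>E\<close> and hence
  equal; the edges of this path lie in both sets.\<close>

lemma tree_adj_Int:
  assumes "edge_tree E" "E1 \<subseteq> E" "E2 \<subseteq> E" "joined E1 u w" "joined E2 u w"
  shows "joined (E1 \<inter> E2) u w"
proof -
  obtain p q where pq: "epath E1 u p w" "epath E2 u q w" using assms rtrancl_epath by meson
  hence "p = q" using assms(1-3) epath_mono unfolding edge_tree_def by metis
  hence "epath (E1 \<inter> E2) u p w"
    using pq by (auto simp: epath_def successively_conv_nth)
  thus ?thesis by (rule epath_rtrancl)
qed

text \<open>Intersecting the connection in \<open>E'\<close> with the path that consists of the edge
  alone leaves no room for another edge. Most uses of the tree property go through this
  form.\<close>

lemma tree_edge_in: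
  assumes "edge_tree E" "{u, w} \<in> E" "E' \<subseteq> E" "joined E' u w"
  shows "{u, w} \<in> E'"
proof -
  have "joined ({{u, w}} \<inter> E') u w"
    using assms by (intro tree_adj_Int) auto
  moreover have "u \<noteq> w" using assms edge_neq by metis
  ultimately have "adj ({{u, w}} \<inter> E') \<noteq> {}" by auto
  thus ?thesis by (auto simp: adj_def)
qed

text \<open>Uniqueness in \<open>simplicial_tree\<close> concerns paths inside the vertex set. A
  path with at least two vertices lies there because its edges do; between equal ends only the
  one-vertex path is simple.\<close>

lemma simplicial_tree_edge_tree:
  assumes "simplicial_tree T"
  shows "edge_tree (sedges T)"
proof -
  have e: "\<And>e. e \<in> sedges T \<Longrightarrow> e \<subseteq> sverts T \<and> card e = 2"
    and u: "\<And>u w. u \<in> sverts T \<Longrightarrow> w \<in> sverts T \<Longrightarrow> \<exists>!p. is_path T u p w"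
    using assms by (auto simp: simplicial_tree_def)
  have "p = q" if p: "epath (sedges T) u p w" and q: "epath (sedges T) u q w" for u w p q
  proof (cases "u = w")
    case True
    have "p = [u]" if "epath (sedges T) u p u" for p
    proof (rule ccontr)
      assume "p \<noteq> [u]"
      thus False using that by (cases p) (auto simp: epath_def split: if_splits)
    qed
    thus ?thesis using p q True by metis
  next
    case False
    have path: "is_path T u p w" if p: "epath (sedges T) u p w" for p
    proof -
      have *: "successively (\<lambda>x y. {x, y} \<in> sedges T) p \<Longrightarrow> length p \<ge> 2 \<Longrightarrow> set p \<subseteq> sverts T" for p
      proof (induction p)
        case (Cons a p)
        then obtain b r where p: "p = b # r" by (cases p) auto
        hence "a \<in> sverts T" "b \<in> sverts T" using Cons.prems e by auto
        thus ?case using Cons p by (cases r) auto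
      qed simp
      have "length p \<ge> 2" using p False by (cases p rule: remdups_adj.cases) (auto simp: epath_def)
      thus ?thesis using p * by (auto simp: epath_def is_path_def)
    qed
    hence "u \<in> sverts T" "w \<in> sverts T" using p unfolding is_path_def
      by (metis hd_in_set last_in_set subsetD)+
    thus ?thesis using u path p q by blast
  qed
  thus ?thesis using e by (auto simp: edge_tree_def)
qed

lemma simplicial_tree_connected:
  "simplicial_tree T \<Longrightarrow> u \<in> sverts T \<Longrightarrow> w \<in> sverts T \<Longrightarrow> joined (sedges T) u w"
proof -
  assume "simplicial_tree T" "u \<in> sverts T" "w \<in> sverts T"
  then obtain p where "is_path T u p w" unfolding simplicial_tree_def by blast
  hence "epath (sedges T) u p w" by (simp add: is_path_def epath_def)
  thus ?thesis by (rule epath_rtrancl)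
qed

text \<open>If the walk without backtracking returned to \<open>x a\<close> at time
  \<open>n + 1\<close>, its part from \<open>a\<close> to \<open>n\<close> would join the ends of
  the last edge, so this edge would occur in that part. By injectivity up to \<open>n\<close> it
  could only be the edge from \<open>a\<close> to \<open>a + 1 = n\<close>, which would be a
  backtrack.\<close>

lemma walk_inj:
  assumes "edge_tree E" "\<And>i. i < n \<Longrightarrow> {x i, x (Suc i)} \<in> E"
    and "\<And>i. Suc i < n \<Longrightarrow> x (Suc (Suc i)) \<noteq> x i"
  shows "inj_on x {..n}"
  using assms(2,3)
proof (induction n)
  case (Suc n)
  hence inj: "inj_on x {..n}" by auto
  have "x (Suc n) \<noteq> x a" if "a \<le> n" for a
  proof
    assume eq: "x (Suc n) = x a"
    have "a \<noteq> n" using Suc.prems(1)[of n] edge_neq[OF assms(1)] eq by fastforce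
    moreover have "Suc a \<noteq> n" using Suc.prems(2)[of a] eq by auto
    ultimately have a: "Suc a < n" using that by linarith
    let ?E = "{{x i, x (Suc i)} | i. a \<le> i \<and> i < n}"
    have "joined ?E (x a) (x n)" by (rule walk_rtrancl) (use that in blast)+
    hence c: "joined ?E (x n) (x (Suc n))" unfolding eq by (rule adj_sym)
    have "?E \<subseteq> E" using Suc.prems(1) by auto
    hence "{x n, x (Suc n)} \<in> ?E"
      using tree_edge_in[OF assms(1) _ _ c] Suc.prems(1)[of n] by blast
    then obtain i where i: "a \<le> i" "i < n" "{x n, x a} = {x i, x (Suc i)}" using eq by auto
    hence "(x n = x i \<and> x a = x (Suc i)) \<or> (x n = x (Suc i) \<and> x a = x i)"
      by (auto simp: doubleton_eq_iff)
    thus False using inj i a by (auto simp: inj_on_eq_iff)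
  qed
  moreover have "{..Suc n} = insert (Suc n) {..n}" by auto
  ultimately show ?case using inj by auto
qed simp

text \<open>Otherwise the remainder of the walk and the new connection would join the ends of the
  removed edge without using it.\<close>

lemma walk_separates:
  assumes "edge_tree E" "\<And>i. i < n \<Longrightarrow> {x i, x (Suc i)} \<in> E" "inj_on x {..n}" "i < n"
  shows "\<not> joined (E - {{x i, x (Suc i)}}) (x 0) (x n)"
proof
  let ?d = "{x i, x (Suc i)}" let ?R = "(adj (E - {?d}))\<^sup>*"
  assume c: "(x 0, x n) \<in> ?R"
  have d: "{x k, x (Suc k)} \<noteq> ?d" if "k < n" "k \<noteq> i" for k
  proof
    assume "{x k, x (Suc k)} = ?d"
    hence "(x k = x i) \<or> (x k = x (Suc i) \<and> x (Suc k) = x i)"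
      by (auto simp: doubleton_eq_iff)
    thus False using that assms(3,4) by (auto simp: inj_on_eq_iff)
  qed
  have "(x 0, x i) \<in> ?R" "(x (Suc i), x n) \<in> ?R"
    using assms d by (auto intro!: walk_rtrancl)
  with c have "(x i, x (Suc i)) \<in> ?R" by (meson adj_sym rtrancl_trans)
  thus False using tree_edge_in[OF assms(1), of "x i" "x (Suc i)" "E - {?d}"] assms by auto
qed

section \<open>Points, chains and simplicial maps\<close>

text \<open>The point with parameter \<open>t\<close> on the edge from \<open>u\<close> to
  \<open>w\<close>. For \<open>u = w\<close> it is the vertex, whatever \<open>t\<close> is, so
  edges that a vertex map collapses need no separate notation.\<close>

definition ept :: "'v \<Rightarrow> 'v \<Rightarrow> real \<Rightarrow> 'v \<Rightarrow> real" where
  "ept u w t = (\<lambda>x. (1 - t) * of_bool (x = u) + t * of_bool (x = w))"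

lemma ept_0 [simp]: "ept u w 0 = vpoint u"
  and ept_1 [simp]: "ept u w 1 = vpoint w"
  and ept_same [simp]: "ept u u t = vpoint u"
  by (auto simp: ept_def vpoint_def fun_eq_iff indicator_def)

lemma ept_swap: "ept u w t = ept w u (1 - t)"
  by (auto simp: ept_def fun_eq_iff)

lemma closed_edge_ept:
  assumes "u \<noteq> w"
  shows "p \<in> closed_edge {u, w} \<longleftrightarrow> (\<exists>t. 0 \<le> t \<and> t \<le> 1 \<and> p = ept u w t)"
proof
  assume p: "p \<in> closed_edge {u, w}"
  hence *: "\<And>v. 0 \<le> p v" "\<And>v. v \<noteq> u \<Longrightarrow> v \<noteq> w \<Longrightarrow> p v = 0" "p u + p w = 1"
    using assms by (auto simp: closed_edge_def)
  have eq: "p = ept u w (p w)"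
  proof
    fix x show "p x = ept u w (p w) x"
      using *(2)[of x] *(3) assms by (cases "x = u"; cases "x = w") (simp_all add: ept_def)
  qed
  have "0 \<le> p w" "p w \<le> 1" using *(1)[of u] *(1)[of w] *(3) by linarith+
  with eq show "\<exists>t. 0 \<le> t \<and> t \<le> 1 \<and> p = ept u w t" by (intro exI[of _ "p w"] conjI)
next
  assume "\<exists>t. 0 \<le> t \<and> t \<le> 1 \<and> p = ept u w t"
  then obtain t where "0 \<le> t" "t \<le> 1" "p = ept u w t" by blast
  thus "p \<in> closed_edge {u, w}"
    using assms by (simp add: closed_edge_def ept_def of_bool_def)
qed

lemma ept_closed_edge: "u \<noteq> w \<Longrightarrow> 0 \<le> t \<Longrightarrow> t \<le> 1 \<Longrightarrow> ept u w t \<in> closed_edge {u, w}"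
  using closed_edge_ept by metis

lemma closed_edgeE:
  assumes "p \<in> closed_edge {u, w}" "u \<noteq> w"
  obtains t where "0 \<le> t" "t \<le> 1" "p = ept u w t"
  using assms closed_edge_ept by metis

lemma vpoint_closed_edge: "card e = 2 \<Longrightarrow> u \<in> e \<Longrightarrow> vpoint u \<in> closed_edge e"
proof -
  assume "card e = 2" "u \<in> e"
  then obtain a w where *: "e = {a, w}" "a \<noteq> w" "u = a \<or> u = w" by (metis card_2_iff insertE singletonD)
  thus ?thesis using ept_closed_edge[of a w 0] ept_closed_edge[of a w 1] by auto
qed

lemma vpoint_inject [simp]: "vpoint u = vpoint w \<longleftrightarrow> u = w"
  by (auto simp: vpoint_def fun_eq_iff indicator_def split: if_splits)

text \<open>The fraction of the edge between two of its points (\<open>edist_ept\<close>), which is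
  the factor of the edge length in \<open>tdist\<close>.\<close>

definition edist :: "'v set \<Rightarrow> ('v \<Rightarrow> real) \<Rightarrow> ('v \<Rightarrow> real) \<Rightarrow> real" where
  "edist e p q = (\<Sum>v\<in>e. \<bar>p v - q v\<bar>) / 2"

lemma edist_nonneg [simp]: "0 \<le> edist e p q" by (simp add: edist_def sum_nonneg)
lemma edist_sym: "edist e p q = edist e q p" by (simp add: edist_def abs_minus_commute)

lemma edist_ept: "u \<noteq> w \<Longrightarrow> edist {u, w} (ept u w s) (ept u w t) = \<bar>s - t\<bar>"
proof -
  assume "u \<noteq> w"
  hence "(\<Sum>v\<in>{u, w}. \<bar>ept u w s v - ept u w t v\<bar>) = \<bar>t - s\<bar> + \<bar>s - t\<bar>"
    by (simp add: ept_def)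
  thus ?thesis by (simp add: edist_def abs_minus_commute)
qed

lemma edist_le_1: assumes "card e = 2" "p \<in> closed_edge e" "q \<in> closed_edge e"
  shows "edist e p q \<le> 1"
proof -
  obtain u w where e: "e = {u, w}" "u \<noteq> w" using assms by (auto simp: card_2_iff)
  thus ?thesis using assms edist_ept[OF e(2)] by (auto simp: closed_edge_ept)
qed

text \<open>A chain of links, each inside one closed edge, with \<open>s\<close> an upper bound for
  its length. Bounds instead of exact lengths make the relation monotone in \<open>s\<close>. The
  trivial chain exists at every function \<open>p\<close>, so membership in the realisation is
  tracked separately.\<close>

inductive ch :: "'v set set \<Rightarrow> ('v set \<Rightarrow> real) \<Rightarrow> ('v \<Rightarrow> real) \<Rightarrow> ('v \<Rightarrow> real) \<Rightarrow> real \<Rightarrow> bool"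
  for E l where
  ch_refl: "0 \<le> s \<Longrightarrow> ch E l p p s"
| ch_step: "e \<in> E \<Longrightarrow> p \<in> closed_edge e \<Longrightarrow> q \<in> closed_edge e \<Longrightarrow> ch E l q r s \<Longrightarrow>
    l e * edist e p q + s \<le> t \<Longrightarrow> ch E l p r t"

lemma ch_weaken: "ch E l p q s \<Longrightarrow> s \<le> t \<Longrightarrow> ch E l p q t"
  by (induction arbitrary: t rule: ch.induct) (auto intro: ch.ch_refl ch.ch_step order_trans)

lemma ch_trans: "ch E l p q s \<Longrightarrow> ch E l q r t \<Longrightarrow> ch E l p r (s + t)"
proof (induction rule: ch.induct)
  case (ch_refl s p) thus ?case by (auto elim: ch_weaken)
next
  case (ch_step e p p' q s t')
  thus ?case by (intro ch.ch_step[of e E p p' l r "s + t" "t' + t"]) auto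
qed

lemma ch_edge:
  "e \<in> E \<Longrightarrow> p \<in> closed_edge e \<Longrightarrow> q \<in> closed_edge e \<Longrightarrow> l e * edist e p q \<le> s \<Longrightarrow> ch E l p q s"
  by (rule ch_step[where s = 0]) (auto intro: ch_refl)

lemma ch_sym: "ch E l p q s \<Longrightarrow> ch E l q p s"
proof (induction rule: ch.induct)
  case (ch_refl s p) thus ?case by (auto intro: ch.ch_refl)
next
  case (ch_step e p q r s t)
  have "ch E l q p (l e * edist e p q)"
    using ch_step by (intro ch_edge[of e]) (auto simp: edist_sym)
  hence "ch E l r p (s + l e * edist e p q)" using ch_step ch_trans by metis
  thus ?case by (rule ch_weaken) (use ch_step in auto)
qed

lemma ch_nonneg: assumes "ch E l p q s" "\<And>e. e \<in> E \<Longrightarrow> 0 \<le> l e" shows "0 \<le> s"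
  using assms(1)
proof (induction rule: ch.induct)
  case (ch_step e p q r s t)
  hence "0 \<le> l e * edist e p q" using assms(2) by auto
  with ch_step.IH ch_step.hyps show ?case by linarith
qed

lemma ch_mono_len:
  assumes "ch E l p q s" "E \<subseteq> E'" "\<And>e. e \<in> E \<Longrightarrow> l' e \<le> K * l e" "0 \<le> K"
  shows "ch E' l' p q (K * s)"
  using assms(1)
proof (induction rule: ch.induct)
  case (ch_step e p q r s t)
  have "l' e * edist e p q \<le> (K * l e) * edist e p q"
    using assms(3) ch_step by (intro mult_right_mono) auto
  moreover have "K * (l e * edist e p q + s) \<le> K * t"
    using ch_step assms(4) by (intro mult_left_mono) auto
  ultimately show ?case using ch_step assms(2)
    by (intro ch.ch_step[of e E' p q l' r "K * s"]) (auto simp: algebra_simps)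
qed (use assms in \<open>auto intro: ch_refl\<close>)

lemma Inf_up_closure:
  fixes A :: "real set"
  assumes ne: "A \<noteq> {}" and lb: "\<And>a. a \<in> A \<Longrightarrow> B \<le> a"
  shows "Inf {s. \<exists>a\<in>A. a \<le> s} = Inf A"
proof (rule antisym)
  have bA: "bdd_below A" by (rule bdd_belowI[OF lb])
  show "Inf A \<le> Inf {s. \<exists>a\<in>A. a \<le> s}"
  proof (rule cInf_greatest)
    show "{s. \<exists>a\<in>A. a \<le> s} \<noteq> {}" using ne by blast
    fix x assume "x \<in> {s. \<exists>a\<in>A. a \<le> s}"
    then obtain a where "a \<in> A" "a \<le> x" by blast
    thus "Inf A \<le> x" using cInf_lower[OF _ bA] order_trans by blast
  qed
  show "Inf {s. \<exists>a\<in>A. a \<le> s} \<le> Inf A"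
  proof (rule cInf_superset_mono[OF ne])
    show "bdd_below {s. \<exists>a\<in>A. a \<le> s}"
      by (intro bdd_belowI[of _ B]) (use lb order_trans in blast)
  qed blast
qed

text \<open>The sums in \<open>tdist\<close> are exact and the bounds in \<open>ch\<close> are not,
  but closing a set of reals upwards does not change its infimum.\<close>

lemma tdist_eq:
  assumes "\<And>e. e \<in> sedges T \<Longrightarrow> 0 \<le> len T e"
  shows "tdist T p q = Inf {s. ch (sedges T) (len T) p q s}"
proof -
  let ?P = "\<lambda>n c e. c (0::nat) = p \<and> c n = q \<and>
       (\<forall>k<n. e k \<in> sedges T \<and> c k \<in> closed_edge (e k) \<and> c (Suc k) \<in> closed_edge (e k))"
  let ?s = "\<lambda>n c e. \<Sum>k<n. len T (e k) * edist (e k) (c k) (c (Suc k))"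
  let ?A = "{?s n c e | n c e. ?P n c e}"
  have t: "tdist T p q = Inf ?A" unfolding tdist_def edist_def ..
  have 1: "ch (sedges T) (len T) (c 0) (c n) (?s n c e)"
    if "\<forall>k<n. e k \<in> sedges T \<and> c k \<in> closed_edge (e k) \<and> c (Suc k) \<in> closed_edge (e k)" for n c e
    using that
  proof (induction n)
    case 0 thus ?case by (simp add: ch_refl)
  next
    case (Suc n)
    have "ch (sedges T) (len T) (c n) (c (Suc n)) (len T (e n) * edist (e n) (c n) (c (Suc n)))"
      using Suc.prems by (intro ch_edge[of "e n"]) auto
    moreover have "ch (sedges T) (len T) (c 0) (c n) (?s n c e)" using Suc by auto
    ultimately show ?case using ch_trans by fastforce
  qed
  have 2: "\<exists>n c e. c (0::nat) = p \<and> c n = q \<and> ?s n c e \<le> s \<and>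
      (\<forall>k<n. e k \<in> sedges T \<and> c k \<in> closed_edge (e k) \<and> c (Suc k) \<in> closed_edge (e k))"
    if "ch (sedges T) (len T) p q s" for s p q
    using that
  proof (induction rule: ch.induct)
    case (ch_refl s p)
    thus ?case by (intro exI[of _ 0] exI[of _ "\<lambda>_. p"]) auto
  next
    case (ch_step e0 p q r s t)
    then obtain n c e where *: "c (0::nat) = q" "c n = r" "?s n c e \<le> s"
      "\<forall>k<n. e k \<in> sedges T \<and> c k \<in> closed_edge (e k) \<and> c (Suc k) \<in> closed_edge (e k)" by auto
    let ?c = "case_nat p c" let ?e = "case_nat e0 e"
    have "?s (Suc n) ?c ?e = len T e0 * edist e0 p q + ?s n c e"
      unfolding sum.lessThan_Suc_shift by (simp add: *)
    thus ?case using ch_step * less_Suc_eq_0_disj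
      by (intro exI[of _ "Suc n"] exI[of _ ?c] exI[of _ ?e]) auto
  qed
  have B: "{s. ch (sedges T) (len T) p q s} = {s. \<exists>a\<in>?A. a \<le> s}"
  proof (intro subset_antisym subsetI)
    fix s assume "s \<in> {s. ch (sedges T) (len T) p q s}"
    hence "ch (sedges T) (len T) p q s" by simp
    from 2[OF this] show "s \<in> {s. \<exists>a\<in>?A. a \<le> s}" by blast
  next
    fix s assume "s \<in> {s. \<exists>a\<in>?A. a \<le> s}"
    then obtain n c e where *: "?s n c e \<le> s" "p = c 0" "q = c n"
      "\<forall>k<n. e k \<in> sedges T \<and> c k \<in> closed_edge (e k) \<and> c (Suc k) \<in> closed_edge (e k)"
      by blast
    thus "s \<in> {s. ch (sedges T) (len T) p q s}" using 1[OF *(4)] ch_weaken by auto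
  qed
  show ?thesis
  proof (cases "?A = {}")
    \<comment> \<open>Without any chain both sides are the infimum of the empty set, so the equation
      needs no connectedness.\<close>
    case True thus ?thesis unfolding t B by (simp only: True) simp
  next
    case False
    have lb: "0 \<le> a" if "a \<in> ?A" for a
      using that assms by (auto intro!: sum_nonneg)
    show ?thesis unfolding t B by (rule Inf_up_closure[symmetric, OF False lb])
  qed
qed

lemma tdist_le:
  assumes "\<And>e. e \<in> sedges T \<Longrightarrow> 0 \<le> len T e" "ch (sedges T) (len T) p q s"
  shows "tdist T p q \<le> s"
  unfolding tdist_eq[of T, OF assms(1), simplified]
proof (rule cInf_lower)
  show "bdd_below {s. ch (sedges T) (len T) p q s}"
    using assms(1) by (intro bdd_belowI[of _ 0]) (auto dest: ch_nonneg)
qed (use assms in auto)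

lemma tdist_less:
  assumes "\<And>e. e \<in> sedges T \<Longrightarrow> 0 \<le> len T e" "ch (sedges T) (len T) p q s0" "tdist T p q < s"
  shows "ch (sedges T) (len T) p q s"
proof -
  have "{s. ch (sedges T) (len T) p q s} \<noteq> {}" using assms(2) by blast
  moreover have "Inf {s. ch (sedges T) (len T) p q s} < s"
    using assms(3) by (subst (asm) tdist_eq[OF assms(1)])
  ultimately have "\<exists>t\<in>{s. ch (sedges T) (len T) p q s}. t < s" by (rule cInf_lessD)
  then obtain t where "ch (sedges T) (len T) p q t" "t < s" by blast
  thus ?thesis using ch_weaken[of _ _ p q t s] by simp
qed

lemma tdist_greatest:
  assumes "\<And>e. e \<in> sedges T \<Longrightarrow> 0 \<le> len T e" "ch (sedges T) (len T) p q s0"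
    "\<And>s. ch (sedges T) (len T) p q s \<Longrightarrow> B \<le> s"
  shows "B \<le> tdist T p q"
  unfolding tdist_eq[of T, OF assms(1), simplified] using assms(2,3) by (intro cInf_greatest) auto

text \<open>On points of a realisation, whose support is finite, this is the affine extension of the
  vertex map \<open>g\<close>.\<close>

definition push :: "('v \<Rightarrow> 'w) \<Rightarrow> ('v \<Rightarrow> real) \<Rightarrow> 'w \<Rightarrow> real" where
  "push g p x = (\<Sum>v | p v \<noteq> 0 \<and> g v = x. p v)"

lemma push_superset:
  assumes "finite F" "{v. p v \<noteq> 0} \<subseteq> F"
  shows "push g p x = (\<Sum>v\<in>F. p v * of_bool (g v = x))"
proof -
  have "(\<Sum>v\<in>F. p v * of_bool (g v = x)) = (\<Sum>v\<in>{v. p v \<noteq> 0 \<and> g v = x}. p v * of_bool (g v = x))"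
    using assms by (intro sum.mono_neutral_right) auto
  thus ?thesis unfolding push_def by (auto intro!: sum.cong)
qed

lemma push_vpoint [simp]: "push g (vpoint v) = vpoint (g v)"
proof
  fix x show "push g (vpoint v) x = vpoint (g v) x"
    by (subst push_superset[of "{v}"]) (auto simp: vpoint_def indicator_def split: if_splits)
qed

lemma push_ept [simp]: "push g (ept u w t) = ept (g u) (g w) t"
proof (cases "u = w")
  case False
  show ?thesis
  proof
    fix x show "push g (ept u w t) x = ept (g u) (g w) t x"
      by (subst push_superset[of "{u, w}"]) (use False in \<open>auto simp: ept_def split: if_splits\<close>)
  qed
qed simp

text \<open>Group elements, projections and the collapse are all vertex maps that send an edge to a
  point or to an edge; this one estimate serves for all of them. A collapsed link simply disappears
  from the chain.\<close>

lemma ch_push: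
  assumes c: "ch E l p q s" and E: "\<And>e. e \<in> E \<Longrightarrow> card e = 2" and K: "0 \<le> K"
    and l: "\<And>e. e \<in> E \<Longrightarrow> 0 \<le> l e"
    and g: "\<And>u w. {u, w} \<in> E \<Longrightarrow> g u \<noteq> g w \<Longrightarrow> {g u, g w} \<in> E' \<and> l' {g u, g w} \<le> K * l {u, w}"
  shows "ch E' l' (push g p) (push g q) (K * s)"
  using c
proof (induction rule: ch.induct)
  case (ch_step e p q r s t)
  obtain u w where e: "e = {u, w}" "u \<noteq> w" using E[OF ch_step.hyps(1)] by (auto simp: card_2_iff)
  obtain a where a: "0 \<le> a" "a \<le> 1" and p: "p = ept u w a"
    using ch_step.hyps(2) closed_edge_ept[OF e(2)] unfolding e(1) by blast
  obtain b where b: "0 \<le> b" "b \<le> 1" and q: "q = ept u w b"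
    using ch_step.hyps(3) closed_edge_ept[OF e(2)] unfolding e(1) by blast
  note ab = a b
  have "K * (l e * edist e p q + s) \<le> K * t"
    using ch_step K by (intro mult_left_mono) auto
  hence t: "K * l e * \<bar>a - b\<bar> + K * s \<le> K * t"
    using e p q by (simp add: edist_ept algebra_simps)
  have n: "0 \<le> K * l e * \<bar>a - b\<bar>" using K l ch_step by auto
  show ?case
  proof (cases "g u = g w")
    case True
    thus ?thesis using ch_step t n by (simp add: p q) (erule ch_weaken, linarith)
  next
    case False
    hence E': "{g u, g w} \<in> E'" "l' {g u, g w} \<le> K * l e" using g ch_step e by auto
    have "l' {g u, g w} * \<bar>a - b\<bar> \<le> K * l e * \<bar>a - b\<bar>" using E' by (intro mult_right_mono) auto
    hence "l' {g u, g w} * edist {g u, g w} (push g p) (push g q) + K * s \<le> K * t"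
      using t False by (simp add: p q edist_ept)
    with E'(1) _ _ ch_step.IH show ?thesis
      by (rule ch.ch_step) (use False ab in \<open>simp_all add: p q ept_closed_edge\<close>)
  qed
qed (use K in \<open>auto intro: ch_refl\<close>)

lemma ch_adj:
  assumes "joined E u w" "\<And>e. e \<in> E \<Longrightarrow> card e = 2"
  shows "\<exists>s. ch E l (vpoint u) (vpoint w) s"
  using assms(1)
proof (induction rule: rtrancl_induct)
  case (step y z)
  then obtain s where s: "ch E l (vpoint u) (vpoint y) s" by blast
  have e: "{y, z} \<in> E" using step by simp
  hence "ch E l (vpoint y) (vpoint z) (l {y, z} * edist {y, z} (vpoint y) (vpoint z))"
    using assms(2) by (intro ch_edge[of "{y, z}"]) (auto intro!: vpoint_closed_edge)
  thus ?case using s ch_trans by blast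
qed (auto intro: ch_refl[of 0])

section \<open>Metric graphs with a group action\<close>

text \<open>Connected graphs instead of trees: extension of maps and Lipschitz estimates happen at
  this level, and the coarsened pieces of the core enter the argument only through it.\<close>

locale mgraph =
  fixes G :: "'h monoid" (structure) and T :: "('h, 'v) mtree"
  assumes grp: "group G"
    and act_closed: "h \<in> carrier G \<Longrightarrow> v \<in> sverts T \<Longrightarrow> act T h v \<in> sverts T"
    and act_one: "v \<in> sverts T \<Longrightarrow> act T \<one>\<^bsub>G\<^esub> v = v"
    and act_mult: "g \<in> carrier G \<Longrightarrow> h \<in> carrier G \<Longrightarrow> v \<in> sverts T \<Longrightarrow>
      act T (g \<otimes>\<^bsub>G\<^esub> h) v = act T g (act T h v)"
    and edge_card: "e \<in> sedges T \<Longrightarrow> card e = 2"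
    and edge_verts: "e \<in> sedges T \<Longrightarrow> e \<subseteq> sverts T"
    and act_edge: "h \<in> carrier G \<Longrightarrow> e \<in> sedges T \<Longrightarrow> act T h ` e \<in> sedges T"
    and len_pos: "e \<in> sedges T \<Longrightarrow> 0 < len T e"
    and len_act: "h \<in> carrier G \<Longrightarrow> e \<in> sedges T \<Longrightarrow> len T (act T h ` e) = len T e"
    and edge_free: "h \<in> carrier G \<Longrightarrow> e \<in> sedges T \<Longrightarrow> act T h ` e = e \<Longrightarrow> h = \<one>\<^bsub>G\<^esub>"
    and conn: "u \<in> sverts T \<Longrightarrow> w \<in> sverts T \<Longrightarrow> joined (sedges T) u w"
begin

abbreviation VT :: "'v set" where "VT \<equiv> sverts T"
abbreviation ET :: "'v set set" where "ET \<equiv> sedges T"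
abbreviation PT :: "('v \<Rightarrow> real) set" where "PT \<equiv> points T"
abbreviation chT :: "('v \<Rightarrow> real) \<Rightarrow> ('v \<Rightarrow> real) \<Rightarrow> real \<Rightarrow> bool" where "chT \<equiv> ch ET (len T)"

lemma one_in [simp]: "\<one> \<in> carrier G" using grp by (simp add: group.is_monoid)
lemma inv_in [simp]: "h \<in> carrier G \<Longrightarrow> inv h \<in> carrier G" using grp by simp
lemma mult_in [simp]: "g \<in> carrier G \<Longrightarrow> h \<in> carrier G \<Longrightarrow> g \<otimes> h \<in> carrier G"
  using grp by (simp add: group.is_monoid monoid.m_closed)
lemma inv_mult [simp]: "h \<in> carrier G \<Longrightarrow> inv h \<otimes> h = \<one>"
  and mult_inv [simp]: "h \<in> carrier G \<Longrightarrow> h \<otimes> inv h = \<one>"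
  and inv_inv [simp]: "h \<in> carrier G \<Longrightarrow> inv (inv h) = h"
  using grp by (simp_all add: group.l_inv group.r_inv group.inv_inv)

lemma conj_neq_one:
  assumes "g \<in> carrier G" "h \<in> carrier G" "h \<noteq> \<one>"
  shows "g \<otimes> h \<otimes> inv g \<noteq> \<one>"
proof
  interpret group G by (rule grp)
  assume eq: "g \<otimes> h \<otimes> inv g = \<one>"
  have "inv g \<otimes> (g \<otimes> h \<otimes> inv g) \<otimes> g = h"
    using assms by (simp add: m_assoc) (simp add: m_assoc[symmetric])
  thus False using eq assms by simp
qed

lemma act_inv_act: "h \<in> carrier G \<Longrightarrow> v \<in> VT \<Longrightarrow> act T (inv h) (act T h v) = v"
  using act_mult[of "inv h" h v] act_one by simp

lemma act_act_inv: "h \<in> carrier G \<Longrightarrow> v \<in> VT \<Longrightarrow> act T h (act T (inv h) v) = v"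
  using act_mult[of h "inv h" v] act_one by simp

lemma act_inj: "h \<in> carrier G \<Longrightarrow> u \<in> VT \<Longrightarrow> w \<in> VT \<Longrightarrow>
    act T h u = act T h w \<longleftrightarrow> u = w"
  using act_inv_act by metis

lemma act_inj_on: "h \<in> carrier G \<Longrightarrow> inj_on (act T h) VT"
  using act_inj by (simp add: inj_on_def)

lemma edge_neq': "{u, w} \<in> ET \<Longrightarrow> u \<noteq> w"
  using edge_card by fastforce

lemma edge_obtain:
  assumes "e \<in> ET"
  obtains u w where "e = {u, w}" "u \<noteq> w" "u \<in> VT" "w \<in> VT"
  using edge_card[OF assms] edge_verts[OF assms] by (auto simp: card_2_iff)

lemma edge_ends: "{u, w} \<in> ET \<Longrightarrow> u \<in> VT \<and> w \<in> VT"
  using edge_verts by auto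

lemma len_nonneg: "e \<in> ET \<Longrightarrow> 0 \<le> len T e" using len_pos by (simp add: less_imp_le)

lemma act_adj:
  assumes "joined E u w" "\<And>e. e \<in> E \<Longrightarrow> act T h ` e \<in> E'"
  shows "joined E' (act T h u) (act T h w)"
  using assms(1)
proof (induction rule: rtrancl_induct)
  case (step y z)
  hence "(act T h y, act T h z) \<in> adj E'" using assms(2)[of "{y, z}"] by simp
  thus ?case using step.IH by (rule rtrancl_into_rtrancl[rotated])
qed simp

lemma points_ept:
  "p \<in> PT \<longleftrightarrow> (\<exists>u w t. u \<in> VT \<and> w \<in> VT \<and> (u = w \<or> {u, w} \<in> ET) \<and>
     0 \<le> t \<and> t \<le> 1 \<and> p = ept u w t)" (is "_ \<longleftrightarrow> ?R")
proof
  assume "p \<in> PT"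
  then consider v where "v \<in> VT" "p = vpoint v" | e where "e \<in> ET" "p \<in> closed_edge e"
    by (auto simp: points_def)
  thus ?R
  proof cases
    case 1
    thus ?thesis by (intro exI[of _ v] exI[of _ 0]) simp
  next
    case 2
    then obtain u w where e: "e = {u, w}" "u \<noteq> w" "u \<in> VT" "w \<in> VT"
      using edge_obtain by metis
    then obtain t where "0 \<le> t" "t \<le> 1" "p = ept u w t" using 2(2) closed_edge_ept by metis
    thus ?thesis using e 2(1) by blast
  qed
next
  assume ?R
  then obtain u w t where *: "u \<in> VT" "w \<in> VT" "u = w \<or> {u, w} \<in> ET"
    "0 \<le> t" "t \<le> 1" "p = ept u w t" by blast
  show "p \<in> PT"
  proof (cases "u = w")
    case True
    thus ?thesis using * by (simp add: points_def)
  next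
    case False
    hence "p \<in> closed_edge {u, w}" "{u, w} \<in> ET" using * ept_closed_edge by auto
    thus ?thesis unfolding points_def by blast
  qed
qed

lemma points_cases:
  assumes "p \<in> PT"
  obtains u w t where "u \<in> VT" "w \<in> VT" "u = w \<or> {u, w} \<in> ET"
    "0 \<le> t" "t \<le> 1" "p = ept u w t"
  using assms points_ept by metis

lemma ept_points: "{u, w} \<in> ET \<Longrightarrow> 0 \<le> t \<Longrightarrow> t \<le> 1 \<Longrightarrow> ept u w t \<in> PT"
  using points_ept edge_ends by blast

lemma vpoint_points: "v \<in> VT \<Longrightarrow> vpoint v \<in> PT" by (simp add: points_def)

lemma closed_edge_points: "e \<in> ET \<Longrightarrow> p \<in> closed_edge e \<Longrightarrow> p \<in> PT"
  unfolding points_def by blast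

lemma point_act_ept:
  assumes h: "h \<in> carrier G" and uw: "u \<in> VT" "w \<in> VT"
  shows "point_act T h (ept u w t) = ept (act T h u) (act T h w) t"
proof
  fix x
  show "point_act T h (ept u w t) x = ept (act T h u) (act T h w) t x"
  proof (cases "x \<in> VT")
    case True
    define y where "y = act T (inv h) x"
    have y: "y \<in> VT" "act T h y = x" using True h act_closed act_act_inv by (auto simp: y_def)
    have "inv_into VT (act T h) x = y"
      using inv_into_f_eq[OF act_inj_on[OF h] y] .
    hence "point_act T h (ept u w t) x = ept u w t y" using True by (simp add: point_act_def)
    moreover have "y = u \<longleftrightarrow> x = act T h u" "y = w \<longleftrightarrow> x = act T h w"
      using y uw act_inj[OF h] by metis+
    ultimately show ?thesis by (simp add: ept_def)
  next
    case False
    hence "x \<noteq> act T h u" "x \<noteq> act T h w" using uw h act_closed by metis+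
    thus ?thesis using False by (simp add: point_act_def ept_def)
  qed
qed

lemma point_act_vpoint: "h \<in> carrier G \<Longrightarrow> v \<in> VT \<Longrightarrow>
    point_act T h (vpoint v) = vpoint (act T h v)"
  using point_act_ept[of h v v 0] by simp

lemma point_act_push:
  assumes "h \<in> carrier G" "p \<in> PT"
  shows "point_act T h p = push (act T h) p"
  using assms(2) by (rule points_cases) (simp add: point_act_ept assms(1))

lemma point_act_closed:
  assumes h: "h \<in> carrier G" and "p \<in> PT"
  shows "point_act T h p \<in> PT"
  using assms(2)
proof (rule points_cases)
  fix u w t assume *: "u \<in> VT" "w \<in> VT" "u = w \<or> {u, w} \<in> ET"
    "0 \<le> t" "t \<le> 1" "p = ept u w t"
  hence "act T h u = act T h w \<or> {act T h u, act T h w} \<in> ET"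
    using act_edge[OF h, of "{u, w}"] by auto
  thus ?thesis using * h act_closed unfolding points_ept by (metis point_act_ept)
qed

lemma point_act_one: "p \<in> PT \<Longrightarrow> point_act T \<one> p = p"
  by (erule points_cases) (simp add: point_act_ept act_one)

lemma point_act_mult: "g \<in> carrier G \<Longrightarrow> h \<in> carrier G \<Longrightarrow> p \<in> PT \<Longrightarrow>
    point_act T (g \<otimes> h) p = point_act T g (point_act T h p)"
  by (erule points_cases) (simp add: point_act_ept act_mult act_closed)

lemma point_act_inv: "h \<in> carrier G \<Longrightarrow> p \<in> PT \<Longrightarrow>
    point_act T (inv h) (point_act T h p) = p"
  using point_act_mult[of "inv h" h p] point_act_one by simp

lemma ch_ept_end:
  assumes "u = w \<or> {u, w} \<in> ET" "0 \<le> t" "t \<le> 1"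
  shows "ch ET l (vpoint u) (ept u w t) (l {u, w} * t) \<or> u = w"
proof (cases "u = w")
  case False
  thus ?thesis using assms edist_ept[of u w 0 t] ept_closed_edge[of u w 0] ept_closed_edge[of u w t]
    by (intro disjI1 ch_edge[of "{u, w}"]) auto
qed simp

lemma ch_points_ex:
  assumes "p \<in> PT" "q \<in> PT"
  shows "\<exists>s. ch ET l p q s"
proof -
  have 1: "\<exists>v s. v \<in> VT \<and> ch ET l (vpoint v) p s" if "p \<in> PT" for p
    using that
  proof (rule points_cases)
    fix u w t assume *: "u \<in> VT" "w \<in> VT" "u = w \<or> {u, w} \<in> ET"
      "0 \<le> t" "t \<le> 1" "p = ept u w t"
    show ?thesis
    proof (cases "u = w")
      case True
      thus ?thesis using * ch_refl[of 0] by (intro exI[of _ u] exI[of _ 0]) simp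
    next
      case False
      thus ?thesis using * ch_ept_end[of u w t l] by blast
    qed
  qed
  obtain u s where u: "u \<in> VT" "ch ET l (vpoint u) p s" using 1 assms by blast
  obtain w r where w: "w \<in> VT" "ch ET l (vpoint w) q r" using 1 assms by blast
  obtain m where "ch ET l (vpoint u) (vpoint w) m"
    using ch_adj[OF conn[OF u(1) w(1)] edge_card] by blast
  thus ?thesis using ch_trans[OF ch_trans[OF ch_sym[OF u(2)]] w(2)] by blast
qed

lemma tdist_leI: "chT p q s \<Longrightarrow> tdist T p q \<le> s"
  by (rule tdist_le[OF len_nonneg])

lemma tdist_lessD:
  assumes "p \<in> PT" "q \<in> PT" "tdist T p q < s"
  shows "chT p q s"
proof -
  obtain s0 where "chT p q s0" using ch_points_ex assms by blast
  thus ?thesis using tdist_less[OF len_nonneg] assms(3) by blast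
qed

lemma tdist_geI:
  assumes "p \<in> PT" "q \<in> PT" "\<And>s. chT p q s \<Longrightarrow> B \<le> s"
  shows "B \<le> tdist T p q"
proof -
  obtain s0 where "chT p q s0" using ch_points_ex assms by blast
  thus ?thesis using tdist_greatest[OF len_nonneg] assms(3) by blast
qed

lemma tdist_nonneg: "p \<in> PT \<Longrightarrow> q \<in> PT \<Longrightarrow> 0 \<le> tdist T p q"
  by (rule tdist_geI) (auto dest: ch_nonneg len_nonneg)

lemma tdist_refl [simp]: "p \<in> PT \<Longrightarrow> tdist T p p = 0"
  using tdist_nonneg[of p p] tdist_leI[OF ch_refl, of 0 p] by simp

lemma tdist_sym: "p \<in> PT \<Longrightarrow> q \<in> PT \<Longrightarrow> tdist T p q = tdist T q p"
  by (intro antisym tdist_geI tdist_leI) (auto intro: ch_sym)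

lemma tdist_triangle:
  assumes "p \<in> PT" "q \<in> PT" "r \<in> PT"
  shows "tdist T p r \<le> tdist T p q + tdist T q r"
proof (rule field_le_epsilon)
  fix e :: real assume "0 < e"
  hence "chT p q (tdist T p q + e / 2)" "chT q r (tdist T q r + e / 2)"
    using assms by (auto intro!: tdist_lessD)
  from ch_trans[OF this] show "tdist T p r \<le> tdist T p q + tdist T q r + e"
    using tdist_leI by fastforce
qed

lemma tdist_edge: "e \<in> ET \<Longrightarrow> p \<in> closed_edge e \<Longrightarrow> q \<in> closed_edge e \<Longrightarrow>
    tdist T p q \<le> len T e * edist e p q"
  by (intro tdist_leI ch_edge[of e]) auto

lemma tdist_edge_ends: "{u, w} \<in> ET \<Longrightarrow> tdist T (vpoint u) (vpoint w) \<le> len T {u, w}"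
  using tdist_edge[of "{u, w}" "ept u w 0" "ept u w 1"] edge_neq'[of u w]
    ept_closed_edge[of u w 0] ept_closed_edge[of u w 1] edist_ept[of u w 0 1]
  by simp

lemma ch_act:
  assumes "chT p q s" "h \<in> carrier G"
  shows "chT (push (act T h) p) (push (act T h) q) s"
proof -
  have "{act T h u, act T h w} \<in> ET \<and> len T {act T h u, act T h w} \<le> 1 * len T {u, w}"
    if "{u, w} \<in> ET" for u w
    using act_edge[OF assms(2) that] len_act[OF assms(2) that] by simp
  thus ?thesis
    using ch_push[of "ET" "len T" p q s 1 "act T h" "ET" "len T"] assms(1) edge_card len_nonneg
    by simp
qed

lemma tdist_act_le:
  assumes "p \<in> PT" "q \<in> PT" "h \<in> carrier G"
  shows "tdist T (point_act T h p) (point_act T h q) \<le> tdist T p q"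
proof (rule tdist_geI[OF assms(1,2)])
  fix s assume "chT p q s"
  thus "tdist T (point_act T h p) (point_act T h q) \<le> s"
    using ch_act[OF _ assms(3)] assms by (simp add: point_act_push tdist_leI)
qed

lemma tdist_act:
  assumes "p \<in> PT" "q \<in> PT" "h \<in> carrier G"
  shows "tdist T (point_act T h p) (point_act T h q) = tdist T p q"
proof (rule antisym[OF tdist_act_le[OF assms]])
  show "tdist T p q \<le> tdist T (point_act T h p) (point_act T h q)"
    using tdist_act_le[of "point_act T h p" "point_act T h q" "inv h"] assms
    by (simp add: point_act_closed point_act_inv)
qed

end

section \<open>Curves and the extension of equivariant maps from vertices\<close>

text \<open>The chain is traversed in time \<open>s\<close>. Each link receives all the time that
  the bound leaves beyond the rest of the chain, so the speed is at most one even where the bound is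
  not sharp.\<close>

lemma ch_curve:
  assumes c: "ch E l p q s" and E: "\<And>e. e \<in> E \<Longrightarrow> card e = 2" and l: "\<And>e. e \<in> E \<Longrightarrow> 0 < l e"
    and P: "p \<in> P" "\<And>e. e \<in> E \<Longrightarrow> closed_edge e \<subseteq> P"
  shows "\<exists>\<gamma>. \<gamma> 0 = p \<and> \<gamma> s = q \<and> (\<forall>a. \<gamma> a \<in> P) \<and>
     (\<forall>a b. 0 \<le> a \<longrightarrow> a \<le> b \<longrightarrow> b \<le> s \<longrightarrow> ch E l (\<gamma> a) (\<gamma> b) (b - a))"
  using c P(1)
proof (induction rule: ch.induct)
  case (ch_refl s p)
  thus ?case by (intro exI[of _ "\<lambda>_. p"]) (auto intro: ch.ch_refl)
next
  case (ch_step e p q r s t)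
  have "q \<in> P" using ch_step.hyps P(2) by blast
  then obtain \<gamma> where \<gamma>: "\<gamma> 0 = q" "\<gamma> s = r" "\<And>a. \<gamma> a \<in> P"
    "\<And>a b. 0 \<le> a \<Longrightarrow> a \<le> b \<Longrightarrow> b \<le> s \<Longrightarrow> ch E l (\<gamma> a) (\<gamma> b) (b - a)"
    using ch_step.IH by blast
  obtain u w where e: "e = {u, w}" "u \<noteq> w" using E[OF ch_step.hyps(1)] by (auto simp: card_2_iff)
  obtain x where x: "0 \<le> x" "x \<le> 1" and p: "p = ept u w x"
    using ch_step.hyps(2) closed_edge_ept[OF e(2)] unfolding e(1) by blast
  obtain y where y: "0 \<le> y" "y \<le> 1" and q: "q = ept u w y"
    using ch_step.hyps(3) closed_edge_ept[OF e(2)] unfolding e(1) by blast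
  have le: "0 < l e" using l ch_step.hyps by auto
  have s0: "0 \<le> s" using ch_nonneg[OF ch_step.hyps(4)] l by (meson less_imp_le)
  \<comment> \<open>The time for the first link, including the slack of the bound. It may be zero,
    and then the link is constant.\<close>
  define d where "d = t - s"
  have d: "l e * \<bar>x - y\<bar> \<le> d" using ch_step.hyps(5) by (simp add: d_def e p q edist_ept)
  have d0: "0 \<le> d" using d le by (meson abs_ge_zero mult_nonneg_nonneg less_imp_le order_trans)
  have xy: "x = y" if "d = 0" using that d le by (simp add: mult_le_0_iff)
  define f where "f a = x + (y - x) * (a / d)" for a
  have fd: "f d = y" using xy by (simp add: f_def)
  have f01: "0 \<le> f a \<and> f a \<le> 1" if "0 \<le> a" "a \<le> d" for a
  proof -
    have "0 \<le> a / d" "a / d \<le> 1" using that d0 by (auto simp: divide_simps)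
    moreover have "f a = (1 - a / d) * x + (a / d) * y"
      by (simp add: f_def algebra_simps diff_divide_distrib)
    moreover have "0 \<le> (1 - a / d) * x" "0 \<le> (a / d) * y"
      using calculation x y mult_nonneg_nonneg[of "a / d" y] by auto
    ultimately show ?thesis using x y convex_bound_le[of x 1 y "1 - a / d" "a / d"] by linarith
  qed
  \<comment> \<open>The value at negative times is a default that keeps the curve inside
    \<open>P\<close>.\<close>
  define \<delta> where "\<delta> a = (if a < 0 then p else if a \<le> d then ept u w (f a) else \<gamma> (a - d))" for a
  have *: "ch E l (ept u w (f a)) (ept u w (f b)) (b - a)" if "0 \<le> a" "a \<le> b" "b \<le> d" for a b
  proof (rule ch_edge[OF ch_step.hyps(1)])
    show "ept u w (f a) \<in> closed_edge e" "ept u w (f b) \<in> closed_edge e"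
      using e f01 that by (auto intro!: ept_closed_edge)
    show "l e * edist e (ept u w (f a)) (ept u w (f b)) \<le> b - a"
    proof (cases "d = 0")
      case True
      thus ?thesis using that xy by (simp add: f_def e edist_ept)
    next
      case False
      hence "d > 0" using d0 by simp
      have "f a - f b = (x - y) * ((b - a) / d)" by (simp add: f_def algebra_simps diff_divide_distrib)
      hence "\<bar>f a - f b\<bar> = \<bar>x - y\<bar> * ((b - a) / d)" using that \<open>d > 0\<close> by (simp add: abs_mult)
      hence "l e * \<bar>f a - f b\<bar> = (l e * \<bar>x - y\<bar>) * ((b - a) / d)" by simp
      also have "\<dots> \<le> d * ((b - a) / d)" using d that \<open>d > 0\<close> by (intro mult_right_mono) auto
      finally show ?thesis using \<open>d > 0\<close> by (simp add: e edist_ept)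
    qed
  qed
  have "ch E l (\<delta> a) (\<delta> b) (b - a)" if ab: "0 \<le> a" "a \<le> b" "b \<le> t" for a b
  proof -
    consider "b \<le> d" | "a \<le> d" "d < b" | "d < a" by linarith
    thus ?thesis
    proof cases
      case 1 thus ?thesis using * ab by (simp add: \<delta>_def)
    next
      case 2
      have "ch E l (ept u w (f a)) (ept u w (f d)) (d - a)" using * 2 ab by simp
      moreover have "ch E l (\<gamma> 0) (\<gamma> (b - d)) (b - d - 0)" using 2 ab by (intro \<gamma>(4)) (auto simp: d_def)
      ultimately have "ch E l (ept u w (f a)) (\<gamma> (b - d)) ((d - a) + (b - d))"
        unfolding fd using \<gamma>(1) q ch_trans by fastforce
      thus ?thesis using 2 ab by (simp add: \<delta>_def)
    next
      case 3
      have "ch E l (\<gamma> (a - d)) (\<gamma> (b - d)) ((b - d) - (a - d))" using 3 ab by (intro \<gamma>(4)) (auto simp: d_def)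
      thus ?thesis using 3 ab by (simp add: \<delta>_def)
    qed
  qed
  moreover have "\<delta> 0 = p" using d0 by (simp add: \<delta>_def f_def p)
  moreover have "\<delta> t = r"
  proof (cases "s = 0")
    case True
    hence "t = d" by (simp add: d_def)
    thus ?thesis using fd d0 True \<gamma> q by (simp add: \<delta>_def)
  next
    case False
    thus ?thesis using s0 d0 \<gamma> by (simp add: \<delta>_def d_def)
  qed
  moreover have "\<delta> a \<in> P" for a
  proof -
    have "ept u w (f a) \<in> P" if "0 \<le> a" "a \<le> d"
    proof -
      have "ept u w (f a) \<in> closed_edge e" using e f01[OF that] by (auto intro!: ept_closed_edge)
      thus ?thesis using P(2)[OF ch_step.hyps(1)] by blast
    qed
    thus ?thesis using ch_step.prems \<gamma>(3) by (simp add: \<delta>_def)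
  qed
  ultimately show ?case by (intro exI[of _ \<delta>]) blast
qed

text \<open>Each point \<open>x\<close> has a class \<open>c x\<close>, and classes are moved by
  \<open>k\<close>. A map given over one class of every orbit of classes, and compatible with the
  stabiliser of that class, spreads over the whole orbit by translation. \<open>R\<close> may
  contain several classes of one orbit; \<open>F\<close> is then kept over only one of them, whence
  the existential in the last clause of the conclusion.\<close>

lemma equivariant_choice:
  fixes G :: "'h monoid" (structure)
  assumes G: "group G"
    and a_closed: "\<And>g x. g \<in> carrier G \<Longrightarrow> x \<in> V \<Longrightarrow> a g x \<in> V"
    and a_one: "\<And>x. x \<in> V \<Longrightarrow> a \<one> x = x"
    and a_mult: "\<And>g h x. g \<in> carrier G \<Longrightarrow> h \<in> carrier G \<Longrightarrow> x \<in> V \<Longrightarrow> a (g \<otimes> h) x = a g (a h x)"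
    and b_closed: "\<And>g y. g \<in> carrier G \<Longrightarrow> y \<in> Y \<Longrightarrow> b g y \<in> Y"
    and b_one: "\<And>y. y \<in> Y \<Longrightarrow> b \<one> y = y"
    and b_mult: "\<And>g h y. g \<in> carrier G \<Longrightarrow> h \<in> carrier G \<Longrightarrow> y \<in> Y \<Longrightarrow> b (g \<otimes> h) y = b g (b h y)"
    and c: "\<And>g x. g \<in> carrier G \<Longrightarrow> x \<in> V \<Longrightarrow> c (a g x) = k g (c x)"
    and R: "\<And>x. x \<in> V \<Longrightarrow> \<exists>g\<in>carrier G. k g (c x) \<in> R"
    and F_closed: "\<And>x. x \<in> V \<Longrightarrow> c x \<in> R \<Longrightarrow> F (c x) x \<in> Y"
    and F_stab: "\<And>x g. x \<in> V \<Longrightarrow> c x \<in> R \<Longrightarrow> g \<in> carrier G \<Longrightarrow> k g (c x) = c x \<Longrightarrow>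
      F (c x) (a g x) = b g (F (c x) x)"
  shows "\<exists>f. (\<forall>x\<in>V. f x \<in> Y) \<and> (\<forall>g\<in>carrier G. \<forall>x\<in>V. f (a g x) = b g (f x)) \<and>
     (\<forall>x\<in>V. \<exists>g\<in>carrier G. k g (c x) \<in> R \<and> (\<forall>y\<in>V. c y = k g (c x) \<longrightarrow> f y = F (c y) y))"
proof -
  interpret group G by (rule G)
  \<comment> \<open>As a set this depends only on the orbit of the class, so \<open>SOME\<close>
    returns the same representative along the orbit.\<close>
  define O' where "O' \<beta> = {\<rho> \<in> R. \<exists>g\<in>carrier G. \<rho> = k g \<beta>}" for \<beta>
  define rep where "rep \<beta> = (SOME \<rho>. \<rho> \<in> O' \<beta>)" for \<beta>
  define t where "t \<beta> = (SOME g. g \<in> carrier G \<and> k g \<beta> = rep \<beta>)" for \<beta>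
  define f where "f x = b (inv (t (c x))) (F (rep (c x)) (a (t (c x)) x))" for x
  have k1: "k \<one> (c x) = c x" if "x \<in> V" for x using c[of \<one> x] a_one that by simp
  have km: "k (g \<otimes> h) (c x) = k g (k h (c x))" if "x \<in> V" "g \<in> carrier G" "h \<in> carrier G" for g h x
  proof -
    have "k (g \<otimes> h) (c x) = c (a (g \<otimes> h) x)" using c that by simp
    also have "\<dots> = c (a g (a h x))" using a_mult that by simp
    also have "\<dots> = k g (k h (c x))" using c a_closed that by simp
    finally show ?thesis .
  qed
  have O_eq: "O' (k h (c x)) = O' (c x)" if x: "x \<in> V" and h: "h \<in> carrier G" for x h
  proof -
    have "\<exists>g'\<in>carrier G. k g (k h (c x)) = k g' (c x)" if "g \<in> carrier G" for g
      using km[OF x that h] that h by (metis m_closed)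
    moreover have "\<exists>g'\<in>carrier G. k g (c x) = k g' (k h (c x))" if g: "g \<in> carrier G" for g
    proof -
      have "k (g \<otimes> inv h) (k h (c x)) = k (g \<otimes> inv h \<otimes> h) (c x)" using km x g h by simp
      also have "g \<otimes> inv h \<otimes> h = g" using g h by (simp add: m_assoc)
      finally show ?thesis using g h by (metis inv_closed m_closed)
    qed
    ultimately show ?thesis unfolding O'_def by (metis (lifting))
  qed
  have rep_eq: "rep (k h (c x)) = rep (c x)" if "x \<in> V" "h \<in> carrier G" for x h
    using O_eq[OF that] by (simp add: rep_def)
  have rep_in: "rep (c x) \<in> R" and rep_ex: "\<exists>g\<in>carrier G. k g (c x) = rep (c x)" if "x \<in> V" for x
  proof -
    have "\<exists>\<rho>. \<rho> \<in> O' (c x)" using R[OF that] unfolding O'_def by auto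
    hence "rep (c x) \<in> O' (c x)" unfolding rep_def by (rule someI_ex)
    thus "rep (c x) \<in> R" "\<exists>g\<in>carrier G. k g (c x) = rep (c x)" unfolding O'_def by auto
  qed
  have t: "t (c x) \<in> carrier G" "k (t (c x)) (c x) = rep (c x)" if "x \<in> V" for x
  proof -
    have "\<exists>g. g \<in> carrier G \<and> k g (c x) = rep (c x)" using rep_ex[OF that] by blast
    from someI_ex[OF this] show "t (c x) \<in> carrier G" "k (t (c x)) (c x) = rep (c x)"
      unfolding t_def by auto
  qed
  have z: "a (t (c x)) x \<in> V" "c (a (t (c x)) x) = rep (c x)" if "x \<in> V" for x
    using a_closed c t that by auto
  have Fz: "F (rep (c x)) (a (t (c x)) x) \<in> Y" if "x \<in> V" for x
    using F_closed[OF z(1)[OF that]] z(2)[OF that] rep_in[OF that] by simp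
  have closed: "f x \<in> Y" if "x \<in> V" for x
    unfolding f_def using b_closed Fz t that by simp
  have equiv: "f (a g x) = b g (f x)" if g: "g \<in> carrier G" and x: "x \<in> V" for g x
  proof -
    let ?x' = "a g x" let ?t' = "t (c ?x')" let ?t = "t (c x)" let ?\<rho> = "rep (c x)"
    have x': "?x' \<in> V" using a_closed g x by simp
    have \<rho>: "rep (c ?x') = ?\<rho>" using c rep_eq g x by simp
    have tc: "?t \<in> carrier G" "?t' \<in> carrier G" using t x x' by auto
    \<comment> \<open>\<open>s\<close> carries the normalised translate of \<open>x\<close> to that
      of \<open>a g x\<close>. Both lie over the same representative, so \<open>s\<close> stabilises
      it and \<open>F_stab\<close> applies.\<close>
    define s where "s = ?t' \<otimes> g \<otimes> inv ?t"
    have s: "s \<in> carrier G" using tc g by (simp add: s_def)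
    have "s \<otimes> ?t = ?t' \<otimes> g" using tc g by (simp add: s_def m_assoc)
    hence as: "a s (a ?t x) = a ?t' ?x'"
      using a_mult[OF s tc(1) x] a_mult[OF tc(2) g x] by simp
    have "k s ?\<rho> = k s (c (a ?t x))" using z x by simp
    also have "\<dots> = c (a s (a ?t x))" using c s z x by simp
    also have "\<dots> = ?\<rho>" unfolding as using z(2)[OF x'] \<rho> by simp
    finally have "k s (c (a ?t x)) = c (a ?t x)" using z x by simp
    hence "F ?\<rho> (a s (a ?t x)) = b s (F ?\<rho> (a ?t x))"
      using F_stab[OF z(1)[OF x] _ s] z(2)[OF x] rep_in[OF x] by simp
    hence "f ?x' = b (inv ?t') (b s (F ?\<rho> (a ?t x)))"
      unfolding f_def \<rho> as by simp
    also have "\<dots> = b (inv ?t' \<otimes> s) (F ?\<rho> (a ?t x))" using b_mult Fz[OF x] tc s by simp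
    also have "inv ?t' \<otimes> s = g \<otimes> inv ?t" using tc g by (simp add: s_def m_assoc[symmetric])
    also have "b (g \<otimes> inv ?t) (F ?\<rho> (a ?t x)) = b g (f x)"
      unfolding f_def using b_mult Fz[OF x] tc g by simp
    finally show ?thesis .
  qed
  have loc: "\<exists>g\<in>carrier G. k g (c x) \<in> R \<and> (\<forall>y\<in>V. c y = k g (c x) \<longrightarrow> f y = F (c y) y)" if x: "x \<in> V" for x
  proof (intro bexI conjI ballI impI)
    show "k (t (c x)) (c x) \<in> R" using t rep_in x by simp
    show "t (c x) \<in> carrier G" using t x by simp
    fix y assume y: "y \<in> V" and cy: "c y = k (t (c x)) (c x)"
    have "rep (c y) = c y" using cy rep_eq[OF x, of "t (c x)"] t[OF x] by simp
    hence "k (t (c y)) (c y) = c y" "c y \<in> R" "t (c y) \<in> carrier G" using t[OF y] rep_in[OF y] by auto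
    hence "f y = b (inv (t (c y))) (b (t (c y)) (F (c y) y))"
      unfolding f_def using F_stab[OF y] \<open>rep (c y) = c y\<close> by simp
    also have "\<dots> = F (c y) y"
      using b_mult[of "inv (t (c y))" "t (c y)" "F (c y) y"] b_one F_closed[OF y \<open>c y \<in> R\<close>]
        \<open>t (c y) \<in> carrier G\<close> by simp
    finally show "f y = F (c y) y" .
  qed
  show ?thesis using closed equiv loc by (intro exI[of _ f]) blast
qed

text \<open>For a point of the realisation this is the vertex or the edge that has the point in its
  interior; it serves as the class in \<open>equivariant_choice\<close>.\<close>

definition supp :: "('v \<Rightarrow> real) \<Rightarrow> 'v set" where "supp p = {v. p v \<noteq> 0}"

lemma supp_vpoint [simp]: "supp (vpoint v) = {v}"
  by (auto simp: supp_def vpoint_def indicator_def)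

lemma supp_ept: "u \<noteq> w \<Longrightarrow> 0 < t \<Longrightarrow> t < 1 \<Longrightarrow> supp (ept u w t) = {u, w}"
  by (auto simp: supp_def ept_def)

lemma (in mgraph) points_supp_cases:
  assumes "p \<in> points T"
  obtains (vertex) v where "v \<in> sverts T" "p = vpoint v"
  | (edge) u w t where "{u, w} \<in> sedges T" "u \<noteq> w" "0 < t" "t < 1" "p = ept u w t" "supp p = {u, w}"
  using assms
proof (rule points_cases)
  fix u w t assume *: "u \<in> sverts T" "w \<in> sverts T" "u = w \<or> {u, w} \<in> sedges T"
    "0 \<le> t" "t \<le> 1" "p = ept u w t"
  consider "u = w" | "t = 0" | "t = 1" | "u \<noteq> w" "0 < t" "t < 1" using * by linarith
  thus thesis
  proof cases
    case 4
    thus thesis using * edge[of u w t] supp_ept by metis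
  qed (use * vertex in auto)
qed

lemma (in mgraph) supp_point_act:
  assumes "h \<in> carrier G" "p \<in> points T"
  shows "supp (point_act T h p) = act T h ` supp p"
  using assms(2)
proof (cases rule: points_supp_cases)
  case (vertex v) thus ?thesis by (simp add: point_act_vpoint assms(1))
next
  case (edge u w t)
  hence "u \<in> sverts T" "w \<in> sverts T" using edge_ends by auto
  moreover from this have "act T h u \<noteq> act T h w" using act_inj edge assms by metis
  ultimately show ?thesis using edge by (simp add: point_act_ept assms(1) supp_ept)
qed

lemma edge_curve:
  assumes Y: "mgraph G Y" and Fp: "F u \<in> points Y" "F w \<in> points Y" and "u \<noteq> w"
    and L: "tdist Y (F u) (F w) < s"
  shows "\<exists>\<kappa>. (\<forall>p\<in>closed_edge {u, w}. \<kappa> p \<in> points Y) \<and> \<kappa> (vpoint u) = F u \<and> \<kappa> (vpoint w) = F w \<and>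
    (\<forall>p\<in>closed_edge {u, w}. \<forall>q\<in>closed_edge {u, w}. tdist Y (\<kappa> p) (\<kappa> q) \<le> s * edist {u, w} p q)"
proof -
  interpret Y: mgraph G Y by (rule Y)
  have "ch (sedges Y) (len Y) (F u) (F w) s" using Y.tdist_lessD Fp L by blast
  moreover have "closed_edge e \<subseteq> points Y" if "e \<in> sedges Y" for e using Y.closed_edge_points[OF that] by blast
  ultimately obtain \<gamma> where \<gamma>: "\<gamma> 0 = F u" "\<gamma> s = F w" "\<And>a. \<gamma> a \<in> points Y"
    "\<And>a b. 0 \<le> a \<Longrightarrow> a \<le> b \<Longrightarrow> b \<le> s \<Longrightarrow> ch (sedges Y) (len Y) (\<gamma> a) (\<gamma> b) (b - a)"
    using ch_curve[of "sedges Y" "len Y" "F u" "F w" s "points Y"] Y.edge_card Y.len_pos Fp by blast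
  have s: "0 \<le> s" using Y.tdist_nonneg[OF Fp] L by simp
  \<comment> \<open>On the closed edge the coordinate at \<open>w\<close> is the parameter from
    \<open>u\<close> to \<open>w\<close>.\<close>
  define \<kappa> where "\<kappa> p = \<gamma> (s * p w)" for p
  have e: "ept u w t w = t" for t using \<open>u \<noteq> w\<close> by (simp add: ept_def)
  have le: "tdist Y (\<gamma> (s * a)) (\<gamma> (s * b)) \<le> s * (b - a)" if "0 \<le> a" "a \<le> b" "b \<le> 1" for a b
  proof -
    have "ch (sedges Y) (len Y) (\<gamma> (s * a)) (\<gamma> (s * b)) (s * b - s * a)"
      using that s by (intro \<gamma>(4)) (auto simp: mult_left_mono mult_left_le)
    thus ?thesis using Y.tdist_leI by (fastforce simp: algebra_simps)
  qed
  have "tdist Y (\<kappa> p) (\<kappa> q) \<le> s * edist {u, w} p q"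
    if pp: "p \<in> closed_edge {u, w}" and qq: "q \<in> closed_edge {u, w}" for p q
  proof -
    obtain a where a: "0 \<le> a" "a \<le> 1" "p = ept u w a"
      using closed_edgeE[OF pp \<open>u \<noteq> w\<close>] .
    obtain b where b: "0 \<le> b" "b \<le> 1" "q = ept u w b"
      using closed_edgeE[OF qq \<open>u \<noteq> w\<close>] .
    show ?thesis
    proof (cases "a \<le> b")
      case True
      thus ?thesis using le[of a b] a b \<open>u \<noteq> w\<close> by (simp add: \<kappa>_def e edist_ept)
    next
      case False
      thus ?thesis using le[of b a] a b \<open>u \<noteq> w\<close> Y.tdist_sym \<gamma>(3) by (simp add: \<kappa>_def e edist_ept)
    qed
  qed
  moreover have "\<kappa> (vpoint u) = F u" "\<kappa> (vpoint w) = F w"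
    using \<gamma>(1,2) \<open>u \<noteq> w\<close> by (simp_all add: \<kappa>_def vpoint_def)
  ultimately show ?thesis using \<gamma>(3) by (intro exI[of _ \<kappa>]) (simp add: \<kappa>_def)
qed

text \<open>An edge is sent along a curve between the images of its ends. Distance is an infimum, so
  the curve is only nearly shortest and \<open>M\<close> must exceed \<open>L\<close>. Equivariance
  costs nothing in the interior of an edge because edge stabilisers are trivial.\<close>

lemma edge_extension:
  assumes X: "mgraph G X" and Y: "mgraph G Y"
    and Fp: "\<And>v. v \<in> sverts X \<Longrightarrow> F v \<in> points Y"
    and Fe: "\<And>g v. g \<in> carrier G \<Longrightarrow> v \<in> sverts X \<Longrightarrow> F (act X g v) = point_act Y g (F v)"
    and L: "\<And>u w. {u, w} \<in> sedges X \<Longrightarrow> tdist Y (F u) (F w) \<le> L * len X {u, w}"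
    and LM: "L < M"
  shows "\<exists>f. (\<forall>p\<in>points X. f p \<in> points Y) \<and>
    (\<forall>g\<in>carrier G. \<forall>p\<in>points X. f (point_act X g p) = point_act Y g (f p)) \<and>
    (\<forall>v\<in>sverts X. f (vpoint v) = F v) \<and>
    (\<forall>e\<in>sedges X. \<forall>p\<in>closed_edge e. \<forall>q\<in>closed_edge e. tdist Y (f p) (f q) \<le> M * len X e * edist e p q)"
proof -
  interpret X: mgraph G X by (rule X)
  interpret Y: mgraph G Y by (rule Y)
  let ?C = "\<lambda>e \<kappa>. (\<forall>p\<in>closed_edge e. \<kappa> p \<in> points Y) \<and> (\<forall>v\<in>e. \<kappa> (vpoint v) = F v) \<and>
    (\<forall>p\<in>closed_edge e. \<forall>q\<in>closed_edge e. tdist Y (\<kappa> p) (\<kappa> q) \<le> M * len X e * edist e p q)"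
  have "\<exists>\<kappa>. ?C e \<kappa>" if e: "e \<in> sedges X" for e
  proof -
    obtain u w where uw: "e = {u, w}" "u \<noteq> w" "u \<in> sverts X" "w \<in> sverts X"
      using X.edge_obtain e by metis
    have "L * len X e < M * len X e" using LM X.len_pos[OF e] by simp
    hence "tdist Y (F u) (F w) < M * len X e" using L[of u w] e uw by simp
    from edge_curve[OF Y Fp[OF uw(3)] Fp[OF uw(4)] uw(2) this] show ?thesis unfolding uw(1) by blast
  qed
  then obtain \<kappa> where \<kappa>: "\<And>e. e \<in> sedges X \<Longrightarrow> ?C e (\<kappa> e)" by metis
  \<comment> \<open>The prescription by class: the vertex map on a vertex, the chosen curve on the
    interior of an edge.\<close>
  define Fl where "Fl \<beta> p = (if \<exists>v. \<beta> = {v} then F (the_elem \<beta>) else \<kappa> \<beta> p)" for \<beta> p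
  have Fl1: "Fl {v} p = F v" for v p by (simp add: Fl_def)
  have Fl2: "Fl {u, w} p = \<kappa> {u, w} p" if "u \<noteq> w" for u w p
    using that by (auto simp: Fl_def doubleton_eq_iff)
  have "\<exists>f. (\<forall>x\<in>points X. f x \<in> points Y) \<and>
     (\<forall>g\<in>carrier G. \<forall>x\<in>points X. f (point_act X g x) = point_act Y g (f x)) \<and>
     (\<forall>x\<in>points X. \<exists>g\<in>carrier G. act X g ` supp x \<in> UNIV \<and>
        (\<forall>y\<in>points X. supp y = act X g ` supp x \<longrightarrow> f y = Fl (supp y) y))"
  proof (rule equivariant_choice[where V = "points X" and Y = "points Y" and a = "point_act X"
        and b = "point_act Y" and c = supp and k = "\<lambda>g. (`) (act X g)" and R = UNIV and F = Fl,
        OF X.grp X.point_act_closed X.point_act_one X.point_act_mult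
        Y.point_act_closed Y.point_act_one Y.point_act_mult X.supp_point_act])
    show "\<exists>g\<in>carrier G. act X g ` supp x \<in> UNIV" for x using X.one_in by blast
    show "Fl (supp p) p \<in> points Y" if "p \<in> points X" for p
      using that
    proof (cases rule: X.points_supp_cases)
      case (vertex v) thus ?thesis using Fp Fl1 by simp
    next
      case (edge u w t)
      thus ?thesis using \<kappa>[of "{u, w}"] ept_closed_edge[of u w t] Fl2 by simp
    qed
    show "Fl (supp p) (point_act X g p) = point_act Y g (Fl (supp p) p)"
      if p: "p \<in> points X" "supp p \<in> UNIV" and g: "g \<in> carrier G" "act X g ` supp p = supp p" for p g
      using p(1)
    proof (cases rule: X.points_supp_cases)
      case (vertex v)
      hence "act X g v = v" using g by simp
      thus ?thesis using vertex Fe[OF g(1), of v] Fl1 by simp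
    next
      case (edge u w t)
      hence "g = \<one>\<^bsub>G\<^esub>" using X.edge_free[OF g(1), of "{u, w}"] g(2) by simp
      moreover have "Fl (supp p) p \<in> points Y"
        using edge \<kappa>[of "{u, w}"] ept_closed_edge[of u w t] Fl2 by simp
      ultimately show ?thesis using p by (simp add: X.point_act_one Y.point_act_one)
    qed
  qed
  then obtain f where f0: "\<forall>x\<in>points X. f x \<in> points Y"
    "\<forall>g\<in>carrier G. \<forall>x\<in>points X. f (point_act X g x) = point_act Y g (f x)"
    "\<forall>x\<in>points X. \<exists>g\<in>carrier G. act X g ` supp x \<in> UNIV \<and>
        (\<forall>y\<in>points X. supp y = act X g ` supp x \<longrightarrow> f y = Fl (supp y) y)" by (elim exE conjE)
  have f: "\<And>x. x \<in> points X \<Longrightarrow> f x \<in> points Y"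
    "\<And>g x. g \<in> carrier G \<Longrightarrow> x \<in> points X \<Longrightarrow> f (point_act X g x) = point_act Y g (f x)"
    "\<And>x. x \<in> points X \<Longrightarrow> \<exists>g\<in>carrier G.
        (\<forall>y\<in>points X. supp y = act X g ` supp x \<longrightarrow> f y = Fl (supp y) y)"
    using f0 by blast+
  have fv: "f (vpoint v) = F v" if v: "v \<in> sverts X" for v
  proof -
    obtain g where g: "g \<in> carrier G"
      "\<And>y. y \<in> points X \<Longrightarrow> supp y = act X g ` supp (vpoint v) \<Longrightarrow> f y = Fl (supp y) y"
      using f(3)[OF X.vpoint_points[OF v]] by blast
    have "f (vpoint (act X g v)) = F (act X g v)"
      using g(2)[of "vpoint (act X g v)"] v g(1) X.act_closed Fl1 by (simp add: X.vpoint_points)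
    hence "point_act Y g (f (vpoint v)) = point_act Y g (F v)"
      using f(2)[OF g(1) X.vpoint_points[OF v]] Fe[OF g(1) v] v g(1) by (simp add: X.point_act_vpoint)
    thus ?thesis
      using Y.point_act_inv[OF g(1) f(1)[OF X.vpoint_points[OF v]]] Y.point_act_inv[OF g(1) Fp[OF v]] by metis
  qed
  have "tdist Y (f p) (f q) \<le> M * len X e * edist e p q"
    if e: "e \<in> sedges X" and p: "p \<in> closed_edge e" and q: "q \<in> closed_edge e" for e p q
  proof -
    obtain u w where uw: "e = {u, w}" "u \<noteq> w" "u \<in> sverts X" "w \<in> sverts X"
      using X.edge_obtain e by metis
    have m: "ept u w (1/2) \<in> points X" using X.ept_points[of u w "1/2"] e uw by simp
    have sm: "supp (ept u w (1/2)) = e" using supp_ept[of u w "1/2"] uw by simp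
    \<comment> \<open>\<open>f\<close> follows the chosen curve on just one edge of each orbit. The
      estimate is read off there and carried back by the isometry \<open>g\<close>.\<close>
    obtain g where g: "g \<in> carrier G"
      "\<And>y. y \<in> points X \<Longrightarrow> supp y = act X g ` e \<Longrightarrow> f y = Fl (supp y) y"
      using f(3)[OF m] unfolding sm by blast
    let ?u = "act X g u" and ?w = "act X g w"
    have ge: "act X g ` e = {?u, ?w}" "{?u, ?w} \<in> sedges X" "?u \<noteq> ?w"
      using X.act_edge[OF g(1) e] X.act_inj[OF g(1) uw(3,4)] uw by auto
    have fg: "f (ept ?u ?w t) = \<kappa> {?u, ?w} (ept ?u ?w t)" if t: "0 \<le> t" "t \<le> 1" for t
    proof -
      consider "t = 0" | "t = 1" | "0 < t" "t < 1" using t by linarith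
      thus ?thesis
      proof cases
        case 1 thus ?thesis using fv \<kappa>[OF ge(2)] X.edge_ends[OF ge(2)] by simp
      next
        case 2 thus ?thesis using fv \<kappa>[OF ge(2)] X.edge_ends[OF ge(2)] by simp
      next
        case 3 thus ?thesis
          using g(2)[of "ept ?u ?w t"] X.ept_points[OF ge(2)] supp_ept[OF ge(3)] Fl2[OF ge(3)] ge(1) by simp
      qed
    qed
    obtain a where a: "0 \<le> a" "a \<le> 1" "p = ept u w a"
      using closed_edgeE[OF p[unfolded uw(1)] uw(2)] .
    obtain b where b: "0 \<le> b" "b \<le> 1" "q = ept u w b"
      using closed_edgeE[OF q[unfolded uw(1)] uw(2)] .
    have pq: "p \<in> points X" "q \<in> points X" using X.closed_edge_points e p q by blast+
    have "tdist Y (f p) (f q) = tdist Y (point_act Y g (f p)) (point_act Y g (f q))"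
      using Y.tdist_act g(1) f(1) pq by simp
    also have "\<dots> = tdist Y (f (ept ?u ?w a)) (f (ept ?u ?w b))"
      using f(2)[OF g(1) pq(1)] f(2)[OF g(1) pq(2)] unfolding a(3) b(3)
      by (simp add: X.point_act_ept[OF g(1) uw(3,4)])
    also have "\<dots> \<le> M * len X {?u, ?w} * edist {?u, ?w} (ept ?u ?w a) (ept ?u ?w b)"
      using fg a b \<kappa>[OF ge(2)] ept_closed_edge[OF ge(3)] by simp
    also have "\<dots> = M * len X e * edist e p q"
      using X.len_act[OF g(1) e] ge uw a b by (simp add: edist_ept)
    finally show ?thesis .
  qed
  thus ?thesis using f(1,2) fv by (intro exI[of _ f]) blast
qed

text \<open>The edge estimates add up along a chain, and then the infimum over chains is
  taken.\<close>

lemma edge_lipschitz: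
  assumes X: "mgraph G X" and Y: "mgraph G Y" and M: "0 \<le> M"
    and f: "\<And>p. p \<in> points X \<Longrightarrow> f p \<in> points Y"
    and e: "\<And>e p q. e \<in> sedges X \<Longrightarrow> p \<in> closed_edge e \<Longrightarrow> q \<in> closed_edge e \<Longrightarrow>
      tdist Y (f p) (f q) \<le> M * len X e * edist e p q"
    and pq: "p \<in> points X" "q \<in> points X"
  shows "tdist Y (f p) (f q) \<le> M * tdist X p q"
proof -
  interpret X: mgraph G X by (rule X)
  interpret Y: mgraph G Y by (rule Y)
  have c: "tdist Y (f p) (f q) \<le> M * s" if "ch (sedges X) (len X) p q s" "p \<in> points X" for p q s
    using that
  proof (induction rule: ch.induct)
    case (ch_refl s p)
    thus ?case using f M by simp
  next
    case (ch_step e p q r s t)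
    have q: "q \<in> points X" using X.closed_edge_points ch_step.hyps by blast
    have "r \<in> points X" using ch_step.hyps(4) q
    proof (induction rule: ch.induct)
      case (ch_step e p q r s t) thus ?case using X.closed_edge_points by blast
    qed
    hence "tdist Y (f p) (f r) \<le> tdist Y (f p) (f q) + tdist Y (f q) (f r)"
      using Y.tdist_triangle f q ch_step.prems by simp
    also have "\<dots> \<le> M * len X e * edist e p q + M * s"
      using e[OF ch_step.hyps(1-3)] ch_step.IH[OF q] by simp
    also have "\<dots> = M * (len X e * edist e p q + s)" by (simp add: algebra_simps)
    also have "\<dots> \<le> M * t" using ch_step.hyps(5) M by (rule mult_left_mono)
    finally show ?case .
  qed
  show ?thesis
  \<comment> \<open>The passage to the infimum divides by \<open>M\<close>; for \<open>M = 0\<close>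
    any single chain gives the claim.\<close>
  proof (cases "M = 0")
    case True
    obtain s where "ch (sedges X) (len X) p q s" using X.ch_points_ex[OF pq] by blast
    thus ?thesis using c[OF _ pq(1)] True by fastforce
  next
    case False
    hence M': "0 < M" using M by simp
    have "tdist Y (f p) (f q) / M \<le> tdist X p q"
    proof (rule X.tdist_geI[OF pq])
      fix s assume "ch (sedges X) (len X) p q s"
      hence "tdist Y (f p) (f q) \<le> M * s" using c pq(1) by blast
      thus "tdist Y (f p) (f q) / M \<le> s" using M' by (simp add: pos_divide_le_eq mult.commute[of s M])
    qed
    thus ?thesis using M' by (simp add: pos_divide_le_eq mult.commute)
  qed
qed

text \<open>Vertex images with a bound on every edge suffice: \<open>edge_extension\<close> gives
  the constants \<open>L + d\<close> for all positive \<open>d\<close>, and the infimum over maps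
  removes the slack.\<close>

lemma stretch_leI:
  assumes X: "\<And>i. i \<in> idx S \<Longrightarrow> mgraph (grp S i) (X i)" and Y: "\<And>i. i \<in> idx S \<Longrightarrow> mgraph (grp S i) (Y i)"
    and F: "\<And>i v. i \<in> idx S \<Longrightarrow> v \<in> sverts (X i) \<Longrightarrow> F i v \<in> points (Y i)"
    and Fe: "\<And>i g v. i \<in> idx S \<Longrightarrow> g \<in> carrier (grp S i) \<Longrightarrow> v \<in> sverts (X i) \<Longrightarrow>
      F i (act (X i) g v) = point_act (Y i) g (F i v)"
    and L: "\<And>i u w. i \<in> idx S \<Longrightarrow> {u, w} \<in> sedges (X i) \<Longrightarrow>
      tdist (Y i) (F i u) (F i w) \<le> L * len (X i) {u, w}"
    and L0: "0 \<le> L"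
  shows "stretch S X Y \<le> ereal L"
proof (rule ereal_le_epsilon2)
  fix d :: real assume d: "0 < d"
  let ?P = "\<lambda>i f. (\<forall>p\<in>points (X i). f p \<in> points (Y i)) \<and>
    (\<forall>g\<in>carrier (grp S i). \<forall>p\<in>points (X i). f (point_act (X i) g p) = point_act (Y i) g (f p)) \<and>
    (\<forall>e\<in>sedges (X i). \<forall>p\<in>closed_edge e. \<forall>q\<in>closed_edge e.
      tdist (Y i) (f p) (f q) \<le> (L + d) * len (X i) e * edist e p q)"
  have "\<exists>f. ?P i f" if i: "i \<in> idx S" for i
    using edge_extension[OF X[OF i] Y[OF i] F[OF i] Fe[OF i] L[OF i], of "L + d"] d by auto
  then obtain f where f: "\<And>i. i \<in> idx S \<Longrightarrow> ?P i (f i)" by metis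
  have "f \<in> equivariant_maps S X Y" using f by (auto simp: equivariant_maps_def)
  hence "stretch S X Y \<le> (SUP i\<in>idx S. Lip (X i) (Y i) (f i))"
    unfolding stretch_def by (rule INF_lower)
  also have "\<dots> \<le> ereal (L + d)"
  proof (rule SUP_least)
    fix i assume i: "i \<in> idx S"
    have "tdist (Y i) (f i p) (f i q) \<le> (L + d) * tdist (X i) p q"
      if "p \<in> points (X i)" "q \<in> points (X i)" for p q
      using edge_lipschitz[OF X[OF i] Y[OF i], of "L + d" "f i"] f[OF i] that L0 d by simp
    thus "Lip (X i) (Y i) (f i) \<le> ereal (L + d)"
      unfolding Lip_def using L0 d by (intro Inf_lower) auto
  qed
  finally show "stretch S X Y \<le> ereal L + ereal d" by simp
qed

lemma stretch_lessD:
  assumes "stretch S X Y < ereal L"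
    and X: "\<And>i. i \<in> idx S \<Longrightarrow> mgraph (grp S i) (X i)" and Y: "\<And>i. i \<in> idx S \<Longrightarrow> mgraph (grp S i) (Y i)"
  shows "\<exists>f\<in>equivariant_maps S X Y. \<forall>i\<in>idx S. 0 \<le> L \<and>
    (\<forall>p\<in>points (X i). \<forall>q\<in>points (X i). tdist (Y i) (f i p) (f i q) \<le> L * tdist (X i) p q)"
proof -
  obtain f where f: "f \<in> equivariant_maps S X Y" "(SUP i\<in>idx S. Lip (X i) (Y i) (f i)) < ereal L"
    using assms(1) unfolding stretch_def INF_less_iff by blast
  have "0 \<le> L \<and> (\<forall>p\<in>points (X i). \<forall>q\<in>points (X i). tdist (Y i) (f i p) (f i q) \<le> L * tdist (X i) p q)"
    if i: "i \<in> idx S" for i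
  proof -
    interpret X: mgraph "grp S i" "X i" by (rule X[OF i])
    have "Lip (X i) (Y i) (f i) < ereal L" using f(2) SUP_upper[OF i] le_less_trans by metis
    then obtain K where K: "0 \<le> K" "K < L"
      "\<forall>p\<in>points (X i). \<forall>q\<in>points (X i). tdist (Y i) (f i p) (f i q) \<le> K * tdist (X i) p q"
      unfolding Lip_def Inf_less_iff by auto
    have "tdist (Y i) (f i p) (f i q) \<le> L * tdist (X i) p q"
      if pq: "p \<in> points (X i)" "q \<in> points (X i)" for p q
    proof -
      have "K * tdist (X i) p q \<le> L * tdist (X i) p q"
        using K X.tdist_nonneg[OF pq] by (intro mult_right_mono) auto
      thus ?thesis using K(3) pq by (meson order_trans)
    qed
    thus ?thesis using K by auto
  qed
  thus ?thesis using f(1) by blast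
qed

section \<open>Trees\<close>

locale mtree = mgraph +
  assumes tree: "edge_tree (sedges T)"
begin

lemma epath_act:
  assumes p: "epath ET u p w" and u: "u \<in> VT" and h: "h \<in> carrier G"
  shows "epath ET (act T h u) (map (act T h) p) (act T h w)"
proof -
  have "set p \<subseteq> VT"
  proof
    fix v assume "v \<in> set p"
    then obtain i where i: "i < length p" "v = p ! i" by (auto simp: in_set_conv_nth)
    have "p ! j \<in> VT" if "j < length p" for j
      using that
    proof (induction j)
      case 0 thus ?case using p u by (auto simp: epath_def hd_conv_nth)
    next
      case (Suc j)
      hence "{p ! j, p ! Suc j} \<in> ET" using p by (auto simp: epath_def successively_conv_nth)
      thus ?case using edge_ends by blast
    qed
    thus "v \<in> VT" using i by simp
  qed
  hence "inj_on (act T h) (set p)" using act_inj_on[OF h] inj_on_subset by blast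
  moreover have "{act T h x, act T h y} \<in> ET" if "{x, y} \<in> ET" for x y
    using act_edge[OF h that] by simp
  ultimately show ?thesis using p unfolding epath_def
    by (auto simp: distinct_map successively_map hd_map last_map elim: successively_mono)
qed

text \<open>The simple path between two fixed vertices would be fixed by uniqueness, and with it its
  first edge.\<close>

lemma fixed_vertex_unique:
  assumes h: "h \<in> carrier G" "h \<noteq> \<one>" and uw: "u \<in> VT" "w \<in> VT"
    and fx: "act T h u = u" "act T h w = w"
  shows "u = w"
proof (rule ccontr)
  assume "u \<noteq> w"
  obtain p where p: "epath ET u p w" using rtrancl_epath[OF conn[OF uw]] by blast
  have "epath ET u (map (act T h) p) w" using epath_act[OF p uw(1) h(1)] fx by simp
  hence eq: "map (act T h) p = p" using p tree unfolding edge_tree_def by metis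
  obtain a b q where ab: "p = a # b # q" using p \<open>u \<noteq> w\<close>
    by (cases p rule: remdups_adj.cases) (auto simp: epath_def)
  hence "{a, b} \<in> ET" "act T h a = a" "act T h b = b" using p eq by (auto simp: epath_def)
  thus False using edge_free[OF h(1), of "{a, b}"] h(2) by simp
qed

lemma fixed_point_vertex:
  assumes h: "h \<in> carrier G" "h \<noteq> \<one>" and p: "p \<in> PT" "point_act T h p = p"
  obtains v where "v \<in> VT" "p = vpoint v" "act T h v = v"
  using p(1)
proof (cases rule: points_supp_cases)
  case (vertex v)
  thus ?thesis using that p(2) h by (simp add: point_act_vpoint)
next
  case (edge u w t)
  have "act T h ` supp p = supp p" using supp_point_act[OF h(1) p(1)] p(2) by simp
  hence "act T h ` {u, w} = {u, w}" unfolding edge(6) .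
  thus ?thesis using edge_free[OF h(1)] edge(1) h(2) by blast
qed

text \<open>A fixed point in the interior of an edge would make \<open>h\<close> stabilise that
  edge, so both points are vertices. This is the rigidity that forces values of equivariant
  maps.\<close>

lemma fixed_point_unique:
  assumes h: "h \<in> carrier G" "h \<noteq> \<one>" and p: "p \<in> PT" "point_act T h p = p"
    and q: "q \<in> PT" "point_act T h q = q"
  shows "p = q"
  using fixed_point_vertex[OF h p] fixed_point_vertex[OF h q] fixed_vertex_unique[OF h] by metis

text \<open>The components of this set of edges are the branches of the tree at
  \<open>x\<close>.\<close>

definition off :: "'b \<Rightarrow> 'b set set" where "off x = {e \<in> ET. x \<notin> e}"

lemma off_avoids: "joined (off x) u w \<Longrightarrow> u \<noteq> x \<Longrightarrow> w \<noteq> x"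
  by (induction rule: rtrancl_induct) (auto simp: off_def)

lemma off_act:
  assumes h: "h \<in> carrier G" "act T h x = x" "x \<in> VT" and "joined (off x) u w"
  shows "joined (off x) (act T h u) (act T h w)"
proof (rule act_adj[OF assms(4)])
  fix e assume e: "e \<in> off x"
  hence "act T h ` e \<in> ET" using act_edge[OF h(1)] by (simp add: off_def)
  moreover have "x \<notin> act T h ` e"
  proof
    assume "x \<in> act T h ` e"
    then obtain v where "v \<in> e" "act T h v = act T h x" using h by auto
    thus False using act_inj[OF h(1) _ h(3), of v] e edge_verts unfolding off_def by auto
  qed
  ultimately show "act T h ` e \<in> off x" by (simp add: off_def)
qed

text \<open>The first edge from \<open>x\<close> towards \<open>v\<close> and its image under
  \<open>h\<close> would lead into the same branch. A tree has only one edge from \<open>x\<close>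
  into a branch, so \<open>h\<close> would fix that edge.\<close>

lemma off_moved:
  assumes h: "h \<in> carrier G" "h \<noteq> \<one>" "act T h x = x" "x \<in> VT"
    and v: "v \<in> VT" "v \<noteq> x"
  shows "\<not> joined (off x) v (act T h v)"
proof
  assume c: "joined (off x) v (act T h v)"
  obtain y n where y: "y 0 = x" "y n = v" "inj_on y {..n}" "\<And>i. i < n \<Longrightarrow> {y i, y (Suc i)} \<in> ET"
    using rtrancl_walk[OF conn[OF h(4) v(1)]] by metis
  have n: "0 < n" using y v by (cases n) auto
  have "joined (off x) (y 1) (y n)"
  proof (rule walk_rtrancl)
    fix k assume k: "1 \<le> k" "k < n"
    have "y k \<noteq> y 0" "y (Suc k) \<noteq> y 0" using y(3) k by (auto simp: inj_on_eq_iff)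
    thus "{y k, y (Suc k)} \<in> off x" using y k by (auto simp: off_def)
  qed (use n in simp)
  hence 1: "joined (off x) (y 1) v" using y by simp
  have "joined (off x) (act T h (y 1)) (act T h v)" by (rule off_act[OF h(1,3,4) 1])
  hence 2: "joined (off x) (act T h (y 1)) (y 1)" using 1 c by (meson adj_sym rtrancl_trans)
  have e: "{x, y 1} \<in> ET" using y n by fastforce
  have he: "{x, act T h (y 1)} \<in> ET" using act_edge[OF h(1) e] h(3) by simp
  let ?E = "insert {x, act T h (y 1)} (off x)"
  have "joined ?E x (act T h (y 1))" by (simp add: r_into_rtrancl)
  moreover have "joined ?E (act T h (y 1)) (y 1)" by (rule adj_mono[OF 2]) blast
  ultimately have "joined ?E x (y 1)" by (rule rtrancl_trans)
  moreover have "?E \<subseteq> ET" using he by (auto simp: off_def)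
  ultimately have "{x, y 1} \<in> ?E" using tree_edge_in[OF tree e] by blast
  hence eq: "{x, y 1} = {x, act T h (y 1)}" by (auto simp: off_def)
  have "act T h ` {x, y 1} = {x, act T h (y 1)}" using h(3) by simp
  hence "act T h ` {x, y 1} = {x, y 1}" by (rule trans[OF _ eq[symmetric]])
  thus False using edge_free[OF h(1) e] h(2) by blast
qed

text \<open>The retraction onto the branch of \<open>p\<close> at \<open>x\<close> moves \<open>h p\<close> to \<open>x\<close>, since \<open>h\<close> permutes the
  branches at \<open>x\<close> without fixed points.\<close>

lemma tdist_fixed_le:
  assumes h: "h \<in> carrier G" "h \<noteq> \<one>" "act T h x = x" "x \<in> VT" and p: "p \<in> PT"
  shows "tdist T p (vpoint x) \<le> tdist T p (point_act T h p)"
  using p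
proof (rule points_cases)
  fix u w t assume p': "u \<in> VT" "w \<in> VT" "u = w \<or> {u, w} \<in> ET"
    "0 \<le> t" "t \<le> 1" "p = ept u w t"
  show ?thesis
  proof (cases "u = x \<and> w = x")
    case True
    thus ?thesis using p' h vpoint_points by (simp add: point_act_vpoint)
  next
    case False
    \<comment> \<open>An end of the edge different from \<open>x\<close>; it singles out the branch
      that contains \<open>p\<close>.\<close>
    define v0 where "v0 = (if u = x then w else u)"
    have v0: "v0 \<noteq> x" "v0 \<in> VT" using False p' by (auto simp: v0_def)
    define B where "B = {v. joined (off x) v0 v}"
    define r where "r v = (if v \<in> B then v else x)" for v
    have xB: "x \<notin> B" using off_avoids v0 by (auto simp: B_def)
    have step: "b \<in> B" if "a \<in> B" "{a, b} \<in> ET" "b \<noteq> x" for a b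
    proof -
      have "a \<noteq> x" using that xB by auto
      hence "{a, b} \<in> off x" using that by (simp add: off_def)
      thus ?thesis using that unfolding B_def by (auto intro: rtrancl_into_rtrancl)
    qed
    have "v0 \<in> B" by (simp add: B_def)
    have uwB: "u \<in> B \<or> u = x" "w \<in> B \<or> w = x"
      using \<open>v0 \<in> B\<close> step[of u w] p'(3) by (auto simp: v0_def split: if_splits)
    have BT: "v \<in> VT" if "v \<in> B" for v
      using that adj_vertex_transfer[of v0 v "off x" "VT"] v0 edge_ends
      by (auto simp: B_def off_def)
    have hB: "act T h v \<notin> B" if "v \<in> B" for v
    proof
      assume "act T h v \<in> B"
      hence "joined (off x) v (act T h v)" using that unfolding B_def
        by (metis adj_sym mem_Collect_eq rtrancl_trans)
      moreover have "v \<noteq> x" using that xB by auto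
      ultimately show False using off_moved[OF h BT[OF that]] by blast
    qed
    have rp: "push r p = p" using uwB xB p' by (auto simp: r_def)
    have "r (act T h u) = x" "r (act T h w) = x" using hB uwB h(3) by (auto simp: r_def)
    hence rhp: "push r (point_act T h p) = vpoint x"
      using p' by (simp add: point_act_ept[OF h(1)])
    show ?thesis
    proof (rule tdist_geI[OF p point_act_closed[OF h(1) p]])
      fix s assume c: "chT p (point_act T h p) s"
      have "{r a, r b} \<in> ET \<and> len T {r a, r b} \<le> 1 * len T {a, b}"
        if e: "{a, b} \<in> ET" and ne: "r a \<noteq> r b" for a b
      proof -
        have "{r a, r b} = {a, b}"
          using step[of a b] step[of b a] e ne by (auto simp: r_def insert_commute split: if_splits)
        thus ?thesis using e by simp
      qed
      hence "chT (push r p) (push r (point_act T h p)) (1 * s)"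
        using edge_card len_nonneg by (intro ch_push[OF c]) auto
      thus "tdist T p (vpoint x) \<le> s" using rp rhp tdist_leI by simp
    qed
  qed
qed

text \<open>The nearest-point projection onto the subtree spanned by \<open>W\<close>: the vertex at
  which the way from \<open>v\<close> enters \<open>W\<close>, found without reference to edge
  lengths.\<close>

definition proj :: "'b set \<Rightarrow> 'b \<Rightarrow> 'b" where
  "proj W v = (THE w. w \<in> W \<and> joined {e \<in> ET. \<not> e \<subseteq> W} v w)"

definition convex_verts :: "'b set \<Rightarrow> bool" where
  "convex_verts W \<longleftrightarrow> W \<noteq> {} \<and> W \<subseteq> VT \<and>
     (\<forall>u\<in>W. \<forall>w\<in>W. joined {e \<in> ET. e \<subseteq> W} u w)"

text \<open>Two candidates are joined by edges inside \<open>W\<close> and also by edges not inside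
  \<open>W\<close>, hence by edges in the empty intersection.\<close>

lemma proj_unique:
  assumes W: "convex_verts W" and "w \<in> W" "joined {e \<in> ET. \<not> e \<subseteq> W} v w"
    "w' \<in> W" "joined {e \<in> ET. \<not> e \<subseteq> W} v w'"
  shows "w = w'"
proof -
  let ?E1 = "{e \<in> ET. e \<subseteq> W}" and ?E2 = "{e \<in> ET. \<not> e \<subseteq> W}"
  have "joined ?E1 w w'" using W assms by (simp add: convex_verts_def)
  moreover have "joined ?E2 w w'" using assms by (meson adj_sym rtrancl_trans)
  ultimately have "joined (?E1 \<inter> ?E2) w w'" by (intro tree_adj_Int[OF tree]) auto
  moreover have "?E1 \<inter> ?E2 = {}" by auto
  ultimately show ?thesis by (simp add: adj_def)
qed

lemma proj_ex:
  assumes W: "convex_verts W" and v: "v \<in> VT"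
  shows "\<exists>w. w \<in> W \<and> joined {e \<in> ET. \<not> e \<subseteq> W} v w"
proof -
  obtain w0 where w0: "w0 \<in> W" "w0 \<in> VT" using W by (auto simp: convex_verts_def)
  obtain y n where y: "y 0 = v" "y n = w0" "\<And>i. i < n \<Longrightarrow> {y i, y (Suc i)} \<in> ET"
    using rtrancl_walk[OF conn[OF v w0(2)]] by metis
  define m where "m = (LEAST m. y m \<in> W)"
  have m: "y m \<in> W" "m \<le> n" "\<And>k. k < m \<Longrightarrow> y k \<notin> W"
    using y w0 LeastI[of "\<lambda>m. y m \<in> W" n] Least_le[of "\<lambda>m. y m \<in> W" n] not_less_Least
    by (auto simp: m_def)
  have "joined {e \<in> ET. \<not> e \<subseteq> W} (y 0) (y m)"
    by (rule walk_rtrancl) (use m y in auto)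
  thus ?thesis using m y by auto
qed

lemma proj:
  assumes "convex_verts W" "v \<in> VT"
  shows "proj W v \<in> W" "joined {e \<in> ET. \<not> e \<subseteq> W} v (proj W v)"
proof -
  have "\<exists>!w. w \<in> W \<and> joined {e \<in> ET. \<not> e \<subseteq> W} v w"
    using proj_ex[OF assms] proj_unique[OF assms(1)] by (intro ex_ex1I) blast+
  from theI'[OF this] show "proj W v \<in> W" "joined {e \<in> ET. \<not> e \<subseteq> W} v (proj W v)"
    unfolding proj_def by auto
qed

lemma proj_eqI:
  assumes "convex_verts W" "v \<in> VT" "w \<in> W" "joined {e \<in> ET. \<not> e \<subseteq> W} v w"
  shows "proj W v = w"
  using proj_unique[OF assms(1) proj[OF assms(1,2)] assms(3,4)] .

lemma proj_id: "convex_verts W \<Longrightarrow> v \<in> W \<Longrightarrow> proj W v = v"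
  by (rule proj_eqI) (auto simp: convex_verts_def)

text \<open>An edge not inside \<open>W\<close> can be prepended to the way into \<open>W\<close>,
  so its two ends project to the same vertex. Hence the projection stretches nothing, for all edge
  lengths at once (\<open>ch_proj\<close>).\<close>

lemma proj_edge:
  assumes W: "convex_verts W" and e: "{a, b} \<in> ET"
  shows "(a \<in> W \<and> b \<in> W) \<or> proj W a = proj W b"
proof (cases "{a, b} \<subseteq> W")
  case False
  have ab: "a \<in> VT" "b \<in> VT" using edge_ends e by auto
  have "joined {e \<in> ET. \<not> e \<subseteq> W} a b" using e False by (intro r_into_rtrancl) simp
  hence "joined {e \<in> ET. \<not> e \<subseteq> W} a (proj W b)"
    using proj(2)[OF W ab(2)] by (rule rtrancl_trans)
  thus ?thesis using proj_eqI[OF W ab(1) proj(1)[OF W ab(2)]] by simp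
qed simp

lemma convex_act:
  assumes W: "convex_verts W" and h: "h \<in> carrier G"
  shows "convex_verts (act T h ` W)"
  unfolding convex_verts_def
proof (intro conjI ballI)
  show "act T h ` W \<noteq> {}" "act T h ` W \<subseteq> VT" using W act_closed[OF h] by (auto simp: convex_verts_def)
  fix u w assume "u \<in> act T h ` W" "w \<in> act T h ` W"
  then obtain u' w' where *: "u' \<in> W" "w' \<in> W" "u = act T h u'" "w = act T h w'" by auto
  hence "joined {e \<in> ET. e \<subseteq> W} u' w'" using W by (simp add: convex_verts_def)
  thus "joined {e \<in> ET. e \<subseteq> act T h ` W} u w"
    unfolding * by (rule act_adj) (use act_edge[OF h] in auto)
qed

lemma proj_act:
  assumes W: "convex_verts W" and h: "h \<in> carrier G" and v: "v \<in> VT"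
  shows "proj (act T h ` W) (act T h v) = act T h (proj W v)"
proof (rule proj_eqI[OF convex_act[OF W h] act_closed[OF h v]])
  show "act T h (proj W v) \<in> act T h ` W" using proj(1)[OF W v] by simp
  show "joined {e \<in> ET. \<not> e \<subseteq> act T h ` W} (act T h v) (act T h (proj W v))"
  proof (rule act_adj[OF proj(2)[OF W v]])
    fix e assume e: "e \<in> {e \<in> ET. \<not> e \<subseteq> W}"
    then obtain x where x: "x \<in> e" "x \<notin> W" "x \<in> VT" using edge_verts by blast
    have "act T h x \<notin> act T h ` W"
    proof
      assume "act T h x \<in> act T h ` W"
      then obtain y where "y \<in> W" "act T h x = act T h y" by blast
      thus False using act_inj[OF h x(3)] x W by (metis convex_verts_def subsetD)
    qed
    thus "act T h ` e \<in> {e \<in> ET. \<not> e \<subseteq> act T h ` W}" using e x act_edge[OF h] by auto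
  qed
qed

lemma ch_proj:
  assumes W: "convex_verts W" and c: "ch ET l p q s" and l: "\<And>e. e \<in> ET \<Longrightarrow> 0 \<le> l e"
  shows "ch {e \<in> ET. e \<subseteq> W} l (push (proj W) p) (push (proj W) q) s"
proof -
  have "{proj W a, proj W b} \<in> {e \<in> ET. e \<subseteq> W} \<and> l {proj W a, proj W b} \<le> 1 * l {a, b}"
    if e: "{a, b} \<in> ET" and ne: "proj W a \<noteq> proj W b" for a b
    using proj_edge[OF W e] ne e proj_id[OF W] by auto
  hence "ch {e \<in> ET. e \<subseteq> W} l (push (proj W) p) (push (proj W) q) (1 * s)"
    using edge_card l by (intro ch_push[OF c]) auto
  thus ?thesis by simp
qed

end

text \<open>The source of all lower bounds for distances. \<open>\<sigma> d\<close> is a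
  two-colouring of the vertices that changes only across \<open>d\<close>, so
  \<open>push (\<sigma> d) p True\<close> is a coordinate that varies only along \<open>d\<close>,
  by at most the fraction of \<open>d\<close> covered. Each link of a chain therefore pays for a
  single coordinate.\<close>

lemma ch_cut:
  fixes \<sigma> :: "'v set \<Rightarrow> 'v \<Rightarrow> bool"
  assumes c: "ch E l p q s" and D: "finite D" "D \<subseteq> E"
    and E: "\<And>e. e \<in> E \<Longrightarrow> card e = 2" and l: "\<And>e. e \<in> E \<Longrightarrow> 0 \<le> l e"
    and \<sigma>: "\<And>d u w. d \<in> D \<Longrightarrow> {u, w} \<in> E \<Longrightarrow> {u, w} \<noteq> d \<Longrightarrow> \<sigma> d u = \<sigma> d w"
  shows "(\<Sum>d\<in>D. l d * \<bar>push (\<sigma> d) p True - push (\<sigma> d) q True\<bar>) \<le> s"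
  using c
proof (induction rule: ch.induct)
  case (ch_step e p q r s t)
  obtain u w where e: "e = {u, w}" "u \<noteq> w" using E[OF ch_step.hyps(1)] by (auto simp: card_2_iff)
  obtain a where a: "0 \<le> a" "a \<le> 1" "p = ept u w a"
    using closed_edgeE[OF ch_step.hyps(2)[unfolded e(1)] e(2)] .
  obtain b where b: "0 \<le> b" "b \<le> 1" "q = ept u w b"
    using closed_edgeE[OF ch_step.hyps(3)[unfolded e(1)] e(2)] .
  have z: "push (\<sigma> d) p True - push (\<sigma> d) q True = 0" if "d \<in> D" "d \<noteq> e" for d
    using \<sigma>[OF that(1), of u w] that ch_step.hyps(1) e a b by simp
  have le: "\<bar>push (\<sigma> d) p True - push (\<sigma> d) q True\<bar> \<le> \<bar>a - b\<bar>" for d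
  proof -
    have "push (\<sigma> d) p True = ept (\<sigma> d u) (\<sigma> d w) a True" "push (\<sigma> d) q True = ept (\<sigma> d u) (\<sigma> d w) b True"
      using a(3) b(3) by simp_all
    thus ?thesis by (cases "\<sigma> d u"; cases "\<sigma> d w") (simp_all add: ept_def abs_minus_commute)
  qed
  have "(\<Sum>d\<in>D. l d * \<bar>push (\<sigma> d) p True - push (\<sigma> d) q True\<bar>)
      = (\<Sum>d\<in>D \<inter> {e}. l d * \<bar>push (\<sigma> d) p True - push (\<sigma> d) q True\<bar>)"
    using D z by (intro sum.mono_neutral_right) auto
  also have "\<dots> \<le> l e * \<bar>a - b\<bar>"
    using le[of e] l[OF ch_step.hyps(1)] by (cases "e \<in> D") (simp_all add: mult_left_mono)
  finally have 1: "(\<Sum>d\<in>D. l d * \<bar>push (\<sigma> d) p True - push (\<sigma> d) q True\<bar>) \<le> l e * edist e p q"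
    using e a b by (simp add: edist_ept)
  have "(\<Sum>d\<in>D. l d * \<bar>push (\<sigma> d) p True - push (\<sigma> d) r True\<bar>) \<le>
     (\<Sum>d\<in>D. l d * \<bar>push (\<sigma> d) p True - push (\<sigma> d) q True\<bar> + l d * \<bar>push (\<sigma> d) q True - push (\<sigma> d) r True\<bar>)"
  proof (rule sum_mono)
    fix d assume "d \<in> D"
    hence "0 \<le> l d" using l D by blast
    hence "l d * \<bar>push (\<sigma> d) p True - push (\<sigma> d) r True\<bar> \<le>
        l d * (\<bar>push (\<sigma> d) p True - push (\<sigma> d) q True\<bar> + \<bar>push (\<sigma> d) q True - push (\<sigma> d) r True\<bar>)"
      by (intro mult_left_mono) auto
    thus "l d * \<bar>push (\<sigma> d) p True - push (\<sigma> d) r True\<bar> \<le>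
        l d * \<bar>push (\<sigma> d) p True - push (\<sigma> d) q True\<bar> + l d * \<bar>push (\<sigma> d) q True - push (\<sigma> d) r True\<bar>"
      by (simp add: distrib_left)
  qed
  thus ?case using 1 ch_step.IH ch_step.hyps(5) by (simp add: sum.distrib)
qed simp

context mtree
begin

definition side :: "'b \<Rightarrow> 'b set \<Rightarrow> 'b \<Rightarrow> bool" where
  "side a d v \<longleftrightarrow> joined (ET - {d}) a v"

lemma side_edge: "{u, w} \<in> ET \<Longrightarrow> {u, w} \<noteq> d \<Longrightarrow> side a d u = side a d w"
proof -
  assume "{u, w} \<in> ET" "{u, w} \<noteq> d"
  hence "joined (ET - {d}) u w" by (intro r_into_rtrancl) simp
  thus ?thesis unfolding side_def by (meson adj_sym rtrancl_trans)
qed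

text \<open>The walk itself is a chain of this length. Conversely each of its edges separates its
  ends, and \<open>ch_cut\<close> applied to all these edges bounds every chain from below.\<close>

lemma tdist_walk:
  assumes x: "\<And>i. i < n \<Longrightarrow> {x i, x (Suc i)} \<in> ET" "inj_on x {..n}" "x 0 \<in> VT"
  shows "tdist T (vpoint (x 0)) (vpoint (x n)) = (\<Sum>i<n. len T {x i, x (Suc i)})"
proof (rule antisym)
  have c: "chT (vpoint (x 0)) (vpoint (x m)) (\<Sum>i<m. len T {x i, x (Suc i)})"
    if "m \<le> n" for m
    using that
  proof (induction m)
    case 0 thus ?case by (simp add: ch_refl)
  next
    case (Suc m)
    have e: "{x m, x (Suc m)} \<in> ET" using x(1) Suc.prems by simp
    have ne: "x m \<noteq> x (Suc m)" using edge_neq' e by blast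
    have "chT (ept (x m) (x (Suc m)) 0) (ept (x m) (x (Suc m)) 1) (len T {x m, x (Suc m)})"
      using e ept_closed_edge[OF ne] ne
      by (intro ch_edge[of "{x m, x (Suc m)}"]) (auto simp: edist_ept simp del: ept_0 ept_1)
    thus ?case using ch_trans[OF Suc.IH] Suc.prems by simp
  qed
  show "tdist T (vpoint (x 0)) (vpoint (x n)) \<le> (\<Sum>i<n. len T {x i, x (Suc i)})"
    using c[of n] by (simp add: tdist_leI)
  have xn: "x n \<in> VT" using x(1)[of "n - 1"] x(3) edge_ends by (cases n) auto
  let ?e = "\<lambda>i. {x i, x (Suc i)}"
  have inj: "inj_on ?e {..<n}"
  proof (rule inj_onI)
    fix i j assume "i \<in> {..<n}" "j \<in> {..<n}" and eq: "?e i = ?e j"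
    hence ij: "i < n" "j < n" by auto
    have "x i = x j \<or> (x i = x (Suc j) \<and> x (Suc i) = x j)" using eq by (auto simp: doubleton_eq_iff)
    thus "i = j" using x(2) ij by (auto simp: inj_on_eq_iff)
  qed
  show "(\<Sum>i<n. len T (?e i)) \<le> tdist T (vpoint (x 0)) (vpoint (x n))"
  proof (rule tdist_geI[OF vpoint_points[OF x(3)] vpoint_points[OF xn]])
    fix s assume s: "chT (vpoint (x 0)) (vpoint (x n)) s"
    have "(\<Sum>d\<in>?e ` {..<n}. len T d * \<bar>push (side (x 0) d) (vpoint (x 0)) True - push (side (x 0) d) (vpoint (x n)) True\<bar>) \<le> s"
      by (rule ch_cut[OF s]) (use x(1) edge_card len_nonneg side_edge in auto)
    moreover have "\<bar>push (side (x 0) d) (vpoint (x 0)) True - push (side (x 0) d) (vpoint (x n)) True\<bar> = 1"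
      if d: "d \<in> ?e ` {..<n}" for d
    proof -
      obtain i where i: "i < n" "d = ?e i" using d by auto
      have "side (x 0) d (x 0)" "\<not> side (x 0) d (x n)"
        using walk_separates[OF tree x(1) x(2) i(1)] i by (auto simp: side_def)
      thus ?thesis by (simp only: push_vpoint) (simp add: vpoint_def)
    qed
    ultimately have "(\<Sum>d\<in>?e ` {..<n}. len T d) \<le> s" by simp
    thus "(\<Sum>i<n. len T (?e i)) \<le> s" using sum.reindex[OF inj, of "len T"] by simp
  qed
qed

end

section \<open>Collapsing an invariant subgraph\<close>

locale sgtree = mtree G T for G :: "'h monoid" (structure) and T :: "('h, 'v) mtree" +
  fixes A :: "'v sgraph"
  assumes sub: "subgraph_of G T A"
begin

abbreviation comp :: "'v \<Rightarrow> 'v set" where "comp \<equiv> component A"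

lemma A_edge: "e \<in> sedges A \<Longrightarrow> e \<in> ET" and A_vert: "v \<in> sverts A \<Longrightarrow> v \<in> VT"
  and A_act: "h \<in> carrier G \<Longrightarrow> e \<in> sedges A \<Longrightarrow> act T h ` e \<in> sedges A"
  using sub by (auto simp: subgraph_of_def)

lemma A_act_iff: "h \<in> carrier G \<Longrightarrow> e \<in> ET \<Longrightarrow> act T h ` e \<in> sedges A \<longleftrightarrow> e \<in> sedges A"
proof
  assume h: "h \<in> carrier G" and e: "e \<in> ET" and a: "act T h ` e \<in> sedges A"
  have "act T (inv h) ` (act T h ` e) = e"
    using act_inv_act[OF h] edge_verts[OF e] by (force simp: image_image)
  thus "e \<in> sedges A" using A_act[OF inv_in[OF h] a] by simp
qed (use A_act in auto)

lemma comp_verts: "v \<in> VT \<Longrightarrow> w \<in> comp v \<Longrightarrow> w \<in> VT"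
  using adj_vertex_transfer[of v w "sedges A" "VT"] A_edge edge_ends by auto

lemma comp_self: "v \<in> comp v" by simp

lemma comp_act: assumes h: "h \<in> carrier G" and v: "v \<in> VT"
  shows "act T h ` comp v = comp (act T h v)"
proof
  show "act T h ` comp v \<subseteq> comp (act T h v)"
    using act_adj[of v _ "sedges A" h "sedges A"] A_act[OF h] by auto
  show "comp (act T h v) \<subseteq> act T h ` comp v"
  proof
    fix w assume w: "w \<in> comp (act T h v)"
    hence wT: "w \<in> VT" using comp_verts act_closed h v by blast
    have "joined (sedges A) (act T (inv h) (act T h v)) (act T (inv h) w)"
      using w A_act[OF inv_in[OF h]] by (intro act_adj[of _ _ "sedges A"]) auto
    hence "act T (inv h) w \<in> comp v" using act_inv_act[OF h v] by simp
    thus "w \<in> act T h ` comp v" using act_act_inv[OF h wT] by force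
  qed
qed

text \<open>By the tree property an edge whose ends lie in one component of \<open>A\<close> belongs
  to \<open>A\<close>; so no edge that survives the collapse becomes a loop.\<close>

lemma comp_edge_iff: assumes e: "{u, w} \<in> ET"
  shows "comp u = comp w \<longleftrightarrow> {u, w} \<in> sedges A"
proof
  assume "comp u = comp w"
  thus "{u, w} \<in> sedges A" using tree_edge_in[OF tree e, of "sedges A"] A_edge
    by (simp add: component_eq_iff subset_iff)
next
  assume "{u, w} \<in> sedges A"
  thus "comp u = comp w" by (simp add: component_eq_iff r_into_rtrancl)
qed

lemma convex_comp:
  assumes v: "v \<in> VT"
  shows "convex_verts (comp v)" "{e \<in> ET. e \<subseteq> comp v} \<subseteq> sedges A"
proof -
  have "joined {e \<in> ET. e \<subseteq> comp v} u w" if u: "u \<in> comp v" and w: "w \<in> comp v" for u w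
  proof -
    have "joined (sedges A) u w" using u w adj_sym by (metis in_component rtrancl_trans)
    thus ?thesis
    proof (induction rule: rtrancl_induct)
      case (step a b)
      have "a \<in> comp v" "b \<in> comp v" using u step(1,2) by (auto intro: rtrancl_trans rtrancl_into_rtrancl)
      hence "(a, b) \<in> adj {e \<in> ET. e \<subseteq> comp v}" using step(2) A_edge by simp
      with step.IH show ?case by (rule rtrancl_into_rtrancl)
    qed simp
  qed
  thus "convex_verts (comp v)" unfolding convex_verts_def using comp_verts[OF v] comp_self[of v] by blast
  show "{e \<in> ET. e \<subseteq> comp v} \<subseteq> sedges A"
  proof
    fix e assume "e \<in> {e \<in> ET. e \<subseteq> comp v}"
    hence e: "e \<in> ET" "e \<subseteq> comp v" by auto
    then obtain a b where ab: "e = {a, b}" using edge_obtain by metis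
    hence "joined (sedges A) v a" "joined (sedges A) v b" using e by auto
    hence "comp a = comp b" using component_eqI by metis
    thus "e \<in> sedges A" using comp_edge_iff[of a b] e ab by simp
  qed
qed

end

text \<open>That the collapse is again a tree is taken from the hypothesis that the boundary point
  lies in the bordification, and is recorded as \<open>col\<close>.\<close>

locale ctree = sgtree G T A for G :: "'h monoid" (structure) and T :: "('h, 'v) mtree" and A :: "'v sgraph" +
  assumes col: "mtree G (collapse_tree T A)"
begin

abbreviation C :: "('h, 'v set) mtree" where "C \<equiv> collapse_tree T A"

sublocale C: mtree G C by (rule col)

lemma C_verts: "sverts C = comp ` VT" by (simp add: collapse_tree_def)

lemma comp_in_C: "v \<in> VT \<Longrightarrow> comp v \<in> sverts C" by (simp add: C_verts)

lemma C_act: "h \<in> carrier G \<Longrightarrow> v \<in> VT \<Longrightarrow> act C h (comp v) = comp (act T h v)"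
  by (simp add: collapse_tree_def comp_act)

lemma C_edges: "sedges C = {{comp u, comp w} | u w. {u, w} \<in> ET - sedges A}" (is "_ = ?R")
proof -
  have "(\<lambda>e. comp ` e) ` (ET - sedges A) = ?R"
  proof (intro subset_antisym subsetI)
    fix d assume "d \<in> (\<lambda>e. comp ` e) ` (ET - sedges A)"
    then obtain e where e: "e \<in> ET - sedges A" "d = comp ` e" by (rule imageE)
    then obtain u w where uw: "e = {u, w}" using edge_obtain[of e] by blast
    hence "d = {comp u, comp w} \<and> {u, w} \<in> ET - sedges A" using e by simp
    thus "d \<in> ?R" by blast
  next
    fix d assume "d \<in> ?R"
    then obtain u w where uw: "d = {comp u, comp w}" "{u, w} \<in> ET - sedges A" by blast
    hence "d = comp ` {u, w}" by simp
    thus "d \<in> (\<lambda>e. comp ` e) ` (ET - sedges A)" using uw(2) by (rule image_eqI)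
  qed
  thus ?thesis by (simp add: collapse_tree_def)
qed

lemma C_edgeE:
  assumes "d \<in> sedges C"
  obtains u w where "d = {comp u, comp w}" "{u, w} \<in> ET" "{u, w} \<notin> sedges A"
    "u \<in> VT" "w \<in> VT" "u \<noteq> w" "comp u \<noteq> comp w"
proof -
  obtain u w where "d = {comp u, comp w}" "{u, w} \<in> ET" "{u, w} \<notin> sedges A"
    using assms unfolding C_edges by auto
  thus thesis using that[of u w] edge_ends[of u w] edge_neq'[of u w] comp_edge_iff[of u w] by simp
qed

lemma C_edgeI: "{u, w} \<in> ET \<Longrightarrow> {u, w} \<notin> sedges A \<Longrightarrow> {comp u, comp w} \<in> sedges C"
  unfolding C_edges by auto

text \<open>The second edge together with \<open>A\<close> would join the ends of the first, so the
  first is one of these edges and cannot be in \<open>A\<close>. This makes the description of edge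
  lengths in \<open>collapse_tree\<close> well defined.\<close>

lemma comp_edge_inj:
  assumes e: "{u, w} \<in> ET" "{u, w} \<notin> sedges A" and e': "{u', w'} \<in> ET"
    and eq: "comp u = comp u'" "comp w = comp w'"
  shows "{u, w} = {u', w'}"
proof -
  let ?E = "insert {u', w'} (sedges A)"
  have "joined ?E u u'" using eq(1) unfolding component_eq_iff by (rule adj_mono) blast
  moreover have "joined ?E u' w'" by (simp add: r_into_rtrancl)
  moreover have "joined ?E w' w" using eq(2)[symmetric] unfolding component_eq_iff by (rule adj_mono) blast
  ultimately have "joined ?E u w" by (meson rtrancl_trans)
  hence "{u, w} \<in> ?E" using tree_edge_in[OF tree e(1), of ?E] A_edge e' by auto
  thus ?thesis using e(2) by auto
qed

lemma comp_edge_inj_set: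
  assumes e: "{u, w} \<in> ET" "{u, w} \<notin> sedges A" and e': "{u', w'} \<in> ET"
    and eq: "{comp u, comp w} = {comp u', comp w'}"
  shows "(u = u' \<and> w = w') \<or> (u = w' \<and> w = u')"
proof -
  consider "comp u = comp u'" "comp w = comp w'" | "comp u = comp w'" "comp w = comp u'"
    using eq by (auto simp: doubleton_eq_iff)
  hence "{u, w} = {u', w'}"
  proof cases
    case 1 thus ?thesis using comp_edge_inj[OF e e'] by simp
  next
    case 2 thus ?thesis using comp_edge_inj[OF e, of w' u'] e' by (simp add: insert_commute)
  qed
  thus ?thesis by (auto simp: doubleton_eq_iff)
qed

lemma C_len: assumes e: "{u, w} \<in> ET" "{u, w} \<notin> sedges A"
  shows "len C {comp u, comp w} = len T {u, w}"
proof -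
  have "(THE e. e \<in> ET - sedges A \<and> comp ` e = {comp u, comp w}) = {u, w}"
  proof (rule the_equality)
    have "comp ` {u, w} = {comp u, comp w}" by (simp only: image_insert image_empty)
    with e show "{u, w} \<in> ET - sedges A \<and> comp ` {u, w} = {comp u, comp w}" by blast
  next
    fix e' assume e': "e' \<in> ET - sedges A \<and> comp ` e' = {comp u, comp w}"
    hence "e' \<in> ET" by blast
    then obtain a b where ab: "e' = {a, b}" by (rule edge_obtain)
    have "comp ` e' = {comp a, comp b}" unfolding ab by (simp only: image_insert image_empty)
    hence eq: "{comp u, comp w} = {comp a, comp b}" using e' by simp
    have "(u = a \<and> w = b) \<or> (u = b \<and> w = a)"
      using comp_edge_inj_set[OF e _ eq] \<open>e' \<in> ET\<close> ab by simp
    thus "e' = {u, w}" using ab by auto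
  qed
  thus ?thesis by (simp add: collapse_tree_def)
qed

lemma push_comp_points: assumes "p \<in> PT" shows "push comp p \<in> points C"
  using assms
proof (rule points_cases)
  fix u w t assume *: "u \<in> VT" "w \<in> VT" "u = w \<or> {u, w} \<in> ET"
    "0 \<le> t" "t \<le> 1" "p = ept u w t"
  hence "comp u = comp w \<or> {comp u, comp w} \<in> sedges C"
    using C_edgeI[of u w] comp_edge_iff[of u w] by auto
  hence "\<exists>u' w' s. u' \<in> sverts C \<and> w' \<in> sverts C \<and> (u' = w' \<or> {u', w'} \<in> sedges C) \<and>
     0 \<le> s \<and> s \<le> 1 \<and> push comp p = ept u' w' s"
    using * comp_in_C by (intro exI[of _ "comp u"] exI[of _ "comp w"] exI[of _ t]) simp
  thus ?thesis unfolding C.points_ept .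
qed

lemma push_comp_act: assumes h: "h \<in> carrier G" and p: "p \<in> PT"
  shows "push comp (point_act T h p) = point_act C h (push comp p)"
  using p
proof (rule points_cases)
  fix u w t assume *: "u \<in> VT" "w \<in> VT" "p = ept u w t"
  thus ?thesis by (simp add: point_act_ept[OF h] C.point_act_ept[OF h] comp_in_C C_act[OF h])
qed

lemma push_comp_surj: assumes "q \<in> points C" shows "\<exists>p\<in>PT. push comp p = q"
  using assms
proof (cases rule: C.points_supp_cases)
  case (vertex P)
  then obtain v where "v \<in> VT" "P = comp v" by (auto simp: C_verts)
  thus ?thesis using vertex by (intro bexI[of _ "vpoint v"]) (simp_all add: vpoint_points)
next
  case (edge P Q t)
  obtain u w where uw: "{P, Q} = {comp u, comp w}" "{u, w} \<in> ET" using C_edgeE[OF edge(1)] by metis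
  then consider "P = comp u" "Q = comp w" | "P = comp w" "Q = comp u" by (auto simp: doubleton_eq_iff)
  thus ?thesis
  proof cases
    case 1
    thus ?thesis using edge uw ept_points[OF uw(2), of t] by (intro bexI[of _ "ept u w t"]) simp_all
  next
    case 2
    thus ?thesis using edge uw ept_points[of w u t] by (intro bexI[of _ "ept w u t"]) (simp_all add: insert_commute)
  qed
qed

lemma ch_comp:
  assumes c: "ch ET l p q s" and l: "\<And>e. e \<in> ET \<Longrightarrow> 0 \<le> l e"
    "\<And>e. e \<in> ET \<Longrightarrow> e \<notin> sedges A \<Longrightarrow> l e = len T e"
  shows "ch (sedges C) (len C) (push comp p) (push comp q) s"
proof -
  have "{comp u, comp w} \<in> sedges C \<and> len C {comp u, comp w} \<le> 1 * l {u, w}"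
    if e: "{u, w} \<in> ET" and ne: "comp u \<noteq> comp w" for u w
    using comp_edge_iff[OF e] ne C_edgeI[OF e] C_len[OF e] l(2)[OF e] by simp
  hence "ch (sedges C) (len C) (push comp p) (push comp q) (1 * s)"
    using edge_card l(1) by (intro ch_push[OF c]) auto
  thus ?thesis by simp
qed

lemma ch_A_comp: "ch (sedges A) l p q s \<Longrightarrow> push comp p = push comp q"
proof (induction rule: ch.induct)
  case (ch_step e p q r s t)
  obtain u w where e: "e = {u, w}" "u \<noteq> w" using edge_obtain[OF A_edge[OF ch_step.hyps(1)]] by metis
  obtain a where a: "p = ept u w a" using closed_edgeE[OF ch_step.hyps(2)[unfolded e(1)] e(2)] .
  obtain b where b: "q = ept u w b" using closed_edgeE[OF ch_step.hyps(3)[unfolded e(1)] e(2)] .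
  have "comp u = comp w" using comp_edge_iff[of u w] ch_step.hyps(1) e A_edge by auto
  thus ?case using ch_step.IH a b by simp
qed simp

definition scaled :: "('v set \<Rightarrow> real) \<Rightarrow> real \<Rightarrow> 'v set \<Rightarrow> real" where
  "scaled l \<tau> e = (if e \<in> sedges A then \<tau> * l e else len T e)"

text \<open>One chain inside \<open>A\<close> is fixed before \<tau> is; shrinking \<open>A\<close>
  by \<tau> shrinks its length by \<tau>.\<close>

lemma ch_comp_const:
  assumes "joined (sedges A) u w" "\<And>e. e \<in> sedges A \<Longrightarrow> 0 \<le> l e"
  shows "\<exists>K\<ge>0. \<forall>\<tau>>0. ch ET (scaled l \<tau>) (vpoint u) (vpoint w) (K * \<tau>)"
proof -
  have "\<And>e. e \<in> sedges A \<Longrightarrow> card e = 2" using A_edge edge_card by blast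
  then obtain K where K: "ch (sedges A) l (vpoint u) (vpoint w) K" using ch_adj[OF assms(1), of l] by blast
  have "ch ET (scaled l \<tau>) (vpoint u) (vpoint w) (K * \<tau>)" if "0 < \<tau>" for \<tau>
  proof -
    have "ch ET (scaled l \<tau>) (vpoint u) (vpoint w) (\<tau> * K)"
      by (rule ch_mono_len[OF K]) (use A_edge that in \<open>auto simp: scaled_def\<close>)
    thus ?thesis by (simp add: mult.commute)
  qed
  moreover have "0 \<le> K" using ch_nonneg[OF K] assms(2) by blast
  ultimately show ?thesis by blast
qed

lemma fiber_vertex:
  assumes p: "p \<in> PT" and P: "push comp p = vpoint P" and l: "\<And>e. e \<in> sedges A \<Longrightarrow> 0 \<le> l e"
  shows "\<exists>u K. u \<in> VT \<and> comp u = P \<and> 0 \<le> K \<and>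
    (\<forall>\<tau>>0. ch ET (scaled l \<tau>) p (vpoint u) (K * \<tau>))"
  using p
proof (cases rule: points_supp_cases)
  case (vertex v)
  thus ?thesis using P by (intro exI[of _ v] exI[of _ 0]) (simp add: ch_refl)
next
  case (edge u w t)
  have eq: "comp u = comp w"
  proof (rule ccontr)
    assume ne: "comp u \<noteq> comp w"
    have "push comp p = ept (comp u) (comp w) t" using edge by simp
    hence "supp (vpoint P) = {comp u, comp w}" using supp_ept[OF ne] edge P by metis
    thus False using ne by auto
  qed
  hence e: "{u, w} \<in> sedges A" using comp_edge_iff edge by blast
  have "ch ET (scaled l \<tau>) p (vpoint u) (l {u, w} * \<tau>)" if "0 < \<tau>" for \<tau>
  proof (rule ch_edge[OF edge(1)])
    show "p \<in> closed_edge {u, w}" "vpoint u \<in> closed_edge {u, w}"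
      using edge ept_closed_edge[of u w] ept_closed_edge[of u w 0] by auto
    hence "edist {u, w} p (vpoint u) \<le> 1" using edist_le_1[OF edge_card[OF edge(1)]] by blast
    thus "scaled l \<tau> {u, w} * edist {u, w} p (vpoint u) \<le> l {u, w} * \<tau>"
      using e that l[OF e] mult_left_mono[of "edist {u, w} p (vpoint u)" 1 "\<tau> * l {u, w}"]
      by (simp add: scaled_def mult.commute)
  qed
  moreover have "push comp p = vpoint (comp u)" using edge eq by simp
  ultimately show ?thesis using l[OF e] P edge_ends[OF edge(1)] by (intro exI[of _ u] exI[of _ "l {u, w}"]) simp
qed

text \<open>Over a vertex of the collapse both points are within reach of vertices of one component
  of \<open>A\<close>. Over the interior of an edge the collapse is injective and the points
  coincide.\<close>

lemma fiber_const:
  assumes p: "p \<in> PT" and q: "q \<in> PT" and pq: "push comp p = push comp q"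
    and l: "\<And>e. e \<in> sedges A \<Longrightarrow> 0 \<le> l e"
  shows "\<exists>K\<ge>0. \<forall>\<tau>>0. ch ET (scaled l \<tau>) p q (K * \<tau>)"
proof (cases "\<exists>P. push comp p = vpoint P")
  case True
  then obtain P where P: "push comp p = vpoint P" by blast
  obtain u K where u: "u \<in> VT" "comp u = P" "0 \<le> K"
    "\<And>\<tau>. 0 < \<tau> \<Longrightarrow> ch ET (scaled l \<tau>) p (vpoint u) (K * \<tau>)"
    using fiber_vertex[OF p P, of l] l by blast
  obtain w K' where w: "w \<in> VT" "comp w = P" "0 \<le> K'"
    "\<And>\<tau>. 0 < \<tau> \<Longrightarrow> ch ET (scaled l \<tau>) q (vpoint w) (K' * \<tau>)"
    using fiber_vertex[OF q, of P l] P pq l by auto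
  have "joined (sedges A) u w" using u w component_eq_iff by metis
  then obtain M where M: "0 \<le> M" "\<And>\<tau>. 0 < \<tau> \<Longrightarrow> ch ET (scaled l \<tau>) (vpoint u) (vpoint w) (M * \<tau>)"
    using ch_comp_const[of u w l] l by blast
  have "ch ET (scaled l \<tau>) p q ((K + M + K') * \<tau>)" if "0 < \<tau>" for \<tau>
    using ch_trans[OF ch_trans[OF u(4)[OF that] M(2)[OF that]] ch_sym[OF w(4)[OF that]]]
    by (simp add: algebra_simps)
  thus ?thesis using u w M by (intro exI[of _ "K + M + K'"]) simp
next
  case False
  have nv: "\<exists>u w t. {u, w} \<in> ET \<and> {u, w} \<notin> sedges A \<and> 0 < t \<and> t < 1 \<and> p = ept u w t \<and>
      comp u \<noteq> comp w \<and> push comp p = ept (comp u) (comp w) t"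
    if p: "p \<in> PT" and n: "\<not> (\<exists>P. push comp p = vpoint P)" for p
    using p
  proof (cases rule: points_supp_cases)
    case (vertex v) thus ?thesis using n by simp
  next
    case (edge u w t)
    hence ne: "comp u \<noteq> comp w" using n by auto
    hence "{u, w} \<notin> sedges A" using comp_edge_iff[OF edge(1)] by simp
    thus ?thesis using edge ne by (intro exI[of _ u] exI[of _ w] exI[of _ t]) simp
  qed
  obtain u w t where u: "{u, w} \<in> ET" "{u, w} \<notin> sedges A" "0 < t" "t < 1" "p = ept u w t"
      "comp u \<noteq> comp w" "push comp p = ept (comp u) (comp w) t"
    using nv[OF p False] by blast
  obtain u' w' t' where u': "{u', w'} \<in> ET" "{u', w'} \<notin> sedges A" "0 < t'" "t' < 1" "q = ept u' w' t'"
      "comp u' \<noteq> comp w'" "push comp q = ept (comp u') (comp w') t'"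
    using nv[OF q] False pq by auto
  have ee: "ept (comp u) (comp w) t = ept (comp u') (comp w') t'" using u(7) u'(7) pq by simp
  have "{comp u, comp w} = {comp u', comp w'}"
    using supp_ept[OF u(6,3,4)] supp_ept[OF u'(6,3,4)] ee by simp
  hence "(u = u' \<and> w = w') \<or> (u = w' \<and> w = u')" using comp_edge_inj_set[OF u(1,2) u'(1)] by blast
  hence "p = q"
  proof
    assume a: "u = u' \<and> w = w'"
    hence "t = t'" using fun_cong[OF ee, of "comp w"] u(6) by (simp add: ept_def)
    thus ?thesis using a u u' by simp
  next
    assume a: "u = w' \<and> w = u'"
    hence "t = 1 - t'" using fun_cong[OF ee, of "comp w"] u(6) by (simp add: ept_def)
    thus ?thesis using a u(5) u'(5) ept_swap[of u' w' t'] by simp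
  qed
  thus ?thesis by (intro exI[of _ 0]) (simp add: ch_refl)
qed

text \<open>Every link of a chain in the collapse lifts with its length; consecutive lifts are
  joined inside a fibre. The number of these corrections depends on the chain and not on \<tau>, so
  the extra cost is linear in \<tau>.\<close>

lemma ch_lift:
  assumes c: "ch (sedges C) (len C) p' q' s" and p: "p \<in> PT" "push comp p = p'"
    and q: "q \<in> PT" "push comp q = q'" and l: "\<And>e. e \<in> sedges A \<Longrightarrow> 0 \<le> l e"
  shows "\<exists>K\<ge>0. \<forall>\<tau>>0. ch ET (scaled l \<tau>) p q (s + K * \<tau>)"
  using c p q(2)
proof (induction arbitrary: p rule: ch.induct)
  case (ch_refl s p')
  then obtain K where K: "0 \<le> K" "\<And>\<tau>. 0 < \<tau> \<Longrightarrow> ch ET (scaled l \<tau>) p q (K * \<tau>)"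
    using fiber_const[of p q l] q l by metis
  have "ch ET (scaled l \<tau>) p q (s + K * \<tau>)" if "0 < \<tau>" for \<tau>
    by (rule ch_weaken[OF K(2)[OF that]]) (use ch_refl in simp)
  thus ?case using K(1) by blast
next
  case (ch_step d p' r' q' s t)
  obtain u w where uw: "d = {comp u, comp w}" "{u, w} \<in> ET" "{u, w} \<notin> sedges A" "u \<noteq> w" "comp u \<noteq> comp w"
    using C_edgeE[OF ch_step.hyps(1)] by metis
  obtain a where a: "0 \<le> a" "a \<le> 1" "p' = ept (comp u) (comp w) a"
    using closed_edgeE[OF ch_step.hyps(2)[unfolded uw(1)] uw(5)] .
  obtain b where b: "0 \<le> b" "b \<le> 1" "r' = ept (comp u) (comp w) b"
    using closed_edgeE[OF ch_step.hyps(3)[unfolded uw(1)] uw(5)] .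
  let ?p = "ept u w a" and ?r = "ept u w b"
  have pr: "?p \<in> PT" "?r \<in> PT" using ept_points[OF uw(2)] a b by auto
  obtain K where K: "0 \<le> K" "\<And>\<tau>. 0 < \<tau> \<Longrightarrow> ch ET (scaled l \<tau>) p ?p (K * \<tau>)"
    using fiber_const[of p ?p l] ch_step.prems pr a l by auto
  obtain M where M: "0 \<le> M" "\<And>\<tau>. 0 < \<tau> \<Longrightarrow> ch ET (scaled l \<tau>) ?r q (s + M * \<tau>)"
    using ch_step.IH[OF pr(2)] b ch_step.prems by auto
  have "ch ET (scaled l \<tau>) p q (t + (K + M) * \<tau>)" if \<tau>: "0 < \<tau>" for \<tau>
  proof -
    have "ch ET (scaled l \<tau>) ?p ?r (len T {u, w} * \<bar>a - b\<bar>)"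
      using a b uw ept_closed_edge[OF uw(4)] by (intro ch_edge[OF uw(2)]) (auto simp: scaled_def edist_ept)
    hence 1: "ch ET (scaled l \<tau>) p q (K * \<tau> + len T {u, w} * \<bar>a - b\<bar> + (s + M * \<tau>))"
      using ch_trans[OF ch_trans[OF K(2)[OF \<tau>]] M(2)[OF \<tau>]] by blast
    have "len T {u, w} * \<bar>a - b\<bar> + s \<le> t"
      using ch_step.hyps(5) uw C_len[OF uw(2,3)] a b by (simp add: edist_ept)
    thus ?thesis by (intro ch_weaken[OF 1]) (simp add: algebra_simps)
  qed
  thus ?case using K(1) M(1) by (intro exI[of _ "K + M"]) simp
qed

lemma side_A: "joined (sedges A) u w \<Longrightarrow> d \<notin> sedges A \<Longrightarrow> side a d u = side a d w"
proof (induction rule: rtrancl_induct)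
  case (step y z)
  thus ?case using side_edge[of y z d a] A_edge by auto
qed simp

lemma pointsA_cases:
  assumes "p \<in> points A"
  obtains u w t where "u \<in> VT" "w \<in> VT" "joined (sedges A) u w" "0 \<le> t" "t \<le> 1" "p = ept u w t"
    "push comp p = vpoint (comp u)"
proof -
  consider v where "v \<in> sverts A" "p = vpoint v" | e where "e \<in> sedges A" "p \<in> closed_edge e"
    using assms by (auto simp: points_def)
  thus thesis
  proof cases
    case 1
    thus thesis using that[of v v 0] A_vert by simp
  next
    case 2
    obtain u w where e: "e = {u, w}" "u \<noteq> w" "u \<in> VT" "w \<in> VT"
      using edge_obtain[OF A_edge[OF 2(1)]] by metis
    obtain t where t: "0 \<le> t" "t \<le> 1" "p = ept u w t" using closed_edgeE[OF 2(2)[unfolded e(1)] e(2)] .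
    have "joined (sedges A) u w" using 2 e by (simp add: r_into_rtrancl)
    moreover from this have "comp u = comp w" by (simp add: component_eq_iff)
    ultimately show thesis using that[of u w t] e t by simp
  qed
qed

lemma points_A: "p \<in> points A \<Longrightarrow> p \<in> PT"
  unfolding points_def using A_edge A_vert by blast

text \<open>A path in the subgraph stays in one component: the coordinate of a cut edge outside \<open>A\<close> is
  continuous and takes only the values 0 and 1.\<close>

lemma path_in_A:
  assumes \<gamma>: "\<And>t. 0 \<le> t \<Longrightarrow> t \<le> 1 \<Longrightarrow> \<gamma> t \<in> points A"
    and lip: "\<And>s t. 0 \<le> s \<Longrightarrow> s \<le> 1 \<Longrightarrow> 0 \<le> t \<Longrightarrow> t \<le> 1 \<Longrightarrow> tdist T (\<gamma> s) (\<gamma> t) \<le> K * \<bar>s - t\<bar>"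
  shows "push comp (\<gamma> 0) = push comp (\<gamma> 1)"
proof (rule ccontr)
  assume ne: "push comp (\<gamma> 0) \<noteq> push comp (\<gamma> 1)"
  have \<gamma>0: "\<gamma> 0 \<in> points A" and \<gamma>1: "\<gamma> 1 \<in> points A" using \<gamma> by auto
  obtain u u' t where u: "u \<in> VT" "joined (sedges A) u u'" "\<gamma> 0 = ept u u' t"
    "push comp (\<gamma> 0) = vpoint (comp u)" using pointsA_cases[OF \<gamma>0] by metis
  obtain w w' t' where w: "w \<in> VT" "joined (sedges A) w w'" "\<gamma> 1 = ept w w' t'"
    "push comp (\<gamma> 1) = vpoint (comp w)" using pointsA_cases[OF \<gamma>1] by metis
  have "\<not> joined (sedges A) u w" using ne u(4) w(4) by (simp add: component_eq_iff)
  obtain x n where x: "x 0 = u" "x n = w" "inj_on x {..n}" "\<And>i. i < n \<Longrightarrow> {x i, x (Suc i)} \<in> ET"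
    using rtrancl_walk[OF conn[OF u(1) w(1)]] by metis
  have "\<exists>i<n. {x i, x (Suc i)} \<notin> sedges A"
  proof (rule ccontr)
    assume "\<not> ?thesis"
    hence "joined (sedges A) (x 0) (x n)" by (intro walk_rtrancl) auto
    thus False using \<open>\<not> joined (sedges A) u w\<close> x by simp
  qed
  then obtain i where i: "i < n" "{x i, x (Suc i)} \<notin> sedges A" by blast
  define d where "d = {x i, x (Suc i)}"
  have d: "d \<in> ET" "d \<notin> sedges A" using x i by (auto simp: d_def)
  define g where "g t = push (side u d) (\<gamma> t) True" for t
  have "side u d u" "\<not> side u d w"
    using walk_separates[OF tree x(4) x(3) i(1)] x by (auto simp: side_def d_def)
  hence g01: "g 0 = 1" "g 1 = 0"
    using u w side_A[OF u(2) d(2)] side_A[OF w(2) d(2)] by (simp_all add: g_def vpoint_def)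
  have g_vals: "g t = 0 \<or> g t = 1" if t: "0 \<le> t" "t \<le> 1" for t
  proof -
    obtain a b c where abc: "joined (sedges A) a b" "\<gamma> t = ept a b c"
      using pointsA_cases[OF \<gamma>[OF t]] by metis
    hence "side u d a = side u d b" using side_A d by blast
    thus ?thesis using abc by (simp add: g_def vpoint_def indicator_def)
  qed
  have g_lip: "\<bar>g s - g t\<bar> \<le> K / len T d * \<bar>s - t\<bar>" if st: "0 \<le> s" "s \<le> 1" "0 \<le> t" "t \<le> 1" for s t
  proof -
    have "len T d * \<bar>g s - g t\<bar> \<le> tdist T (\<gamma> s) (\<gamma> t)"
    proof (rule tdist_geI[OF points_A[OF \<gamma>] points_A[OF \<gamma>]])
      fix r assume r: "chT (\<gamma> s) (\<gamma> t) r"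
      have "(\<Sum>d\<in>{d}. len T d * \<bar>push (side u d) (\<gamma> s) True - push (side u d) (\<gamma> t) True\<bar>) \<le> r"
        by (rule ch_cut[OF r]) (use d edge_card len_nonneg side_edge in auto)
      thus "len T d * \<bar>g s - g t\<bar> \<le> r" by (simp add: g_def)
    qed (use st in auto)
    also have "\<dots> \<le> K * \<bar>s - t\<bar>" using lip st by simp
    finally show ?thesis using len_pos[OF d(1)] by (simp add: field_simps)
  qed
  have "continuous_on {0..1} g"
  proof (rule continuous_onI)
    fix s e :: real assume s: "s \<in> {0..1}" and e: "0 < e"
    define M where "M = \<bar>K / len T d\<bar> + 1"
    have M: "0 < M" by (simp add: M_def add_nonneg_pos)
    have "dist (g t) (g s) \<le> e" if t: "t \<in> {0..1}" "dist t s < e / M" for t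
    proof -
      have "\<bar>g t - g s\<bar> \<le> K / len T d * \<bar>t - s\<bar>" using g_lip s t by simp
      also have "\<dots> \<le> M * \<bar>t - s\<bar>"
        using abs_ge_self[of "K / len T d"] by (intro mult_right_mono) (auto simp only: M_def abs_ge_zero)
      also have "\<dots> \<le> e" using t(2) M by (simp add: dist_real_def field_simps)
      finally show ?thesis by (simp add: dist_real_def)
    qed
    thus "\<exists>da>0. \<forall>t\<in>{0..1}. dist t s < da \<longrightarrow> dist (g t) (g s) \<le> e"
      using M e by (intro exI[of _ "e / M"]) simp
  qed
  then obtain t where "0 \<le> t" "t \<le> 1" "g t = 1 / 2"
    using IVT2'[of g 1 "1/2" 0] g01 by auto
  thus False using g_vals[of t] by simp
qed

end

lemma mtree_len:
  assumes T: "mtree G T" and l: "equivariant_length G (T\<lparr>len := l\<rparr>)"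
  shows "mtree G (T\<lparr>len := l\<rparr>)"
proof -
  interpret T: mtree G T by (rule T)
  show ?thesis using l
    by (intro mtree.intro mgraph.intro mtree_axioms.intro)
      (use T.act_closed T.act_one T.act_mult T.edge_card T.edge_verts T.act_edge T.edge_free T.conn T.tree
        T.grp in \<open>auto simp: equivariant_length_def\<close>)
qed

lemma metric_tree_mtree:
  assumes "metric_tree G T" shows "mtree G T"
proof -
  have st: "simplicial_tree T" and ga: "group_action G (sverts T) (act T)"
    and el: "equivariant_length G T"
    and ed: "\<And>h e. h \<in> carrier G \<Longrightarrow> e \<in> sedges T \<Longrightarrow> act T h ` e \<in> sedges T"
    and fr: "\<And>h e. e \<in> sedges T \<Longrightarrow> h \<in> carrier G \<Longrightarrow> act T h ` e = e \<Longrightarrow> h = \<one>\<^bsub>G\<^esub>"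
    using assms by (auto simp: metric_tree_def)
  interpret ga: group_action G "sverts T" "act T" by (rule ga)
  have grp: "group G" using ga.group_hom by (simp add: group_hom_def)
  have one: "act T \<one>\<^bsub>G\<^esub> v = v" if "v \<in> sverts T" for v
    using fun_cong[OF ga.id_eq_one, of v] that by simp
  show ?thesis
  proof (intro mtree.intro mgraph.intro mtree_axioms.intro)
    show "group G" by (rule grp)
    show "act T \<one>\<^bsub>G\<^esub> v = v" if "v \<in> sverts T" for v by (rule one[OF that])
    show "act T h v \<in> sverts T" if "h \<in> carrier G" "v \<in> sverts T" for h v
      using ga.element_image that by blast
    show "act T (g \<otimes>\<^bsub>G\<^esub> h) v = act T g (act T h v)" if "g \<in> carrier G" "h \<in> carrier G" "v \<in> sverts T" for g h v
      using ga.composition_rule that by blast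
    show "card e = 2" "e \<subseteq> sverts T" if "e \<in> sedges T" for e
      using st that by (auto simp: simplicial_tree_def)
    show "0 < len T e" if "e \<in> sedges T" for e using el that by (simp add: equivariant_length_def)
    show "len T (act T h ` e) = len T e" if "h \<in> carrier G" "e \<in> sedges T" for h e
      using el that by (simp add: equivariant_length_def)
    show "joined (sedges T) u w" if "u \<in> sverts T" "w \<in> sverts T" for u w
      using simplicial_tree_connected[OF st that] .
    show "edge_tree (sedges T)" by (rule simplicial_tree_edge_tree[OF st])
  qed (use ed fr in auto)
qed

lemma finite_uniform:
  fixes P :: "'a \<Rightarrow> real \<Rightarrow> bool"
  assumes "finite E" "\<And>e. e \<in> E \<Longrightarrow> \<exists>K. P e K" "\<And>e K K'. e \<in> E \<Longrightarrow> P e K \<Longrightarrow> K \<le> K' \<Longrightarrow> P e K'"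
  shows "\<exists>K\<ge>0. \<forall>e\<in>E. P e K"
proof -
  obtain k where k: "\<And>e. e \<in> E \<Longrightarrow> P e (k e)" using assms(2) by metis
  have "P e (\<Sum>e\<in>E. \<bar>k e\<bar>)" if e: "e \<in> E" for e
  proof (rule assms(3)[OF e k[OF e]])
    show "k e \<le> (\<Sum>e\<in>E. \<bar>k e\<bar>)" using member_le_sum[OF e, of "\<lambda>e. \<bar>k e\<bar>"] assms(1) by fastforce
  qed
  thus ?thesis by (intro exI[of _ "\<Sum>e\<in>E. \<bar>k e\<bar>"]) (simp add: sum_nonneg)
qed

lemma points_update [simp]:
  "points (T\<lparr>len := l\<rparr>) = points T" "points (T\<lparr>act := a\<rparr>) = points T"
  by (simp_all add: points_def)

lemma point_act_update [simp]:
  "point_act (T\<lparr>len := l\<rparr>) = point_act T"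
  "point_act (T\<lparr>act := \<lambda>h. act T (f h)\<rparr>) h = point_act T (f h)"
  by (simp_all add: point_act_def fun_eq_iff)

lemma tdist_update [simp]: "tdist (T\<lparr>act := a\<rparr>) = tdist T"
  by (simp add: tdist_def fun_eq_iff)

section \<open>Vertices of the collapse with trivial stabiliser\<close>

context ctree
begin

text \<open>At a light vertex an equivariant map may be prescribed freely. At the others, called
  heavy below, its value is forced.\<close>

definition light :: "'v set \<Rightarrow> bool" where
  "light P \<longleftrightarrow> (\<forall>g\<in>carrier G. act C g P = P \<longrightarrow> g = \<one>)"

lemma light_act:
  assumes h: "h \<in> carrier G" and P: "P \<in> sverts C"
  shows "light (act C h P) \<longleftrightarrow> light P"
proof -
  have 1: "light (act C h P)" if "light P" "h \<in> carrier G" "P \<in> sverts C" for P h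
    unfolding light_def
  proof (intro ballI impI)
    interpret group G by (rule grp)
    fix g assume g: "g \<in> carrier G" "act C g (act C h P) = act C h P"
    have "act C (inv h \<otimes> (g \<otimes> h)) P = P"
      using g that C.act_mult C.act_closed C.act_inv_act by simp
    hence "inv h \<otimes> (g \<otimes> h) = \<one>" using that g by (simp add: light_def)
    hence "g \<otimes> h = h" using g that by (metis inv_equality inv_inv m_closed inv_closed inv_unique' r_inv l_inv)
    thus "g = \<one>" using g that by (simp add: r_cancel_one')
  qed
  show ?thesis using 1[of P h] 1[of "act C h P" "inv h"] h P C.act_closed C.act_inv_act by auto
qed

text \<open>On free orbits a value chosen at one point extends by translation, and the required
  property survives because \<open>Q\<close> is invariant.\<close>

lemma light_choice:
  assumes b_closed: "\<And>g y. g \<in> carrier G \<Longrightarrow> y \<in> Y \<Longrightarrow> b g y \<in> Y"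
    and b_one: "\<And>y. y \<in> Y \<Longrightarrow> b \<one> y = y"
    and b_mult: "\<And>g h y. g \<in> carrier G \<Longrightarrow> h \<in> carrier G \<Longrightarrow> y \<in> Y \<Longrightarrow> b (g \<otimes> h) y = b g (b h y)"
    and ex: "\<And>P. P \<in> sverts C \<Longrightarrow> \<exists>y\<in>Y. Q P y"
    and Q: "\<And>g P y. g \<in> carrier G \<Longrightarrow> P \<in> sverts C \<Longrightarrow> y \<in> Y \<Longrightarrow> Q P y \<Longrightarrow> Q (act C g P) (b g y)"
  shows "\<exists>f. \<forall>P\<in>sverts C. light P \<longrightarrow> f P \<in> Y \<and> Q P (f P) \<and> (\<forall>g\<in>carrier G. f (act C g P) = b g (f P))"
proof -
  define V where "V = {P \<in> sverts C. light P}"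
  define F where "F P = (SOME y. y \<in> Y \<and> Q P y)" for P
  have F: "F P \<in> Y" "Q P (F P)" if "P \<in> sverts C" for P
  proof -
    have "\<exists>y. y \<in> Y \<and> Q P y" using ex that by blast
    from someI_ex[OF this] show "F P \<in> Y" "Q P (F P)" by (auto simp: F_def)
  qed
  have "\<exists>f. (\<forall>P\<in>V. f P \<in> Y) \<and> (\<forall>g\<in>carrier G. \<forall>P\<in>V. f (act C g P) = b g (f P)) \<and>
     (\<forall>P\<in>V. \<exists>g\<in>carrier G. act C g P \<in> UNIV \<and> (\<forall>y\<in>V. y = act C g P \<longrightarrow> f y = F y))"
  proof (rule equivariant_choice[where V = V and Y = Y and a = "act C" and b = b and c = "\<lambda>P. P"
        and k = "act C" and R = UNIV and F = "\<lambda>_. F", OF grp])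
    show "act C g P \<in> V" if "g \<in> carrier G" "P \<in> V" for g P
      using that light_act C.act_closed by (auto simp: V_def)
    show "\<exists>g\<in>carrier G. act C g P \<in> UNIV" for P using one_in by blast
    show "F P \<in> Y" if "P \<in> V" for P using F that by (simp add: V_def)
    show "F (act C g P) = b g (F P)" if "P \<in> V" "P \<in> UNIV" "g \<in> carrier G" "act C g P = P" for P g
    proof -
      have "g = \<one>" using that by (auto simp: V_def light_def)
      thus ?thesis using that F b_one by (simp add: V_def)
    qed
  qed (use b_closed b_one b_mult C.act_one C.act_mult in \<open>auto simp: V_def\<close>)
  then obtain f where f: "\<forall>P\<in>V. f P \<in> Y" "\<forall>g\<in>carrier G. \<forall>P\<in>V. f (act C g P) = b g (f P)"
     "\<forall>P\<in>V. \<exists>g\<in>carrier G. act C g P \<in> UNIV \<and> (\<forall>y\<in>V. y = act C g P \<longrightarrow> f y = F y)" by (elim exE conjE)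
  have "Q P (f P)" if P: "P \<in> V" for P
  proof -
    obtain g where g: "g \<in> carrier G" "\<forall>y\<in>V. y = act C g P \<longrightarrow> f y = F y" using f(3) P by blast
    have PC: "P \<in> sverts C" "act C g P \<in> sverts C" using P C.act_closed g by (auto simp: V_def)
    have "act C g P \<in> V" using P g light_act C.act_closed by (auto simp: V_def)
    hence "f (act C g P) = F (act C g P)" using g by blast
    hence "Q (act C g P) (f (act C g P))" using F PC by simp
    hence "Q (act C g P) (b g (f P))" using f(2) g P by simp
    hence "Q (act C (inv g) (act C g P)) (b (inv g) (b g (f P)))"
      using Q[of "inv g" "act C g P" "b g (f P)"] g PC f(1) P b_closed by simp
    moreover have "b (inv g) (b g (f P)) = f P"
      using b_mult[of "inv g" g "f P"] b_one f(1) P g by simp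
    ultimately show ?thesis using C.act_inv_act g PC by simp
  qed
  thus ?thesis using f(1,2) by (intro exI[of _ f]) (auto simp: V_def)
qed

lemma scaled_mtree:
  assumes l: "\<And>e. e \<in> sedges A \<Longrightarrow> 0 < l e" "\<And>h e. h \<in> carrier G \<Longrightarrow> e \<in> sedges A \<Longrightarrow> l (act T h ` e) = l e"
    and \<tau>: "0 < \<tau>"
  shows "equivariant_length G (T\<lparr>len := scaled l \<tau>\<rparr>)" "mtree G (T\<lparr>len := scaled l \<tau>\<rparr>)"
proof -
  show "equivariant_length G (T\<lparr>len := scaled l \<tau>\<rparr>)"
    unfolding equivariant_length_def using l \<tau> A_act_iff len_pos len_act by (simp add: scaled_def)
  thus "mtree G (T\<lparr>len := scaled l \<tau>\<rparr>)" by (intro mtree_len mtree_axioms)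
qed

end

section \<open>Displacement and the family of metrics that shrinks \<open>A\<close>\<close>

text \<open>Used twice: for \<phi> on \<open>S\<close>, and for \<psi> on the splitting of the
  core.\<close>

locale aut_system =
  fixes S :: "('i, 'h) splitting" and \<phi> :: "('i, 'h) system_map"
  assumes group_S: "i \<in> idx S \<Longrightarrow> group (grp S i)"
    and perm: "i \<in> idx S \<Longrightarrow> perm \<phi> i \<in> idx S"
    and hom: "i \<in> idx S \<Longrightarrow> maps \<phi> i \<in> hom (grp S i) (grp S (perm \<phi> i))"
    and inj: "i \<in> idx S \<Longrightarrow> inj_on (maps \<phi> i) (carrier (grp S i))"
begin

abbreviation Gc :: "'i \<Rightarrow> 'h set" where "Gc i \<equiv> carrier (grp S i)"

lemma maps_in: "i \<in> idx S \<Longrightarrow> g \<in> Gc i \<Longrightarrow> maps \<phi> i g \<in> Gc (perm \<phi> i)"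
  using hom by (auto simp: hom_def)

lemma maps_mult: "i \<in> idx S \<Longrightarrow> g \<in> Gc i \<Longrightarrow> h \<in> Gc i \<Longrightarrow>
    maps \<phi> i (g \<otimes>\<^bsub>grp S i\<^esub> h) = maps \<phi> i g \<otimes>\<^bsub>grp S (perm \<phi> i)\<^esub> maps \<phi> i h"
  using hom by (auto simp: hom_def)

lemma maps_one: "i \<in> idx S \<Longrightarrow> maps \<phi> i \<one>\<^bsub>grp S i\<^esub> = \<one>\<^bsub>grp S (perm \<phi> i)\<^esub>"
  using hom_one[OF hom group_S group_S[OF perm]] .

lemma maps_neq_one:
  assumes "i \<in> idx S" "g \<in> Gc i" "g \<noteq> \<one>\<^bsub>grp S i\<^esub>"
  shows "maps \<phi> i g \<noteq> \<one>\<^bsub>grp S (perm \<phi> i)\<^esub>"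
proof
  assume "maps \<phi> i g = \<one>\<^bsub>grp S (perm \<phi> i)\<^esub>"
  hence "maps \<phi> i g = maps \<phi> i \<one>\<^bsub>grp S i\<^esub>" using maps_one assms by simp
  thus False using inj_onD[OF inj[OF assms(1)]] assms group.is_monoid[OF group_S] monoid.one_closed
    by metis
qed

lemma twist_mtree:
  assumes "\<And>i. i \<in> idx S \<Longrightarrow> mgraph (grp S i) (Z i)" "i \<in> idx S"
  shows "mgraph (grp S i) (twist \<phi> Z i)"
proof -
  let ?T = "Z (perm \<phi> i)"
  interpret T: mgraph "grp S (perm \<phi> i)" ?T using assms perm by blast
  show ?thesis unfolding twist_def
  proof (intro mgraph.intro)
    show "group (grp S i)" using group_S assms by simp
    fix h e assume "h \<in> Gc i" "e \<in> sedges (?T\<lparr>act := \<lambda>h. act ?T (maps \<phi> i h)\<rparr>)"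
      "act (?T\<lparr>act := \<lambda>h. act ?T (maps \<phi> i h)\<rparr>) h ` e = e"
    hence "maps \<phi> i h = \<one>\<^bsub>grp S (perm \<phi> i)\<^esub>" "h \<in> Gc i"
      using T.edge_free[of "maps \<phi> i h" e] maps_in assms by auto
    thus "h = \<one>\<^bsub>grp S i\<^esub>" using maps_neq_one[OF assms(2)] by blast
  qed (use assms maps_in maps_one maps_mult T.act_closed T.act_one T.act_mult T.edge_card T.edge_verts
      T.act_edge T.len_pos T.len_act T.conn in auto)
qed

lemma displacement_lessD:
  assumes "displacement S \<phi> Z < ereal L" and Z: "\<And>i. i \<in> idx S \<Longrightarrow> mgraph (grp S i) (Z i)"
  obtains f where
    "\<And>i. i \<in> idx S \<Longrightarrow> 0 \<le> L"
    "\<And>i p. i \<in> idx S \<Longrightarrow> p \<in> points (Z i) \<Longrightarrow> f i p \<in> points (Z (perm \<phi> i))"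
    "\<And>i h p. i \<in> idx S \<Longrightarrow> h \<in> Gc i \<Longrightarrow> p \<in> points (Z i) \<Longrightarrow>
      f i (point_act (Z i) h p) = point_act (Z (perm \<phi> i)) (maps \<phi> i h) (f i p)"
    "\<And>i p q. i \<in> idx S \<Longrightarrow> p \<in> points (Z i) \<Longrightarrow> q \<in> points (Z i) \<Longrightarrow>
      tdist (Z (perm \<phi> i)) (f i p) (f i q) \<le> L * tdist (Z i) p q"
proof -
  obtain f where f: "f \<in> equivariant_maps S Z (twist \<phi> Z)" "\<forall>i\<in>idx S. 0 \<le> L \<and>
    (\<forall>p\<in>points (Z i). \<forall>q\<in>points (Z i). tdist (twist \<phi> Z i) (f i p) (f i q) \<le> L * tdist (Z i) p q)"
    using stretch_lessD[OF assms(1)[unfolded displacement_def] Z twist_mtree[OF Z]] by blast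
  have t: "tdist (twist \<phi> Z i) = tdist (Z (perm \<phi> i))" "points (twist \<phi> Z i) = points (Z (perm \<phi> i))"
    "point_act (twist \<phi> Z i) h = point_act (Z (perm \<phi> i)) (maps \<phi> i h)" for i h
    by (simp_all add: twist_def)
  show thesis
  proof (rule that[of f])
    show "0 \<le> L" if "i \<in> idx S" for i using f(2) that by blast
    show "f i p \<in> points (Z (perm \<phi> i))" if "i \<in> idx S" "p \<in> points (Z i)" for i p
      using f(1) that by (auto simp: equivariant_maps_def t)
    show "f i (point_act (Z i) h p) = point_act (Z (perm \<phi> i)) (maps \<phi> i h) (f i p)"
      if "i \<in> idx S" "h \<in> Gc i" "p \<in> points (Z i)" for i h p
      using f(1) that by (auto simp: equivariant_maps_def t)
    show "tdist (Z (perm \<phi> i)) (f i p) (f i q) \<le> L * tdist (Z i) p q"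
      if "i \<in> idx S" "p \<in> points (Z i)" "q \<in> points (Z i)" for i p q
      using f(2) that by (auto simp: t)
  qed
qed

lemma displacement_leI:
  assumes Z: "\<And>i. i \<in> idx S \<Longrightarrow> mgraph (grp S i) (Z i)" and L: "0 \<le> L"
    and F: "\<And>i v. i \<in> idx S \<Longrightarrow> v \<in> sverts (Z i) \<Longrightarrow> F i v \<in> points (Z (perm \<phi> i))"
      "\<And>i g v. i \<in> idx S \<Longrightarrow> g \<in> Gc i \<Longrightarrow> v \<in> sverts (Z i) \<Longrightarrow>
        F i (act (Z i) g v) = point_act (Z (perm \<phi> i)) (maps \<phi> i g) (F i v)"
      "\<And>i u w. i \<in> idx S \<Longrightarrow> {u, w} \<in> sedges (Z i) \<Longrightarrow>
        tdist (Z (perm \<phi> i)) (F i u) (F i w) \<le> L * len (Z i) {u, w}"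
  shows "displacement S \<phi> Z \<le> ereal L"
  unfolding displacement_def
proof (rule stretch_leI[where F = F, OF Z twist_mtree[OF Z]])
qed (use F L in \<open>auto simp: twist_def\<close>)

end

lemma (in ctree) tdist_comp_scaled:
  assumes l: "\<And>e. e \<in> sedges A \<Longrightarrow> 0 < l e" "\<And>h e. h \<in> carrier G \<Longrightarrow> e \<in> sedges A \<Longrightarrow> l (act T h ` e) = l e"
    and \<tau>: "0 < \<tau>" and pq: "p \<in> points T" "q \<in> points T"
  shows "tdist C (push comp p) (push comp q) \<le> tdist (T\<lparr>len := scaled l \<tau>\<rparr>) p q"
proof -
  interpret Y: mtree G "T\<lparr>len := scaled l \<tau>\<rparr>" using scaled_mtree(2)[of l, OF l \<tau>] .
  show ?thesis
  proof (rule Y.tdist_geI)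
    fix s assume "ch (sedges (T\<lparr>len := scaled l \<tau>\<rparr>)) (len (T\<lparr>len := scaled l \<tau>\<rparr>)) p q s"
    hence "ch (sedges C) (len C) (push comp p) (push comp q) s"
      using Y.len_nonneg by (intro ch_comp[of "scaled l \<tau>"]) (auto simp: scaled_def)
    thus "tdist C (push comp p) (push comp q) \<le> s" by (rule C.tdist_leI)
  qed (use pq in simp_all)
qed

lemma (in ctree) comp_const:
  assumes "\<And>u w. {u, w} \<in> sedges A \<Longrightarrow> y u = y w" "comp u = comp w"
  shows "y u = y w"
proof -
  have "joined (sedges A) u w" using assms(2) by (simp add: component_eq_iff)
  thus ?thesis by (induction rule: rtrancl_induct) (use assms(1) in auto)
qed

text \<open>\<open>orbits\<close> expresses that the quotient graphs are finite. All constants that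
  hold uniformly over edges come from it; it is derived from the graph of groups in
  \<open>outer_space_cocompact\<close>.\<close>

locale collapse_system = aut_system S \<phi> for S :: "('i, 'h) splitting" and \<phi> +
  fixes X :: "('i, 'h, 'v) forest" and A :: "'i \<Rightarrow> 'v sgraph"
  assumes fin_idx: "finite (idx S)" and ne_idx: "idx S \<noteq> {}"
    and ct: "i \<in> idx S \<Longrightarrow> ctree (grp S i) (X i) (A i)"
    and orbits: "i \<in> idx S \<Longrightarrow> \<exists>E0. finite E0 \<and> E0 \<subseteq> sedges (X i) \<and>
      (\<forall>e\<in>sedges (X i). \<exists>h\<in>carrier (grp S i). \<exists>e0\<in>E0. e = act (X i) h ` e0)"
    and inv: "invariant_subgraph S \<phi> X A"
begin

abbreviation \<sigma> :: "'i \<Rightarrow> 'i" where "\<sigma> \<equiv> perm \<phi>"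
abbreviation \<theta> :: "'i \<Rightarrow> 'h \<Rightarrow> 'h" where "\<theta> \<equiv> maps \<phi>"
abbreviation tw :: "('i, 'h, 'w) forest \<Rightarrow> 'i \<Rightarrow> 'h \<Rightarrow> ('w \<Rightarrow> real) \<Rightarrow> 'w \<Rightarrow> real" where
  "tw Z i h \<equiv> point_act (Z (\<sigma> i)) (\<theta> i h)"
abbreviation XV :: "'i \<Rightarrow> 'v set" where "XV i \<equiv> sverts (X i)"
abbreviation XE :: "'i \<Rightarrow> 'v set set" where "XE i \<equiv> sedges (X i)"
abbreviation XP :: "'i \<Rightarrow> ('v \<Rightarrow> real) set" where "XP i \<equiv> points (X i)"
abbreviation VA :: "'i \<Rightarrow> 'v set" where "VA i \<equiv> sverts (A i)"
abbreviation EA :: "'i \<Rightarrow> 'v set set" where "EA i \<equiv> sedges (A i)"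
abbreviation cp :: "'i \<Rightarrow> 'v \<Rightarrow> 'v set" where "cp i \<equiv> component (A i)"
abbreviation D :: "('i, 'h, 'v set) forest" where "D \<equiv> collapse X A"
abbreviation DV :: "'i \<Rightarrow> 'v set set" where "DV i \<equiv> sverts (D i)"
abbreviation DE :: "'i \<Rightarrow> 'v set set set" where "DE i \<equiv> sedges (D i)"
abbreviation DP :: "'i \<Rightarrow> ('v set \<Rightarrow> real) set" where "DP i \<equiv> points (D i)"
abbreviation lt :: "'i \<Rightarrow> 'v set \<Rightarrow> bool" where "lt i \<equiv> ctree.light (grp S i) (X i) (A i)"
abbreviation disp :: "('i, 'h, 'w) forest \<Rightarrow> ereal" where "disp \<equiv> displacement S \<phi>"
abbreviation td :: "'i \<Rightarrow> ('v set \<Rightarrow> real) \<Rightarrow> ('v set \<Rightarrow> real) \<Rightarrow> real" where "td i \<equiv> tdist (D (\<sigma> i))"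

definition alen :: "('i \<Rightarrow> 'v set \<Rightarrow> real) \<Rightarrow> bool" where
  "alen l \<longleftrightarrow> (\<forall>i\<in>idx S. \<forall>e\<in>EA i. 0 < l i e \<and> (\<forall>h\<in>Gc i. l i (act (X i) h ` e) = l i e))"

definition Y :: "('i \<Rightarrow> 'v set \<Rightarrow> real) \<Rightarrow> real \<Rightarrow> ('i, 'h, 'v) forest" where
  "Y l \<tau> i = (X i)\<lparr>len := ctree.scaled (X i) (A i) (l i) \<tau>\<rparr>"

lemma D_def': "D i = collapse_tree (X i) (A i)" by (simp add: collapse_def)

lemma X_tree: "i \<in> idx S \<Longrightarrow> mtree (grp S i) (X i)" using ct by (simp add: ctree_def sgtree_def)
lemma D_tree: "i \<in> idx S \<Longrightarrow> mtree (grp S i) (D i)" using ctree.col[OF ct] by (simp add: D_def')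
lemma X_graph: "i \<in> idx S \<Longrightarrow> mgraph (grp S i) (X i)" using X_tree by (simp add: mtree_def)
lemma D_graph: "i \<in> idx S \<Longrightarrow> mgraph (grp S i) (D i)" using D_tree by (simp add: mtree_def)

lemma Y_tree: "alen l \<Longrightarrow> 0 < \<tau> \<Longrightarrow> i \<in> idx S \<Longrightarrow> mtree (grp S i) (Y l \<tau> i)"
  unfolding Y_def by (rule ctree.scaled_mtree(2)[OF ct]) (auto simp: alen_def)
lemma Y_graph: "alen l \<Longrightarrow> 0 < \<tau> \<Longrightarrow> i \<in> idx S \<Longrightarrow> mgraph (grp S i) (Y l \<tau> i)"
  using Y_tree by (simp add: mtree_def)

lemma Y_sel [simp]: "sverts (Y l \<tau> i) = XV i" "sedges (Y l \<tau> i) = XE i"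
  "act (Y l \<tau> i) = act (X i)" "points (Y l \<tau> i) = XP i" "point_act (Y l \<tau> i) = point_act (X i)"
  by (simp_all add: Y_def)

lemma len_Y: "len (Y l \<tau> i) e = (if e \<in> EA i then \<tau> * l i e else len (X i) e)" if "i \<in> idx S"
  using ctree.scaled_def[OF ct[OF that]] by (simp add: Y_def)

lemma Y_simplex: "alen l \<Longrightarrow> 0 < \<tau> \<Longrightarrow> Y l \<tau> \<in> open_simplex S X"
  unfolding open_simplex_def
proof (intro CollectI ballI conjI)
  fix i assume "alen l" "0 < \<tau>" "i \<in> idx S"
  show "Y l \<tau> i = (X i)\<lparr>len := len (Y l \<tau> i)\<rparr>" by (simp add: Y_def)
  show "equivariant_length (grp S i) (Y l \<tau> i)"
    unfolding Y_def by (rule ctree.scaled_mtree(1)[OF ct]) (use \<open>alen l\<close> \<open>0 < \<tau>\<close> \<open>i \<in> idx S\<close> in \<open>auto simp: alen_def\<close>)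
qed

text \<open>This turns the invariance of \<open>A\<close> into combinatorics. The straight map sends
  an edge of \<open>A\<close> to a Lipschitz path in \<open>A\<close>, which by
  \<open>path_in_A\<close> stays over one point of the collapse; so collapsed vertex images are
  constant on the components of \<open>A\<close>.\<close>

lemma vertex_map:
  obtains y where
    "\<And>i v. i \<in> idx S \<Longrightarrow> v \<in> XV i \<Longrightarrow> y i v \<in> DP (\<sigma> i)"
    "\<And>i h v. i \<in> idx S \<Longrightarrow> h \<in> Gc i \<Longrightarrow> v \<in> XV i \<Longrightarrow>
      y i (act (X i) h v) = tw D i h (y i v)"
    "\<And>i u w. i \<in> idx S \<Longrightarrow> {u, w} \<in> EA i \<Longrightarrow> y i u = y i w"
proof -
  obtain f where f: "f \<in> equivariant_maps S X (twist \<phi> X)" "straight S X (twist \<phi> X) f"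
    "\<forall>i\<in>idx S. f i ` points (A i) \<subseteq> points (A (perm \<phi> i))"
    using inv by (auto simp: invariant_subgraph_def)
  have fp: "f i p \<in> XP (\<sigma> i)" if "i \<in> idx S" "p \<in> XP i" for i p
    using f(1) that by (auto simp: equivariant_maps_def twist_def)
  have fe: "f i (point_act (X i) h p) = tw X i h (f i p)"
    if "i \<in> idx S" "h \<in> Gc i" "p \<in> XP i" for i h p
    using f(1) that by (auto simp: equivariant_maps_def twist_def)
  define y where "y i v = push (cp (\<sigma> i)) (f i (vpoint v))" for i v
  show thesis
  proof (rule that[of y])
    fix i v assume i: "i \<in> idx S" and v: "v \<in> XV i"
    interpret X: mgraph "grp S i" "X i" by (rule X_graph[OF i])
    interpret c: ctree "grp S (\<sigma> i)" "X (\<sigma> i)" "A (\<sigma> i)" by (rule ct[OF perm[OF i]])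
    show "y i v \<in> DP (\<sigma> i)"
      using c.push_comp_points fp[OF i] X.vpoint_points[OF v] by (simp add: y_def D_def')
    fix h assume h: "h \<in> Gc i"
    show "y i (act (X i) h v) = tw D i h (y i v)"
      using fe[OF i h X.vpoint_points[OF v]] fp[OF i X.vpoint_points[OF v]]
        c.push_comp_act[OF maps_in[OF i h]] X.point_act_vpoint[OF h v]
      by (simp add: y_def D_def')
  next
    fix i u w assume i: "i \<in> idx S" and e: "{u, w} \<in> EA i"
    interpret c: ctree "grp S i" "X i" "A i" by (rule ct[OF i])
    interpret c': ctree "grp S (\<sigma> i)" "X (\<sigma> i)" "A (\<sigma> i)" by (rule ct[OF perm[OF i]])
    have eX: "{u, w} \<in> XE i" using c.A_edge e by blast
    have ne: "u \<noteq> w" using c.edge_neq' eX by blast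
    obtain k where k: "0 \<le> k" "\<And>p q. p \<in> closed_edge {u, w} \<Longrightarrow> q \<in> closed_edge {u, w} \<Longrightarrow>
        tdist (X (\<sigma> i)) (f i p) (f i q) = k * tdist (X i) p q"
      using f(2) i eX unfolding straight_def twist_def tdist_update by blast
    define \<gamma> where "\<gamma> t = f i (ept u w t)" for t
    have ce: "ept u w t \<in> closed_edge {u, w}" if "0 \<le> t" "t \<le> 1" for t using ept_closed_edge[OF ne that] .
    have "push (cp (\<sigma> i)) (\<gamma> 0) = push (cp (\<sigma> i)) (\<gamma> 1)"
    proof (rule c'.path_in_A[where K = "k * len (X i) {u, w}"])
      fix t :: real assume t: "0 \<le> t" "t \<le> 1"
      have "ept u w t \<in> points (A i)" using ce[OF t] e unfolding points_def by blast
      thus "\<gamma> t \<in> points (A (\<sigma> i))" using f(3) i unfolding \<gamma>_def by blast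
    next
      fix s t :: real assume st: "0 \<le> s" "s \<le> 1" "0 \<le> t" "t \<le> 1"
      have "tdist (X i) (ept u w s) (ept u w t) \<le> len (X i) {u, w} * \<bar>s - t\<bar>"
        using c.tdist_edge[OF eX ce ce, of s t] st edist_ept[OF ne] by simp
      thus "tdist (X (\<sigma> i)) (\<gamma> s) (\<gamma> t) \<le> k * len (X i) {u, w} * \<bar>s - t\<bar>"
        using k(2)[OF ce ce, of s t] st mult_left_mono[OF _ k(1)] by (simp add: \<gamma>_def mult.assoc)
    qed
    thus "y i u = y i w" by (simp add: y_def \<gamma>_def)
  qed
qed

lemma heavy_fixed:
  assumes i: "i \<in> idx S" and v: "v \<in> XV i"
    and y: "y \<in> DP (\<sigma> i)" "tw D i g y = y"
      "y' \<in> DP (\<sigma> i)" "tw D i g y' = y'"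
    and g: "g \<in> Gc i" "g \<noteq> \<one>\<^bsub>grp S i\<^esub>"
  shows "y = y'"
  using mtree.fixed_point_unique[OF D_tree[OF perm[OF i]] maps_in[OF i g(1)] maps_neq_one[OF i g] y] .

definition lip_map :: "('i \<Rightarrow> 'v set \<Rightarrow> real) \<Rightarrow> real \<Rightarrow> real \<Rightarrow> ('i \<Rightarrow> ('v \<Rightarrow> real) \<Rightarrow> ('v \<Rightarrow> real)) \<Rightarrow> bool" where
  "lip_map l \<tau> L f \<longleftrightarrow> 0 \<le> L \<and> (\<forall>i\<in>idx S.
    (\<forall>p\<in>XP i. f i p \<in> XP (\<sigma> i)) \<and>
    (\<forall>h\<in>Gc i. \<forall>p\<in>XP i. f i (point_act (X i) h p) = tw X i h (f i p)) \<and>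
    (\<forall>p\<in>XP i. \<forall>q\<in>XP i. tdist (Y l \<tau> (\<sigma> i)) (f i p) (f i q) \<le> L * tdist (Y l \<tau> i) p q))"

lemma lip_mapD:
  assumes "lip_map l \<tau> L f" "i \<in> idx S"
  shows "0 \<le> L" "p \<in> XP i \<Longrightarrow> f i p \<in> XP (\<sigma> i)"
    "h \<in> Gc i \<Longrightarrow> p \<in> XP i \<Longrightarrow> f i (point_act (X i) h p) = tw X i h (f i p)"
    "p \<in> XP i \<Longrightarrow> q \<in> XP i \<Longrightarrow> tdist (Y l \<tau> (\<sigma> i)) (f i p) (f i q) \<le> L * tdist (Y l \<tau> i) p q"
  using assms by (auto simp: lip_map_def)

lemma lip_collapse:
  assumes "lip_map l \<tau> L f" "alen l" "0 < \<tau>" "i \<in> idx S" "u \<in> XV i" "w \<in> XV i"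
    and c: "ch (XE i) (len (Y l \<tau> i)) (vpoint u) (vpoint w) s"
  shows "td i (push (cp (\<sigma> i)) (f i (vpoint u))) (push (cp (\<sigma> i)) (f i (vpoint w))) \<le> L * s"
proof -
  interpret X: mgraph "grp S i" "X i" by (rule X_graph[OF assms(4)])
  interpret Y: mgraph "grp S i" "Y l \<tau> i" by (rule Y_graph[OF assms(2-4)])
  interpret c: ctree "grp S (\<sigma> i)" "X (\<sigma> i)" "A (\<sigma> i)" by (rule ct[OF perm[OF assms(4)]])
  have uw: "vpoint u \<in> XP i" "vpoint w \<in> XP i" using assms X.vpoint_points by auto
  have "td i (push (cp (\<sigma> i)) (f i (vpoint u))) (push (cp (\<sigma> i)) (f i (vpoint w)))
      \<le> tdist (Y l \<tau> (\<sigma> i)) (f i (vpoint u)) (f i (vpoint w))"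
    unfolding D_def' Y_def
    by (rule c.tdist_comp_scaled)
      (use assms(2,3,4) perm lip_mapD(2)[OF assms(1,4)] uw in \<open>auto simp: alen_def\<close>)
  also have "\<dots> \<le> L * tdist (Y l \<tau> i) (vpoint u) (vpoint w)"
    using lip_mapD(4)[OF assms(1,4) uw] .
  also have "\<dots> \<le> L * s"
    using Y.tdist_leI[of "vpoint u" "vpoint w" s] c lip_mapD(1)[OF assms(1,4)] by (intro mult_left_mono) auto
  finally show ?thesis .
qed

end

section \<open>Lower semicontinuity of the displacement at the boundary point\<close>

context collapse_system
begin

text \<open>Invariance reduces the claim to one edge of each orbit, and monotonicity combines the
  finitely many constants.\<close>

lemma uniform_edges:
  fixes P :: "'i \<Rightarrow> 'v set \<Rightarrow> real \<Rightarrow> bool"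
  assumes ex: "\<And>i e. i \<in> idx S \<Longrightarrow> e \<in> XE i \<Longrightarrow> \<exists>K. P i e K"
    and mono: "\<And>i e K K'. i \<in> idx S \<Longrightarrow> e \<in> XE i \<Longrightarrow> P i e K \<Longrightarrow> K \<le> K' \<Longrightarrow> P i e K'"
    and eqv: "\<And>i e h K. i \<in> idx S \<Longrightarrow> e \<in> XE i \<Longrightarrow> h \<in> Gc i \<Longrightarrow> P i e K \<Longrightarrow>
      P i (act (X i) h ` e) K"
  shows "\<exists>K\<ge>0. \<forall>i\<in>idx S. \<forall>e\<in>XE i. P i e K"
proof -
  have "\<exists>K\<ge>0. \<forall>i\<in>idx S. (\<forall>e\<in>XE i. P i e K)"
  proof (rule finite_uniform[where P = "\<lambda>i K. \<forall>e\<in>XE i. P i e K", OF fin_idx])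
    fix i assume i: "i \<in> idx S"
    obtain E0 where E0: "finite E0" "E0 \<subseteq> XE i"
      "\<forall>e\<in>XE i. \<exists>h\<in>Gc i. \<exists>e0\<in>E0. e = act (X i) h ` e0"
      using orbits[OF i] by (elim exE conjE)
    have "\<exists>K\<ge>0. \<forall>e\<in>E0. P i e K"
      by (rule finite_uniform[OF E0(1)]) (use ex[OF i] mono[OF i] E0(2) in blast)+
    then obtain K where K: "\<forall>e\<in>E0. P i e K" by blast
    have "P i e K" if e: "e \<in> XE i" for e
    proof -
      obtain h e0 where h: "h \<in> Gc i" "e0 \<in> E0" "e = act (X i) h ` e0" using bspec[OF E0(3) e] by blast
      thus ?thesis using eqv[OF i _ h(1), of e0 K] K E0(2) by blast
    qed
    thus "\<exists>K. \<forall>e\<in>XE i. P i e K" by blast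
  next
    fix i K K' assume "i \<in> idx S" "\<forall>e\<in>XE i. P i e K" "K \<le> (K' :: real)"
    thus "\<forall>e\<in>XE i. P i e K'" using mono by blast
  qed
  thus ?thesis .
qed

text \<open>Lower semicontinuity.  A vertex of \<open>X/A\<close> with non-trivial stabiliser has a forced image; it is
  close to the image of any vertex of the component, because some non-trivial element of the
  stabiliser moves that vertex by a small amount.\<close>

lemma displacement_lower:
  assumes l: "alen l"
  shows "\<exists>K\<ge>0. \<forall>\<tau>>0. \<forall>L. disp (Y l \<tau>) < ereal L \<longrightarrow>
    disp D \<le> ereal (L * (1 + K * \<tau>))"
proof -
  obtain y where y:
    "\<And>i v. i \<in> idx S \<Longrightarrow> v \<in> XV i \<Longrightarrow> y i v \<in> DP (\<sigma> i)"
    "\<And>i h v. i \<in> idx S \<Longrightarrow> h \<in> Gc i \<Longrightarrow> v \<in> XV i \<Longrightarrow>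
      y i (act (X i) h v) = tw D i h (y i v)"
    "\<And>i u w. i \<in> idx S \<Longrightarrow> {u, w} \<in> EA i \<Longrightarrow> y i u = y i w"
    using vertex_map by blast
  have yc: "y i u = y i w" if "i \<in> idx S" "cp i u = cp i w" for i u w
    using ctree.comp_const[OF ct[OF that(1)], of "y i"] y(3) that by blast
  have "\<forall>i\<in>idx S. \<exists>c. \<forall>P\<in>DV i. lt i P \<longrightarrow> c P \<in> XV i \<and> cp i (c P) = P \<and>
      (\<forall>g\<in>Gc i. c (act (D i) g P) = act (X i) g (c P))"
  proof
    fix i assume i: "i \<in> idx S"
    interpret c: ctree "grp S i" "X i" "A i" by (rule ct[OF i])
    show "\<exists>c. \<forall>P\<in>DV i. lt i P \<longrightarrow> c P \<in> XV i \<and> cp i (c P) = P \<and>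
      (\<forall>g\<in>Gc i. c (act (D i) g P) = act (X i) g (c P))"
      unfolding D_def'
    proof (rule c.light_choice[where Y = "XV i" and b = "act (X i)" and Q = "\<lambda>P v. cp i v = P"])
      show "\<exists>v\<in>XV i. cp i v = P" if "P \<in> sverts (collapse_tree (X i) (A i))" for P
        using that by (auto simp: c.C_verts)
      show "cp i (act (X i) g v) = act (collapse_tree (X i) (A i)) g P"
        if "g \<in> Gc i" "v \<in> XV i" "cp i v = P" for g P v
        using c.C_act[OF that(1,2)] that(3) by simp
    qed (use c.act_closed c.act_one c.act_mult in auto)
  qed
  from bchoice[OF this] obtain c where c0: "\<forall>i\<in>idx S. \<forall>P\<in>DV i. lt i P \<longrightarrow>
      c i P \<in> XV i \<and> cp i (c i P) = P \<and>
      (\<forall>g\<in>Gc i. c i (act (D i) g P) = act (X i) g (c i P))" by blast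
  have c: "\<And>i P. i \<in> idx S \<Longrightarrow> P \<in> DV i \<Longrightarrow> lt i P \<Longrightarrow> c i P \<in> XV i"
    "\<And>i P. i \<in> idx S \<Longrightarrow> P \<in> DV i \<Longrightarrow> lt i P \<Longrightarrow> cp i (c i P) = P"
    "\<And>i P g. i \<in> idx S \<Longrightarrow> P \<in> DV i \<Longrightarrow> lt i P \<Longrightarrow> g \<in> Gc i \<Longrightarrow>
      c i (act (D i) g P) = act (X i) g (c i P)"
    using c0 by blast+
  define pf where "pf f i u = push (cp (\<sigma> i)) (f i (vpoint u))"
    for f :: "'i \<Rightarrow> ('v \<Rightarrow> real) \<Rightarrow> ('v \<Rightarrow> real)" and i u
  \<comment> \<open>The candidate map on \<open>X/A\<close>. At light vertices it follows
    \<open>f\<close> at the base vertex; at heavy ones it takes the forced value, which by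
    \<open>yc\<close> does not depend on the vertex picked by \<open>SOME\<close>.\<close>
  define g where "g f i P = (if lt i P then pf f i (c i P) else y i (SOME v. v \<in> XV i \<and> cp i v = P))" for f i P
  have g_heavy: "g f i (cp i v) = y i v" if "i \<in> idx S" "v \<in> XV i" "\<not> lt i (cp i v)" for f i v
  proof -
    have "\<exists>w. w \<in> XV i \<and> cp i w = cp i v" using that by blast
    from someI_ex[OF this] have "cp i (SOME w. w \<in> XV i \<and> cp i w = cp i v) = cp i v" by (rule conjunct2)
    from yc[OF that(1) this] show ?thesis using that(3) by (simp only: g_def if_False)
  qed
  have pf_act: "pf f i (act (X i) h u) = tw D i h (pf f i u)"
    and pf_in: "pf f i u \<in> DP (\<sigma> i)"
    if "lip_map l \<tau> L f" "i \<in> idx S" "h \<in> Gc i" "u \<in> XV i" for f \<tau> L i h u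
  proof -
    interpret X: mgraph "grp S i" "X i" by (rule X_graph[OF that(2)])
    interpret c': ctree "grp S (\<sigma> i)" "X (\<sigma> i)" "A (\<sigma> i)" by (rule ct[OF perm[OF that(2)]])
    have u: "vpoint u \<in> XP i" using X.vpoint_points that by simp
    show "pf f i (act (X i) h u) = tw D i h (pf f i u)"
      using lip_mapD(3)[OF that(1,2,3) u] X.point_act_vpoint[OF that(3,4)]
        c'.push_comp_act[OF maps_in[OF that(2,3)] lip_mapD(2)[OF that(1,2) u]] by (simp add: pf_def D_def')
    show "pf f i u \<in> DP (\<sigma> i)"
      using c'.push_comp_points lip_mapD(2)[OF that(1,2) u] by (simp add: pf_def D_def')
  qed
  have g_in: "g f i P \<in> DP (\<sigma> i)" if f: "lip_map l \<tau> L f" and i: "i \<in> idx S" and P: "P \<in> DV i" for f \<tau> L i P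
  proof -
    interpret c: ctree "grp S i" "X i" "A i" by (rule ct[OF i])
    obtain v where v: "v \<in> XV i" "P = cp i v" using P by (auto simp: D_def' c.C_verts)
    show ?thesis
    proof (cases "lt i P")
      case True thus ?thesis using pf_in[OF f i c.one_in] c(1)[OF i P] by (simp add: g_def)
    next
      case False thus ?thesis using g_heavy[OF i v(1)] y(1)[OF i v(1)] v(2) by simp
    qed
  qed
  have g_act: "g f i (act (D i) h P) = tw D i h (g f i P)"
    if f: "lip_map l \<tau> L f" and i: "i \<in> idx S" and h: "h \<in> Gc i" and P: "P \<in> DV i" for f \<tau> L i h P
  proof -
    interpret c: ctree "grp S i" "X i" "A i" by (rule ct[OF i])
    obtain v where v: "v \<in> XV i" "P = cp i v" using P by (auto simp: D_def' c.C_verts)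
    have la: "lt i (act (D i) h P) = lt i P" using c.light_act[OF h] P by (simp add: D_def')
    show ?thesis
    proof (cases "lt i P")
      case True
      thus ?thesis using la c(3)[OF i P True h] pf_act[OF f i h c(1)[OF i P True]] by (simp add: g_def)
    next
      case False
      have hv: "act (D i) h P = cp i (act (X i) h v)" using c.C_act[OF h v(1)] v by (simp add: D_def')
      hence "g f i (act (D i) h P) = y i (act (X i) h v)"
        using g_heavy[OF i c.act_closed[OF h v(1)]] la False by simp
      thus ?thesis using g_heavy[OF i v(1)] False v y(2)[OF i h v(1)] by simp
    qed
  qed
  \<comment> \<open>The candidate differs from \<open>f\<close> followed by the collapse by a
    multiple of \<tau>. \<open>K\<close> is fixed before \<tau>, \<open>L\<close> and
    \<open>f\<close>.\<close>
  have bound: "\<exists>K. \<forall>\<tau>>0. \<forall>L f. lip_map l \<tau> L f \<longrightarrow> td i (pf f i u) (g f i (cp i u)) \<le> L * (K * \<tau>)"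
    if i: "i \<in> idx S" and u: "u \<in> XV i" for i u
  proof -
    interpret c: ctree "grp S i" "X i" "A i" by (rule ct[OF i])
    interpret D': mtree "grp S (\<sigma> i)" "D (\<sigma> i)" by (rule D_tree[OF perm[OF i]])
    have l0: "0 \<le> l i e" if "e \<in> EA i" for e using l i that by (auto simp: alen_def intro: less_imp_le)
    have lY: "len (Y l \<tau> i) = c.scaled (l i) \<tau>" for \<tau> by (simp add: Y_def)
    have P: "cp i u \<in> DV i" using c.comp_in_C[OF u] by (simp add: D_def')
    show ?thesis
    proof (cases "lt i (cp i u)")
      case True
      have cu: "c i (cp i u) \<in> XV i" "cp i (c i (cp i u)) = cp i u" using c(1,2)[OF i P True] by auto
      hence "joined (EA i) u (c i (cp i u))" by (metis component_eq_iff)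
      then obtain K where K: "\<And>\<tau>. 0 < \<tau> \<Longrightarrow> ch (XE i) (c.scaled (l i) \<tau>) (vpoint u) (vpoint (c i (cp i u))) (K * \<tau>)"
        using c.ch_comp_const[of u _ "l i"] l0 by blast
      have "td i (pf f i u) (g f i (cp i u)) \<le> L * (K * \<tau>)" if \<tau>: "0 < \<tau>" and f: "lip_map l \<tau> L f" for \<tau> L f
        using lip_collapse[OF f l \<tau> i u cu(1)] K[OF \<tau>] True by (simp add: lY g_def pf_def)
      thus ?thesis by blast
    next
      case False
      then obtain h where h: "h \<in> Gc i" "h \<noteq> \<one>\<^bsub>grp S i\<^esub>" "act (D i) h (cp i u) = cp i u"
        by (auto simp: c.light_def D_def')
      have hu: "cp i (act (X i) h u) = cp i u" using c.C_act[OF h(1) u] h(3) by (simp add: D_def')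
      hence "joined (EA i) u (act (X i) h u)" by (metis component_eq_iff)
      then obtain K where K: "\<And>\<tau>. 0 < \<tau> \<Longrightarrow> ch (XE i) (c.scaled (l i) \<tau>) (vpoint u) (vpoint (act (X i) h u)) (K * \<tau>)"
        using c.ch_comp_const[of u _ "l i"] l0 by blast
      have yf: "tw D i h (y i u) = y i u"
        using y(2)[OF i h(1) u] yc[OF i hu] by simp
      have \<theta>h: "\<theta> i h \<in> Gc (\<sigma> i)" "\<theta> i h \<noteq> \<one>\<^bsub>grp S (\<sigma> i)\<^esub>"
        using maps_in[OF i h(1)] maps_neq_one[OF i h(1,2)] by auto
      obtain x where x: "x \<in> DV (\<sigma> i)" "y i u = vpoint x" "act (D (\<sigma> i)) (\<theta> i h) x = x"
        using D'.fixed_point_vertex[OF \<theta>h y(1)[OF i u] yf] by blast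
      have "td i (pf f i u) (g f i (cp i u)) \<le> L * (K * \<tau>)" if \<tau>: "0 < \<tau>" and f: "lip_map l \<tau> L f" for \<tau> L f
      proof -
        have "td i (pf f i u) (vpoint x) \<le> td i (pf f i u) (tw D i h (pf f i u))"
          using D'.tdist_fixed_le[OF \<theta>h x(3,1) pf_in[OF f i h(1) u]] .
        also have "\<dots> = td i (pf f i u) (pf f i (act (X i) h u))"
          using pf_act[OF f i h(1) u] by simp
        also have "\<dots> \<le> L * (K * \<tau>)"
          using lip_collapse[OF f l \<tau> i u c.act_closed[OF h(1) u]] K[OF \<tau>] by (simp add: lY pf_def)
        finally show ?thesis using g_heavy[OF i u False] x(2) by simp
      qed
      thus ?thesis by blast
    qed
  qed
  \<comment> \<open>The additive error is expressed as a factor on the length of the edge, so that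
    it enters the Lipschitz constant directly.\<close>
  define PB where "PB i e K \<longleftrightarrow> (\<forall>u w. e = {u, w} \<longrightarrow> e \<notin> EA i \<longrightarrow> (\<forall>\<tau>>0. \<forall>L f. lip_map l \<tau> L f \<longrightarrow>
    td i (g f i (cp i u)) (g f i (cp i w)) \<le> L * (1 + K * \<tau>) * len (X i) e))" for i e and K :: real
  have "\<exists>K\<ge>0. \<forall>i\<in>idx S. \<forall>e\<in>XE i. PB i e K"
  proof (rule uniform_edges)
    fix i e assume i: "i \<in> idx S" and e: "e \<in> XE i"
    interpret c: ctree "grp S i" "X i" "A i" by (rule ct[OF i])
    interpret D': mtree "grp S (\<sigma> i)" "D (\<sigma> i)" by (rule D_tree[OF perm[OF i]])
    have "\<exists>k. \<forall>v\<in>XV i. \<forall>\<tau>>0. \<forall>L f. lip_map l \<tau> L f \<longrightarrow> td i (pf f i v) (g f i (cp i v)) \<le> L * (k v * \<tau>)"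
      using bound[OF i] by metis
    then obtain k where k: "\<And>v \<tau> L f. v \<in> XV i \<Longrightarrow> 0 < \<tau> \<Longrightarrow> lip_map l \<tau> L f \<Longrightarrow>
        td i (pf f i v) (g f i (cp i v)) \<le> L * (k v * \<tau>)" by blast
    \<comment> \<open>The errors at the two ends of the edge, relative to its length.\<close>
    define K where "K = (\<Sum>v\<in>e. k v) / len (X i) e"
    have "td i (g f i (cp i u)) (g f i (cp i w)) \<le> L * (1 + K * \<tau>) * len (X i) e"
      if uw: "e = {u, w}" and eA: "e \<notin> EA i" and \<tau>: "0 < \<tau>" and f: "lip_map l \<tau> L f" for u w \<tau> L f
    proof -
      have uwX: "u \<in> XV i" "w \<in> XV i" "u \<noteq> w" using c.edge_ends c.edge_neq' e uw by auto
      have gp: "g f i (cp i u) \<in> DP (\<sigma> i)" "g f i (cp i w) \<in> DP (\<sigma> i)"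
        using g_in[OF f i] c.comp_in_C uwX by (auto simp: D_def')
      note pp = pf_in[OF f i c.one_in uwX(1)] pf_in[OF f i c.one_in uwX(2)]
      have "ch (sedges (Y l \<tau> i)) (len (Y l \<tau> i)) (ept u w 0) (ept u w 1) (len (X i) {u, w})"
        by (rule ch_edge[of e]) (use e uw eA uwX edist_ept[OF uwX(3), of 0 1] ept_closed_edge[OF uwX(3), of 0]
          ept_closed_edge[OF uwX(3), of 1] len_Y[OF i] in \<open>auto simp del: ept_0 ept_1\<close>)
      hence 1: "td i (pf f i u) (pf f i w) \<le> L * len (X i) e"
        using lip_collapse[OF f l \<tau> i uwX(1,2)] uw by (simp add: pf_def)
      have 2: "td i (g f i (cp i u)) (pf f i u) \<le> L * (k u * \<tau>)"
        using k[OF uwX(1) \<tau> f] D'.tdist_sym[OF gp(1) pp(1)] by simp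
      have 3: "td i (pf f i w) (g f i (cp i w)) \<le> L * (k w * \<tau>)" using k[OF uwX(2) \<tau> f] .
      have "td i (g f i (cp i u)) (g f i (cp i w)) \<le> L * (k u * \<tau>) + L * len (X i) e + L * (k w * \<tau>)"
        using 1 2 3 D'.tdist_triangle[OF gp(1) pp(1) gp(2)] D'.tdist_triangle[OF pp(1) pp(2) gp(2)] by linarith
      also have "\<dots> = L * (1 + K * \<tau>) * len (X i) e"
        using c.len_pos[OF e] uwX(3) by (simp add: K_def uw field_simps)
      finally show ?thesis .
    qed
    thus "\<exists>K. PB i e K" unfolding PB_def by blast
  next
    fix i e K K' assume i: "i \<in> idx S" and e: "e \<in> XE i" and P: "PB i e K" and K: "K \<le> K'"
    interpret c: ctree "grp S i" "X i" "A i" by (rule ct[OF i])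
    have le: "L * (1 + K * \<tau>) * len (X i) e \<le> L * (1 + K' * \<tau>) * len (X i) e" if "0 < \<tau>" "lip_map l \<tau> L f" for \<tau> L f
    proof -
      have "1 + K * \<tau> \<le> 1 + K' * \<tau>" using K that(1) by (simp add: mult_right_mono)
      from mult_right_mono[OF mult_left_mono[OF this lip_mapD(1)[OF that(2) i]] c.len_nonneg[OF e]]
      show ?thesis .
    qed
    show "PB i e K'" unfolding PB_def
    proof (intro allI impI)
      fix u w \<tau> L f assume a: "e = {u, w}" "e \<notin> EA i" "(0::real) < \<tau>" "lip_map l \<tau> L f"
      show "td i (g f i (cp i u)) (g f i (cp i w)) \<le> L * (1 + K' * \<tau>) * len (X i) e"
        using order_trans[OF P[unfolded PB_def, rule_format, OF a] le[OF a(3,4)]] .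
    qed
  next
    fix i e h K assume i: "i \<in> idx S" and e: "e \<in> XE i" and h: "h \<in> Gc i" and P: "PB i e K"
    interpret c: ctree "grp S i" "X i" "A i" by (rule ct[OF i])
    interpret D': mtree "grp S (\<sigma> i)" "D (\<sigma> i)" by (rule D_tree[OF perm[OF i]])
    show "PB i (act (X i) h ` e) K"
      unfolding PB_def
    proof (intro allI impI)
      fix u w \<tau> L f assume uw: "act (X i) h ` e = {u, w}" and nA: "act (X i) h ` e \<notin> EA i"
        and \<tau>: "(0::real) < \<tau>" and f: "lip_map l \<tau> L f"
      have eA: "e \<notin> EA i" using nA c.A_act_iff[OF h e] by simp
      obtain a b where ab: "a \<in> e" "b \<in> e" "u = act (X i) h a" "w = act (X i) h b" using uw by (metis imageE insertI1 insertCI)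
      have abX: "a \<in> XV i" "b \<in> XV i" using c.edge_verts[OF e] ab by auto
      have "u \<noteq> w" using c.edge_neq' c.act_edge[OF h e] uw by auto
      hence eab: "e = {a, b}" using ab c.edge_card[OF e] by (auto simp: card_2_iff)
      have P': "cp i a \<in> DV i" "cp i b \<in> DV i" using c.comp_in_C abX by (auto simp: D_def')
      have uw': "cp i u = act (D i) h (cp i a)" "cp i w = act (D i) h (cp i b)"
        using c.C_act[OF h] abX ab by (auto simp: D_def')
      have "td i (g f i (cp i u)) (g f i (cp i w)) = td i (g f i (cp i a)) (g f i (cp i b))"
        unfolding uw' g_act[OF f i h P'(1)] g_act[OF f i h P'(2)]
        by (rule D'.tdist_act[OF g_in[OF f i P'(1)] g_in[OF f i P'(2)] maps_in[OF i h]])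
      also have "\<dots> \<le> L * (1 + K * \<tau>) * len (X i) e" using P eab eA \<tau> f unfolding PB_def by blast
      also have "len (X i) e = len (X i) (act (X i) h ` e)" using c.len_act[OF h e] by simp
      finally show "td i (g f i (cp i u)) (g f i (cp i w)) \<le> L * (1 + K * \<tau>) * len (X i) (act (X i) h ` e)" .
    qed
  qed
  then obtain K where K: "0 \<le> K" "\<And>i e. i \<in> idx S \<Longrightarrow> e \<in> XE i \<Longrightarrow> PB i e K" by blast
  have "disp D \<le> ereal (L * (1 + K * \<tau>))" if \<tau>: "0 < \<tau>" and less: "disp (Y l \<tau>) < ereal L" for \<tau> L
  proof -
    obtain f where f:
      "\<And>i. i \<in> idx S \<Longrightarrow> 0 \<le> L"
      "\<And>i p. i \<in> idx S \<Longrightarrow> p \<in> points (Y l \<tau> i) \<Longrightarrow> f i p \<in> points (Y l \<tau> (\<sigma> i))"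
      "\<And>i h p. i \<in> idx S \<Longrightarrow> h \<in> Gc i \<Longrightarrow> p \<in> points (Y l \<tau> i) \<Longrightarrow>
        f i (point_act (Y l \<tau> i) h p) = point_act (Y l \<tau> (\<sigma> i)) (\<theta> i h) (f i p)"
      "\<And>i p q. i \<in> idx S \<Longrightarrow> p \<in> points (Y l \<tau> i) \<Longrightarrow> q \<in> points (Y l \<tau> i) \<Longrightarrow>
        tdist (Y l \<tau> (\<sigma> i)) (f i p) (f i q) \<le> L * tdist (Y l \<tau> i) p q"
      using displacement_lessD[OF less Y_graph[OF l \<tau>]] by blast
    have L: "0 \<le> L" using f(1) ne_idx by blast
    have fl: "lip_map l \<tau> L f" using f L unfolding lip_map_def by simp
    show ?thesis
    proof (rule displacement_leI[where F = "g f", OF D_graph])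
      show "0 \<le> L * (1 + K * \<tau>)" using L K \<tau> by simp
      show "g f i v \<in> DP (\<sigma> i)" if "i \<in> idx S" "v \<in> DV i" for i v
        using g_in[OF fl that] .
      show "g f i (act (D i) h v) = tw D i h (g f i v)"
        if "i \<in> idx S" "h \<in> Gc i" "v \<in> DV i" for i h v using g_act[OF fl that] .
      fix i P Q assume i: "i \<in> idx S" and PQ: "{P, Q} \<in> DE i"
      interpret c: ctree "grp S i" "X i" "A i" by (rule ct[OF i])
      obtain u w where uw: "{P, Q} = {cp i u, cp i w}" "{u, w} \<in> XE i" "{u, w} \<notin> EA i"
        using c.C_edgeE[of "{P, Q}"] PQ unfolding D_def' by metis
      have len: "len (D i) {P, Q} = len (X i) {u, w}"
        unfolding D_def' uw(1) by (rule c.C_len[OF uw(2,3)])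
      have PB: "PB i {u, w} K" using K(2)[OF i uw(2)] .
      have b: "td i (g f i (cp i u)) (g f i (cp i w)) \<le> L * (1 + K * \<tau>) * len (X i) {u, w}"
        using PB[unfolded PB_def, rule_format, OF refl uw(3) \<tau> fl] .
      have b': "td i (g f i (cp i w)) (g f i (cp i u)) \<le> L * (1 + K * \<tau>) * len (X i) {u, w}"
        using PB[unfolded PB_def, rule_format, OF insert_commute uw(3) \<tau> fl] .
      have "(P = cp i u \<and> Q = cp i w) \<or> (P = cp i w \<and> Q = cp i u)"
        using uw(1) by (simp add: doubleton_eq_iff)
      thus "td i (g f i P) (g f i Q) \<le> L * (1 + K * \<tau>) * len (D i) {P, Q}"
        using b b' unfolding len by (elim disjE conjE) simp_all
    qed
  qed
  thus ?thesis using K(1) by blast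
qed

end

section \<open>Upper estimate near the boundary point and convergent sequences\<close>

context collapse_system
begin

text \<open>Inside \<open>A\<close> the estimate is homogeneous in \<tau>, as source and target
  shrink together. On the other edges a map of \<open>X/A\<close> is lifted at the cost of a
  multiple of \<tau>, which fits into the gap between \<open>L1\<close> and \<open>L\<close> once
  \<tau> is small.\<close>

lemma displacement_upper:
  assumes l: "alen l" and less: "disp D < ereal L1" "L1 < L"
    and F0_in: "\<And>i v. i \<in> idx S \<Longrightarrow> v \<in> XV i \<Longrightarrow> \<not> lt i (cp i v) \<Longrightarrow> F0 i v \<in> XP (\<sigma> i)"
    and F0_act: "\<And>i h v. i \<in> idx S \<Longrightarrow> h \<in> Gc i \<Longrightarrow> v \<in> XV i \<Longrightarrow> \<not> lt i (cp i v) \<Longrightarrow>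
      F0 i (act (X i) h v) = tw X i h (F0 i v)"
    and F0_ch: "\<And>i u w. i \<in> idx S \<Longrightarrow> {u, w} \<in> EA i \<Longrightarrow> \<not> lt i (cp i u) \<Longrightarrow>
      ch (EA (\<sigma> i)) (l (\<sigma> i)) (F0 i u) (F0 i w) (L * l i {u, w})"
  shows "\<exists>\<tau>0>0. \<forall>\<tau>. 0 < \<tau> \<longrightarrow> \<tau> < \<tau>0 \<longrightarrow> disp (Y l \<tau>) \<le> ereal L"
proof -
  obtain gm where gm:
    "\<And>i. i \<in> idx S \<Longrightarrow> 0 \<le> L1"
    "\<And>i p. i \<in> idx S \<Longrightarrow> p \<in> DP i \<Longrightarrow> gm i p \<in> DP (\<sigma> i)"
    "\<And>i h p. i \<in> idx S \<Longrightarrow> h \<in> Gc i \<Longrightarrow> p \<in> DP i \<Longrightarrow>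
      gm i (point_act (D i) h p) = tw D i h (gm i p)"
    "\<And>i p q. i \<in> idx S \<Longrightarrow> p \<in> DP i \<Longrightarrow> q \<in> DP i \<Longrightarrow>
      td i (gm i p) (gm i q) \<le> L1 * tdist (D i) p q"
    using displacement_lessD[OF less(1) D_graph] by blast
  have L: "0 \<le> L1" "0 \<le> L" using gm(1) ne_idx less(2) by force+
  have "\<forall>i\<in>idx S. \<exists>c. \<forall>P\<in>DV i. lt i P \<longrightarrow> c P \<in> XP (\<sigma> i) \<and>
      push (cp (\<sigma> i)) (c P) = gm i (vpoint P) \<and>
      (\<forall>g\<in>Gc i. c (act (D i) g P) = tw X i g (c P))"
  proof
    fix i assume i: "i \<in> idx S"
    interpret c: ctree "grp S i" "X i" "A i" by (rule ct[OF i])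
    interpret c': ctree "grp S (\<sigma> i)" "X (\<sigma> i)" "A (\<sigma> i)" by (rule ct[OF perm[OF i]])
    have gv: "gm i (vpoint P) \<in> points (collapse_tree (X (\<sigma> i)) (A (\<sigma> i)))" if "P \<in> DV i" for P
      using gm(2)[OF i mgraph.vpoint_points[OF D_graph[OF i] that]] by (simp add: D_def')
    show "\<exists>c. \<forall>P\<in>DV i. lt i P \<longrightarrow> c P \<in> XP (\<sigma> i) \<and>
      push (cp (\<sigma> i)) (c P) = gm i (vpoint P) \<and>
      (\<forall>g\<in>Gc i. c (act (D i) g P) = tw X i g (c P))"
      unfolding D_def'
    proof (rule c.light_choice[where Y = "XP (\<sigma> i)" and b = "\<lambda>g. tw X i g"
          and Q = "\<lambda>P p. push (cp (\<sigma> i)) p = gm i (vpoint P)"])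
      fix P assume P: "P \<in> sverts (collapse_tree (X i) (A i))"
      show "\<exists>p\<in>XP (\<sigma> i). push (cp (\<sigma> i)) p = gm i (vpoint P)"
        using c'.push_comp_surj[OF gv] P by (simp add: D_def')
      fix g p assume g: "g \<in> Gc i" and p: "p \<in> XP (\<sigma> i)" and
        eq: "push (cp (\<sigma> i)) p = gm i (vpoint P)"
      have "push (cp (\<sigma> i)) (tw X i g p) = tw D i g (gm i (vpoint P))"
        using c'.push_comp_act[OF maps_in[OF i g] p] eq by (simp add: D_def')
      also have "\<dots> = gm i (point_act (D i) g (vpoint P))"
        using gm(3)[OF i g c.C.vpoint_points[OF P, folded D_def']] by simp
      also have "point_act (D i) g (vpoint P) = vpoint (act (D i) g P)"
        using c.C.point_act_vpoint[OF g P] by (simp add: D_def')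
      finally show "push (cp (\<sigma> i)) (tw X i g p) = gm i (vpoint (act (collapse_tree (X i) (A i)) g P))"
        by (simp add: D_def')
    next
      show "tw X i g p \<in> XP (\<sigma> i)" if "g \<in> Gc i" "p \<in> XP (\<sigma> i)" for g p
        using c'.point_act_closed[OF maps_in[OF i that(1)] that(2)] .
      show "tw X i \<one>\<^bsub>grp S i\<^esub> p = p" if "p \<in> XP (\<sigma> i)" for p
        using c'.point_act_one[OF that] maps_one[OF i] by simp
      show "tw X i (g \<otimes>\<^bsub>grp S i\<^esub> h) p = tw X i g (tw X i h p)"
        if "g \<in> Gc i" "h \<in> Gc i" "p \<in> XP (\<sigma> i)" for g h p
        using c'.point_act_mult[OF maps_in[OF i that(1)] maps_in[OF i that(2)] that(3)] maps_mult[OF i that(1,2)] by simp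
    qed
  qed
  from bchoice[OF this] obtain c where c0: "\<forall>i\<in>idx S. \<forall>P\<in>DV i. lt i P \<longrightarrow> c i P \<in> XP (\<sigma> i) \<and>
      push (cp (\<sigma> i)) (c i P) = gm i (vpoint P) \<and>
      (\<forall>g\<in>Gc i. c i (act (D i) g P) = tw X i g (c i P))" by blast
  have c: "\<And>i P. i \<in> idx S \<Longrightarrow> P \<in> DV i \<Longrightarrow> lt i P \<Longrightarrow> c i P \<in> XP (\<sigma> i)"
    "\<And>i P. i \<in> idx S \<Longrightarrow> P \<in> DV i \<Longrightarrow> lt i P \<Longrightarrow> push (cp (\<sigma> i)) (c i P) = gm i (vpoint P)"
    "\<And>i P g. i \<in> idx S \<Longrightarrow> P \<in> DV i \<Longrightarrow> lt i P \<Longrightarrow> g \<in> Gc i \<Longrightarrow>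
      c i (act (D i) g P) = tw X i g (c i P)"
    using c0 by blast+
  \<comment> \<open>A light component is sent to a single point, so its edges are not stretched at
    all; on heavy components the given map takes over.\<close>
  define F where "F i u = (if lt i (cp i u) then c i (cp i u) else F0 i u)" for i u
  have cpD: "cp i u \<in> DV i" if "i \<in> idx S" "u \<in> XV i" for i u
    using ctree.comp_in_C[OF ct[OF that(1)] that(2)] by (simp add: D_def')
  have F_in: "F i u \<in> XP (\<sigma> i)" if "i \<in> idx S" "u \<in> XV i" for i u
    using c(1)[OF that(1) cpD[OF that]] F0_in[OF that] by (simp add: F_def)
  have F_act: "F i (act (X i) h u) = tw X i h (F i u)"
    if i: "i \<in> idx S" and h: "h \<in> Gc i" and u: "u \<in> XV i" for i h u
  proof -
    interpret c: ctree "grp S i" "X i" "A i" by (rule ct[OF i])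
    have 1: "cp i (act (X i) h u) = act (D i) h (cp i u)" using c.C_act[OF h u] by (simp add: D_def')
    have 2: "lt i (cp i (act (X i) h u)) = lt i (cp i u)"
      unfolding 1 using c.light_act[OF h] cpD[OF i u] by (simp add: D_def')
    show ?thesis
    proof (cases "lt i (cp i u)")
      case True
      thus ?thesis using 1 2 c(3)[OF i cpD[OF i u] True h] by (simp add: F_def)
    next
      case False
      thus ?thesis using 2 F0_act[OF i h u False] by (simp add: F_def)
    qed
  qed
  have F_edge: "push (cp (\<sigma> i)) (F i u) = push (cp (\<sigma> i)) (F i w)"
    if i: "i \<in> idx S" and e: "{u, w} \<in> EA i" for i u w
  proof -
    interpret c: ctree "grp S i" "X i" "A i" by (rule ct[OF i])
    interpret c': ctree "grp S (\<sigma> i)" "X (\<sigma> i)" "A (\<sigma> i)" by (rule ct[OF perm[OF i]])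
    have uw: "cp i u = cp i w" using c.comp_edge_iff[OF c.A_edge[OF e]] e by simp
    show ?thesis
    proof (cases "lt i (cp i u)")
      case True thus ?thesis using uw by (simp add: F_def)
    next
      case False
      thus ?thesis using uw c'.ch_A_comp[OF F0_ch[OF i e False]] by (simp add: F_def)
    qed
  qed
  \<comment> \<open>The glueing step: \<open>F0\<close> and \<open>gm\<close> are unrelated, but
    over a heavy vertex the collapsed value of the one and the value of the other are fixed by the
    same non-trivial element, hence equal.\<close>
  have F_push: "push (cp (\<sigma> i)) (F i u) = gm i (vpoint (cp i u))" if i: "i \<in> idx S" and u: "u \<in> XV i" for i u
  proof (cases "lt i (cp i u)")
    case True thus ?thesis using c(2)[OF i cpD[OF i u] True] by (simp add: F_def)
  next
    case False
    interpret c: ctree "grp S i" "X i" "A i" by (rule ct[OF i])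
    interpret c': ctree "grp S (\<sigma> i)" "X (\<sigma> i)" "A (\<sigma> i)" by (rule ct[OF perm[OF i]])
    obtain h where h: "h \<in> Gc i" "h \<noteq> \<one>\<^bsub>grp S i\<^esub>" "act (D i) h (cp i u) = cp i u"
      using False by (auto simp: c.light_def D_def')
    have hu: "cp i (act (X i) h u) = cp i u" using c.C_act[OF h(1) u] h(3) by (simp add: D_def')
    have "push (cp (\<sigma> i)) (F i (act (X i) h u)) = push (cp (\<sigma> i)) (F i u)"
      using c.comp_const[of "\<lambda>v. push (cp (\<sigma> i)) (F i v)", OF F_edge[OF i] hu] .
    hence 1: "tw D i h (push (cp (\<sigma> i)) (F i u)) = push (cp (\<sigma> i)) (F i u)"
      using F_act[OF i h(1) u] c'.push_comp_act[OF maps_in[OF i h(1)] F_in[OF i u]] by (simp add: D_def')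
    have vD: "vpoint (cp i u) \<in> DP i" using mgraph.vpoint_points[OF D_graph[OF i] cpD[OF i u]] .
    have "point_act (D i) h (vpoint (cp i u)) = vpoint (cp i u)"
      using mgraph.point_act_vpoint[OF D_graph[OF i] h(1) cpD[OF i u]] h(3) by simp
    hence 2: "tw D i h (gm i (vpoint (cp i u))) = gm i (vpoint (cp i u))"
      using gm(3)[OF i h(1) vD] by simp
    have 3: "push (cp (\<sigma> i)) (F i u) \<in> DP (\<sigma> i)"
      using c'.push_comp_points[OF F_in[OF i u]] by (simp add: D_def')
    show ?thesis using heavy_fixed[OF i u 3 1 gm(2)[OF i vD] 2 h(1,2)] .
  qed
  have l0: "0 \<le> l i e" if "i \<in> idx S" "e \<in> EA i" for i e
    using l that by (auto simp: alen_def intro: less_imp_le)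
  \<comment> \<open>The threshold for \<tau> is encoded by its inverse \<open>K\<close>: enlarging
    \<open>K\<close> weakens the claim, as \<open>uniform_edges\<close> requires.\<close>
  define PB where "PB i e K \<longleftrightarrow> (\<forall>u w. e = {u, w} \<longrightarrow> (\<forall>\<tau>. 0 < \<tau> \<longrightarrow> \<tau> * K < 1 \<longrightarrow>
    tdist (Y l \<tau> (\<sigma> i)) (F i u) (F i w) \<le> L * len (Y l \<tau> i) e))" for i e and K :: real
  have "\<exists>K\<ge>0. \<forall>i\<in>idx S. \<forall>e\<in>XE i. PB i e K"
  proof (rule uniform_edges)
    fix i e assume i: "i \<in> idx S" and e: "e \<in> XE i"
    interpret c: ctree "grp S i" "X i" "A i" by (rule ct[OF i])
    interpret c': ctree "grp S (\<sigma> i)" "X (\<sigma> i)" "A (\<sigma> i)" by (rule ct[OF perm[OF i]])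
    obtain a b where ab: "e = {a, b}" "a \<noteq> b" "a \<in> XV i" "b \<in> XV i" using c.edge_obtain[OF e] .
    have "\<exists>K. \<forall>\<tau>. 0 < \<tau> \<longrightarrow> \<tau> * K < 1 \<longrightarrow> tdist (Y l \<tau> (\<sigma> i)) (F i a) (F i b) \<le> L * len (Y l \<tau> i) e"
    proof (cases "e \<in> EA i")
      case True
      have eq: "cp i a = cp i b" using c.comp_edge_iff[of a b] e True ab by simp
      have "tdist (Y l \<tau> (\<sigma> i)) (F i a) (F i b) \<le> L * len (Y l \<tau> i) e" if \<tau>: "0 < \<tau>" for \<tau>
      proof -
        interpret Y': mgraph "grp S (\<sigma> i)" "Y l \<tau> (\<sigma> i)" by (rule Y_graph[OF l \<tau> perm[OF i]])
        show ?thesis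
        proof (cases "lt i (cp i a)")
          case lt: True
          hence "F i a = F i b" using eq by (simp add: F_def)
          thus ?thesis using Y'.tdist_refl[of "F i b"] F_in[OF i ab(4)] L \<tau> l0[OF i True] True
            by (simp add: len_Y[OF i])
        next
          case False
          have "ch (EA (\<sigma> i)) (l (\<sigma> i)) (F i a) (F i b) (L * l i e)"
            using F0_ch[OF i _ False, of b] True ab eq False by (simp add: F_def)
          hence "ch (sedges (Y l \<tau> (\<sigma> i))) (len (Y l \<tau> (\<sigma> i))) (F i a) (F i b) (\<tau> * (L * l i e))"
            by (rule ch_mono_len) (use c'.A_edge \<tau> in \<open>auto simp: len_Y[OF perm[OF i]]\<close>)
          hence "tdist (Y l \<tau> (\<sigma> i)) (F i a) (F i b) \<le> \<tau> * (L * l i e)" by (rule Y'.tdist_leI)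
          thus ?thesis using True by (simp add: len_Y[OF i] algebra_simps)
        qed
      qed
      thus ?thesis by blast
    next
      case False
      let ?P = "cp i a" and ?Q = "cp i b"
      have pp: "vpoint ?P \<in> DP i" "vpoint ?Q \<in> DP i"
        using mgraph.vpoint_points[OF D_graph[OF i]] cpD[OF i] ab by auto
      have eD: "{?P, ?Q} \<in> DE i" "len (D i) {?P, ?Q} = len (X i) e"
        using c.C_edgeI[of a b] c.C_len[of a b] e False ab by (auto simp: D_def')
      have le: "0 < len (X i) e" using c.len_pos[OF e] .
      \<comment> \<open>Half of the gap on this edge. One half turns the distance into the length of
        an actual chain, the other absorbs \<open>K * \<tau>\<close>.\<close>
      define \<eta> where "\<eta> = (L - L1) * len (X i) e / 2"
      have \<eta>: "0 < \<eta>" using less(2) le by (simp add: \<eta>_def)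
      have "td i (gm i (vpoint ?P)) (gm i (vpoint ?Q)) \<le> L1 * tdist (D i) (vpoint ?P) (vpoint ?Q)"
        using gm(4)[OF i pp] .
      also have "\<dots> \<le> L1 * len (X i) e"
        using mgraph.tdist_edge_ends[OF D_graph[OF i] eD(1)] eD(2) L(1) by (simp add: mult_left_mono)
      also have "\<dots> < L1 * len (X i) e + \<eta>" using \<eta> by simp
      finally have "ch (DE (\<sigma> i)) (len (D (\<sigma> i))) (gm i (vpoint ?P)) (gm i (vpoint ?Q)) (L1 * len (X i) e + \<eta>)"
        using mgraph.tdist_lessD[OF D_graph[OF perm[OF i]] gm(2)[OF i pp(1)] gm(2)[OF i pp(2)]] by blast
      then obtain K where K: "0 \<le> K" "\<And>\<tau>. 0 < \<tau> \<Longrightarrow>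
          ch (XE (\<sigma> i)) (c'.scaled (l (\<sigma> i)) \<tau>) (F i a) (F i b) (L1 * len (X i) e + \<eta> + K * \<tau>)"
        using c'.ch_lift[OF _ F_in[OF i ab(3)] F_push[OF i ab(3)] F_in[OF i ab(4)] F_push[OF i ab(4)], of _ "l (\<sigma> i)"]
          l0[OF perm[OF i]] unfolding D_def' by blast
      have "tdist (Y l \<tau> (\<sigma> i)) (F i a) (F i b) \<le> L * len (Y l \<tau> i) e" if \<tau>: "0 < \<tau>" "\<tau> * (K / \<eta>) < 1" for \<tau>
      proof -
        interpret Y': mgraph "grp S (\<sigma> i)" "Y l \<tau> (\<sigma> i)" by (rule Y_graph[OF l \<tau>(1) perm[OF i]])
        have "tdist (Y l \<tau> (\<sigma> i)) (F i a) (F i b) \<le> L1 * len (X i) e + \<eta> + K * \<tau>"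
          by (rule Y'.tdist_leI) (use K(2)[OF \<tau>(1)] in \<open>simp add: Y_def\<close>)
        also have "K * \<tau> \<le> \<eta>" using \<tau>(2) \<eta> by (simp add: field_simps)
        finally have "tdist (Y l \<tau> (\<sigma> i)) (F i a) (F i b) \<le> L1 * len (X i) e + \<eta> + \<eta>" by simp
        also have "\<dots> = L * len (X i) e" by (simp add: \<eta>_def algebra_simps)
        finally show ?thesis using False by (simp add: len_Y[OF i])
      qed
      thus ?thesis by blast
    qed
    then obtain K where K: "\<And>\<tau>. 0 < \<tau> \<Longrightarrow> \<tau> * K < 1 \<Longrightarrow> tdist (Y l \<tau> (\<sigma> i)) (F i a) (F i b) \<le> L * len (Y l \<tau> i) e"
      by blast
    have K': "tdist (Y l \<tau> (\<sigma> i)) (F i b) (F i a) \<le> L * len (Y l \<tau> i) e" if \<tau>: "0 < \<tau>" "\<tau> * K < 1" for \<tau>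
      using K[OF \<tau>] mgraph.tdist_sym[OF Y_graph[OF l \<tau>(1) perm[OF i]], of "F i a" "F i b"] F_in[OF i] ab by simp
    have "PB i e K" unfolding PB_def
    proof (intro allI impI)
      fix u w \<tau> assume uw: "e = {u, w}" and \<tau>: "0 < \<tau>" "\<tau> * K < 1"
      have "(u = a \<and> w = b) \<or> (u = b \<and> w = a)" using uw ab(1) by (auto simp: doubleton_eq_iff)
      thus "tdist (Y l \<tau> (\<sigma> i)) (F i u) (F i w) \<le> L * len (Y l \<tau> i) e"
        using K[OF \<tau>] K'[OF \<tau>] by (elim disjE conjE) simp_all
    qed
    thus "\<exists>K. PB i e K" by blast
  next
    fix i e K K' assume P: "PB i e K" and K: "K \<le> (K' :: real)"
    show "PB i e K'" unfolding PB_def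
    proof (intro allI impI)
      fix u w \<tau> assume a: "e = {u, w}" "0 < \<tau>" "\<tau> * K' < 1"
      have "\<tau> * K \<le> \<tau> * K'" using K a(2) by (simp add: mult_left_mono)
      hence "\<tau> * K < 1" using a(3) by linarith
      thus "tdist (Y l \<tau> (\<sigma> i)) (F i u) (F i w) \<le> L * len (Y l \<tau> i) e"
        using P[unfolded PB_def, rule_format, OF a(1,2)] by blast
    qed
  next
    fix i e h K assume i: "i \<in> idx S" and e: "e \<in> XE i" and h: "h \<in> Gc i" and P: "PB i e K"
    interpret c: ctree "grp S i" "X i" "A i" by (rule ct[OF i])
    show "PB i (act (X i) h ` e) K"
      unfolding PB_def
    proof (intro allI impI)
      fix u w \<tau> assume uw: "act (X i) h ` e = {u, w}" and \<tau>: "(0::real) < \<tau>" "\<tau> * K < 1"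
      obtain a b where ab: "a \<in> e" "b \<in> e" "u = act (X i) h a" "w = act (X i) h b" using uw by (metis imageE insertI1 insertCI)
      have abX: "a \<in> XV i" "b \<in> XV i" using c.edge_verts[OF e] ab by auto
      have "u \<noteq> w" using c.edge_neq' c.act_edge[OF h e] uw by auto
      hence eab: "e = {a, b}" using ab c.edge_card[OF e] by (auto simp: card_2_iff)
      have "tdist (Y l \<tau> (\<sigma> i)) (F i u) (F i w) = tdist (Y l \<tau> (\<sigma> i)) (F i a) (F i b)"
        unfolding ab(3,4) F_act[OF i h abX(1)] F_act[OF i h abX(2)]
        using mgraph.tdist_act[OF Y_graph[OF l \<tau>(1) perm[OF i]], of "F i a" "F i b" "\<theta> i h"]
          F_in[OF i abX(1)] F_in[OF i abX(2)] maps_in[OF i h] by simp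
      also have "\<dots> \<le> L * len (Y l \<tau> i) e" using P[unfolded PB_def, rule_format, OF eab \<tau>] .
      also have "len (Y l \<tau> i) e = len (Y l \<tau> i) (act (X i) h ` e)"
        using mgraph.len_act[OF Y_graph[OF l \<tau>(1) i], of h e] h e by simp
      finally show "tdist (Y l \<tau> (\<sigma> i)) (F i u) (F i w) \<le> L * len (Y l \<tau> i) (act (X i) h ` e)" .
    qed
  qed
  then obtain K where K: "0 \<le> K" "\<forall>i\<in>idx S. \<forall>e\<in>XE i. PB i e K" by blast
  \<comment> \<open>The summand 1 keeps the threshold defined when \<open>K = 0\<close>.\<close>
  have "disp (Y l \<tau>) \<le> ereal L" if \<tau>: "0 < \<tau>" "\<tau> < 1 / (K + 1)" for \<tau>
  proof (rule displacement_leI[where F = F, OF Y_graph[OF l \<tau>(1)] L(2)])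
    have "\<tau> * (K + 1) < 1" using \<tau> K(1) by (simp add: pos_less_divide_eq)
    hence \<tau>K: "\<tau> * K < 1" using \<tau>(1) by (simp add: algebra_simps)
    show "tdist (Y l \<tau> (\<sigma> i)) (F i u) (F i w) \<le> L * len (Y l \<tau> i) {u, w}"
      if i: "i \<in> idx S" and e: "{u, w} \<in> sedges (Y l \<tau> i)" for i u w
      using bspec[OF bspec[OF K(2) i], of "{u, w}"] e \<tau>K \<tau>(1) unfolding PB_def by simp
  qed (use F_in F_act in auto)
  moreover have "0 < 1 / (K + 1)" using K(1) by simp
  ultimately show ?thesis by blast
qed

lemma displacement_nonneg:
  assumes "\<And>i. i \<in> idx S \<Longrightarrow> mgraph (grp S i) (Z i)" shows "0 \<le> disp Z"
proof (rule ccontr)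
  assume "\<not> ?thesis"
  hence "disp Z < 0" by simp
  from ereal_dense2[OF this] obtain L where L: "disp Z < ereal L" "ereal L < 0" by blast
  from displacement_lessD[OF L(1) assms] have "0 \<le> L" using ne_idx by blast
  thus False using L(2) by simp
qed

text \<open>The data that \<open>displacement_upper\<close> takes as hypotheses: a metric on
  \<open>A\<close>, and an equivariant map of the vertices of the heavy components that stretches
  the edges of \<open>A\<close> by at most \<open>L\<close> inside \<open>A\<close>.\<close>

abbreviation core_chains :: "real \<Rightarrow> bool" where
  "core_chains L \<equiv> \<exists>l F0. alen l \<and>
    (\<forall>i\<in>idx S. \<forall>v\<in>XV i. \<not> lt i (cp i v) \<longrightarrow> F0 i v \<in> XP (\<sigma> i)) \<and>
    (\<forall>i\<in>idx S. \<forall>h\<in>Gc i. \<forall>v\<in>XV i. \<not> lt i (cp i v) \<longrightarrow>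
      F0 i (act (X i) h v) = tw X i h (F0 i v)) \<and>
    (\<forall>i\<in>idx S. \<forall>u w. {u, w} \<in> EA i \<longrightarrow> \<not> lt i (cp i u) \<longrightarrow>
      ch (EA (\<sigma> i)) (l (\<sigma> i)) (F0 i u) (F0 i w) (L * l i {u, w}))"

text \<open>\<open>core_chains\<close> is available only for constants above the limit value, and
  its metric on \<open>A\<close> depends on the constant. So a new metric is taken for each
  tolerance and shrunk far enough.\<close>

theorem converging_sequence:
  assumes hyp: "\<And>L. disp D < ereal L \<Longrightarrow> core_chains L"
  shows "\<exists>Q. (\<forall>n. Q n \<in> open_simplex S X) \<and>
    (\<forall>i\<in>idx S. \<forall>e\<in>XE i. (\<lambda>n. len (Q n i) e) \<longlonglongrightarrow> (if e \<in> EA i then 0 else len (X i) e)) \<and>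
    (\<lambda>n. disp (Q n)) \<longlonglongrightarrow> disp D"
proof -
  let ?d = "\<lambda>n::nat. 1 / (real n + 1)"
  let ?R = "\<lambda>n Z. Z \<in> open_simplex S X \<and> (\<forall>i\<in>idx S. \<forall>e\<in>XE i.
     \<bar>len (Z i) e - (if e \<in> EA i then 0 else len (X i) e)\<bar> \<le> ?d n) \<and>
     (disp D = \<infinity> \<longrightarrow> disp Z = \<infinity>) \<and>
     (\<forall>r. disp D = ereal r \<longrightarrow>
       ereal (r / (1 + ?d n)) \<le> disp Z \<and> disp Z \<le> ereal (r + ?d n))"
  have core: "\<exists>Z. ?R n Z" if l: "alen l" and \<tau>0: "0 < \<tau>0" and
    up: "\<And>\<tau> r. 0 < \<tau> \<Longrightarrow> \<tau> < \<tau>0 \<Longrightarrow> disp D = ereal r \<Longrightarrow> disp (Y l \<tau>) \<le> ereal (r + ?d n)"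
    for n l \<tau>0
  proof -
    have d: "0 < ?d n" by simp
    obtain K where K: "0 \<le> K" "\<And>\<tau> L. 0 < \<tau> \<Longrightarrow> disp (Y l \<tau>) < ereal L \<Longrightarrow>
        disp D \<le> ereal (L * (1 + K * \<tau>))"
      using displacement_lower[OF l] by blast
    have "\<exists>M\<ge>0. \<forall>i\<in>idx S. \<forall>e\<in>XE i. e \<in> EA i \<longrightarrow> l i e \<le> M"
    proof (rule uniform_edges)
      fix i e h K assume i: "i \<in> idx S" and e: "e \<in> XE i" and h: "h \<in> Gc i"
        and P: "e \<in> EA i \<longrightarrow> l i e \<le> K"
      show "act (X i) h ` e \<in> EA i \<longrightarrow> l i (act (X i) h ` e) \<le> K"
        using sgtree.A_act_iff[OF ctree.axioms(1)[OF ct[OF i]] h e] P l i h by (auto simp: alen_def)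
    qed (auto intro: order_trans)
    then obtain M where M: "0 \<le> M" "\<And>i e. i \<in> idx S \<Longrightarrow> e \<in> XE i \<Longrightarrow> e \<in> EA i \<Longrightarrow> l i e \<le> M" by blast
    \<comment> \<open>\<open>K * \<tau>\<close> controls the loss in
      \<open>displacement_lower\<close>, and \<open>M * \<tau>\<close> the lengths of the edges of
      \<open>A\<close>; both have to stay below the tolerance.\<close>
    define \<tau> where "\<tau> = min (\<tau>0 / 2) (?d n / (K + M + 1))"
    have KM: "0 < K + M + 1" using K(1) M(1) by simp
    have \<tau>: "0 < \<tau>" "\<tau> < \<tau>0" using \<tau>0 d KM by (auto simp: \<tau>_def)
    have "\<tau> \<le> ?d n / (K + M + 1)" by (simp add: \<tau>_def)
    hence "\<tau> * (K + M + 1) \<le> ?d n" using KM by (simp only: pos_le_divide_eq)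
    hence "K * \<tau> + M * \<tau> + \<tau> \<le> ?d n" by (simp add: algebra_simps)
    moreover have "0 \<le> K * \<tau>" "0 \<le> M * \<tau>" using K(1) M(1) \<tau> by auto
    ultimately have K\<tau>: "K * \<tau> \<le> ?d n" "M * \<tau> \<le> ?d n" using \<tau>(1) by linarith+
    have "\<bar>len (Y l \<tau> i) e - (if e \<in> EA i then 0 else len (X i) e)\<bar> \<le> ?d n"
      if i: "i \<in> idx S" and e: "e \<in> XE i" for i e
    proof (cases "e \<in> EA i")
      case True
      have l0: "0 < l i e" using l i True by (simp add: alen_def)
      have "\<tau> * l i e \<le> \<tau> * M" using M(2)[OF i e True] \<tau>(1) by (intro mult_left_mono) auto
      hence "\<tau> * l i e \<le> ?d n" using K\<tau>(2) by (simp add: mult.commute)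
      moreover have "0 < \<tau> * l i e" using l0 \<tau>(1) by simp
      ultimately show ?thesis using True by (simp add: len_Y[OF i])
    qed (simp add: len_Y[OF i])
    moreover have "disp (Y l \<tau>) = \<infinity>" if "disp D = \<infinity>"
    proof (rule ccontr)
      assume "disp (Y l \<tau>) \<noteq> \<infinity>"
      then obtain L where "disp (Y l \<tau>) < ereal L" by (metis less_PInf_Ex_of_nat ereal_infty_less(1))
      thus False using K(2)[OF \<tau>(1)] that by force
    qed
    moreover have "ereal (r / (1 + ?d n)) \<le> disp (Y l \<tau>)" if r: "disp D = ereal r" for r
    proof (rule ccontr)
      assume "\<not> ?thesis"
      hence "disp (Y l \<tau>) < ereal (r / (1 + ?d n))" by (simp only: not_le)
      from ereal_dense2[OF this] obtain L where L: "disp (Y l \<tau>) < ereal L" "L < r / (1 + ?d n)"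
        unfolding less_ereal.simps by blast
      have L0: "0 \<le> L" using displacement_nonneg[OF Y_graph[OF l \<tau>(1)]] L(1)
        by (metis ereal_less_eq(5) less_imp_le order_trans)
      have "r \<le> L * (1 + K * \<tau>)" using K(2)[OF \<tau>(1) L(1)] r by simp
      also have "\<dots> \<le> L * (1 + ?d n)" using K\<tau>(1) L0 by (intro mult_left_mono) auto
      also have "\<dots> < r"
      proof -
        have "0 < 1 + ?d n" using d by linarith
        thus ?thesis using L(2) by (simp only: pos_less_divide_eq)
      qed
      finally show False by simp
    qed
    ultimately show ?thesis using Y_simplex[OF l \<tau>(1)] up[OF \<tau>] by (intro exI[of _ "Y l \<tau>"]) blast
  qed
  have "\<exists>Z. ?R n Z" for n
  proof (cases "disp D = \<infinity>")
    case True
    \<comment> \<open>With infinite value at the boundary any metric on \<open>A\<close> will do,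
      because \<open>displacement_lower\<close> then makes the displacement of
      \<open>Y l \<tau>\<close> infinite as well.\<close>
    have l: "alen (\<lambda>i. len (X i))"
      unfolding alen_def
    proof (intro ballI conjI)
      fix i e assume i: "i \<in> idx S" and e: "e \<in> EA i"
      interpret c: ctree "grp S i" "X i" "A i" by (rule ct[OF i])
      show "0 < len (X i) e" using c.len_pos c.A_edge e by blast
      show "len (X i) (act (X i) h ` e) = len (X i) e" if "h \<in> Gc i" for h
        using c.len_act c.A_edge e that by blast
    qed
    show ?thesis by (rule core[OF l, of 1]) (use True in auto)
  next
    case False
    then obtain r where r: "disp D = ereal r"
      using displacement_nonneg[OF D_graph] by (cases "disp D") auto
    have "disp D < ereal (r + ?d n)" by (simp add: r)
    from hyp[OF this] obtain l F0 where *: "alen l"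
      "\<forall>i\<in>idx S. \<forall>v\<in>XV i. \<not> lt i (cp i v) \<longrightarrow> F0 i v \<in> XP (\<sigma> i)"
      "\<forall>i\<in>idx S. \<forall>h\<in>Gc i. \<forall>v\<in>XV i. \<not> lt i (cp i v) \<longrightarrow>
        F0 i (act (X i) h v) = tw X i h (F0 i v)"
      "\<forall>i\<in>idx S. \<forall>u w. {u, w} \<in> EA i \<longrightarrow> \<not> lt i (cp i u) \<longrightarrow>
        ch (EA (\<sigma> i)) (l (\<sigma> i)) (F0 i u) (F0 i w) ((r + ?d n) * l i {u, w})"
      by (elim exE conjE)
    \<comment> \<open>Half of the tolerance is spent on the map of the collapse; the other half is
      the gap that \<open>displacement_upper\<close> consumes.\<close>
    have less: "disp D < ereal (r + ?d n / 2)" by (simp add: r)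
    have half: "\<And>x :: real. 0 < x \<Longrightarrow> r + x / 2 < r + x" by simp
    have less2: "r + ?d n / 2 < r + ?d n" by (rule half) simp
    obtain \<tau>0 where \<tau>0: "0 < \<tau>0" "\<And>\<tau>. 0 < \<tau> \<Longrightarrow> \<tau> < \<tau>0 \<Longrightarrow> disp (Y l \<tau>) \<le> ereal (r + ?d n)"
      using displacement_upper[OF *(1) less less2, of F0] *(2-4) by blast
    show ?thesis by (rule core[OF *(1) \<tau>0(1)]) (use \<tau>0(2) r in auto)
  qed
  then obtain Q where Q: "\<And>n. ?R n (Q n)" by metis
  have d0: "?d \<longlonglongrightarrow> 0" using LIMSEQ_inverse_real_of_nat by (simp add: inverse_eq_divide add.commute)
  have "(\<lambda>n. len (Q n i) e) \<longlonglongrightarrow> (if e \<in> EA i then 0 else len (X i) e)"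
    if "i \<in> idx S" "e \<in> XE i" for i e
  proof -
    have "(\<lambda>n. len (Q n i) e - (if e \<in> EA i then 0 else len (X i) e)) \<longlonglongrightarrow> 0"
      by (rule Lim_null_comparison[OF _ d0]) (use Q that in \<open>auto intro!: always_eventually\<close>)
    thus ?thesis by (simp add: LIM_zero_iff)
  qed
  moreover have "(\<lambda>n. disp (Q n)) \<longlonglongrightarrow> disp D"
  proof (cases "disp D = \<infinity>")
    case True thus ?thesis using Q by simp
  next
    case False
    then obtain r where r: "disp D = ereal r"
      using displacement_nonneg[OF D_graph] by (cases "disp D") auto
    have "(\<lambda>n. r / (1 + ?d n)) \<longlonglongrightarrow> r / (1 + 0)" by (intro tendsto_intros d0) simp
    hence 1: "(\<lambda>n. ereal (r / (1 + ?d n))) \<longlonglongrightarrow> ereal r" by simp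
    have "(\<lambda>n. r + ?d n) \<longlonglongrightarrow> r + 0" by (intro tendsto_intros d0)
    hence 2: "(\<lambda>n. ereal (r + ?d n)) \<longlonglongrightarrow> ereal r" by simp
    show ?thesis unfolding r
      by (rule tendsto_sandwich[OF _ _ 1 2]) (use Q r in \<open>auto intro!: always_eventually\<close>)
  qed
  ultimately show ?thesis using Q by blast
qed

end

section \<open>Maps between components of \<open>A\<close> from a point of the simplex\<close>

context mtree
begin

lemma proj_push_points:
  assumes W: "convex_verts W" and p: "p \<in> PT"
  shows "push (proj W) p \<in> PT"
    "\<exists>u w t. u \<in> W \<and> w \<in> W \<and> (u = w \<or> {u, w} \<in> ET) \<and> 0 \<le> t \<and> t \<le> 1 \<and> push (proj W) p = ept u w t"
proof -
  show *: "\<exists>u w t. u \<in> W \<and> w \<in> W \<and> (u = w \<or> {u, w} \<in> ET) \<and> 0 \<le> t \<and> t \<le> 1 \<and> push (proj W) p = ept u w t"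
    using p
  proof (rule points_cases)
    fix u w t assume a: "u \<in> VT" "w \<in> VT" "u = w \<or> {u, w} \<in> ET"
      "0 \<le> t" "t \<le> 1" "p = ept u w t"
    have "proj W u = proj W w \<or> {proj W u, proj W w} \<in> ET"
      using a(3) proj_edge[OF W, of u w] proj_id[OF W] by auto
    thus ?thesis using proj(1)[OF W a(1)] proj(1)[OF W a(2)] a
      by (intro exI[of _ "proj W u"] exI[of _ "proj W w"] exI[of _ t]) simp
  qed
  then obtain u w t where "u \<in> W" "w \<in> W" "u = w \<or> {u, w} \<in> ET" "0 \<le> t" "t \<le> 1"
    "push (proj W) p = ept u w t" by blast
  moreover from this have "u \<in> VT" "w \<in> VT" using W by (auto simp: convex_verts_def)
  ultimately show "push (proj W) p \<in> PT" unfolding points_ept by blast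
qed

lemma proj_push_act:
  assumes W: "convex_verts W" and h: "h \<in> carrier G" and p: "p \<in> PT"
  shows "push (proj (act T h ` W)) (point_act T h p) = point_act T h (push (proj W) p)"
  using p
proof (rule points_cases)
  fix u w t assume a: "u \<in> VT" "w \<in> VT" "p = ept u w t"
  have "proj W u \<in> VT" "proj W w \<in> VT"
    using proj(1)[OF W a(1)] proj(1)[OF W a(2)] W by (auto simp: convex_verts_def)
  thus ?thesis using a by (simp add: point_act_ept[OF h] proj_act[OF W h])
qed

end

context collapse_system
begin

text \<open>The components of \<open>A\<close> are mapped into components of \<open>A\<close> by projecting an arbitrary map.\<close>

lemma chains_from_simplex:
  assumes Z: "Z \<in> open_simplex S X" and less: "disp Z < ereal L"
  shows "core_chains L"
proof -
  have Zi: "Z i = (X i)\<lparr>len := len (Z i)\<rparr>" "equivariant_length (grp S i) (Z i)" if "i \<in> idx S" for i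
    using Z that by (auto simp: open_simplex_def)
  have Z_tree: "mtree (grp S i) (Z i)" if i: "i \<in> idx S" for i
    using mtree_len[OF X_tree[OF i], of "len (Z i)"] Zi[OF i] by simp
  have Z_graph: "mgraph (grp S i) (Z i)" if "i \<in> idx S" for i using Z_tree[OF that] by (simp add: mtree_def)
  have Zs: "sverts (Z i) = XV i" "sedges (Z i) = XE i" "act (Z i) = act (X i)"
    "points (Z i) = XP i" "point_act (Z i) = point_act (X i)" if "i \<in> idx S" for i
    by (subst Zi(1)[OF that], simp)+
  obtain L' where L': "disp Z < ereal L'" "L' < L" using ereal_dense2[OF less] by auto
  obtain f where f:
    "\<And>i. i \<in> idx S \<Longrightarrow> 0 \<le> L'"
    "\<And>i p. i \<in> idx S \<Longrightarrow> p \<in> points (Z i) \<Longrightarrow> f i p \<in> points (Z (\<sigma> i))"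
    "\<And>i h p. i \<in> idx S \<Longrightarrow> h \<in> Gc i \<Longrightarrow> p \<in> points (Z i) \<Longrightarrow>
      f i (point_act (Z i) h p) = tw Z i h (f i p)"
    "\<And>i p q. i \<in> idx S \<Longrightarrow> p \<in> points (Z i) \<Longrightarrow> q \<in> points (Z i) \<Longrightarrow>
      tdist (Z (\<sigma> i)) (f i p) (f i q) \<le> L' * tdist (Z i) p q"
    using displacement_lessD[OF L'(1) Z_graph] by blast
  obtain y where y:
    "\<And>i v. i \<in> idx S \<Longrightarrow> v \<in> XV i \<Longrightarrow> y i v \<in> DP (\<sigma> i)"
    "\<And>i h v. i \<in> idx S \<Longrightarrow> h \<in> Gc i \<Longrightarrow> v \<in> XV i \<Longrightarrow>
      y i (act (X i) h v) = tw D i h (y i v)"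
    "\<And>i u w. i \<in> idx S \<Longrightarrow> {u, w} \<in> EA i \<Longrightarrow> y i u = y i w"
    using vertex_map by blast
  \<comment> \<open>The component of \<open>A\<close> assigned to the component of \<open>v\<close>.
    For a heavy component the value of \<open>y\<close> is fixed by a non-trivial element and is
    therefore a vertex of the collapse.\<close>
  define W where "W i v = (THE P. y i v = vpoint P)" for i v
  have W: "W i v \<in> DV (\<sigma> i)" "y i v = vpoint (W i v)" if i: "i \<in> idx S" and v: "v \<in> XV i" and nl: "\<not> lt i (cp i v)" for i v
  proof -
    interpret c: ctree "grp S i" "X i" "A i" by (rule ct[OF i])
    interpret D': mtree "grp S (\<sigma> i)" "D (\<sigma> i)" by (rule D_tree[OF perm[OF i]])
    obtain h where h: "h \<in> Gc i" "h \<noteq> \<one>\<^bsub>grp S i\<^esub>" "act (D i) h (cp i v) = cp i v"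
      using nl by (auto simp: c.light_def D_def')
    have hv: "cp i (act (X i) h v) = cp i v" using c.C_act[OF h(1) v] h(3) by (simp add: D_def')
    have "tw D i h (y i v) = y i v"
      using y(2)[OF i h(1) v] c.comp_const[of "y i", OF y(3)[OF i] hv] by simp
    then obtain x where x: "x \<in> DV (\<sigma> i)" "y i v = vpoint x"
      using D'.fixed_point_vertex[OF maps_in[OF i h(1)] maps_neq_one[OF i h(1,2)] y(1)[OF i v]] by blast
    hence "W i v = x" unfolding W_def by (intro the_equality) auto
    thus "W i v \<in> DV (\<sigma> i)" "y i v = vpoint (W i v)" using x by auto
  qed
  have W_act: "W i (act (X i) h v) = act (X (\<sigma> i)) (\<theta> i h) ` W i v"
    if i: "i \<in> idx S" and v: "v \<in> XV i" and nl: "\<not> lt i (cp i v)" and h: "h \<in> Gc i" for i v h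
  proof -
    interpret c: ctree "grp S i" "X i" "A i" by (rule ct[OF i])
    interpret c': ctree "grp S (\<sigma> i)" "X (\<sigma> i)" "A (\<sigma> i)" by (rule ct[OF perm[OF i]])
    note Wv = W[OF i v nl]
    obtain x where x: "x \<in> XV (\<sigma> i)" "W i v = cp (\<sigma> i) x" using Wv(1) by (auto simp: D_def' c'.C_verts)
    have "y i (act (X i) h v) = vpoint (act (D (\<sigma> i)) (\<theta> i h) (W i v))"
      using y(2)[OF i h v] mgraph.point_act_vpoint[OF D_graph[OF perm[OF i]] maps_in[OF i h] Wv(1)] Wv(2) by simp
    also have "act (D (\<sigma> i)) (\<theta> i h) (W i v) = act (X (\<sigma> i)) (\<theta> i h) ` W i v"
      unfolding x(2) using c'.C_act[OF maps_in[OF i h] x(1)] c'.comp_act[OF maps_in[OF i h] x(1)] by (simp add: D_def')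
    finally show ?thesis unfolding W_def by (intro the_equality) auto
  qed
  have W_conv: "mtree.convex_verts (X (\<sigma> i)) (W i v)" "{e \<in> XE (\<sigma> i). e \<subseteq> W i v} \<subseteq> EA (\<sigma> i)"
    if i: "i \<in> idx S" and v: "v \<in> XV i" and nl: "\<not> lt i (cp i v)" for i v
  proof -
    interpret c': ctree "grp S (\<sigma> i)" "X (\<sigma> i)" "A (\<sigma> i)" by (rule ct[OF perm[OF i]])
    obtain x where x: "x \<in> XV (\<sigma> i)" "W i v = cp (\<sigma> i) x" using W(1)[OF i v nl] by (auto simp: D_def' c'.C_verts)
    show "mtree.convex_verts (X (\<sigma> i)) (W i v)" "{e \<in> XE (\<sigma> i). e \<subseteq> W i v} \<subseteq> EA (\<sigma> i)"
      unfolding x(2) using c'.convex_comp[OF x(1)] by auto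
  qed
  define l where "l i = len (Z i)" for i
  \<comment> \<open>Projection to the assigned component forces the image into \<open>A\<close>
    without stretching, and commutes with the group because the assignment does.\<close>
  define F where "F i v = push (mtree.proj (X (\<sigma> i)) (W i v)) (f i (vpoint v))" for i v
  have fv: "f i (vpoint v) \<in> XP (\<sigma> i)" if "i \<in> idx S" "v \<in> XV i" for i v
    using f(2)[OF that(1)] mgraph.vpoint_points[OF X_graph[OF that(1)] that(2)] Zs[OF that(1)] Zs[OF perm[OF that(1)]] by simp
  have "alen l"
    unfolding alen_def
  proof (intro ballI conjI)
    fix i e assume i: "i \<in> idx S" and e: "e \<in> EA i"
    interpret c: ctree "grp S i" "X i" "A i" by (rule ct[OF i])
    have "e \<in> XE i" using c.A_edge e by blast
    thus "0 < l i e" using Zi(2)[OF i] Zs[OF i] by (simp add: equivariant_length_def l_def)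
    show "l i (act (X i) h ` e) = l i e" if "h \<in> Gc i" for h
      using Zi(2)[OF i] Zs[OF i] that \<open>e \<in> XE i\<close> by (simp add: equivariant_length_def l_def)
  qed
  moreover have "F i v \<in> XP (\<sigma> i)" if i: "i \<in> idx S" and v: "v \<in> XV i" "\<not> lt i (cp i v)" for i v
    unfolding F_def using mtree.proj_push_points(1)[OF X_tree[OF perm[OF i]] W_conv(1)[OF i v] fv[OF i v(1)]] .
  moreover have "F i (act (X i) h v) = tw X i h (F i v)"
    if i: "i \<in> idx S" and h: "h \<in> Gc i" and v: "v \<in> XV i" "\<not> lt i (cp i v)" for i h v
  proof -
    have vp: "vpoint v \<in> XP i" using mgraph.vpoint_points[OF X_graph[OF i] v(1)] .
    have "f i (vpoint (act (X i) h v)) = tw X i h (f i (vpoint v))"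
      using f(3)[OF i h, of "vpoint v"] vp Zs[OF i] Zs[OF perm[OF i]]
        mgraph.point_act_vpoint[OF X_graph[OF i] h v(1)] by simp
    thus ?thesis
      unfolding F_def W_act[OF i v h]
      using mtree.proj_push_act[OF X_tree[OF perm[OF i]] W_conv(1)[OF i v] maps_in[OF i h] fv[OF i v(1)]] by simp
  qed
  moreover have "ch (EA (\<sigma> i)) (l (\<sigma> i)) (F i u) (F i w) (L * l i {u, w})"
    if i: "i \<in> idx S" and e: "{u, w} \<in> EA i" and nl: "\<not> lt i (cp i u)" for i u w
  proof -
    interpret c: ctree "grp S i" "X i" "A i" by (rule ct[OF i])
    interpret X': mtree "grp S (\<sigma> i)" "X (\<sigma> i)" by (rule X_tree[OF perm[OF i]])
    interpret Z: mtree "grp S i" "Z i" by (rule Z_tree[OF i])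
    interpret Z': mtree "grp S (\<sigma> i)" "Z (\<sigma> i)" by (rule Z_tree[OF perm[OF i]])
    have eX: "{u, w} \<in> XE i" using c.A_edge e by blast
    hence uw: "u \<in> XV i" "w \<in> XV i" using c.edge_ends by auto
    have Wuw: "W i u = W i w" using y(3)[OF i e] by (simp add: W_def)
    have vp: "vpoint u \<in> points (Z i)" "vpoint w \<in> points (Z i)" using Z.vpoint_points uw Zs[OF i] by auto
    have eZ: "{u, w} \<in> sedges (Z i)" using eX Zs[OF i] by simp
    have lpos: "0 < len (Z i) {u, w}" using Z.len_pos[OF eZ] .
    have "tdist (Z (\<sigma> i)) (f i (vpoint u)) (f i (vpoint w)) \<le> L' * tdist (Z i) (vpoint u) (vpoint w)"
      using f(4)[OF i vp] .
    also have "\<dots> \<le> L' * len (Z i) {u, w}" using Z.tdist_edge_ends[OF eZ] f(1)[OF i] by (rule mult_left_mono)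
    also have "\<dots> < L * len (Z i) {u, w}" using L'(2) lpos by simp
    finally have "ch (sedges (Z (\<sigma> i))) (len (Z (\<sigma> i))) (f i (vpoint u)) (f i (vpoint w)) (L * len (Z i) {u, w})"
      using Z'.tdist_lessD f(2)[OF i vp(1)] f(2)[OF i vp(2)] by blast
    hence "ch {e \<in> XE (\<sigma> i). e \<subseteq> W i u} (len (Z (\<sigma> i)))
        (push (X'.proj (W i u)) (f i (vpoint u))) (push (X'.proj (W i u)) (f i (vpoint w))) (L * len (Z i) {u, w})"
      using X'.ch_proj[OF W_conv(1)[OF i uw(1) nl]] Z'.len_nonneg Zs[OF perm[OF i]] by simp
    hence "ch (EA (\<sigma> i)) (len (Z (\<sigma> i)))
        (push (X'.proj (W i u)) (f i (vpoint u))) (push (X'.proj (W i u)) (f i (vpoint w))) (1 * (L * len (Z i) {u, w}))"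
      by (rule ch_mono_len) (use W_conv(2)[OF i uw(1) nl] in auto)
    thus ?thesis by (simp add: F_def l_def Wuw)
  qed
  ultimately show ?thesis by (intro exI[of _ l] exI[of _ F]) blast
qed

end

section \<open>Core subgraphs\<close>

lemma subgraph_act_vert: "subgraph_of G T B \<Longrightarrow> h \<in> carrier G \<Longrightarrow> v \<in> sverts B \<Longrightarrow> act T h v \<in> sverts B"
  unfolding subgraph_of_def by blast

context sgtree
begin

abbreviation Cr :: "'v sgraph" where "Cr \<equiv> core G T A"

lemma core_upper:
  assumes "core_graph G T B" "sverts B \<subseteq> sverts A" "sedges B \<subseteq> sedges A"
  shows "sverts B \<subseteq> sverts Cr" "sedges B \<subseteq> sedges Cr"
  using assms unfolding core_def Let_def by auto

lemma core_vertE: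
  assumes "v \<in> sverts Cr"
  obtains B where "core_graph G T B" "sverts B \<subseteq> sverts A" "sedges B \<subseteq> sedges A" "v \<in> sverts B"
  using assms unfolding core_def Let_def by auto

lemma core_sub_A: "sverts Cr \<subseteq> sverts A" "sedges Cr \<subseteq> sedges A"
  unfolding core_def Let_def by auto

lemma core_subgraph: "subgraph_of G T Cr"
proof -
  have B: "subgraph_of G T B" if "core_graph G T B" for B using that by (simp add: core_graph_def)
  have s: "sverts Cr \<subseteq> VT" "sedges Cr \<subseteq> ET" using core_sub_A A_edge A_vert by auto
  have "e \<subseteq> sverts Cr" if "e \<in> sedges Cr" for e
    using that B unfolding core_def Let_def by (fastforce simp: subgraph_of_def)
  moreover have "act T h ` sverts Cr \<subseteq> sverts Cr" if "h \<in> carrier G" for h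
    using that B unfolding core_def Let_def by (fastforce simp: subgraph_of_def)
  moreover have "act T h ` e \<in> sedges Cr" if "h \<in> carrier G" "e \<in> sedges Cr" for h e
    using that B unfolding core_def Let_def by (fastforce simp: subgraph_of_def)
  ultimately show ?thesis using s by (simp add: subgraph_of_def)
qed

text \<open>Additional edges cannot spoil an old vertex: its component still has the old stabiliser
  elements, and its valence does not drop. If a vertex becomes a leaf after being isolated, its
  component was the vertex alone, so its own stabiliser is non-trivial.\<close>

lemma core_graph_extend:
  assumes B: "core_graph G T B" and v: "v \<in> sverts B" and E: "sedges B \<subseteq> sedges B'" and B': "subgraph_of G T B'"
  shows "valence B' v = 1 \<Longrightarrow> \<not> free_vertex G T v" "set_stab G T (component B' v) \<noteq> {\<one>}"
proof -
  have sB: "subgraph_of G T B" using B by (simp add: core_graph_def)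
  interpret B: sgtree G T B using sB by unfold_locales
  interpret B': sgtree G T B' using B' by unfold_locales
  have vT: "v \<in> VT" using B.A_vert v by simp
  have st: "set_stab G T (component B v) \<noteq> {\<one>}" using B v by (simp add: core_graph_def)
  have one: "\<one> \<in> set_stab G T (component B v)"
  proof -
    have "act T \<one> ` component B v = component B v"
      using B.comp_act[OF one_in vT] act_one[OF vT] by simp
    thus ?thesis by (simp add: set_stab_def)
  qed
  then obtain h where h: "h \<in> carrier G" "h \<noteq> \<one>" "act T h ` component B v = component B v"
    using st by (auto simp: set_stab_def)
  hence "component B (act T h v) = component B v" using B.comp_act vT by simp
  hence "joined (sedges B) v (act T h v)" by (metis component_eq_iff)
  hence "component B' (act T h v) = component B' v" using adj_mono[OF _ E] component_eqI by metis
  hence "act T h ` component B' v = component B' v" using B'.comp_act h vT by simp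
  thus "set_stab G T (component B' v) \<noteq> {\<one>}" using h by (auto simp: set_stab_def)
  assume val: "valence B' v = 1"
  have sub: "{e \<in> sedges B. v \<in> e} \<subseteq> {e \<in> sedges B'. v \<in> e}" using E by auto
  have fin: "finite {e \<in> sedges B'. v \<in> e}" using val unfolding valence_def by (metis card.infinite zero_neq_one)
  have "valence B v \<le> 1" using card_mono[OF fin sub] val by (simp add: valence_def)
  then consider "valence B v = 1" | "valence B v = 0" by linarith
  thus "\<not> free_vertex G T v"
  proof cases
    case 1 thus ?thesis using B v by (simp add: core_graph_def)
  next
    case 2
    hence "{e \<in> sedges B. v \<in> e} = {}" using finite_subset[OF sub fin] by (simp add: valence_def)
    hence ne: "\<And>w. {v, w} \<notin> sedges B" by auto
    have "component B v = {v}"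
    proof (intro subset_antisym subsetI)
      fix w assume "w \<in> component B v"
      hence "joined (sedges B) v w" by simp
      thus "w \<in> {v}" by (cases rule: converse_rtranclE) (use ne in auto)
    qed simp
    hence "act T h v = v" using h by auto
    thus ?thesis using h by (auto simp: free_vertex_def stabilizer_def)
  qed
qed

text \<open>The core with all translates of the walk adjoined is again a core graph, so by
  maximality it adds nothing. \<open>val\<close> excludes free leaves among the new vertices, and
  \<open>heavy\<close> excludes components with trivial stabiliser.\<close>

lemma core_absorb:
  assumes xA: "\<And>i. i \<le> n \<Longrightarrow> x i \<in> sverts A" "\<And>i. i < n \<Longrightarrow> {x i, x (Suc i)} \<in> sedges A"
    and E1: "E1 = {act T h ` {x i, x (Suc i)} | h i. h \<in> carrier G \<and> i < n}"
    and val: "\<And>i. i \<le> n \<Longrightarrow> x i \<in> sverts Cr \<or> \<not> free_vertex G T (x i) \<or>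
      (\<exists>e e'. e \<in> E1 \<and> e' \<in> E1 \<and> e \<noteq> e' \<and> x i \<in> e \<and> x i \<in> e')"
    and heavy: "\<And>i. i \<le> n \<Longrightarrow> x i \<in> sverts Cr \<or>
      (\<exists>h\<in>carrier G. h \<noteq> \<one> \<and> joined (sedges Cr \<union> E1) (x i) (act T h (x i))) \<or>
      (\<exists>w\<in>sverts Cr. joined (sedges Cr \<union> E1) (x i) w)"
  shows "\<And>i. i \<le> n \<Longrightarrow> x i \<in> sverts Cr" "\<And>i. i < n \<Longrightarrow> {x i, x (Suc i)} \<in> sedges Cr"
proof -
  define B where "B = \<lparr>sverts = sverts Cr \<union> {act T h (x i) | h i. h \<in> carrier G \<and> i \<le> n}, sedges = sedges Cr \<union> E1\<rparr>"
  have xT: "x i \<in> VT" if "i \<le> n" for i using xA(1)[OF that] A_vert by blast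
  have Bv: "sverts B = sverts Cr \<union> {act T h (x i) | h i. h \<in> carrier G \<and> i \<le> n}" and Be: "sedges B = sedges Cr \<union> E1"
    by (simp_all add: B_def)
  have Avact: "act T h v \<in> sverts A" if "h \<in> carrier G" "v \<in> sverts A" for h v
    using subgraph_act_vert[OF sub that] .
  have E1A: "e \<in> sedges A" if e: "e \<in> E1" for e
  proof -
    obtain h i where "h \<in> carrier G" "i < n" "e = act T h ` {x i, x (Suc i)}" using e E1 by blast
    thus ?thesis using A_act xA(2) by blast
  qed
  have BA: "sverts B \<subseteq> sverts A" "sedges B \<subseteq> sedges A"
    using core_sub_A Avact xA(1) E1A unfolding Bv Be by auto
  have E1e: "e \<subseteq> {act T h (x i) | h i. h \<in> carrier G \<and> i \<le> n}" if e: "e \<in> E1" for e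
  proof -
    obtain h i where h: "h \<in> carrier G" "i < n" "e = act T h ` {x i, x (Suc i)}" using e E1 by blast
    hence "i \<le> n" "Suc i \<le> n" by auto
    with h show ?thesis by blast
  qed
  have E1act: "act T g ` e \<in> E1" if g: "g \<in> carrier G" and e: "e \<in> E1" for g e
  proof -
    obtain h i where h: "h \<in> carrier G" "i < n" "e = act T h ` {x i, x (Suc i)}" using e E1 by blast
    have "act T g ` e = act T (g \<otimes> h) ` {x i, x (Suc i)}"
      using act_mult[OF g h(1)] xT[of i] xT[of "Suc i"] h by simp
    thus ?thesis unfolding E1 using g h by (intro CollectI exI[of _ "g \<otimes> h"] exI[of _ i]) simp
  qed
  have sB: "subgraph_of G T B"
    unfolding subgraph_of_def
  proof (intro conjI ballI)
    show "sverts B \<subseteq> VT" "sedges B \<subseteq> ET" using BA A_vert A_edge by auto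
    show "e \<subseteq> sverts B" if "e \<in> sedges B" for e
      using that E1e[of e] core_subgraph unfolding Bv Be by (auto simp: subgraph_of_def)
    fix g assume g: "g \<in> carrier G"
    show "act T g ` sverts B \<subseteq> sverts B"
    proof
      fix v assume "v \<in> act T g ` sverts B"
      then consider w where "w \<in> sverts Cr" "v = act T g w" | h i where "h \<in> carrier G" "i \<le> n" "v = act T g (act T h (x i))"
        unfolding Bv by blast
      thus "v \<in> sverts B"
      proof cases
        case 1 thus ?thesis using subgraph_act_vert[OF core_subgraph g] unfolding Bv by blast
      next
        case 2
        hence "v = act T (g \<otimes> h) (x i)" using act_mult[OF g _ xT] by simp
        thus ?thesis using g 2 mult_in unfolding Bv by blast
      qed
    qed
    show "act T g ` e \<in> sedges B" if "e \<in> sedges B" for e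
      using that E1act[OF g] core_subgraph g unfolding Be by (auto simp: subgraph_of_def)
  qed
  interpret B: sgtree G T B using sB by unfold_locales
  have old: "(valence B v = 1 \<longrightarrow> \<not> free_vertex G T v) \<and> set_stab G T (component B v) \<noteq> {\<one>}" if v: "v \<in> sverts Cr" for v
  proof -
    obtain B0 where B0: "core_graph G T B0" "sverts B0 \<subseteq> sverts A" "sedges B0 \<subseteq> sedges A" "v \<in> sverts B0"
      using core_vertE[OF v] .
    have "sedges B0 \<subseteq> sedges B" using core_upper(2)[OF B0(1-3)] Be by auto
    from core_graph_extend[OF B0(1,4) this sB] show ?thesis by blast
  qed
  have crit: "\<not> free_vertex G T v" if that: "valence B v = 1" "v = act T g (x i)" "g \<in> carrier G" "i \<le> n" "x i \<notin> sverts Cr" for v g i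
  proof -
    note that' = that
    consider "\<not> free_vertex G T (x i)" | e e' where "e \<in> E1" "e' \<in> E1" "e \<noteq> e'" "x i \<in> e" "x i \<in> e'"
      using val[OF that'(4)] that'(5) by blast
    thus ?thesis
    proof cases
      case 1
      then obtain h where h: "h \<in> carrier G" "act T h (x i) = x i" "h \<noteq> \<one>"
        using act_one[OF xT[OF that'(4)]] by (auto simp: free_vertex_def stabilizer_def)
      interpret group G by (rule grp)
      let ?k = "g \<otimes> h \<otimes> inv g"
      have k: "?k \<in> carrier G" using h that' by simp
      have "act T ?k v = act T (g \<otimes> h) (act T (inv g) v)"
        using act_mult[of "g \<otimes> h" "inv g" v] h that' act_closed xT by simp
      also have "act T (inv g) v = x i" using act_inv_act that' xT by simp
      also have "act T (g \<otimes> h) (x i) = v" using act_mult[of g h "x i"] h that' xT by simp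
      finally have "act T ?k v = v" .
      moreover have "?k \<noteq> \<one>" using conj_neq_one[OF that'(3) h(1,3)] .
      ultimately show ?thesis using k by (auto simp: free_vertex_def stabilizer_def)
    next
      case 2
      have "act T g ` e \<noteq> act T g ` e'"
      proof
        assume eq: "act T g ` e = act T g ` e'"
        have "e \<subseteq> VT" "e' \<subseteq> VT" using 2 E1e act_closed xT by blast+
        hence "e = e'" using eq act_inj_on[OF that'(3)] by (meson inj_on_image_eq_iff)
        thus False using 2 by simp
      qed
      moreover have "act T g ` e \<in> {e \<in> sedges B. v \<in> e}" "act T g ` e' \<in> {e \<in> sedges B. v \<in> e}"
        using 2 E1act[OF that'(3)] that'(2) unfolding Be by auto
      moreover obtain d where "{e \<in> sedges B. v \<in> e} = {d}" using that'(1) unfolding valence_def by (auto simp: card_1_singleton_iff)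
      ultimately show ?thesis by auto
    qed
  qed
  have stab: "set_stab G T (component B (x i)) \<noteq> {\<one>}" if i: "i \<le> n" for i
  proof -
    consider "x i \<in> sverts Cr" | h where "h \<in> carrier G" "h \<noteq> \<one>" "joined (sedges B) (x i) (act T h (x i))"
      | w where "w \<in> sverts Cr" "joined (sedges B) (x i) w"
      using heavy[OF i] unfolding Be by blast
    thus ?thesis
    proof cases
      case 1 thus ?thesis using old by blast
    next
      case 2
      have "act T h ` component B (x i) = component B (act T h (x i))" using B.comp_act[OF 2(1) xT[OF i]] .
      also have "\<dots> = component B (x i)" using component_eqI[OF 2(3)] by simp
      finally show ?thesis using 2 by (auto simp: set_stab_def)
    next
      case 3
      thus ?thesis using old[OF 3(1)] component_eqI[OF 3(2)] by simp
    qed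
  qed
  have stab': "set_stab G T (component B (act T g (x i))) \<noteq> {\<one>}" if g: "g \<in> carrier G" and i: "i \<le> n" for g i
  proof -
    interpret group G by (rule grp)
    have o: "\<one> \<in> set_stab G T (component B (x i))"
      using B.comp_act[OF one_in xT[OF i]] act_one[OF xT[OF i]] by (simp add: set_stab_def)
    then obtain h where h: "h \<in> carrier G" "h \<noteq> \<one>" "act T h ` component B (x i) = component B (x i)"
      using stab[OF i] by (auto simp: set_stab_def)
    have hx: "component B (act T h (x i)) = component B (x i)" using B.comp_act[OF h(1) xT[OF i]] h(3) by simp
    let ?k = "g \<otimes> h \<otimes> inv g"
    have k: "?k \<in> carrier G" using h g by simp
    have gx: "act T g (x i) \<in> VT" using act_closed[OF g xT[OF i]] .
    have "act T ?k (act T g (x i)) = act T (g \<otimes> h) (act T (inv g) (act T g (x i)))"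
      using act_mult[of "g \<otimes> h" "inv g" "act T g (x i)"] h g gx by simp
    also have "\<dots> = act T g (act T h (x i))" using act_inv_act[OF g xT[OF i]] act_mult[OF g h(1) xT[OF i]] by simp
    finally have "act T ?k ` component B (act T g (x i)) = component B (act T g (act T h (x i)))"
      using B.comp_act[OF k gx] by simp
    also have "\<dots> = act T g ` component B (act T h (x i))" using B.comp_act[OF g act_closed[OF h(1) xT[OF i]]] by simp
    also have "\<dots> = component B (act T g (x i))" using hx B.comp_act[OF g xT[OF i]] by simp
    finally have "?k \<in> set_stab G T (component B (act T g (x i)))" using k by (simp add: set_stab_def)
    moreover have "?k \<noteq> \<one>" using conj_neq_one[OF g h(1,2)] .
    ultimately show ?thesis by auto
  qed
  have "core_graph G T B"
    unfolding core_graph_def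
  proof (intro conjI ballI impI sB)
    fix v assume "v \<in> sverts B"
    then consider "v \<in> sverts Cr" | g i where "v = act T g (x i)" "g \<in> carrier G" "i \<le> n" "v \<notin> sverts Cr"
      unfolding Bv by blast
    note cs = this
    show "\<not> free_vertex G T v" if val1: "valence B v = 1"
      using cs
    proof cases
      case 1 thus ?thesis using old val1 by blast
    next
      case 2
      have "x i \<notin> sverts Cr" using subgraph_act_vert[OF core_subgraph 2(2)] 2(1,4) by blast
      thus ?thesis using crit[OF val1 2(1-3)] by blast
    qed
    show "set_stab G T (component B v) \<noteq> {\<one>}" using cs
    proof cases
      case 1 thus ?thesis using old by blast
    next
      case 2 thus ?thesis using stab' by blast
    qed
  qed
  from core_upper[OF this BA] have up: "sverts B \<subseteq> sverts Cr" "sedges B \<subseteq> sedges Cr" .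
  show "x i \<in> sverts Cr" if "i \<le> n" for i
  proof -
    have "act T \<one> (x i) \<in> sverts B" unfolding Bv using that one_in by blast
    thus ?thesis using up act_one[OF xT[OF that]] by auto
  qed
  show "{x i, x (Suc i)} \<in> sedges Cr" if "i < n" for i
  proof -
    have "act T \<one> ` {x i, x (Suc i)} \<in> E1" unfolding E1 using that one_in by blast
    moreover have "act T \<one> ` {x i, x (Suc i)} = {x i, x (Suc i)}"
      using act_one xT[of i] xT[of "Suc i"] that by simp
    ultimately show ?thesis using up unfolding Be by auto
  qed
qed

text \<open>On a simple path in \<open>A\<close> between two vertices of the core every inner vertex
  lies on two different edges of the path, so \<open>core_absorb\<close> takes the path into the
  core.\<close>

lemma core_connected:
  assumes "u \<in> sverts Cr" "w \<in> sverts Cr" "joined (sedges A) u w"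
  shows "joined (sedges Cr) u w"
proof -
  obtain x n where x: "x 0 = u" "x n = w" "inj_on x {..n}" "\<And>i. i < n \<Longrightarrow> {x i, x (Suc i)} \<in> sedges A"
    using rtrancl_walk[OF assms(3)] by metis
  define E1 where "E1 = {act T h ` {x i, x (Suc i)} | h i. h \<in> carrier G \<and> i < n}"
  have Av: "a \<in> sverts A \<and> b \<in> sverts A" if "{a, b} \<in> sedges A" for a b using sub that by (auto simp: subgraph_of_def)
  have xA: "x i \<in> sverts A" if "i \<le> n" for i
  proof (cases "i = 0")
    case True thus ?thesis using x assms core_sub_A by auto
  next
    case False
    hence "{x (i - 1), x i} \<in> sedges A" using x(4)[of "i - 1"] that by simp
    thus ?thesis using Av by blast
  qed
  have eE: "{x i, x (Suc i)} \<in> E1" if "i < n" for i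
  proof -
    have "act T \<one> ` {x i, x (Suc i)} = {x i, x (Suc i)}"
      using act_one xA[of i] xA[of "Suc i"] A_vert that by simp
    thus ?thesis unfolding E1_def using that one_in by blast
  qed
  have "{x i, x (Suc i)} \<in> sedges Cr" if "i < n" for i
  proof (rule core_absorb(2)[OF xA x(4) E1_def _ _ that])
    fix j assume j: "j \<le> n"
    show "x j \<in> sverts Cr \<or> \<not> free_vertex G T (x j) \<or> (\<exists>e e'. e \<in> E1 \<and> e' \<in> E1 \<and> e \<noteq> e' \<and> x j \<in> e \<and> x j \<in> e')"
    proof (cases "j = 0 \<or> j = n")
      case True thus ?thesis using x assms by auto
    next
      case False
      hence "{x (j - 1), x j} \<in> E1" "{x j, x (Suc j)} \<in> E1" using eE[of "j - 1"] eE[of j] j by auto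
      moreover have "x (j - 1) \<noteq> x (Suc j)" "x (j - 1) \<noteq> x j" using x(3) False j by (auto simp: inj_on_eq_iff)
      hence "{x (j - 1), x j} \<noteq> {x j, x (Suc j)}" by (auto simp: doubleton_eq_iff)
      ultimately show ?thesis by blast
    qed
    have "joined (sedges Cr \<union> E1) (x 0) (x j)" by (rule walk_rtrancl) (use eE j in auto)
    hence "joined (sedges Cr \<union> E1) (x j) u" using adj_sym x(1) by metis
    thus "x j \<in> sverts Cr \<or> (\<exists>h\<in>carrier G. h \<noteq> \<one> \<and> joined (sedges Cr \<union> E1) (x j) (act T h (x j))) \<or>
      (\<exists>w\<in>sverts Cr. joined (sedges Cr \<union> E1) (x j) w)" using assms(1) by blast
  qed auto
  hence "joined (sedges Cr) (x 0) (x n)" by (intro walk_rtrancl) auto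
  thus ?thesis using x by simp
qed

text \<open>Take a vertex of the component that \<open>g\<close> moves as little as possible. If it
  is fixed, it is not free. Otherwise the translates of the path to its image form the axis of
  \<open>g\<close>, which has no leaves. In both cases \<open>core_absorb\<close> applies.\<close>

lemma core_exists:
  assumes v: "v \<in> sverts A" and g: "g \<in> carrier G" "g \<noteq> \<one>" "joined (sedges A) v (act T g v)"
  shows "\<exists>w\<in>sverts Cr. joined (sedges A) v w"
proof -
  have Av: "a \<in> sverts A \<and> b \<in> sverts A" if "{a, b} \<in> sedges A" for a b using sub that by (auto simp: subgraph_of_def)
  define Q where "Q n \<longleftrightarrow> (\<exists>u. joined (sedges A) v u \<and> (u, act T g u) \<in> adj (sedges A) ^^ n)" for n
  have "\<exists>n. Q n" unfolding Q_def using g(3) rtrancl_imp_relpow by blast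
  define n where "n = (LEAST n. Q n)"
  have n: "Q n" "\<And>m. m < n \<Longrightarrow> \<not> Q m" using LeastI_ex[OF \<open>\<exists>n. Q n\<close>] not_less_Least by (auto simp: n_def)
  obtain u where u: "joined (sedges A) v u" "(u, act T g u) \<in> adj (sedges A) ^^ n" using n(1) by (auto simp: Q_def)
  obtain x where x: "x 0 = u" "x n = act T g u" "\<And>i. i < n \<Longrightarrow> {x i, x (Suc i)} \<in> sedges A"
    using u(2) by (auto simp: relpow_fun_conv)
  have uA: "u \<in> sverts A" using adj_vertex_transfer[OF u(1) v] Av by blast
  have xA: "x i \<in> sverts A" if "i \<le> n" for i
  proof (cases "i = 0")
    case True thus ?thesis using x uA by simp
  next
    case False
    hence "{x (i - 1), x i} \<in> sedges A" using x(3)[of "i - 1"] that by simp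
    thus ?thesis using Av by blast
  qed
  have xT: "x i \<in> VT" if "i \<le> n" for i using xA[OF that] A_vert by blast
  define E1 where "E1 = {act T h ` {x i, x (Suc i)} | h i. h \<in> carrier G \<and> i < n}"
  have eE: "{x i, x (Suc i)} \<in> E1" if "i < n" for i
  proof -
    have "act T \<one> ` {x i, x (Suc i)} = {x i, x (Suc i)}" using act_one xT[of i] xT[of "Suc i"] that by simp
    thus ?thesis unfolding E1_def using that one_in by blast
  qed
  have eEg: "act T h ` {x i, x (Suc i)} \<in> E1" if "i < n" "h \<in> carrier G" for i h
    unfolding E1_def using that by blast
  have rel: "(x a, x b) \<in> adj (sedges A) ^^ (b - a)" if "a \<le> b" "b \<le> n" for a b
    unfolding relpow_fun_conv using that x(3) by (intro exI[of _ "\<lambda>i. x (a + i)"]) auto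
  \<comment> \<open>Cutting out a backtrack would give a shorter connection from \<open>u\<close> to
    its image.\<close>
  have nob: "x i \<noteq> x (i + 2)" if "i + 2 \<le> n" for i
  proof
    assume eq: "x i = x (i + 2)"
    have "(x 0, x i) \<in> adj (sedges A) ^^ i" "(x (i + 2), x n) \<in> adj (sedges A) ^^ (n - (i + 2))"
      using rel[of 0 i] rel[of "i + 2" n] that by auto
    hence "(u, act T g u) \<in> adj (sedges A) ^^ (i + (n - (i + 2)))" using eq x relpow_add[of i _ "adj (sedges A)"] by auto
    hence "Q (i + (n - (i + 2)))" using u(1) by (auto simp: Q_def)
    thus False using n(2)[of "i + (n - (i + 2))"] that by simp
  qed
  \<comment> \<open>At the start of the path the second edge of the axis is the last edge moved back
    by the inverse of \<open>g\<close>.\<close>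
  have ends: "\<exists>e e'. e \<in> E1 \<and> e' \<in> E1 \<and> e \<noteq> e' \<and> x 0 \<in> e \<and> x 0 \<in> e'" if n0: "0 < n"
  proof (intro exI conjI)
    let ?g' = "inv g"
    let ?e = "{x 0, x (Suc 0)}" and ?e' = "act T ?g' ` {x (n - 1), x (Suc (n - 1))}"
    show "?e \<in> E1" by (rule eE[OF n0])
    show "?e' \<in> E1" by (rule eEg) (use n0 g in auto)
    have gx: "act T ?g' (x n) = x 0" using act_inv_act[OF g(1), of u] x(1,2) xT[of 0] by simp
    show "x 0 \<in> ?e" "x 0 \<in> ?e'" using gx n0 by auto
    show "?e \<noteq> ?e'"
    proof
      assume eq: "?e = ?e'"
      have ne: "x 0 \<noteq> x 1" using edge_neq' A_edge x(3)[OF n0] by auto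
      have "?e' = {act T ?g' (x (n - 1)), x 0}" using gx n0 by simp
      hence "x 1 \<in> {act T ?g' (x (n - 1)), x 0}" using eq by auto
      hence "x 1 = act T ?g' (x (n - 1))" using ne by simp
      hence gx1: "act T g (x 1) = x (n - 1)" using act_act_inv[OF g(1) xT[of "n - 1"]] by simp
      show False
      \<comment> \<open>If the two edges agree, \<open>g\<close> sends \<open>x 1\<close> to
        \<open>x (n - 1)\<close>. For \<open>n = 1\<close> it flips an edge; otherwise it moves
        \<open>x 1\<close> by only \<open>n - 2\<close>.\<close>
      proof (cases "n = 1")
        case True
        hence "act T g ` {x 0, x 1} = {x 0, x 1}" using gx1 x by (auto simp: insert_commute)
        moreover have "{x 0, x 1} \<in> ET" using A_edge x(3)[OF n0] by simp
        ultimately show False using edge_free[OF g(1)] g(2) by blast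
      next
        case False
        hence "(x 1, act T g (x 1)) \<in> adj (sedges A) ^^ (n - 1 - 1)" using rel[of 1 "n - 1"] gx1 n0 by simp
        moreover have "joined (sedges A) v (x 1)"
          using u(1) x(1) x(3)[OF n0] by (auto intro: rtrancl_into_rtrancl)
        ultimately have "Q (n - 1 - 1)" by (auto simp: Q_def)
        thus False using n(2)[of "n - 1 - 1"] n0 by simp
      qed
    qed
  qed
  have walk0: "joined (sedges Cr \<union> E1) (x 0) (x j)" if "j \<le> n" for j by (rule walk_rtrancl) (use eE that in auto)
  have "x 0 \<in> sverts Cr"
  proof (rule core_absorb(1)[OF xA x(3) E1_def])
    fix i assume i: "i \<le> n"
    show "x i \<in> sverts Cr \<or> \<not> free_vertex G T (x i) \<or> (\<exists>e e'. e \<in> E1 \<and> e' \<in> E1 \<and> e \<noteq> e' \<and> x i \<in> e \<and> x i \<in> e')"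
    proof (cases "n = 0")
      case True
      hence "act T g (x i) = x i" using x i by simp
      hence "\<not> free_vertex G T (x i)" using g by (auto simp: free_vertex_def stabilizer_def)
      thus ?thesis by blast
    next
      case False
      hence n0: "0 < n" by simp
      consider "i = 0" | "i = n" | "0 < i" "i < n" using i by linarith
      thus ?thesis
      proof cases
        case 1 thus ?thesis using ends[OF n0] by blast
      next
        case 2
        obtain e e' where e: "e \<in> E1" "e' \<in> E1" "e \<noteq> e'" "x 0 \<in> e" "x 0 \<in> e'" using ends[OF n0] by blast
        have E1g: "act T g ` d \<in> E1 \<and> d \<subseteq> VT" if d: "d \<in> E1" for d
        proof -
          obtain h i where h: "h \<in> carrier G" "i < n" "d = act T h ` {x i, x (Suc i)}" using d E1_def by blast
          have "act T g ` d = act T (g \<otimes> h) ` {x i, x (Suc i)}"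
            using act_mult[OF g(1) h(1)] xT[of i] xT[of "Suc i"] h by simp
          thus ?thesis using eEg[OF h(2), of "g \<otimes> h"] g h act_closed[OF h(1)] xT[of i] xT[of "Suc i"] by auto
        qed
        have "act T g ` e \<noteq> act T g ` e'"
          using E1g[OF e(1)] E1g[OF e(2)] act_inj_on[OF g(1)] e(3) by (meson inj_on_image_eq_iff)
        moreover have "x i \<in> act T g ` e" "x i \<in> act T g ` e'" using e 2 x by auto
        ultimately show ?thesis using E1g e by blast
      next
        case 3
        hence "{x (i - 1), x i} \<in> E1" "{x i, x (Suc i)} \<in> E1" using eE[of "i - 1"] eE[of i] by auto
        moreover have "x (i - 1) \<noteq> x (Suc i)" using nob[of "i - 1"] 3 by simp
        moreover have "x (i - 1) \<noteq> x i" using edge_neq'[of "x (i - 1)" "x i"] A_edge x(3)[of "i - 1"] 3 by simp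
        hence "{x (i - 1), x i} \<noteq> {x i, x (Suc i)}" using \<open>x (i - 1) \<noteq> x (Suc i)\<close> by (auto simp: doubleton_eq_iff)
        ultimately show ?thesis by blast
      qed
    qed
    have "joined E1 (act T g (x 0)) (act T g (x i))"
    proof (rule act_adj)
      show "joined {{x i, x (Suc i)} | i. i < n} (x 0) (x i)" by (rule walk_rtrancl) (use i in auto)
      show "act T g ` e \<in> E1" if "e \<in> {{x i, x (Suc i)} | i. i < n}" for e using that eEg g by blast
    qed
    hence "joined (sedges Cr \<union> E1) (x n) (act T g (x i))" using x adj_mono[of _ _ E1] by auto
    moreover have "joined (sedges Cr \<union> E1) (x i) (x n)"
      using walk0[OF i] walk0[of n] adj_sym by (metis order_refl rtrancl_trans)
    ultimately have "joined (sedges Cr \<union> E1) (x i) (act T g (x i))" by simp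
    thus "x i \<in> sverts Cr \<or> (\<exists>h\<in>carrier G. h \<noteq> \<one> \<and> joined (sedges Cr \<union> E1) (x i) (act T h (x i))) \<or>
      (\<exists>w\<in>sverts Cr. joined (sedges Cr \<union> E1) (x i) w)" using g by blast
  qed auto
  thus ?thesis using u(1) x(1) by blast
qed

end

section \<open>Forgetting free vertices of valence two\<close>

text \<open>\<open>unsubdivide\<close> with the set of kept vertices as a parameter, so that one set
  serves all edge lengths on the same piece.\<close>

definition coarsen :: "'v set \<Rightarrow> ('h, 'v) mtree \<Rightarrow> ('h, 'v) mtree" where
  "coarsen W T = \<lparr>sverts = W,
     sedges = {{u, w} | u w. u \<in> W \<and> w \<in> W \<and> u \<noteq> w \<and> (\<exists>p. is_path T u p w \<and> set p \<inter> W = {u, w})},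
     act = (\<lambda>h. restrict (act T h) W),
     len = (\<lambda>e. THE d. \<exists>u w. e = {u, w} \<and> d = tdist T (vpoint u) (vpoint w))\<rparr>"

lemma unsubdivide_coarsen: "unsubdivide G T = coarsen (essential_vertices G T) T"
  by (simp add: unsubdivide_def coarsen_def Let_def)

lemma walk_epath:
  assumes "inj_on x {..n}" "\<And>i. i < n \<Longrightarrow> {x i, x (Suc i)} \<in> E"
  shows "epath E (x 0) (map x [0..<Suc n]) (x n)"
  unfolding epath_def
proof (intro conjI)
  show "hd (map x [0..<Suc n]) = x 0" by (simp add: hd_map del: upt_Suc)
  have "set [0..<Suc n] = {..n}" by auto
  thus "distinct (map x [0..<Suc n])"
    using assms(1) by (simp only: distinct_map distinct_upt)
  show "successively (\<lambda>x y. {x, y} \<in> E) (map x [0..<Suc n])"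
    using assms(2) by (simp add: successively_conv_nth nth_append del: upt_Suc)
qed auto

locale subdiv = mtree G T for G :: "'h monoid" (structure) and T :: "('h, 'v) mtree" +
  fixes W :: "'v set"
  assumes W_sub: "W \<subseteq> sverts T" and W_ne: "W \<noteq> {}"
    and W_act: "h \<in> carrier G \<Longrightarrow> v \<in> W \<Longrightarrow> act T h v \<in> W"
    and free: "v \<in> sverts T \<Longrightarrow> v \<notin> W \<Longrightarrow> h \<in> carrier G \<Longrightarrow> act T h v = v \<Longrightarrow> h = \<one>\<^bsub>G\<^esub>"
    and val2: "v \<in> sverts T \<Longrightarrow> v \<notin> W \<Longrightarrow> valence T v = 2"
    and orb: "\<exists>V0. finite V0 \<and> V0 \<subseteq> sverts T \<and> (\<forall>v\<in>sverts T. \<exists>h\<in>carrier G. \<exists>v0\<in>V0. v = act T h v0)"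
begin

abbreviation U :: "('h, 'v) mtree" where "U \<equiv> coarsen W T"

lemma W_act_iff: "h \<in> carrier G \<Longrightarrow> v \<in> VT \<Longrightarrow> act T h v \<in> W \<longleftrightarrow> v \<in> W"
  using W_act[of h v] W_act[of "inv h" "act T h v"] act_inv_act[of h v] by auto

lemma nbr_two:
  assumes v: "v \<in> VT" "v \<notin> W" and e: "{v, a} \<in> ET" "{v, b} \<in> ET" "{v, c} \<in> ET" and ab: "a \<noteq> b"
  shows "c = a \<or> c = b"
proof (rule ccontr)
  assume n: "\<not> ?thesis"
  have ne: "v \<noteq> a" "v \<noteq> b" "v \<noteq> c" using e edge_neq' by auto
  have fin: "finite {e \<in> ET. v \<in> e}" using val2[OF v] unfolding valence_def by (metis card.infinite zero_neq_numeral)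
  have "card {{v, a}, {v, b}, {v, c}} = 3" using n ab ne by (auto simp: doubleton_eq_iff card_insert_if)
  moreover have "{{v, a}, {v, b}, {v, c}} \<subseteq> {e \<in> ET. v \<in> e}" using e by auto
  ultimately show False using card_mono[OF fin, of "{{v, a}, {v, b}, {v, c}}"] val2[OF v] by (simp add: valence_def)
qed

lemma nbr_other:
  assumes v: "v \<in> VT" "v \<notin> W" and e: "{v, a} \<in> ET"
  shows "\<exists>b. b \<noteq> a \<and> {v, b} \<in> ET"
proof (rule ccontr)
  assume n: "\<not> ?thesis"
  have "{e \<in> ET. v \<in> e} \<subseteq> {{v, a}}"
  proof
    fix e assume "e \<in> {e \<in> ET. v \<in> e}"
    hence ee: "e \<in> ET" "v \<in> e" by auto
    then obtain p q where pq: "e = {p, q}" using edge_obtain by metis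
    then obtain b where "e = {v, b}" using ee(2) by auto
    thus "e \<in> {{v, a}}" using n ee(1) by auto
  qed
  hence "valence T v \<le> card {{v, a}}" unfolding valence_def by (intro card_mono) auto
  thus False using val2[OF v] by simp
qed

definition dW :: "'v \<Rightarrow> nat" where "dW v = (LEAST n. \<exists>w\<in>W. (v, w) \<in> adj ET ^^ n)"

lemma dW_ex: assumes "v \<in> VT" shows "\<exists>w\<in>W. (v, w) \<in> adj ET ^^ dW v"
proof -
  obtain w where w: "w \<in> W" using W_ne by blast
  hence "joined ET v w" using conn assms W_sub by blast
  then obtain n where "(v, w) \<in> adj ET ^^ n" using rtrancl_imp_relpow by blast
  hence "\<exists>w\<in>W. (v, w) \<in> adj ET ^^ n" using w by blast
  thus ?thesis unfolding dW_def by (rule LeastI)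
qed

lemma dW_le: "w \<in> W \<Longrightarrow> (v, w) \<in> adj ET ^^ n \<Longrightarrow> dW v \<le> n"
  unfolding dW_def by (rule Least_le) blast

lemma dW_nbr:
  assumes "v \<in> VT" "v \<notin> W"
  shows "\<exists>a. {v, a} \<in> ET \<and> dW a < dW v"
proof -
  obtain w where w: "w \<in> W" "(v, w) \<in> adj ET ^^ dW v" using dW_ex[OF assms(1)] by blast
  obtain m where m: "dW v = Suc m" using w assms(2) by (cases "dW v") auto
  then obtain a where a: "(v, a) \<in> adj ET" "(a, w) \<in> adj ET ^^ m" using relpow_Suc_D2[of v w m] w(2) by metis
  thus ?thesis using dW_le[OF w(1) a(2)] m by auto
qed

lemma dW_act: assumes h: "h \<in> carrier G" and v: "v \<in> VT" shows "dW (act T h v) = dW v"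
proof -
  have le: "dW (act T h v) \<le> dW v" if h: "h \<in> carrier G" and v: "v \<in> VT" for h v
  proof -
    obtain w where w: "w \<in> W" "(v, w) \<in> adj ET ^^ dW v" using dW_ex[OF v] by blast
    obtain f where f: "f 0 = v" "f (dW v) = w" "\<And>i. i < dW v \<Longrightarrow> {f i, f (Suc i)} \<in> ET"
      using w(2) by (auto simp: relpow_fun_conv)
    have "{act T h (f i), act T h (f (Suc i))} \<in> ET" if "i < dW v" for i
      using act_edge[OF h f(3)[OF that]] by simp
    hence "(act T h v, act T h w) \<in> adj ET ^^ dW v"
      unfolding relpow_fun_conv using f by (intro exI[of _ "\<lambda>i. act T h (f i)"]) auto
    thus ?thesis using dW_le W_act[OF h w(1)] by blast
  qed
  show ?thesis using le[OF h v] le[OF inv_in[OF h] act_closed[OF h v]] act_inv_act[OF h v] by simp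
qed

lemma dW_bounded: "\<exists>B. \<forall>v\<in>VT. dW v \<le> B"
proof -
  obtain V0 where V0: "finite V0" "V0 \<subseteq> VT" "\<forall>v\<in>VT. \<exists>h\<in>carrier G. \<exists>v0\<in>V0. v = act T h v0"
    using orb by blast
  have "dW v \<le> (\<Sum>v0\<in>V0. dW v0)" if v: "v \<in> VT" for v
  proof -
    obtain h v0 where h: "h \<in> carrier G" "v0 \<in> V0" "v = act T h v0" using V0(3) v by blast
    hence "dW v = dW v0" using dW_act V0(2) by blast
    thus ?thesis using member_le_sum[OF h(2), of dW] V0(1) by simp
  qed
  thus ?thesis by blast
qed

text \<open>Walking straight on through vertices of valence two reaches \<open>W\<close>, because the distance to \<open>W\<close>
  is bounded and cannot grow forever.\<close>

lemma ray:
  assumes e: "{a, b} \<in> ET"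
  shows "\<exists>K r. 0 < K \<and> r 0 = a \<and> r 1 = b \<and> r K \<in> W \<and> (\<forall>j. 0 < j \<and> j < K \<longrightarrow> r j \<notin> W) \<and>
    (\<forall>j<K. {r j, r (Suc j)} \<in> ET) \<and> (\<forall>j. Suc j < K \<longrightarrow> r (Suc (Suc j)) \<noteq> r j)"
proof -
  define nxt where "nxt u v = (SOME c. c \<noteq> u \<and> {v, c} \<in> ET)" for u v
  have nxt: "nxt u v \<noteq> u" "{v, nxt u v} \<in> ET" if "{u, v} \<in> ET" "v \<notin> W" for u v
  proof -
    have "v \<in> VT" using edge_ends that by blast
    hence "\<exists>c. c \<noteq> u \<and> {v, c} \<in> ET" using nbr_other[of v u] that by (simp add: insert_commute)
    from someI_ex[OF this] show "nxt u v \<noteq> u" "{v, nxt u v} \<in> ET" by (auto simp: nxt_def)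
  qed
  define s where "s = rec_nat (a, b) (\<lambda>_ (u, v). (v, nxt u v))"
  have s0: "s 0 = (a, b)" and sS: "s (Suc n) = (snd (s n), nxt (fst (s n)) (snd (s n)))" for n
    by (simp_all add: s_def case_prod_beta)
  define r where "r n = fst (s n)" for n
  have rS: "r (Suc n) = snd (s n)" for n by (simp add: r_def sS)
  have r0: "r 0 = a" "r 1 = b" using rS[of 0] by (simp_all add: r_def s0)
  have rSS: "r (Suc (Suc n)) = nxt (r n) (r (Suc n))" for n unfolding rS[of "Suc n"] sS rS by (simp add: r_def)
  have edges: "{r n, r (Suc n)} \<in> ET" if "\<And>j. 0 < j \<Longrightarrow> j \<le> n \<Longrightarrow> r j \<notin> W" for n
    using that
  proof (induction n)
    case 0 thus ?case using e r0 by simp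
  next
    case (Suc n)
    thus ?case using nxt(2)[of "r n" "r (Suc n)"] unfolding rSS by auto
  qed
  have nb: "r (Suc (Suc n)) \<noteq> r n" if "\<And>j. 0 < j \<Longrightarrow> j \<le> Suc n \<Longrightarrow> r j \<notin> W" for n
    unfolding rSS using nxt(1)[of "r n" "r (Suc n)"] edges[of n] that by auto
  have "\<exists>n>0. r n \<in> W"
  proof (rule ccontr)
    assume "\<not> ?thesis"
    hence nW: "r n \<notin> W" if "0 < n" for n using that by blast
    have E: "{r n, r (Suc n)} \<in> ET" for n using edges nW by blast
    have rT: "r n \<in> VT" for n using E edge_ends by blast
    \<comment> \<open>Some neighbour of a vertex outside \<open>W\<close> is nearer to
      \<open>W\<close>, and the only neighbours are those before and after it on the walk.\<close>
    have small: "dW (r n) < dW (r (Suc n)) \<or> dW (r (Suc (Suc n))) < dW (r (Suc n))" for n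
    proof -
      obtain c where c: "{r (Suc n), c} \<in> ET" "dW c < dW (r (Suc n))" using dW_nbr[OF rT nW, of "Suc n"] by blast
      have "c = r n \<or> c = r (Suc (Suc n))"
        using nbr_two[OF rT nW, of "Suc n" "r n" "r (Suc (Suc n))" c] E[of n] E[of "Suc n"] c(1) nb[of n] nW
        by (auto simp: insert_commute)
      thus ?thesis using c(2) by auto
    qed
    \<comment> \<open>A descent would never end: the vertex just left is farther away, so the next
      one must be nearer. Hence the distance grows at every step, against its boundedness.\<close>
    have up: "\<not> dW (r (Suc n)) < dW (r n)" for n
    proof
      assume d: "dW (r (Suc n)) < dW (r n)"
      have "dW (r (n + Suc k)) < dW (r (n + k))" for k
      proof (induction k)
        case 0 thus ?case using d by simp
      next
        case (Suc k) thus ?case using small[of "n + k"] by auto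
      qed
      hence "dW (r (n + k)) + k \<le> dW (r n)" for k
      proof (induction k)
        case (Suc k) thus ?case using Suc.prems[of k] Suc.IH by fastforce
      qed simp
      from this[of "Suc (dW (r n))"] show False by simp
    qed
    have "dW (r n) < dW (r (Suc n))" for n using small[of n] up[of "Suc n"] by auto
    hence "n \<le> dW (r n)" for n by (induction n) (auto simp: Suc_le_eq intro: le_less_trans)
    moreover obtain B where "\<forall>v\<in>VT. dW v \<le> B" using dW_bounded by blast
    ultimately have "Suc B \<le> B" using rT order_trans by blast
    thus False by simp
  qed
  then obtain n where n: "0 < n" "r n \<in> W" by blast
  define K where "K = (LEAST k. 0 < k \<and> r k \<in> W)"
  have K: "0 < K" "r K \<in> W" using LeastI[of "\<lambda>k. 0 < k \<and> r k \<in> W" n] n by (auto simp: K_def)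
  have K': "r j \<notin> W" if "0 < j" "j < K" for j using not_less_Least[of j "\<lambda>k. 0 < k \<and> r k \<in> W"] that by (auto simp: K_def)
  show ?thesis
  proof (intro exI[of _ K] exI[of _ r] conjI allI impI)
    show "{r j, r (Suc j)} \<in> ET" if "j < K" for j by (rule edges) (use K' that in auto)
    show "r (Suc (Suc j)) \<noteq> r j" if "Suc j < K" for j by (rule nb) (use K' that in auto)
  qed (use K K' r0 in auto)
qed

text \<open>These walks, up to reversal, become the edges of the coarser graph
  (\<open>U_edges\<close>).\<close>

definition seg :: "nat \<Rightarrow> (nat \<Rightarrow> 'v) \<Rightarrow> bool" where
  "seg n x \<longleftrightarrow> 0 < n \<and> x 0 \<in> W \<and> x n \<in> W \<and> (\<forall>i. 0 < i \<longrightarrow> i < n \<longrightarrow> x i \<notin> W) \<and>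
     (\<forall>i<n. {x i, x (Suc i)} \<in> ET) \<and> inj_on x {..n}"

lemma segD:
  assumes "seg n x"
  shows "0 < n" "x 0 \<in> W" "x n \<in> W" "0 < i \<Longrightarrow> i < n \<Longrightarrow> x i \<notin> W" "i < n \<Longrightarrow> {x i, x (Suc i)} \<in> ET"
    "inj_on x {..n}" "i \<le> n \<Longrightarrow> j \<le> n \<Longrightarrow> x i = x j \<longleftrightarrow> i = j" "x 0 \<noteq> x n"
  using assms by (auto simp: seg_def inj_on_eq_iff)

lemma seg_verts: assumes "seg n x" "i \<le> n" shows "x i \<in> VT"
proof (cases "i = n")
  case True thus ?thesis using segD(3)[OF assms(1)] W_sub by auto
next
  case False thus ?thesis using segD(5)[OF assms(1), of i] assms(2) edge_ends by auto
qed

lemma seg_rev: assumes "seg n x" shows "seg n (\<lambda>i. x (n - i))"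
  unfolding seg_def
proof (intro conjI allI impI)
  show "{x (n - i), x (n - Suc i)} \<in> ET" if "i < n" for i
  proof -
    have "Suc (n - Suc i) = n - i" using that by simp
    thus ?thesis using segD(5)[OF assms, of "n - Suc i"] that by (simp add: insert_commute)
  qed
  show "inj_on (\<lambda>i. x (n - i)) {..n}"
    using segD(7)[OF assms] by (auto simp: inj_on_def)
qed (use segD[OF assms] in auto)

lemma seg_act: assumes x: "seg n x" and h: "h \<in> carrier G" shows "seg n (\<lambda>i. act T h (x i))"
  unfolding seg_def
proof (intro conjI allI impI)
  show "{act T h (x i), act T h (x (Suc i))} \<in> ET" if "i < n" for i
    using act_edge[OF h segD(5)[OF x that]] by simp
  show "inj_on (\<lambda>i. act T h (x i)) {..n}"
    using segD(7)[OF x] act_inj[OF h] seg_verts[OF x] by (auto simp: inj_on_def)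
  show "act T h (x i) \<notin> W" if "0 < i" "i < n" for i
    using W_act_iff[OF h seg_verts[OF x, of i]] segD(4)[OF x that] that by simp
qed (use segD[OF x] W_act[OF h] in auto)

text \<open>The rays that start along the edge in its two directions both reach \<open>W\<close>.
  Their union does not backtrack, so it is injective by \<open>walk_inj\<close>.\<close>

lemma seg_ex:
  assumes e: "{v, v'} \<in> ET"
  shows "\<exists>n x j. seg n x \<and> j < n \<and> x j = v \<and> x (Suc j) = v'"
proof -
  obtain K r where r: "0 < K" "r 0 = v" "r 1 = v'" "r K \<in> W" "\<forall>j. 0 < j \<and> j < K \<longrightarrow> r j \<notin> W"
    "\<forall>j<K. {r j, r (Suc j)} \<in> ET" "\<forall>j. Suc j < K \<longrightarrow> r (Suc (Suc j)) \<noteq> r j"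
    using ray[OF e] by blast
  have e': "{v', v} \<in> ET" using e by (simp add: insert_commute)
  obtain M q where q: "0 < M" "q 0 = v'" "q 1 = v" "q M \<in> W" "\<forall>j. 0 < j \<and> j < M \<longrightarrow> q j \<notin> W"
    "\<forall>j<M. {q j, q (Suc j)} \<in> ET" "\<forall>j. Suc j < M \<longrightarrow> q (Suc (Suc j)) \<noteq> q j"
    using ray[OF e'] by blast
  define m where "m = M - 1"
  have M: "M = Suc m" using q(1) by (simp add: m_def)
  \<comment> \<open>\<open>q\<close> backwards, then \<open>r\<close>. Both rays contain the edge,
    so at the indices \<open>m\<close> and \<open>m + 1\<close> either description may be used
    (\<open>x1\<close>, \<open>x2\<close>).\<close>
  define x where "x i = (if i \<le> m then q (M - i) else r (i - m))" for i
  define n where "n = m + K"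
  have x1: "x i = q (M - i)" if "i \<le> Suc m" for i
    using that r q by (cases "i = Suc m") (auto simp: x_def M)
  have x2: "x i = r (i - m)" if "m \<le> i" for i
    using that r q by (cases "i = m") (auto simp: x_def M)
  have ed: "{x i, x (Suc i)} \<in> ET" if "i < n" for i
  proof (cases "i \<le> m")
    case True
    have "Suc (M - Suc i) = M - i" "M - Suc i < M" using True M by auto
    thus ?thesis using q(6)[rule_format, of "M - Suc i"] x1[of i] x1[of "Suc i"] True by (simp add: insert_commute)
  next
    case False
    hence "Suc (i - m) = Suc i - m" "i - m < K" using that by (auto simp: n_def)
    thus ?thesis using r(6)[rule_format, of "i - m"] x2[of i] x2[of "Suc i"] False by simp
  qed
  have nb: "x (Suc (Suc i)) \<noteq> x i" if "Suc i < n" for i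
  proof (cases "Suc i \<le> m")
    case True
    have "Suc (Suc (M - Suc (Suc i))) = M - i" "Suc (M - Suc (Suc i)) < M" using True M by auto
    thus ?thesis using q(7)[rule_format, of "M - Suc (Suc i)"] x1[of i] x1[of "Suc (Suc i)"] True by auto
  next
    case False
    hence "Suc (Suc (i - m)) = Suc (Suc i) - m" "Suc (i - m) < K" using that by (auto simp: n_def)
    thus ?thesis using r(7)[rule_format, of "i - m"] x2[of i] x2[of "Suc (Suc i)"] False by auto
  qed
  have "inj_on x {..n}" by (rule walk_inj[OF tree, where x = x and n = n]) (fact ed, fact nb)
  moreover have "x i \<notin> W" if "0 < i" "i < n" for i
  proof (cases "i \<le> m")
    case True
    thus ?thesis using q(5)[rule_format, of "M - i"] x1[of i] that M by auto
  next
    case False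
    thus ?thesis using r(5)[rule_format, of "i - m"] x2[of i] that by (auto simp: n_def)
  qed
  moreover have "x 0 \<in> W" "x n \<in> W" using x1[of 0] q(4) x2[of n] r(4) by (auto simp: n_def)
  ultimately have "seg n x" using ed r(1) by (auto simp: seg_def n_def)
  moreover have "x m = v" "x (Suc m) = v'" using x2[of m] x1[of "Suc m"] r q M by auto
  moreover have "m < n" using r(1) by (simp add: n_def)
  ultimately show ?thesis by blast
qed

text \<open>After a common directed edge the next vertex is determined as long as the current one
  has valence two, and both walks stop at their first vertex in \<open>W\<close>.\<close>

lemma seg_forward:
  assumes x: "seg n x" and y: "seg m y" and j: "j < n" "k < m" and eq: "x j = y k" "x (Suc j) = y (Suc k)"
  shows "n - j = m - k" "x n = y m"
proof -
  have *: "x (j + i) = y (k + i) \<and> x (j + Suc i) = y (k + Suc i)" if "j + Suc i \<le> n" "k + Suc i \<le> m" for i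
    using that
  proof (induction i)
    case 0 thus ?case using eq by simp
  next
    case (Suc i)
    hence IH: "x (j + i) = y (k + i)" "x (j + Suc i) = y (k + Suc i)" by auto
    let ?v = "x (j + Suc i)"
    have v: "?v \<in> VT" "?v \<notin> W" using seg_verts[OF x] segD(4)[OF x] Suc.prems by auto
    have "{?v, x (j + i)} \<in> ET" "{?v, x (j + Suc (Suc i))} \<in> ET"
      using segD(5)[OF x, of "j + i"] segD(5)[OF x, of "j + Suc i"] Suc.prems by (auto simp: insert_commute)
    moreover have "{?v, y (k + Suc (Suc i))} \<in> ET"
      using segD(5)[OF y, of "k + Suc i"] Suc.prems IH by auto
    moreover have "x (j + i) \<noteq> x (j + Suc (Suc i))" using segD(7)[OF x, of "j + i" "j + Suc (Suc i)"] Suc.prems by simp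
    moreover have "y (k + Suc (Suc i)) \<noteq> x (j + i)"
      using segD(7)[OF y, of "k + i" "k + Suc (Suc i)"] Suc.prems IH by simp
    ultimately have "y (k + Suc (Suc i)) = x (j + Suc (Suc i))" using nbr_two[OF v] by blast
    thus ?case using IH by simp
  qed
  have eqi: "x (j + i) = y (k + i)" if "i \<le> n - j" "i \<le> m - k" for i
  proof (cases i)
    case 0 thus ?thesis using eq by simp
  next
    case (Suc i') thus ?thesis using *[of i'] that j by simp
  qed
  have jn: "j + (n - j) = n" "k + (m - k) = m" using j by auto
  show nm: "n - j = m - k"
  proof (rule ccontr)
    assume "n - j \<noteq> m - k"
    then consider "n - j < m - k" | "m - k < n - j" by linarith
    thus False
    proof cases
      case 1
      hence "x n = y (k + (n - j))" using eqi[of "n - j"] jn by simp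
      moreover have "0 < k + (n - j)" "k + (n - j) < m" using 1 j by linarith+
      ultimately show False using segD(3)[OF x] segD(4)[OF y, of "k + (n - j)"] by simp
    next
      case 2
      hence "y m = x (j + (m - k))" using eqi[of "m - k"] jn by simp
      moreover have "0 < j + (m - k)" "j + (m - k) < n" using 2 j by linarith+
      ultimately show False using segD(3)[OF y] segD(4)[OF x, of "j + (m - k)"] by simp
    qed
  qed
  show "x n = y m" using eqi[of "n - j"] jn nm by simp
qed

text \<open>\<open>seg_forward\<close> for the walks and for their reversals: a common directed edge
  determines both ends. Lengths may therefore be assigned to edges through any segment containing
  them.\<close>

lemma seg_same:
  assumes x: "seg n x" and y: "seg m y" and j: "j < n" "k < m" and eq: "x j = y k" "x (Suc j) = y (Suc k)"
  shows "n = m" "x n = y m" "x 0 = y 0"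
proof -
  note f = seg_forward[OF assms]
  have b: "n - (n - Suc j) = m - (m - Suc k)" "x (n - n) = y (m - m)"
    using seg_forward[OF seg_rev[OF x] seg_rev[OF y], of "n - Suc j" "m - Suc k"] j eq
    by (auto simp: Suc_diff_Suc)
  show "n = m" using f(1) b(1) j by linarith
  show "x n = y m" "x 0 = y 0" using f(2) b(2) by auto
qed

lemma seg_edge_unique:
  assumes x: "seg n x" and y: "seg m y" and j: "j < n" "k < m" and eq: "{x j, x (Suc j)} = {y k, y (Suc k)}"
  shows "n = m" "{x 0, x n} = {y 0, y m}"
proof -
  consider "x j = y k" "x (Suc j) = y (Suc k)" | "x j = y (Suc k)" "x (Suc j) = y k"
    using eq by (auto simp: doubleton_eq_iff)
  hence "n = m \<and> {x 0, x n} = {y 0, y m}"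
  proof cases
    case 1 thus ?thesis using seg_same[OF x y j] by simp
  next
    case 2
    have "x j = y (m - (m - Suc k))" "x (Suc j) = y (m - Suc (m - Suc k))" using 2 j by (auto simp: Suc_diff_Suc)
    thus ?thesis using seg_same[OF x seg_rev[OF y] j(1), of "m - Suc k"] j by auto
  qed
  thus "n = m" "{x 0, x n} = {y 0, y m}" by auto
qed

lemma U_sel [simp]: "sverts U = W" "h \<in> carrier G \<Longrightarrow> v \<in> W \<Longrightarrow> act U h v = act T h v"
  by (simp_all add: coarsen_def)

lemma U_edges: "sedges U = {{x 0, x n} | n x. seg n x}"
proof (intro subset_antisym subsetI)
  fix e assume "e \<in> sedges U"
  then obtain u w p where uw: "e = {u, w}" "u \<in> W" "w \<in> W" "u \<noteq> w" "is_path T u p w" "set p \<inter> W = {u, w}"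
    unfolding coarsen_def by auto
  let ?n = "length p - 1" and ?x = "\<lambda>i. p ! i"
  have p: "p \<noteq> []" "hd p = u" "last p = w" "distinct p" "successively (\<lambda>x y. {x, y} \<in> ET) p"
    using uw(5) by (auto simp: is_path_def)
  have l: "length p = Suc ?n" using p(1) by simp
  have x0: "p ! 0 = u" "p ! ?n = w" using p by (auto simp: hd_conv_nth last_conv_nth)
  have inj: "p ! i = p ! j \<longleftrightarrow> i = j" if "i \<le> ?n" "j \<le> ?n" for i j
    using nth_eq_iff_index_eq[OF p(4), of i j] that l by auto
  have "0 < ?n" using x0 uw(4) by (metis gr0I)
  moreover have "p ! i \<notin> W" if "0 < i" "i < ?n" for i
  proof
    assume "p ! i \<in> W"
    hence "p ! i \<in> {u, w}" using uw(6) l that by (metis IntI Suc_lessD less_SucI nth_mem)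
    thus False using inj[of i 0] inj[of i ?n] x0 that by auto
  qed
  moreover have "{p ! i, p ! Suc i} \<in> ET" if "i < ?n" for i
    using p(5) that l unfolding successively_conv_nth by simp
  moreover have "inj_on ?x {..?n}" using inj by (auto simp: inj_on_def)
  ultimately have "seg ?n ?x" using x0 uw by (simp add: seg_def)
  thus "e \<in> {{x 0, x n} | n x. seg n x}" using x0 uw(1) by (intro CollectI exI[of _ ?n] exI[of _ ?x]) simp
next
  fix e assume "e \<in> {{x 0, x n} | n x. seg n x}"
  then obtain n x where x: "seg n x" "e = {x 0, x n}" by blast
  let ?p = "map x [0..<Suc n]"
  have "epath ET (x 0) ?p (x n)" by (rule walk_epath[OF segD(6)[OF x(1)] segD(5)[OF x(1)]])
  moreover have sp: "set ?p = x ` {..n}" by (auto simp del: upt_Suc)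
  moreover have "x ` {..n} \<subseteq> VT" using seg_verts[OF x(1)] by auto
  ultimately have path: "is_path T (x 0) ?p (x n)" by (auto simp: is_path_def epath_def)
  have "x ` {..n} \<inter> W = {x 0, x n}"
  proof (intro subset_antisym subsetI)
    fix v assume "v \<in> x ` {..n} \<inter> W"
    then obtain i where i: "i \<le> n" "v = x i" "x i \<in> W" by auto
    hence "i = 0 \<or> i = n" using segD(4)[OF x(1), of i] by (metis gr0I le_neq_implies_less)
    thus "v \<in> {x 0, x n}" using i by auto
  qed (use segD[OF x(1)] in auto)
  hence c: "x 0 \<in> W \<and> x n \<in> W \<and> x 0 \<noteq> x n \<and> (\<exists>p. is_path T (x 0) p (x n) \<and> set p \<inter> W = {x 0, x n})"
    using segD[OF x(1)] path sp by metis
  thus "e \<in> sedges U" unfolding coarsen_def mtree.simps sgraph.simps x(2) by blast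
qed

abbreviation dd :: "'v \<Rightarrow> 'v \<Rightarrow> real" where "dd u w \<equiv> tdist T (vpoint u) (vpoint w)"

lemma dd_sym: "u \<in> VT \<Longrightarrow> w \<in> VT \<Longrightarrow> dd u w = dd w u"
  using tdist_sym vpoint_points by blast

lemma seg_dist: assumes x: "seg n x" and ab: "a \<le> b" "b \<le> n"
  shows "dd (x a) (x b) = (\<Sum>i=a..<b. len T {x i, x (Suc i)})"
proof -
  have "dd (x (a + 0)) (x (a + (b - a))) = (\<Sum>i<b - a. len T {x (a + i), x (a + Suc i)})"
    using tdist_walk[of "b - a" "\<lambda>i. x (a + i)"] segD(5,7)[OF x] seg_verts[OF x] ab
    by (auto simp: inj_on_def)
  also have "\<dots> = (\<Sum>i=a..<b. len T {x i, x (Suc i)})"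
    using sum.shift_bounds_nat_ivl[of "\<lambda>i. len T {x i, x (Suc i)}" 0 a "b - a"] ab
    by (simp add: atLeast0LessThan add.commute)
  finally show ?thesis using ab by simp
qed

lemma seg_dist_add: assumes x: "seg n x" and j: "j \<le> n" shows "dd (x 0) (x n) = dd (x 0) (x j) + dd (x j) (x n)"
  using seg_dist[OF x, of 0 n] seg_dist[OF x, of 0 j] seg_dist[OF x, of j n] j
    sum.atLeastLessThan_concat[of 0 j n "\<lambda>i. len T {x i, x (Suc i)}"] by simp

lemma seg_dist_pos: assumes x: "seg n x" shows "0 < dd (x 0) (x n)"
  unfolding seg_dist[OF x le0 order_refl]
  by (rule sum_pos) (use segD[OF x] len_pos in auto)

lemma U_len: assumes x: "seg n x" shows "len U {x 0, x n} = dd (x 0) (x n)"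
proof -
  have "(THE d. \<exists>u w. {x 0, x n} = {u, w} \<and> d = dd u w) = dd (x 0) (x n)"
  proof (rule the_equality)
    fix d assume "\<exists>u w. {x 0, x n} = {u, w} \<and> d = dd u w"
    then obtain u w where "{x 0, x n} = {u, w}" "d = dd u w" by blast
    hence "(u = x 0 \<and> w = x n) \<or> (u = x n \<and> w = x 0)" by (auto simp: doubleton_eq_iff)
    thus "d = dd (x 0) (x n)" using \<open>d = dd u w\<close> dd_sym[of "x 0" "x n"] seg_verts[OF x] by auto
  qed blast
  thus ?thesis by (simp add: coarsen_def)
qed

lemma U_edgeE:
  assumes "{u, w} \<in> sedges U"
  obtains n x where "seg n x" "x 0 = u" "x n = w"
proof -
  obtain n x where x: "seg n x" "{u, w} = {x 0, x n}" using assms unfolding U_edges by auto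
  hence "(u = x 0 \<and> w = x n) \<or> (u = x n \<and> w = x 0)" by (auto simp: doubleton_eq_iff)
  thus thesis using that[OF x(1)] that[OF seg_rev[OF x(1)]] by auto
qed

text \<open>A simple walk between vertices of \<open>W\<close> is cut at its visits to
  \<open>W\<close>; each part is a segment.\<close>

lemma U_conn: assumes "u \<in> W" "w \<in> W" shows "joined (sedges U) u w"
proof -
  have *: "x 0 \<in> W \<Longrightarrow> x n \<in> W \<Longrightarrow> inj_on x {..n} \<Longrightarrow> (\<And>i. i < n \<Longrightarrow> {x i, x (Suc i)} \<in> ET) \<Longrightarrow>
      joined (sedges U) (x 0) (x n)" for x n
  proof (induction n arbitrary: x rule: less_induct)
    case (less n)
    show ?case
    proof (cases "n = 0")
      case False
      define m where "m = (LEAST m. 0 < m \<and> x m \<in> W)"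
      have P: "0 < n \<and> x n \<in> W" using False less.prems by simp
      have m: "0 < m" "x m \<in> W" "m \<le> n"
        using LeastI[of "\<lambda>m. 0 < m \<and> x m \<in> W", OF P] Least_le[of "\<lambda>m. 0 < m \<and> x m \<in> W", OF P] by (auto simp: m_def)
      have m': "x j \<notin> W" if "0 < j" "j < m" for j
        using not_less_Least[of j "\<lambda>m. 0 < m \<and> x m \<in> W"] that by (auto simp: m_def)
      have "inj_on x {..m}" using less.prems(3) m(3) by (auto intro: inj_on_subset)
      hence "seg m x" using m m' less.prems by (auto simp: seg_def)
      hence "(x 0, x m) \<in> adj (sedges U)" unfolding U_edges by auto
      moreover have "inj_on (\<lambda>i. x (m + i)) {..n - m}"
      proof (rule inj_onI)
        fix a b assume "a \<in> {..n - m}" "b \<in> {..n - m}" "x (m + a) = x (m + b)"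
        thus "a = b" using inj_onD[OF less.prems(3), of "m + a" "m + b"] m(3) by auto
      qed
      hence "joined (sedges U) ((\<lambda>i. x (m + i)) 0) ((\<lambda>i. x (m + i)) (n - m))"
        by (intro less.IH) (use m less.prems in auto)
      ultimately show ?thesis using m(3) by (auto intro: converse_rtrancl_into_rtrancl)
    qed simp
  qed
  have "joined ET u w" using conn assms W_sub by blast
  from rtrancl_walk[OF this] obtain x n where "x 0 = u" "x n = w" "inj_on x {..n}" "\<forall>i<n. {x i, x (Suc i)} \<in> ET"
    by blast
  thus ?thesis using *[of x n] assms by auto
qed

text \<open>By uniqueness of paths an element that exchanges the ends reverses the whole segment. It
  then fixes the middle vertex, which lies outside \<open>W\<close> and is free, or stabilises the
  middle edge.\<close>

lemma seg_flip_trivial: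
  assumes x: "seg n x" and h: "h \<in> carrier G" and fl: "act T h (x 0) = x n" "act T h (x n) = x 0"
  shows "h = \<one>"
proof -
  let ?y = "\<lambda>i. act T h (x (n - i))"
  have y: "seg n ?y" using seg_act[OF seg_rev[OF x] h] .
  have p1: "epath ET (x 0) (map x [0..<Suc n]) (x n)" by (rule walk_epath[OF segD(6)[OF x] segD(5)[OF x]])
  have "epath ET (?y 0) (map ?y [0..<Suc n]) (?y n)" by (rule walk_epath[OF segD(6)[OF y] segD(5)[OF y]])
  hence p2: "epath ET (x 0) (map ?y [0..<Suc n]) (x n)" using fl by (simp del: upt_Suc)
  have eq: "map x [0..<Suc n] = map ?y [0..<Suc n]"
    using tree[unfolded edge_tree_def, THEN conjunct2, rule_format, OF conjI[OF p1 p2]] .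
  have xy: "x i = ?y i" if "i \<le> n" for i
    using arg_cong[OF eq, of "\<lambda>l. l ! i"] that by (simp del: upt_Suc)
  show ?thesis
  proof (cases "even n")
    case True
    then obtain m where m: "n = 2 * m" by blast
    hence "act T h (x m) = x m" using xy[of m] by simp
    moreover have "x m \<notin> W" using segD(4)[OF x, of m] segD(1)[OF x] m by simp
    ultimately show ?thesis using free[of "x m" h] seg_verts[OF x, of m] m h by simp
  next
    case False
    then obtain m where m: "n = 2 * m + 1" by (metis oddE)
    have "n - m = Suc m" "n - Suc m = m" using m by auto
    hence "act T h (x (Suc m)) = x m" "act T h (x m) = x (Suc m)" using xy[of m] xy[of "Suc m"] m by auto
    hence "act T h ` {x m, x (Suc m)} = {x m, x (Suc m)}" by auto
    moreover have "{x m, x (Suc m)} \<in> ET" using segD(5)[OF x, of m] m by simp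
    ultimately show ?thesis using edge_free[OF h] by blast
  qed
qed

lemma U_graph: "mgraph G U"
proof (intro mgraph.intro)
  show "group G" by (rule grp)
  show "act U h v \<in> sverts U" if "h \<in> carrier G" "v \<in> sverts U" for h v using that W_act by simp
  show "act U \<one> v = v" if "v \<in> sverts U" for v using that act_one W_sub by auto
  show "act U (g \<otimes> h) v = act U g (act U h v)" if "g \<in> carrier G" "h \<in> carrier G" "v \<in> sverts U" for g h v
    using that act_mult W_sub W_act by (simp add: subset_iff)
  show "card e = 2" if "e \<in> sedges U" for e using that segD(8) unfolding U_edges by auto
  show "e \<subseteq> sverts U" if "e \<in> sedges U" for e using that segD(2,3) unfolding U_edges by auto
  have ae: "act U h ` {x 0, x n} = {act T h (x 0), act T h (x n)}" if "seg n x" "h \<in> carrier G" for h n x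
    using that segD(2,3)[OF that(1)] by simp
  show "act U h ` e \<in> sedges U" if h: "h \<in> carrier G" and e: "e \<in> sedges U" for h e
  proof -
    obtain n x where x: "seg n x" "e = {x 0, x n}" using e unfolding U_edges by blast
    have "act U h ` e = {act T h (x 0), act T h (x n)}" using ae[OF x(1) h] x(2) by simp
    thus ?thesis unfolding U_edges using seg_act[OF x(1) h]
      by (intro CollectI exI[of _ n] exI[of _ "\<lambda>i. act T h (x i)"] conjI)
  qed
  show "0 < len U e" if e: "e \<in> sedges U" for e
  proof -
    obtain n x where x: "seg n x" "e = {x 0, x n}" using e unfolding U_edges by blast
    thus ?thesis using U_len seg_dist_pos by simp
  qed
  show "len U (act U h ` e) = len U e" if h: "h \<in> carrier G" and e: "e \<in> sedges U" for h e
  proof -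
    obtain n x where x: "seg n x" "e = {x 0, x n}" using e unfolding U_edges by blast
    have v: "x 0 \<in> VT" "x n \<in> VT" using seg_verts[OF x(1)] by auto
    have "len U (act U h ` e) = dd (act T h (x 0)) (act T h (x n))" using U_len[OF seg_act[OF x(1) h]] ae[OF x(1) h] x(2) by simp
    also have "\<dots> = dd (x 0) (x n)"
      using tdist_act[OF vpoint_points[OF v(1)] vpoint_points[OF v(2)] h] point_act_vpoint[OF h] v by simp
    finally show ?thesis using U_len[OF x(1)] x(2) by simp
  qed
  show "h = \<one>" if h: "h \<in> carrier G" and e: "e \<in> sedges U" and fx: "act U h ` e = e" for h e
  proof -
    obtain n x where x: "seg n x" "e = {x 0, x n}" using e unfolding U_edges by blast
    have v: "x 0 \<in> VT" "x n \<in> VT" "x 0 \<noteq> x n" using seg_verts[OF x(1)] segD(8)[OF x(1)] by auto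
    have "{act T h (x 0), act T h (x n)} = {x 0, x n}" using fx ae[OF x(1) h] x(2) by simp
    then consider "act T h (x 0) = x 0" "act T h (x n) = x n" | "act T h (x 0) = x n" "act T h (x n) = x 0"
      by (auto simp: doubleton_eq_iff)
    thus ?thesis
    proof cases
      case 1 thus ?thesis using fixed_vertex_unique[OF h _ v(1,2)] v(3) by blast
    next
      case 2 thus ?thesis using seg_flip_trivial[OF x(1) h] by blast
    qed
  qed
  show "joined (sedges U) u w" if "u \<in> sverts U" "w \<in> sverts U" for u w using that U_conn by simp
qed

sublocale U: mgraph G U by (rule U_graph)

text \<open>The place of \<open>x j\<close> on the coarse edge spanned by the segment, at the same
  proportion of the distance.\<close>

definition kp :: "nat \<Rightarrow> (nat \<Rightarrow> 'v) \<Rightarrow> nat \<Rightarrow> 'v \<Rightarrow> real" where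
  "kp n x j = ept (x 0) (x n) (dd (x 0) (x j) / dd (x 0) (x n))"

lemma kp_rev: assumes x: "seg n x" and j: "j \<le> n" shows "kp n (\<lambda>i. x (n - i)) (n - j) = kp n x j"
proof -
  have v: "x 0 \<in> VT" "x n \<in> VT" "x j \<in> VT" using seg_verts[OF x] j by auto
  have "dd (x n) (x j) / dd (x n) (x 0) = 1 - dd (x 0) (x j) / dd (x 0) (x n)"
    using seg_dist_add[OF x j] seg_dist_pos[OF x] dd_sym[OF v(1,2)] dd_sym[OF v(3,2)] by (simp add: field_simps)
  thus ?thesis using j ept_swap[of "x 0" "x n"] by (simp add: kp_def)
qed

text \<open>Two segments through the same inner vertex leave it along the same edge, or do so after
  one of them is reversed.\<close>

lemma kp_unique:
  assumes x: "seg n x" and y: "seg m y" and j: "0 < j" "j < n" "0 < k" "k < m" and eq: "x j = y k"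
  shows "kp n x j = kp m y k"
proof -
  have same: "kp n x j = kp m y k" if x: "seg n x" and j: "0 < j" "j < n" and eq: "x j = y k" "x (Suc j) = y (Suc k)" for n x j
    using seg_same[OF x y j(2) \<open>k < m\<close> eq] eq(1) by (simp add: kp_def)
  have v: "x j \<in> VT" "x j \<notin> W" using seg_verts[OF x] segD(4)[OF x] j by auto
  have "{x j, x (Suc j)} \<in> ET" "{x j, x (j - 1)} \<in> ET" "{x j, y (Suc k)} \<in> ET"
    using segD(5)[OF x, of j] segD(5)[OF x, of "j - 1"] segD(5)[OF y, of k] j eq by (auto simp: insert_commute)
  moreover have "x (Suc j) \<noteq> x (j - 1)" using segD(7)[OF x, of "Suc j" "j - 1"] j by simp
  ultimately have "y (Suc k) = x (Suc j) \<or> y (Suc k) = x (j - 1)" using nbr_two[OF v] by blast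
  thus ?thesis
  proof
    assume "y (Suc k) = x (Suc j)" thus ?thesis using same[OF x j(1,2) eq] by simp
  next
    assume "y (Suc k) = x (j - 1)"
    moreover have "n - Suc (n - j) = j - 1" using j by simp
    ultimately have "kp n (\<lambda>i. x (n - i)) (n - j) = kp m y k"
      using same[OF seg_rev[OF x], of "n - j"] j eq by simp
    thus ?thesis using kp_rev[OF x, of j] j by simp
  qed
qed

text \<open>The vertex map that forgets the subdivision. \<open>SOME\<close> takes any segment
  through the vertex; by \<open>kp_unique\<close> the choice does not matter.\<close>

definition k :: "'v \<Rightarrow> 'v \<Rightarrow> real" where
  "k v = (if v \<in> W then vpoint v else SOME p. \<exists>n x j. seg n x \<and> 0 < j \<and> j < n \<and> x j = v \<and> p = kp n x j)"

lemma k_seg: assumes x: "seg n x" and j: "j \<le> n" shows "k (x j) = kp n x j"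
proof -
  consider "j = 0" | "j = n" | "0 < j" "j < n" using j by linarith
  thus ?thesis
  proof cases
    case 1
    thus ?thesis using segD(2)[OF x] tdist_refl[OF vpoint_points[OF seg_verts[OF x, of 0]]] by (simp add: k_def kp_def)
  next
    case 2
    thus ?thesis using segD(3)[OF x] seg_dist_pos[OF x] by (simp add: k_def kp_def)
  next
    case 3
    have "\<exists>p n' x' j'. seg n' x' \<and> 0 < j' \<and> j' < n' \<and> x' j' = x j \<and> p = kp n' x' j'" using x 3 by blast
    from someI_ex[OF this] obtain n' x' j' where *: "seg n' x'" "0 < j'" "j' < n'" "x' j' = x j"
      "(SOME p. \<exists>n' x' j'. seg n' x' \<and> 0 < j' \<and> j' < n' \<and> x' j' = x j \<and> p = kp n' x' j') = kp n' x' j'" by blast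
    thus ?thesis using kp_unique[OF *(1) x *(2,3) 3 *(4)] segD(4)[OF x 3] by (simp add: k_def)
  qed
qed

lemma vertex_seg: assumes "v \<in> VT" "v \<notin> W" shows "\<exists>n x j. seg n x \<and> j \<le> n \<and> x j = v"
proof -
  have "{e \<in> ET. v \<in> e} \<noteq> {}" using val2[OF assms] unfolding valence_def by (metis card.empty zero_neq_numeral)
  then obtain e where e: "e \<in> ET" "v \<in> e" by blast
  then obtain w where "{v, w} \<in> ET" using edge_obtain[OF e(1)] by (metis insert_commute insertE singletonD)
  from seg_ex[OF this] obtain n x j where "seg n x" "j < n" "x j = v" by blast
  thus ?thesis by (intro exI[of _ n] exI[of _ x] exI[of _ j]) simp
qed

lemma kp_points: assumes x: "seg n x" and j: "j \<le> n" shows "kp n x j \<in> points U" "kp n x j \<in> closed_edge {x 0, x n}"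
proof -
  have "0 \<le> dd (x 0) (x j)" "0 \<le> dd (x j) (x n)" using tdist_nonneg vpoint_points seg_verts[OF x] j by auto
  hence t: "0 \<le> dd (x 0) (x j) / dd (x 0) (x n)" "dd (x 0) (x j) / dd (x 0) (x n) \<le> 1"
    using seg_dist_add[OF x j] seg_dist_pos[OF x] by (auto simp: divide_le_eq)
  have "{x 0, x n} \<in> sedges U" using x unfolding U_edges by blast
  thus "kp n x j \<in> points U" unfolding kp_def using U.ept_points t by blast
  show "kp n x j \<in> closed_edge {x 0, x n}" unfolding kp_def using ept_closed_edge[OF segD(8)[OF x]] t by blast
qed

lemma k_points: assumes "v \<in> VT" shows "k v \<in> points U"
proof (cases "v \<in> W")
  case True thus ?thesis using U.vpoint_points by (simp add: k_def)
next
  case False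
  thus ?thesis using vertex_seg[OF assms False] k_seg kp_points(1) by metis
qed

lemma k_act: assumes h: "h \<in> carrier G" and v: "v \<in> VT" shows "k (act T h v) = point_act U h (k v)"
proof (cases "v \<in> W")
  case True thus ?thesis using W_act[OF h True] U.point_act_vpoint[OF h] h by (simp add: k_def)
next
  case False
  obtain n x j where x: "seg n x" "j \<le> n" "x j = v" using vertex_seg[OF v False] by blast
  have d: "dd (act T h u) (act T h w) = dd u w" if "u \<in> VT" "w \<in> VT" for u w
    using tdist_act[OF vpoint_points vpoint_points h] that point_act_vpoint[OF h] by simp
  have xv: "x 0 \<in> VT" "x n \<in> VT" "x j \<in> VT" using seg_verts[OF x(1)] x(2) by auto
  have "k (act T h v) = kp n (\<lambda>i. act T h (x i)) j" using k_seg[OF seg_act[OF x(1) h] x(2)] x(3) by simp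
  also have "\<dots> = ept (act T h (x 0)) (act T h (x n)) (dd (x 0) (x j) / dd (x 0) (x n))"
    using d xv by (simp add: kp_def)
  also have "\<dots> = point_act U h (kp n x j)"
    using U.point_act_ept[OF h, of "x 0" "x n"] segD(2,3)[OF x(1)] h by (simp add: kp_def)
  also have "kp n x j = k v" using k_seg[OF x(1,2)] x(3) by simp
  finally show ?thesis .
qed

lemma k_edge: assumes e: "{v, v'} \<in> ET" shows "tdist U (k v) (k v') \<le> len T {v, v'}"
proof -
  obtain n x j where x: "seg n x" "j < n" "x j = v" "x (Suc j) = v'" using seg_ex[OF e] by blast
  have eU: "{x 0, x n} \<in> sedges U" using x(1) unfolding U_edges by blast
  have "tdist U (kp n x j) (kp n x (Suc j)) \<le> len U {x 0, x n} * edist {x 0, x n} (kp n x j) (kp n x (Suc j))"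
    using U.tdist_edge[OF eU kp_points(2)[OF x(1)] kp_points(2)[OF x(1)], of j "Suc j"] x(2) by simp
  also have "\<dots> = dd (x 0) (x n) * \<bar>dd (x 0) (x j) / dd (x 0) (x n) - dd (x 0) (x (Suc j)) / dd (x 0) (x n)\<bar>"
    using U_len[OF x(1)] edist_ept[OF segD(8)[OF x(1)]] by (simp add: kp_def)
  also have "\<dots> = \<bar>dd (x 0) (x j) - dd (x 0) (x (Suc j))\<bar>"
    using seg_dist_pos[OF x(1)] by (simp add: diff_divide_distrib[symmetric] abs_divide)
  also have "\<dots> = len T {v, v'}"
    using seg_dist[OF x(1), of 0 j] seg_dist[OF x(1), of 0 "Suc j"] x len_nonneg[OF e] by simp
  finally show ?thesis using k_seg[OF x(1), of j] k_seg[OF x(1), of "Suc j"] x by simp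
qed

text \<open>The two realisations describe the same metric space, but constants arbitrarily close to
  1 suffice for the comparison, and \<open>edge_extension\<close> gives these from the vertex map
  \<open>k\<close>. The converse direction \<open>from_U\<close> starts from the inclusion of
  \<open>W\<close>.\<close>

lemma into_U:
  assumes \<epsilon>: "0 < \<epsilon>"
  obtains f where "\<And>p. p \<in> PT \<Longrightarrow> f p \<in> points U"
    "\<And>h p. h \<in> carrier G \<Longrightarrow> p \<in> PT \<Longrightarrow> f (point_act T h p) = point_act U h (f p)"
    "\<And>p q. p \<in> PT \<Longrightarrow> q \<in> PT \<Longrightarrow> tdist U (f p) (f q) \<le> (1 + \<epsilon>) * tdist T p q"
proof -
  have "tdist U (k u) (k w) \<le> 1 * len T {u, w}" if "{u, w} \<in> ET" for u w using k_edge[OF that] by simp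
  from edge_extension[OF mgraph_axioms U_graph k_points k_act this, of "1 + \<epsilon>"] \<epsilon> obtain f where
    f: "\<forall>p\<in>PT. f p \<in> points U" "\<forall>g\<in>carrier G. \<forall>p\<in>PT. f (point_act T g p) = point_act U g (f p)"
    "\<forall>e\<in>ET. \<forall>p\<in>closed_edge e. \<forall>q\<in>closed_edge e. tdist U (f p) (f q) \<le> (1 + \<epsilon>) * len T e * edist e p q"
    by auto
  have "tdist U (f p) (f q) \<le> (1 + \<epsilon>) * tdist T p q" if "p \<in> PT" "q \<in> PT" for p q
    using edge_lipschitz[OF mgraph_axioms U_graph, of "1 + \<epsilon>" f p q] f \<epsilon> that by simp
  with f show thesis by (intro that[of f]) auto
qed

lemma from_U:
  assumes \<epsilon>: "0 < \<epsilon>"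
  obtains f where "\<And>p. p \<in> points U \<Longrightarrow> f p \<in> PT"
    "\<And>h p. h \<in> carrier G \<Longrightarrow> p \<in> points U \<Longrightarrow> f (point_act U h p) = point_act T h (f p)"
    "\<And>p q. p \<in> points U \<Longrightarrow> q \<in> points U \<Longrightarrow> tdist T (f p) (f q) \<le> (1 + \<epsilon>) * tdist U p q"
proof -
  have "dd u w \<le> 1 * len U {u, w}" if e: "{u, w} \<in> sedges U" for u w
    using U_edgeE[OF e] U_len by (metis mult_1 order_refl)
  moreover have "vpoint v \<in> PT" if "v \<in> sverts U" for v using that W_sub vpoint_points by auto
  moreover have "vpoint (act U h v) = point_act T h (vpoint v)" if "h \<in> carrier G" "v \<in> sverts U" for h v
    using that W_sub point_act_vpoint by auto
  ultimately obtain f where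
    f: "\<forall>p\<in>points U. f p \<in> PT" "\<forall>g\<in>carrier G. \<forall>p\<in>points U. f (point_act U g p) = point_act T g (f p)"
    "\<forall>e\<in>sedges U. \<forall>p\<in>closed_edge e. \<forall>q\<in>closed_edge e. tdist T (f p) (f q) \<le> (1 + \<epsilon>) * len U e * edist e p q"
    using edge_extension[OF U_graph mgraph_axioms, of vpoint 1 "1 + \<epsilon>"] \<epsilon> by auto
  have "tdist T (f p) (f q) \<le> (1 + \<epsilon>) * tdist U p q" if "p \<in> points U" "q \<in> points U" for p q
    using edge_lipschitz[OF U_graph mgraph_axioms, of "1 + \<epsilon>" f p q] f \<epsilon> that by simp
  with f show thesis by (intro that[of f]) auto
qed

text \<open>The length of a coarse edge is divided evenly among the edges of its segment. This is
  well defined because a segment is determined by any of its edges up to reversal.\<close>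

lemma refine_length:
  assumes lam: "\<And>e. e \<in> sedges U \<Longrightarrow> 0 < lam e" "\<And>h e. h \<in> carrier G \<Longrightarrow> e \<in> sedges U \<Longrightarrow> lam (act U h ` e) = lam e"
  obtains l where "equivariant_length G (T\<lparr>len := l\<rparr>)"
    "\<And>n x. seg n x \<Longrightarrow> (\<Sum>i=0..<n. l {x i, x (Suc i)}) = lam {x 0, x n}"
proof -
  define l where "l e = (SOME r. \<exists>n x j. seg n x \<and> j < n \<and> e = {x j, x (Suc j)} \<and> r = lam {x 0, x n} / real n)" for e
  have l: "l {x j, x (Suc j)} = lam {x 0, x n} / real n" if x: "seg n x" "j < n" for n x j
  proof -
    have "\<exists>r n' x' j'. seg n' x' \<and> j' < n' \<and> {x j, x (Suc j)} = {x' j', x' (Suc j')} \<and> r = lam {x' 0, x' n'} / real n'"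
      using x by blast
    from someI_ex[OF this] obtain n' x' j' where *: "seg n' x'" "j' < n'" "{x j, x (Suc j)} = {x' j', x' (Suc j')}"
      "l {x j, x (Suc j)} = lam {x' 0, x' n'} / real n'" unfolding l_def by blast
    thus ?thesis using seg_edge_unique[OF x(1) *(1) x(2) *(2,3)] by simp
  qed
  show thesis
  proof (rule that[of l])
    show "equivariant_length G (T\<lparr>len := l\<rparr>)"
      unfolding equivariant_length_def
    proof (intro ballI conjI)
      fix e assume "e \<in> sedges (T\<lparr>len := l\<rparr>)"
      hence e: "e \<in> ET" by simp
      obtain a b where ab: "e = {a, b}" using edge_obtain[OF e] by metis
      obtain n x j where x: "seg n x" "j < n" "x j = a" "x (Suc j) = b" using seg_ex[of a b] e ab by blast
      have eU: "{x 0, x n} \<in> sedges U" using x(1) unfolding U_edges by blast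
      have le: "l e = lam {x 0, x n} / real n" using l[OF x(1,2)] x ab by simp
      thus "0 < len (T\<lparr>len := l\<rparr>) e" using lam(1)[OF eU] segD(1)[OF x(1)] by simp
      fix h assume h: "h \<in> carrier G"
      have "l (act T h ` e) = lam {act T h (x 0), act T h (x n)} / real n" using l[OF seg_act[OF x(1) h] x(2)] x ab by simp
      also have "{act T h (x 0), act T h (x n)} = act U h ` {x 0, x n}" using segD(2,3)[OF x(1)] h by simp
      finally show "len (T\<lparr>len := l\<rparr>) (act (T\<lparr>len := l\<rparr>) h ` e) = len (T\<lparr>len := l\<rparr>) e" using lam(2)[OF h eU] le by simp
    qed
    show "(\<Sum>i=0..<n. l {x i, x (Suc i)}) = lam {x 0, x n}" if x: "seg n x" for n x
    proof -
      have "(\<Sum>i=0..<n. l {x i, x (Suc i)}) = (\<Sum>i=0..<n. lam {x 0, x n} / real n)" by (rule sum.cong) (use l[OF x] in auto)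
      thus ?thesis using segD(1)[OF x] by simp
    qed
  qed
qed

end

lemma tdist_cong:
  assumes "sedges T = sedges T'" "\<And>e. e \<in> sedges T \<Longrightarrow> len T e = len T' e" "\<And>e. e \<in> sedges T \<Longrightarrow> 0 \<le> len T e"
  shows "tdist T p q = tdist T' p q"
proof -
  have "ch (sedges T) (len T) p q s \<longleftrightarrow> ch (sedges T') (len T') p q s" for s
    using ch_mono_len[of "sedges T" "len T" p q s "sedges T'" "len T'" 1]
      ch_mono_len[of "sedges T'" "len T'" p q s "sedges T" "len T" 1] assms by auto
  moreover have "0 \<le> len T' e" if "e \<in> sedges T'" for e using assms that by metis
  ultimately show ?thesis using tdist_eq[of T p q, OF assms(3)] tdist_eq[of T' p q] by simp
qed

section \<open>The components of the core as trees in their own right\<close>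

locale core_piece = sgtree G T A for G :: "'h monoid" (structure) and T :: "('h, 'v) mtree" and A :: "'v sgraph" +
  fixes P :: "'v set"
  assumes P_comp: "P \<in> component (core G T A) ` sverts (core G T A)"
    and vorb: "\<exists>V0. finite V0 \<and> V0 \<subseteq> sverts T \<and> (\<forall>v\<in>sverts T. \<exists>h\<in>carrier G. \<exists>v0\<in>V0. v = act T h v0)"
begin

sublocale Cr: sgtree G T Cr using core_subgraph by unfold_locales

abbreviation H :: "'h monoid" where "H \<equiv> G\<lparr>carrier := set_stab G T P\<rparr>"

definition TP :: "('v set \<Rightarrow> real) \<Rightarrow> ('h, 'v) mtree" where
  "TP l = \<lparr>sverts = P, sedges = {e \<in> sedges Cr. e \<subseteq> P}, act = (\<lambda>h. restrict (act T h) P), len = l\<rparr>"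

lemma TP_sel [simp]: "sverts (TP l) = P" "sedges (TP l) = {e \<in> sedges Cr. e \<subseteq> P}" "len (TP l) = l"
  "v \<in> P \<Longrightarrow> act (TP l) h v = act T h v"
  by (simp_all add: TP_def)

lemma P_root: obtains v where "v \<in> sverts Cr" "P = component Cr v"
  using P_comp by auto

lemma P_sub_Cr: "P \<subseteq> sverts Cr"
proof
  obtain v where v: "v \<in> sverts Cr" "P = component Cr v" using P_root .
  fix w assume "w \<in> P"
  hence "joined (sedges Cr) v w" using v by simp
  moreover have "b \<in> sverts Cr" if "{a, b} \<in> sedges Cr" for a b
    using core_subgraph that unfolding subgraph_of_def by blast
  ultimately show "w \<in> sverts Cr" using adj_vertex_transfer[OF _ v(1)] by blast
qed

lemma P_sub: "P \<subseteq> VT" using P_sub_Cr Cr.A_vert by auto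

lemma P_ne: "P \<noteq> {}" using P_root by (metis empty_iff Cr.comp_self)

lemma P_of: "v \<in> P \<Longrightarrow> component Cr v = P"
  using P_root component_eqI in_component by metis

lemma P_convex: "convex_verts P" "{e \<in> ET. e \<subseteq> P} = {e \<in> sedges Cr. e \<subseteq> P}"
proof -
  obtain v where v: "v \<in> sverts Cr" "P = component Cr v" using P_root .
  have vT: "v \<in> VT" using Cr.A_vert v by simp
  show "convex_verts P" using Cr.convex_comp(1)[OF vT] v by simp
  show "{e \<in> ET. e \<subseteq> P} = {e \<in> sedges Cr. e \<subseteq> P}" using Cr.convex_comp(2)[OF vT] v Cr.A_edge by auto
qed

lemma H_in: "h \<in> set_stab G T P \<Longrightarrow> h \<in> carrier G" and H_img: "h \<in> set_stab G T P \<Longrightarrow> act T h ` P = P"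
  by (auto simp: set_stab_def)

lemma H_act: "h \<in> set_stab G T P \<Longrightarrow> v \<in> P \<Longrightarrow> act T h v \<in> P" using H_img by blast

text \<open>\<open>P\<close> is a full component, so a translate of \<open>P\<close> that meets
  \<open>P\<close> is \<open>P\<close>.\<close>

lemma H_iff: assumes h: "h \<in> carrier G" and v: "v \<in> P" shows "h \<in> set_stab G T P \<longleftrightarrow> act T h v \<in> P"
proof
  assume "act T h v \<in> P"
  hence "act T h ` P = P" using Cr.comp_act[OF h, of v] P_of v P_sub by (metis subsetD)
  thus "h \<in> set_stab G T P" using h by (simp add: set_stab_def)
qed (use H_img v in blast)

lemma H_subgroup: "subgroup (set_stab G T P) G"
proof -
  interpret group G by (rule grp)
  obtain v where v: "v \<in> P" using P_ne by blast
  hence vT: "v \<in> VT" using P_sub by blast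
  show ?thesis
  proof
    show "set_stab G T P \<subseteq> carrier G" using H_in by blast
    show "\<one> \<in> set_stab G T P" using H_iff[OF one_in v] act_one[OF vT] v by simp
    show "x \<otimes> y \<in> set_stab G T P" if "x \<in> set_stab G T P" "y \<in> set_stab G T P" for x y
      using H_iff[of "x \<otimes> y", OF _ v] act_mult[of x y v] H_in H_img that v vT by (metis imageI m_closed)
    show "inv x \<in> set_stab G T P" if x: "x \<in> set_stab G T P" for x
    proof -
      obtain w where w: "w \<in> P" "act T x w = v" using H_img[OF x] v by (metis imageE)
      hence "act T (inv x) v = w" using act_inv_act[OF H_in[OF x]] P_sub by blast
      thus ?thesis using H_iff[of "inv x", OF _ v] w H_in[OF x] by simp
    qed
  qed
qed

lemma H_group: "group H"
  using subgroup.subgroup_is_group[OF H_subgroup grp] .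

definition piece_len :: "('v set \<Rightarrow> real) \<Rightarrow> bool" where
  "piece_len l \<longleftrightarrow> (\<forall>e\<in>sedges Cr. e \<subseteq> P \<longrightarrow> 0 < l e \<and> (\<forall>h\<in>set_stab G T P. l (act T h ` e) = l e))"

lemma act_TP: "e \<subseteq> P \<Longrightarrow> act (TP l) h ` e = act T h ` e"
  by (rule image_cong) auto

lemma piece_len_iff: "piece_len l \<longleftrightarrow> equivariant_length H (TP l)"
  by (auto simp: piece_len_def equivariant_length_def act_TP)

lemma TP_conn: assumes "u \<in> P" "w \<in> P" shows "joined (sedges (TP l)) u w"
  using P_convex assms by (simp add: convex_verts_def)

lemma TP_tree: assumes l: "piece_len l" shows "mtree H (TP l)"
proof (intro mtree.intro mgraph.intro mtree_axioms.intro)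
  show "group H" by (rule H_group)
  show "act (TP l) h v \<in> sverts (TP l)" if "h \<in> carrier H" "v \<in> sverts (TP l)" for h v using that H_img by auto
  show "act (TP l) \<one>\<^bsub>H\<^esub> v = v" if "v \<in> sverts (TP l)" for v using that act_one P_sub by auto
  show "act (TP l) (g \<otimes>\<^bsub>H\<^esub> h) v = act (TP l) g (act (TP l) h v)"
    if "g \<in> carrier H" "h \<in> carrier H" "v \<in> sverts (TP l)" for g h v
    using that act_mult[of g h v] H_in H_act[of h v] P_sub by auto
  show "card e = 2" "e \<subseteq> sverts (TP l)" if "e \<in> sedges (TP l)" for e using that edge_card Cr.A_edge by auto
  show "act (TP l) h ` e \<in> sedges (TP l)" if "h \<in> carrier H" "e \<in> sedges (TP l)" for h e
    using that Cr.A_act[OF H_in] H_act[of h] act_TP[of e l h] by auto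
  show "0 < len (TP l) e" if "e \<in> sedges (TP l)" for e using l that by (simp add: piece_len_def)
  show "len (TP l) (act (TP l) h ` e) = len (TP l) e" if "h \<in> carrier H" "e \<in> sedges (TP l)" for h e
    using l that act_TP[of e l h] by (simp add: piece_len_def)
  show "h = \<one>\<^bsub>H\<^esub>" if "h \<in> carrier H" "e \<in> sedges (TP l)" "act (TP l) h ` e = e" for h e
    using that edge_free[OF H_in, of h e] Cr.A_edge act_TP[of e l h] by auto
  show "joined (sedges (TP l)) u w" if "u \<in> sverts (TP l)" "w \<in> sverts (TP l)" for u w
    using TP_conn that by simp
  show "edge_tree (sedges (TP l))" by (rule edge_tree_mono[OF tree]) (use Cr.A_edge in auto)
qed

definition Wess :: "'v set" where "Wess = essential_vertices H (TP (len T))"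

lemma essential_TP: "essential_vertices H (TP l) = Wess"
proof -
  have "free_vertex H (TP l) = free_vertex H (TP (len T))" "valence (TP l) = valence (TP (len T))"
    "act (TP l) = act (TP (len T))"
    by (simp_all add: fun_eq_iff free_vertex_def valence_def TP_def)
  thus ?thesis by (simp only: Wess_def essential_vertices_def TP_sel(1))
qed

lemma free_TP: assumes v: "v \<in> P" shows "free_vertex H (TP l) v \<longleftrightarrow> (\<forall>h\<in>carrier G. act T h v = v \<longrightarrow> h = \<one>)"
proof -
  have "act T \<one> v = v" using act_one v P_sub by blast
  moreover have "h \<in> set_stab G T P" if "h \<in> carrier G" "act T h v = v" for h using H_iff[OF that(1) v] that v by simp
  ultimately show ?thesis using v H_in one_in by (auto simp: free_vertex_def stabilizer_def)
qed

text \<open>Two cases follow the definition of \<open>essential_vertices\<close>: normally all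
  vertices other than free ones of valence two are kept, and if there are none, one orbit is.
  Invariance in the first case holds because \<open>h\<close> conjugates stabilisers and permutes
  the edges.\<close>

lemma Wess: "Wess \<subseteq> P" "Wess \<noteq> {}" "h \<in> set_stab G T P \<Longrightarrow> v \<in> Wess \<Longrightarrow> act T h v \<in> Wess"
  "v \<in> P \<Longrightarrow> v \<notin> Wess \<Longrightarrow> free_vertex H (TP l) v \<and> valence (TP l) v = 2"
proof -
  let ?T = "TP (len T)"
  let ?W = "{v \<in> P. \<not> (free_vertex H ?T v \<and> valence ?T v = 2)}"
  have def: "Wess = (if ?W \<noteq> {} then ?W else vorbit H ?T (SOME v. v \<in> P))"
    by (simp only: Wess_def essential_vertices_def Let_def TP_sel(1))
  let ?v = "SOME v. v \<in> P"
  have v: "?v \<in> P" using P_ne some_in_eq by blast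
  have orb: "vorbit H ?T ?v = {act T h ?v | h. h \<in> set_stab G T P}"
    using v by (auto simp: Group_Action.orbit_def)
  interpret group G by (rule grp)
  have one: "\<one> \<in> set_stab G T P" using subgroup.one_closed[OF H_subgroup] .
  have o: "{act T h ?v | h. h \<in> set_stab G T P} \<subseteq> P" "{act T h ?v | h. h \<in> set_stab G T P} \<noteq> {}"
    using v H_act one by blast+
  show "Wess \<subseteq> P" unfolding def orb using o(1) by simp
  show "Wess \<noteq> {}" unfolding def orb using o(2) by simp
  have feq: "free_vertex H (TP l) = free_vertex H ?T" and veq: "valence (TP l) = valence ?T" for l
    by (simp_all add: fun_eq_iff free_vertex_def valence_def TP_def)
  have out: "free_vertex H ?T v \<and> valence ?T v = 2" if a: "v \<in> P" "v \<notin> Wess" for v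
  proof (cases "?W = {}")
    case True thus ?thesis using a(1) by blast
  next
    case False
    hence "Wess = ?W" using def by (simp only: if_True not_False_eq_True)
    thus ?thesis using a by blast
  qed
  show "free_vertex H (TP l) v \<and> valence (TP l) v = 2" if "v \<in> P" "v \<notin> Wess"
    unfolding feq[of l] veq[of l] by (rule out[OF that])
  show "act T h v \<in> Wess" if h: "h \<in> set_stab G T P" and w: "v \<in> Wess"
  proof (cases "?W = {}")
    case True
    hence We: "Wess = {act T h ?v | h. h \<in> set_stab G T P}" using def unfolding orb
      by (simp only: if_False simp_thms)
    then obtain g where g: "g \<in> set_stab G T P" "v = act T g ?v" using w by blast
    hence "act T h v = act T (h \<otimes> g) ?v"
      using act_mult[OF H_in[OF h] H_in[OF g(1)], of ?v] g(2) v P_sub by (simp add: subset_iff)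
    thus ?thesis using subgroup.m_closed[OF H_subgroup h g(1)] unfolding We by blast
  next
    case False
    hence We: "Wess = ?W" using def by (simp only: if_True not_False_eq_True)
    hence vW: "v \<in> P" "\<not> (free_vertex H ?T v \<and> valence ?T v = 2)" using w by blast+
    have hv: "act T h v \<in> P" using H_img[OF h] vW by blast
    have vT: "v \<in> VT" using vW P_sub by blast
    have hG: "h \<in> carrier G" using H_in h .
    have "free_vertex H ?T v" if f: "free_vertex H ?T (act T h v)"
      unfolding free_TP[OF vW(1)]
    proof (intro ballI impI)
      fix g assume g: "g \<in> carrier G" "act T g v = v"
      let ?k = "h \<otimes> g \<otimes> inv h"
      have "act T ?k (act T h v) = act T (h \<otimes> g) (act T (inv h) (act T h v))"
        using act_mult[of "h \<otimes> g" "inv h" "act T h v"] hG g act_closed[OF hG vT] by simp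
      also have "\<dots> = act T h v" using act_inv_act[OF hG vT] act_mult[OF hG g(1) vT] g by simp
      finally have "?k = \<one>" using f free_TP[OF hv] hG g by simp
      thus "g = \<one>" using conj_neq_one[OF hG g(1)] by blast
    qed
    moreover have "valence ?T v = valence ?T (act T h v)"
      unfolding valence_def
    proof (rule bij_betw_same_card[of "\<lambda>e. act T h ` e"], rule bij_betw_imageI)
      show "inj_on (\<lambda>e. act T h ` e) {e \<in> sedges ?T. v \<in> e}"
      proof (rule inj_onI)
        fix e e' assume a: "e \<in> {e \<in> sedges ?T. v \<in> e}" "e' \<in> {e \<in> sedges ?T. v \<in> e}" "act T h ` e = act T h ` e'"
        hence "e \<subseteq> VT" "e' \<subseteq> VT" using P_sub by auto
        thus "e = e'" using a(3) act_inj_on[OF hG] by (meson inj_on_image_eq_iff)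
      qed
      show "(\<lambda>e. act T h ` e) ` {e \<in> sedges ?T. v \<in> e} = {e \<in> sedges ?T. act T h v \<in> e}"
      proof (intro subset_antisym subsetI)
        fix e assume "e \<in> (\<lambda>e. act T h ` e) ` {e \<in> sedges ?T. v \<in> e}"
        then obtain d where "d \<in> sedges Cr" "d \<subseteq> P" "v \<in> d" "e = act T h ` d" by auto
        thus "e \<in> {e \<in> sedges ?T. act T h v \<in> e}" using Cr.A_act[OF hG] H_img[OF h] by auto
      next
        fix e assume "e \<in> {e \<in> sedges ?T. act T h v \<in> e}"
        hence e: "e \<in> sedges Cr" "e \<subseteq> P" "act T h v \<in> e" by auto
        let ?d = "act T (inv h) ` e"
        have "act T h ` ?d = e" using act_act_inv[OF hG] e(2) P_sub by (force simp: image_image)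
        moreover have "v \<in> ?d" using e(3) act_inv_act[OF hG vT] by (metis imageI)
        moreover have "?d \<in> sedges Cr" using Cr.A_act[of "inv h"] hG e by simp
        moreover have "?d \<subseteq> P" using H_img[OF subgroup.m_inv_closed[OF H_subgroup h]] e(2) by blast
        ultimately show "e \<in> (\<lambda>e. act T h ` e) ` {e \<in> sedges ?T. v \<in> e}" by (intro image_eqI[of _ _ ?d]) auto
      qed
    qed
    ultimately have "\<not> (free_vertex H ?T (act T h v) \<and> valence ?T (act T h v) = 2)" using vW(2) by auto
    thus ?thesis using hv unfolding We by blast
  qed
qed

text \<open>Finiteness of the orbits passes to the stabiliser of \<open>P\<close>: each orbit of the
  large group that meets \<open>P\<close> gets a representative inside \<open>P\<close>, and an
  element that carries it to another vertex of \<open>P\<close> stabilises \<open>P\<close> by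
  \<open>H_iff\<close>.\<close>

lemma TP_subdiv: assumes l: "piece_len l" shows "subdiv H (TP l) Wess"
proof (intro subdiv.intro TP_tree[OF l] subdiv_axioms.intro)
  show "Wess \<subseteq> sverts (TP l)" "Wess \<noteq> {}" using Wess by auto
  show "act (TP l) h v \<in> Wess" if "h \<in> carrier H" "v \<in> Wess" for h v
    using Wess(1) Wess(3)[of h v] that by (auto simp: subset_iff)
  show "h = \<one>\<^bsub>H\<^esub>" if "v \<in> sverts (TP l)" "v \<notin> Wess" "h \<in> carrier H" "act (TP l) h v = v" for v h
    using Wess(4)[of v l] free_TP[of v l] H_in that by simp
  show "valence (TP l) v = 2" if "v \<in> sverts (TP l)" "v \<notin> Wess" for v using Wess(4)[of v l] that by simp
  obtain V0 where V0: "finite V0" "V0 \<subseteq> VT" "\<forall>v\<in>VT. \<exists>h\<in>carrier G. \<exists>v0\<in>V0. v = act T h v0" using vorb by blast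
  define r where "r v0 = (SOME v. v \<in> P \<and> (\<exists>h\<in>carrier G. v = act T h v0))" for v0
  define V1 where "V1 = r ` {v0 \<in> V0. \<exists>v. v \<in> P \<and> (\<exists>h\<in>carrier G. v = act T h v0)}"
  have r: "r v0 \<in> P \<and> (\<exists>h\<in>carrier G. r v0 = act T h v0)" if "\<exists>v. v \<in> P \<and> (\<exists>h\<in>carrier G. v = act T h v0)" for v0
    using someI_ex[OF that] by (simp add: r_def)
  show "\<exists>V0. finite V0 \<and> V0 \<subseteq> sverts (TP l) \<and> (\<forall>v\<in>sverts (TP l). \<exists>h\<in>carrier H. \<exists>v0\<in>V0. v = act (TP l) h v0)"
  proof (intro exI[of _ V1] conjI ballI)
    show "finite V1" using V0 by (simp add: V1_def)
    show "V1 \<subseteq> sverts (TP l)" using r by (auto simp: V1_def)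
    fix v assume "v \<in> sverts (TP l)"
    hence v: "v \<in> P" by simp
    then obtain h v0 where h: "h \<in> carrier G" "v0 \<in> V0" "v = act T h v0" using V0(3) P_sub by blast
    hence ex: "\<exists>v. v \<in> P \<and> (\<exists>h\<in>carrier G. v = act T h v0)" using v by blast
    from r[OF ex] obtain g where g: "g \<in> carrier G" "r v0 = act T g v0" "r v0 \<in> P" by blast
    have v0: "v0 \<in> VT" using h V0 by blast
    have "act T (h \<otimes> inv g) (r v0) = v"
      using act_mult[OF h(1) inv_in[OF g(1)], of "r v0"] act_inv_act[OF g(1) v0] g h act_closed[OF g(1) v0] by simp
    moreover have "h \<otimes> inv g \<in> set_stab G T P" using H_iff[of "h \<otimes> inv g", OF _ g(3)] calculation v g h by simp
    moreover have "r v0 \<in> V1" using ex h by (auto simp: V1_def)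
    ultimately show "\<exists>h\<in>carrier H. \<exists>v0\<in>V1. v = act (TP l) h v0" using g(3) by (metis TP_sel(4) partial_object.select_convs(1) partial_object.surjective partial_object.update_convs(1))
  qed
qed

lemma TP_points: assumes "p \<in> points (TP l)"
  obtains u w t where "u \<in> P" "w \<in> P" "u = w \<or> {u, w} \<in> sedges Cr" "0 \<le> t" "t \<le> 1" "p = ept u w t"
proof -
  consider v where "v \<in> P" "p = vpoint v" | e where "e \<in> sedges Cr" "e \<subseteq> P" "p \<in> closed_edge e"
    using assms by (auto simp: points_def)
  thus thesis
  proof cases
    case 1 thus thesis using that[of v v 0] by simp
  next
    case 2
    obtain u w where uw: "e = {u, w}" "u \<noteq> w" using edge_obtain[OF Cr.A_edge[OF 2(1)]] by metis
    obtain t where "0 \<le> t" "t \<le> 1" "p = ept u w t" using closed_edgeE[OF 2(3)[unfolded uw(1)] uw(2)] .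
    thus thesis using that[of u w t] 2 uw by auto
  qed
qed

lemma TP_points_sub: "p \<in> points (TP l) \<Longrightarrow> p \<in> PT"
  using P_sub Cr.A_edge unfolding points_def by auto

lemma TP_points_proj: assumes "p \<in> PT" shows "push (proj P) p \<in> points (TP l)"
proof -
  obtain u w t where *: "u \<in> P" "w \<in> P" "u = w \<or> {u, w} \<in> ET" "0 \<le> t" "t \<le> 1" "push (proj P) p = ept u w t"
    using proj_push_points(2)[OF P_convex(1) assms] by blast
  show ?thesis
  proof (cases "u = w")
    case True thus ?thesis using * by (simp add: points_def)
  next
    case False
    hence "{u, w} \<in> {e \<in> ET. e \<subseteq> P}" using * by auto
    hence "{u, w} \<in> sedges (TP l)" using P_convex(2) by simp
    moreover have "push (proj P) p \<in> closed_edge {u, w}" using * ept_closed_edge[OF False] by simp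
    ultimately show ?thesis unfolding points_def by blast
  qed
qed

lemma TP_point_act: assumes l: "piece_len l" and h: "h \<in> set_stab G T P" and p: "p \<in> points (TP l)"
  shows "point_act (TP l) h p = point_act T h p"
  using p
proof (rule TP_points)
  fix u w t assume *: "u \<in> P" "w \<in> P" "p = ept u w t"
  interpret t: mtree H "TP l" by (rule TP_tree[OF l])
  show ?thesis using t.point_act_ept[of h u w t] point_act_ept[OF H_in[OF h], of u w t] * h P_sub by (simp add: subset_iff)
qed

lemma tdist_TP_ge:
  assumes l: "piece_len l" and T': "mgraph G (T\<lparr>len := l'\<rparr>)" and eq: "\<And>e. e \<in> sedges Cr \<Longrightarrow> e \<subseteq> P \<Longrightarrow> l' e = l e"
    and p: "p \<in> points (TP l)" and q: "q \<in> points (TP l)"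
  shows "tdist (T\<lparr>len := l'\<rparr>) p q \<le> tdist (TP l) p q"
proof -
  interpret t: mtree H "TP l" by (rule TP_tree[OF l])
  interpret T': mgraph G "T\<lparr>len := l'\<rparr>" by (rule T')
  show ?thesis
  proof (rule t.tdist_geI[OF p q])
    fix s assume "ch (sedges (TP l)) (len (TP l)) p q s"
    hence "ch (sedges (T\<lparr>len := l'\<rparr>)) (len (T\<lparr>len := l'\<rparr>)) p q (1 * s)"
      by (rule ch_mono_len) (use eq Cr.A_edge in auto)
    thus "tdist (T\<lparr>len := l'\<rparr>) p q \<le> s" using T'.tdist_leI by simp
  qed
qed

lemma tdist_TP_proj:
  assumes l: "piece_len l" and T': "mgraph G (T\<lparr>len := l'\<rparr>)" and eq: "\<And>e. e \<in> sedges Cr \<Longrightarrow> e \<subseteq> P \<Longrightarrow> l' e = l e"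
    and p: "p \<in> PT" and q: "q \<in> PT"
  shows "tdist (TP l) (push (proj P) p) (push (proj P) q) \<le> tdist (T\<lparr>len := l'\<rparr>) p q"
proof -
  interpret t: mtree H "TP l" by (rule TP_tree[OF l])
  interpret T': mgraph G "T\<lparr>len := l'\<rparr>" by (rule T')
  show ?thesis
  proof (rule T'.tdist_geI)
    fix s assume "ch (sedges (T\<lparr>len := l'\<rparr>)) (len (T\<lparr>len := l'\<rparr>)) p q s"
    hence "ch {e \<in> ET. e \<subseteq> P} l' (push (proj P) p) (push (proj P) q) s"
      using T'.len_nonneg by (intro ch_proj[OF P_convex(1)]) auto
    hence "ch (sedges (TP l)) (len (TP l)) (push (proj P) p) (push (proj P) q) (1 * s)"
      by (rule ch_mono_len) (use eq P_convex(2) in auto)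
    thus "tdist (TP l) (push (proj P) p) (push (proj P) q) \<le> s" using t.tdist_leI by simp
  qed (use p q in simp_all)
qed

end

locale core_system = collapse_system S \<phi> X A for S :: "('i, 'h) splitting" and \<phi> and X :: "('i, 'h, 'v) forest" and A +
  fixes J :: "('i \<times> 'v set) set" and \<psi> :: "('i \<times> 'v set, 'h) system_map"
  assumes reps: "core_representatives S X A J"
    and ind: "induced_on_core S \<phi> X J \<psi>"
    and vorbits: "i \<in> idx S \<Longrightarrow> \<exists>V0. finite V0 \<and> V0 \<subseteq> sverts (X i) \<and>
      (\<forall>v\<in>sverts (X i). \<exists>h\<in>carrier (grp S i). \<exists>v0\<in>V0. v = act (X i) h v0)"
begin

abbreviation CS :: "('i \<times> 'v set, 'h) splitting" where "CS \<equiv> core_splitting S X J"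
abbreviation CF :: "('i \<times> 'v set, 'h, 'v) forest" where "CF \<equiv> core_forest S X A J"
abbreviation CrX :: "'i \<Rightarrow> 'v sgraph" where "CrX i \<equiv> core (grp S i) (X i) (A i)"
abbreviation CV :: "'i \<Rightarrow> 'v set" where "CV i \<equiv> sverts (CrX i)"
abbreviation CE :: "'i \<Rightarrow> 'v set set" where "CE i \<equiv> sedges (CrX i)"
abbreviation Gj :: "'i \<times> 'v set \<Rightarrow> 'h monoid" where "Gj j \<equiv> grp S (fst j)"
abbreviation Gn :: "'i \<times> 'v set \<Rightarrow> 'h monoid" where "Gn j \<equiv> grp S (\<sigma> (fst j))"
abbreviation tp :: "'i \<times> 'v set \<Rightarrow> ('v set \<Rightarrow> real) \<Rightarrow> ('h, 'v) mtree" where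
  "tp j \<equiv> core_piece.TP (Gj j) (X (fst j)) (A (fst j)) (snd j)"
abbreviation wes :: "'i \<times> 'v set \<Rightarrow> 'v set" where
  "wes j \<equiv> core_piece.Wess (Gj j) (X (fst j)) (A (fst j)) (snd j)"
abbreviation plen :: "'i \<times> 'v set \<Rightarrow> ('v set \<Rightarrow> real) \<Rightarrow> bool" where
  "plen j \<equiv> core_piece.piece_len (Gj j) (X (fst j)) (A (fst j)) (snd j)"
abbreviation stb :: "'i \<times> 'v set \<Rightarrow> 'h set" where "stb j \<equiv> set_stab (grp S (fst j)) (X (fst j)) (snd j)"
abbreviation nx :: "'i \<times> 'v set \<Rightarrow> 'i \<times> 'v set" where "nx \<equiv> perm \<psi>"

lemma J_idx: "j \<in> J \<Longrightarrow> fst j \<in> idx S" and J_comp: "j \<in> J \<Longrightarrow> snd j \<in> component (CrX (fst j)) ` CV (fst j)"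
  using reps by (auto simp: core_representatives_def core_components_def Let_def)

lemma piece: "j \<in> J \<Longrightarrow> core_piece (Gj j) (X (fst j)) (A (fst j)) (snd j)"
  using ctree.axioms(1)[OF ct[OF J_idx]] J_comp vorbits[OF J_idx]
  by (simp add: core_piece_def core_piece_axioms_def)

lemma CS_sel [simp]: "idx CS = J" "grp CS j = (Gj j)\<lparr>carrier := stb j\<rparr>"
  by (simp_all add: core_splitting_def case_prod_beta)

lemma CF_eq: "j \<in> J \<Longrightarrow> CF j = coarsen (wes j) (tp j (len (X (fst j))))"
  using core_piece.TP_def[OF piece] core_piece.essential_TP[OF piece]
  by (simp add: core_forest_def unsubdivide_coarsen case_prod_beta)

lemma coarsen_update:
  "j \<in> J \<Longrightarrow> coarsen (wes j) (tp j l) = (CF j)\<lparr>len := len (coarsen (wes j) (tp j l))\<rparr>"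
  by (simp add: CF_eq coarsen_def is_path_def core_piece.TP_def[OF piece])

lemma \<psi>_perm: "j \<in> J \<Longrightarrow> nx j \<in> J"
  using ind by (auto simp: induced_on_core_def Aut_def bij_betw_def)

lemma \<psi>_fst: "j \<in> J \<Longrightarrow> fst (nx j) = \<sigma> (fst j)"
  using ind by (cases j) (auto simp: induced_on_core_def)

lemma \<psi>_aut: "aut_system CS \<psi>"
proof (rule aut_system.intro)
  fix j assume "j \<in> idx CS"
  hence j: "j \<in> J" by simp
  show "group (grp CS j)" using core_piece.H_group[OF piece[OF j]] by simp
  show "nx j \<in> idx CS" using \<psi>_perm[OF j] by simp
  have "maps \<psi> j \<in> iso (grp CS j) (grp CS (nx j))" using ind j by (simp add: induced_on_core_def Aut_def)
  thus "maps \<psi> j \<in> hom (grp CS j) (grp CS (nx j))" "inj_on (maps \<psi> j) (carrier (grp CS j))"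
    by (auto simp: iso_def bij_betw_def)
qed

sublocale psi: aut_system CS \<psi> by (rule \<psi>_aut)

lemma \<psi>_stb: "j \<in> J \<Longrightarrow> s \<in> stb j \<Longrightarrow> maps \<psi> j s \<in> stb (nx j)"
  using psi.maps_in[of j s] by simp

text \<open>The element by which \<psi> and \<phi> differ on the piece \<open>j\<close>. Translation
  by it converts maps equivariant for \<psi> into maps equivariant for \<phi>, and its inverse does
  the opposite.\<close>

definition kk :: "'i \<times> 'v set \<Rightarrow> 'h" where
  "kk j = (SOME h. h \<in> Gc (\<sigma> (fst j)) \<and> (\<forall>g\<in>stb j. maps \<psi> j g =
     inv\<^bsub>Gn j\<^esub> h \<otimes>\<^bsub>Gn j\<^esub> \<theta> (fst j) g \<otimes>\<^bsub>Gn j\<^esub> h))"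

lemma kk: assumes "j \<in> J"
  shows "kk j \<in> Gc (\<sigma> (fst j))"
    "g \<in> stb j \<Longrightarrow> maps \<psi> j g =
      inv\<^bsub>Gn j\<^esub> (kk j) \<otimes>\<^bsub>Gn j\<^esub> \<theta> (fst j) g \<otimes>\<^bsub>Gn j\<^esub> kk j"
proof -
  have "\<exists>h. h \<in> Gc (\<sigma> (fst j)) \<and> (\<forall>g\<in>stb j. maps \<psi> j g =
     inv\<^bsub>Gn j\<^esub> h \<otimes>\<^bsub>Gn j\<^esub> \<theta> (fst j) g \<otimes>\<^bsub>Gn j\<^esub> h)"
    using ind assms unfolding induced_on_core_def by (cases j) (simp only: fst_conv snd_conv, blast)
  from someI_ex[OF this] show "kk j \<in> Gc (\<sigma> (fst j))"
    "g \<in> stb j \<Longrightarrow> maps \<psi> j g =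
      inv\<^bsub>Gn j\<^esub> (kk j) \<otimes>\<^bsub>Gn j\<^esub> \<theta> (fst j) g \<otimes>\<^bsub>Gn j\<^esub> kk j"
    unfolding kk_def by blast+
qed

lemma kk_inv: assumes j: "j \<in> J" and s: "s \<in> stb j"
  shows "maps \<psi> j s \<otimes>\<^bsub>Gn j\<^esub> inv\<^bsub>Gn j\<^esub> (kk j) =
      inv\<^bsub>Gn j\<^esub> (kk j) \<otimes>\<^bsub>Gn j\<^esub> \<theta> (fst j) s"
    "kk j \<otimes>\<^bsub>Gn j\<^esub> maps \<psi> j s = \<theta> (fst j) s \<otimes>\<^bsub>Gn j\<^esub> kk j"
proof -
  interpret G: group "Gn j" using group_S[OF perm[OF J_idx[OF j]]] .
  have sG: "\<theta> (fst j) s \<in> Gc (\<sigma> (fst j))" using maps_in[OF J_idx[OF j]] s by (simp add: set_stab_def)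
  note k = kk(1)[OF j] kk(2)[OF j s]
  show "maps \<psi> j s \<otimes>\<^bsub>Gn j\<^esub> inv\<^bsub>Gn j\<^esub> (kk j) =
      inv\<^bsub>Gn j\<^esub> (kk j) \<otimes>\<^bsub>Gn j\<^esub> \<theta> (fst j) s"
    unfolding k(2) using k(1) sG by (simp add: G.m_assoc)
  show "kk j \<otimes>\<^bsub>Gn j\<^esub> maps \<psi> j s = \<theta> (fst j) s \<otimes>\<^bsub>Gn j\<^esub> kk j"
    unfolding k(2) using k(1) sG by (simp add: G.m_assoc[symmetric])
qed

lemma slack:
  assumes "0 \<le> L'" "L' < (L :: real)"
  obtains \<epsilon> where "0 < \<epsilon>" "(1 + \<epsilon>) * L' < L"
proof -
  \<comment> \<open>With this value \<open>\<epsilon> * L'\<close> is at most half of the gap; the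
    summand 1 permits \<open>L' = 0\<close>.\<close>
  define \<epsilon> where "\<epsilon> = (L - L') / (2 * (L' + 1))"
  have "0 < \<epsilon>" using assms by (simp add: \<epsilon>_def)
  moreover have "\<epsilon> * L' \<le> \<epsilon> * (L' + 1)" using calculation by simp
  moreover have "\<epsilon> * (L' + 1) = (L - L') / 2" using assms by (simp add: \<epsilon>_def field_simps)
  ultimately have "(1 + \<epsilon>) * L' < L" using assms by (simp add: algebra_simps)
  with \<open>0 < \<epsilon>\<close> show thesis by (rule that)
qed

text \<open>Projection to a subtree stretches nothing and commutes with the stabiliser of the
  subtree. So any equivariant map of \<open>Z\<close>, projected to the pieces, keeps its constant,
  and passing to the coarse structure multiplies it by \<open>1 + \<epsilon>\<close> only.\<close>

lemma core_displacement_le_aux: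
  assumes Z: "Z \<in> open_simplex S X" and less: "disp Z < ereal L"
  shows "simplex_displacement CS \<psi> CF \<le> ereal L"
proof -
  have Zi: "Z i = (X i)\<lparr>len := len (Z i)\<rparr>" "equivariant_length (grp S i) (Z i)" if "i \<in> idx S" for i
    using Z that by (auto simp: open_simplex_def)
  have Z_tree: "mtree (grp S i) (Z i)" if i: "i \<in> idx S" for i
    using mtree_len[OF X_tree[OF i], of "len (Z i)"] Zi[OF i] by simp
  have Z_graph: "mgraph (grp S i) (Z i)" if "i \<in> idx S" for i using Z_tree[OF that] by (simp add: mtree_def)
  have Z_graph': "mgraph (grp S i) ((X i)\<lparr>len := len (Z i)\<rparr>)" if "i \<in> idx S" for i using Z_graph Zi(1) that by metis
  have Zs: "sverts (Z i) = XV i" "sedges (Z i) = XE i" "act (Z i) = act (X i)"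
    "points (Z i) = XP i" "point_act (Z i) = point_act (X i)" "tdist (Z i) = tdist ((X i)\<lparr>len := len (Z i)\<rparr>)" if "i \<in> idx S" for i
    by (subst Zi(1)[OF that], simp)+
  obtain L' where L': "disp Z < ereal L'" "L' < L" using ereal_dense2[OF less] by auto
  obtain f where f:
    "\<And>i. i \<in> idx S \<Longrightarrow> 0 \<le> L'"
    "\<And>i p. i \<in> idx S \<Longrightarrow> p \<in> points (Z i) \<Longrightarrow> f i p \<in> points (Z (\<sigma> i))"
    "\<And>i h p. i \<in> idx S \<Longrightarrow> h \<in> Gc i \<Longrightarrow> p \<in> points (Z i) \<Longrightarrow>
      f i (point_act (Z i) h p) = tw Z i h (f i p)"
    "\<And>i p q. i \<in> idx S \<Longrightarrow> p \<in> points (Z i) \<Longrightarrow> q \<in> points (Z i) \<Longrightarrow>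
      tdist (Z (\<sigma> i)) (f i p) (f i q) \<le> L' * tdist (Z i) p q"
    using displacement_lessD[OF L'(1) Z_graph] by blast
  have L0: "0 \<le> L'" using f(1) ne_idx by blast
  obtain \<epsilon> where \<epsilon>: "0 < \<epsilon>" "(1 + \<epsilon>) * L' < L" using slack[OF L0 L'(2)] .
  define l where "l j = len (Z (fst j))" for j :: "'i \<times> 'v set"
  define UZ where "UZ j = coarsen (wes j) (tp j (l j))" for j
  have pl: "plen j (l j)" if j: "j \<in> J" for j
  proof -
    interpret c: core_piece "Gj j" "X (fst j)" "A (fst j)" "snd j" by (rule piece[OF j])
    show ?thesis using Zi(2)[OF J_idx[OF j]] Zs[OF J_idx[OF j]] c.Cr.A_edge c.H_in
      by (simp add: c.piece_len_def equivariant_length_def l_def)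
  qed
  have sd: "subdiv (grp CS j) (tp j (l j)) (wes j)" if j: "j \<in> J" for j
    using core_piece.TP_subdiv[OF piece[OF j] pl[OF j]] by simp
  have UZ_graph: "mgraph (grp CS j) (UZ j)" if "j \<in> idx CS" for j
    using subdiv.U_graph[OF sd] that by (simp add: UZ_def)
  have "\<exists>\<kappa>. \<forall>j\<in>J. (\<forall>p\<in>points (tp j (l j)). \<kappa> j p \<in> points (UZ j)) \<and>
     (\<forall>h\<in>stb j. \<forall>p\<in>points (tp j (l j)). \<kappa> j (point_act (tp j (l j)) h p) = point_act (UZ j) h (\<kappa> j p)) \<and>
     (\<forall>p\<in>points (tp j (l j)). \<forall>q\<in>points (tp j (l j)). tdist (UZ j) (\<kappa> j p) (\<kappa> j q) \<le> (1 + \<epsilon>) * tdist (tp j (l j)) p q)"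
  proof (rule bchoice, rule ballI)
    fix j assume j: "j \<in> J"
    from subdiv.into_U[OF sd[OF j] \<epsilon>(1)] obtain g where "\<And>p. p \<in> points (tp j (l j)) \<Longrightarrow> g p \<in> points (UZ j)"
      "\<And>h p. h \<in> carrier (grp CS j) \<Longrightarrow> p \<in> points (tp j (l j)) \<Longrightarrow> g (point_act (tp j (l j)) h p) = point_act (UZ j) h (g p)"
      "\<And>p q. p \<in> points (tp j (l j)) \<Longrightarrow> q \<in> points (tp j (l j)) \<Longrightarrow> tdist (UZ j) (g p) (g q) \<le> (1 + \<epsilon>) * tdist (tp j (l j)) p q"
      unfolding UZ_def by blast
    thus "\<exists>g. (\<forall>p\<in>points (tp j (l j)). g p \<in> points (UZ j)) \<and>
     (\<forall>h\<in>stb j. \<forall>p\<in>points (tp j (l j)). g (point_act (tp j (l j)) h p) = point_act (UZ j) h (g p)) \<and>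
     (\<forall>p\<in>points (tp j (l j)). \<forall>q\<in>points (tp j (l j)). tdist (UZ j) (g p) (g q) \<le> (1 + \<epsilon>) * tdist (tp j (l j)) p q)"
      by (intro exI[of _ g]) simp
  qed
  then obtain \<kappa> where \<kappa>: "\<forall>j\<in>J. (\<forall>p\<in>points (tp j (l j)). \<kappa> j p \<in> points (UZ j)) \<and>
     (\<forall>h\<in>stb j. \<forall>p\<in>points (tp j (l j)). \<kappa> j (point_act (tp j (l j)) h p) = point_act (UZ j) h (\<kappa> j p)) \<and>
     (\<forall>p\<in>points (tp j (l j)). \<forall>q\<in>points (tp j (l j)). tdist (UZ j) (\<kappa> j p) (\<kappa> j q) \<le> (1 + \<epsilon>) * tdist (tp j (l j)) p q)"
    by blast
  \<comment> \<open>The inverse conjugator makes the map equivariant for \<psi>; then it can be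
    projected to the representative piece \<open>nx j\<close>.\<close>
  define r where "r j v = point_act (X (\<sigma> (fst j))) (inv\<^bsub>Gn j\<^esub> (kk j)) (f (fst j) (vpoint v))" for j v
  define q where "q j v = push (mtree.proj (X (\<sigma> (fst j))) (snd (nx j))) (r j v)" for j v
  have piece': "core_piece (Gn j) (X (\<sigma> (fst j))) (A (\<sigma> (fst j))) (snd (nx j))" if j: "j \<in> J" for j
    using piece[OF \<psi>_perm[OF j]] \<psi>_fst[OF j] by simp
  have vT: "v \<in> XV (fst j)" if j: "j \<in> J" and v: "v \<in> snd j" for j v
    using core_piece.P_sub[OF piece[OF j]] v by blast
  have fv: "f (fst j) (vpoint v) \<in> XP (\<sigma> (fst j))" if j: "j \<in> J" and v: "v \<in> snd j" for j v
    using f(2)[OF J_idx[OF j], of "vpoint v"] mgraph.vpoint_points[OF X_graph[OF J_idx[OF j]] vT[OF j v]]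
      Zs[OF J_idx[OF j]] Zs[OF perm[OF J_idx[OF j]]] by simp
  have rp: "r j v \<in> XP (\<sigma> (fst j))" if j: "j \<in> J" and v: "v \<in> snd j" for j v
  proof -
    interpret X': mgraph "Gn j" "X (\<sigma> (fst j))" using X_graph[OF perm[OF J_idx[OF j]]] .
    show ?thesis unfolding r_def using X'.point_act_closed[OF X'.inv_in[OF kk(1)[OF j]] fv[OF j v]] .
  qed
  have qp: "q j v \<in> points (tp (nx j) (l (nx j)))" if j: "j \<in> J" and v: "v \<in> snd j" for j v
    using core_piece.TP_points_proj[OF piece'[OF j] rp[OF j v]] \<psi>_fst[OF j] by (simp add: q_def)
  have q_act: "q j (act (X (fst j)) s v) = point_act (tp (nx j) (l (nx j))) (maps \<psi> j s) (q j v)"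
    if j: "j \<in> J" and v: "v \<in> snd j" and s: "s \<in> stb j" for j v s
  proof -
    interpret c: core_piece "Gj j" "X (fst j)" "A (fst j)" "snd j" by (rule piece[OF j])
    interpret c': core_piece "Gn j" "X (\<sigma> (fst j))" "A (\<sigma> (fst j))" "snd (nx j)" by (rule piece'[OF j])
    have i: "fst j \<in> idx S" using J_idx[OF j] .
    have sG: "s \<in> Gc (fst j)" using c.H_in[OF s] .
    have ms: "maps \<psi> j s \<in> set_stab (Gn j) (X (\<sigma> (fst j))) (snd (nx j))"
      using \<psi>_stb[OF j s] \<psi>_fst[OF j] by simp
    note msG = c'.H_in[OF ms]
    have "f (fst j) (vpoint (act (X (fst j)) s v)) = tw X (fst j) s (f (fst j) (vpoint v))"
      using f(3)[OF i sG, of "vpoint v"] c.vpoint_points[OF vT[OF j v]] c.point_act_vpoint[OF sG vT[OF j v]]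
        Zs[OF i] Zs[OF perm[OF i]] by simp
    hence "r j (act (X (fst j)) s v) = point_act (X (\<sigma> (fst j)))
        (inv\<^bsub>Gn j\<^esub> (kk j) \<otimes>\<^bsub>Gn j\<^esub> \<theta> (fst j) s) (f (fst j) (vpoint v))"
      unfolding r_def using c'.point_act_mult[OF c'.inv_in[OF kk(1)[OF j]] maps_in[OF i sG] fv[OF j v]] by simp
    also have "\<dots> = point_act (X (\<sigma> (fst j))) (maps \<psi> j s) (r j v)"
      unfolding r_def kk_inv(1)[OF j s, symmetric]
      using c'.point_act_mult[OF msG c'.inv_in[OF kk(1)[OF j]] fv[OF j v]] by simp
    finally have rr: "r j (act (X (fst j)) s v) = point_act (X (\<sigma> (fst j))) (maps \<psi> j s) (r j v)" .
    have "q j (act (X (fst j)) s v) = point_act (X (\<sigma> (fst j))) (maps \<psi> j s) (q j v)"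
      unfolding q_def rr using c'.proj_push_act[OF c'.P_convex(1) msG rp[OF j v]] c'.H_img[OF ms] by simp
    also have "\<dots> = point_act (tp (nx j) (l (nx j))) (maps \<psi> j s) (q j v)"
      using core_piece.TP_point_act[OF piece[OF \<psi>_perm[OF j]] pl[OF \<psi>_perm[OF j]] \<psi>_stb[OF j s] qp[OF j v]] \<psi>_fst[OF j] by simp
    finally show ?thesis .
  qed
  have q_dist: "tdist (tp (nx j) (l (nx j))) (q j u) (q j w) \<le> L' * tdist (tp j (l j)) (vpoint u) (vpoint w)"
    if j: "j \<in> J" and u: "u \<in> snd j" and w: "w \<in> snd j" for j u w
  proof -
    have i: "fst j \<in> idx S" using J_idx[OF j] .
    interpret X': mgraph "Gn j" "X (\<sigma> (fst j))" using X_graph[OF perm[OF i]] .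
    interpret Z': mgraph "Gn j" "Z (\<sigma> (fst j))" using Z_graph[OF perm[OF i]] .
    interpret c: core_piece "Gj j" "X (fst j)" "A (fst j)" "snd j" by (rule piece[OF j])
    have pl': "core_piece.piece_len (Gn j) (X (\<sigma> (fst j))) (A (\<sigma> (fst j))) (snd (nx j)) (len (Z (\<sigma> (fst j))))"
      using pl[OF \<psi>_perm[OF j]] \<psi>_fst[OF j] by (simp add: l_def)
    have vp: "vpoint u \<in> points (Z (fst j))" "vpoint w \<in> points (Z (fst j))"
      using c.vpoint_points vT[OF j] u w Zs[OF i] by auto
    have "tdist (tp (nx j) (l (nx j))) (q j u) (q j w) \<le> tdist ((X (\<sigma> (fst j)))\<lparr>len := len (Z (\<sigma> (fst j)))\<rparr>) (r j u) (r j w)"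
      using core_piece.tdist_TP_proj[OF piece'[OF j] pl' Z_graph'[OF perm[OF i]] _ rp[OF j u] rp[OF j w]] \<psi>_fst[OF j]
      by (simp add: q_def l_def)
    also have "\<dots> = tdist (Z (\<sigma> (fst j))) (f (fst j) (vpoint u)) (f (fst j) (vpoint w))"
      unfolding r_def Zs(6)[OF perm[OF i], symmetric] Zs(5)[OF perm[OF i], symmetric]
      by (rule Z'.tdist_act) (use fv[OF j u] fv[OF j w] Zs[OF perm[OF i]] X'.inv_in[OF kk(1)[OF j]] in auto)
    also have "\<dots> \<le> L' * tdist (Z (fst j)) (vpoint u) (vpoint w)" using f(4)[OF i vp] .
    also have "\<dots> \<le> L' * tdist (tp j (l j)) (vpoint u) (vpoint w)"
    proof (rule mult_left_mono[OF _ L0])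
      have "vpoint u \<in> points (c.TP (l j))" "vpoint w \<in> points (c.TP (l j))" using u w by (auto simp: points_def)
      thus "tdist (Z (fst j)) (vpoint u) (vpoint w) \<le> tdist (tp j (l j)) (vpoint u) (vpoint w)"
        unfolding Zs(6)[OF i] using c.tdist_TP_ge[OF pl[OF j] Z_graph'[OF i]] by (simp add: l_def)
    qed
    finally show ?thesis .
  qed
  have "displacement CS \<psi> UZ \<le> ereal ((1 + \<epsilon>) * L')"
  proof (rule psi.displacement_leI[where F = "\<lambda>j v. \<kappa> (nx j) (q j v)", OF UZ_graph])
    show "0 \<le> (1 + \<epsilon>) * L'" using \<epsilon>(1) L0 by simp
    fix j assume jj: "j \<in> idx CS"
    hence j: "j \<in> J" by simp
    interpret c: core_piece "Gj j" "X (fst j)" "A (fst j)" "snd j" by (rule piece[OF j])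
    interpret s: subdiv "grp CS j" "tp j (l j)" "wes j" by (rule sd[OF j])
    have wP: "v \<in> snd j" if "v \<in> sverts (UZ j)" for v using that c.Wess(1) by (auto simp: UZ_def)
    show "\<kappa> (nx j) (q j v) \<in> points (UZ (nx j))" if "v \<in> sverts (UZ j)" for v
      using \<kappa> \<psi>_perm[OF j] qp[OF j wP[OF that]] by blast
    show "\<kappa> (nx j) (q j (act (UZ j) g v)) = point_act (UZ (nx j)) (maps \<psi> j g) (\<kappa> (nx j) (q j v))"
      if g: "g \<in> carrier (grp CS j)" and v: "v \<in> sverts (UZ j)" for g v
    proof -
      have gs: "g \<in> stb j" using g by simp
      have vW: "v \<in> wes j" using v by (simp add: UZ_def)
      have "act (UZ j) g v = act (X (fst j)) g v" using s.U_sel(2)[OF g vW] wP[OF v] by (simp add: UZ_def)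
      hence "q j (act (UZ j) g v) = point_act (tp (nx j) (l (nx j))) (maps \<psi> j g) (q j v)"
        using q_act[OF j wP[OF v] gs] by simp
      thus ?thesis using \<kappa> \<psi>_perm[OF j] qp[OF j wP[OF v]] \<psi>_stb[OF j gs] by simp
    qed
    fix u w assume e: "{u, w} \<in> sedges (UZ j)"
    hence uw: "u \<in> snd j" "w \<in> snd j" using mgraph.edge_ends[OF UZ_graph[OF jj]] wP by auto
    obtain n x where x: "s.seg n x" "x 0 = u" "x n = w" using s.U_edgeE e unfolding UZ_def by blast
    have len: "len (UZ j) {u, w} = tdist (tp j (l j)) (vpoint u) (vpoint w)" using s.U_len[OF x(1)] x by (simp add: UZ_def)
    have "tdist (UZ (nx j)) (\<kappa> (nx j) (q j u)) (\<kappa> (nx j) (q j w))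
        \<le> (1 + \<epsilon>) * tdist (tp (nx j) (l (nx j))) (q j u) (q j w)"
      using \<kappa> \<psi>_perm[OF j] qp[OF j uw(1)] qp[OF j uw(2)] by blast
    also have "\<dots> \<le> (1 + \<epsilon>) * (L' * tdist (tp j (l j)) (vpoint u) (vpoint w))"
      using q_dist[OF j uw] \<epsilon>(1) by (intro mult_left_mono) auto
    finally show "tdist (UZ (nx j)) (\<kappa> (nx j) (q j u)) (\<kappa> (nx j) (q j w)) \<le> (1 + \<epsilon>) * L' * len (UZ j) {u, w}"
      unfolding len by (simp add: mult.assoc)
  qed
  also have "\<dots> \<le> ereal L" using \<epsilon>(2) by simp
  finally have d: "displacement CS \<psi> UZ \<le> ereal L" .
  \<comment> \<open>The vertices kept by the coarsening do not depend on edge lengths, so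
    \<open>UZ\<close> and the core forest of \<open>X\<close> differ by their lengths alone.\<close>
  have "UZ \<in> open_simplex CS CF"
    unfolding open_simplex_def
  proof (intro CollectI ballI conjI)
    fix j assume jj: "j \<in> idx CS"
    hence j: "j \<in> J" by simp
    show "UZ j = (CF j)\<lparr>len := len (UZ j)\<rparr>" using coarsen_update[OF j] by (simp add: UZ_def)
    interpret u: mgraph "grp CS j" "UZ j" by (rule UZ_graph[OF jj])
    show "equivariant_length (grp CS j) (UZ j)" using u.len_pos u.len_act by (simp add: equivariant_length_def)
  qed
  hence "simplex_displacement CS \<psi> CF \<le> displacement CS \<psi> UZ"
    unfolding simplex_displacement_def by (rule INF_lower)
  thus ?thesis using d by simp
qed

theorem core_displacement_le: "simplex_displacement CS \<psi> CF \<le> simplex_displacement S \<phi> X"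
  unfolding simplex_displacement_def[of S \<phi> X]
proof (rule INF_greatest, rule ccontr)
  fix Z assume Z: "Z \<in> open_simplex S X" and "\<not> simplex_displacement CS \<psi> CF \<le> disp Z"
  hence "disp Z < simplex_displacement CS \<psi> CF" by simp
  from ereal_dense2[OF this] obtain L where L: "disp Z < ereal L" "ereal L < simplex_displacement CS \<psi> CF" by blast
  thus False using core_displacement_le_aux[OF Z L(1)] by simp
qed

end

section \<open>Maps between components of \<open>A\<close> from maps of the core\<close>

context core_system
begin

text \<open>The lengths of a nearly optimal coarse point are spread over the subdivided pieces by
  \<open>refine_length\<close>. Its map is then transported through \<open>into_U\<close> at the
  level of vertices and through \<open>from_U\<close>, within the gap below
  \<open>L\<close>.\<close>

lemma core_pieces_map:
  assumes less: "simplex_displacement CS \<psi> CF < ereal L" and Lpos: "0 < L"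
  shows "\<exists>l F. \<forall>j\<in>J. plen j (l j) \<and>
    (\<forall>v\<in>snd j. F j v \<in> points (tp (nx j) (l (nx j)))) \<and>
    (\<forall>s\<in>stb j. \<forall>v\<in>snd j. F j (act (X (fst j)) s v) = point_act (tp (nx j) (l (nx j))) (maps \<psi> j s) (F j v)) \<and>
    (\<forall>u w. {u, w} \<in> CE (fst j) \<longrightarrow> {u, w} \<subseteq> snd j \<longrightarrow>
      ch (sedges (tp (nx j) (l (nx j)))) (l (nx j)) (F j u) (F j w) (L * l j {u, w}))"
proof -
  obtain Z where Z: "Z \<in> open_simplex CS CF" "displacement CS \<psi> Z < ereal L"
    using less unfolding simplex_displacement_def INF_less_iff by blast
  obtain L1 where L1: "displacement CS \<psi> Z < ereal L1" "L1 < L" using ereal_dense2[OF Z(2)] by auto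
  \<comment> \<open>For empty \<open>J\<close> nothing forces \<open>L1\<close> to be non-negative,
    as \<open>slack\<close> requires; positivity of \<open>L\<close> keeps the maximum below
    \<open>L\<close>.\<close>
  define L' where "L' = max L1 0"
  have L': "displacement CS \<psi> Z < ereal L'" "L' < L" "0 \<le> L'"
    using L1 Lpos by (auto simp: L'_def max_def intro: less_le_trans)
  obtain \<epsilon>0 where \<epsilon>0: "0 < \<epsilon>0" "(1 + \<epsilon>0) * L' < L" using slack[OF L'(3,2)] .
  have Zj: "Z j = (CF j)\<lparr>len := len (Z j)\<rparr>" "equivariant_length (grp CS j) (Z j)" if "j \<in> J" for j
    using Z(1) that by (auto simp: open_simplex_def)
  have plX: "plen j (len (X (fst j)))" if j: "j \<in> J" for j
  proof -
    interpret c: core_piece "Gj j" "X (fst j)" "A (fst j)" "snd j" by (rule piece[OF j])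
    show ?thesis using c.len_pos c.len_act c.Cr.A_edge c.H_in by (simp add: c.piece_len_def)
  qed
  have "\<exists>l. plen j l \<and> (\<forall>p q. tdist (coarsen (wes j) (tp j l)) p q = tdist (Z j) p q)" if j: "j \<in> J" for j
  proof -
    interpret c: core_piece "Gj j" "X (fst j)" "A (fst j)" "snd j" by (rule piece[OF j])
    interpret s: subdiv "grp CS j" "tp j (len (X (fst j)))" "wes j" using c.TP_subdiv[OF plX[OF j]] by simp
    have se: "sedges (Z j) = sedges s.U" by (subst Zj(1)[OF j]) (simp add: CF_eq[OF j])
    have ac: "act (Z j) = act s.U" by (subst Zj(1)[OF j]) (simp add: CF_eq[OF j])
    obtain l where l: "equivariant_length (grp CS j) ((tp j (len (X (fst j))))\<lparr>len := l\<rparr>)"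
      "\<And>n x. s.seg n x \<Longrightarrow> (\<Sum>i=0..<n. l {x i, x (Suc i)}) = len (Z j) {x 0, x n}"
      using s.refine_length[of "len (Z j)"] Zj(2)[OF j] unfolding equivariant_length_def se ac by blast
    have "(tp j (len (X (fst j))))\<lparr>len := l\<rparr> = tp j l" by (simp add: c.TP_def)
    hence pl: "plen j l" using l(1) by (simp add: c.piece_len_iff)
    interpret s': subdiv "grp CS j" "tp j l" "wes j" using c.TP_subdiv[OF pl] by simp
    have sg: "s'.seg n x = s.seg n x" for n x by (simp add: s.seg_def s'.seg_def)
    have "tdist s'.U p q = tdist (Z j) p q" for p q
    proof (rule tdist_cong)
      show "sedges s'.U = sedges (Z j)" unfolding se s.U_edges s'.U_edges sg ..
      show "0 \<le> len s'.U e" if "e \<in> sedges s'.U" for e using s'.U.len_nonneg[OF that] .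
      show "len s'.U e = len (Z j) e" if ee: "e \<in> sedges s'.U" for e
      proof -
        obtain n x where x: "s'.seg n x" "e = {x 0, x n}" using ee unfolding s'.U_edges by blast
        have "len s'.U e = (\<Sum>i=0..<n. l {x i, x (Suc i)})" using s'.U_len[OF x(1)] s'.seg_dist[OF x(1) le0 order_refl] x(2) by simp
        thus ?thesis using l(2)[of n x] x sg by simp
      qed
    qed
    thus ?thesis using pl by blast
  qed
  hence "\<exists>l. \<forall>j\<in>J. plen j (l j) \<and> (\<forall>p q. tdist (coarsen (wes j) (tp j (l j))) p q = tdist (Z j) p q)"
    by (intro bchoice) blast
  then obtain l where l: "\<And>j. j \<in> J \<Longrightarrow> plen j (l j)"
    "\<And>j p q. j \<in> J \<Longrightarrow> tdist (coarsen (wes j) (tp j (l j))) p q = tdist (Z j) p q" by blast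
  define U where "U j = coarsen (wes j) (tp j (l j))" for j
  have sd: "subdiv (grp CS j) (tp j (l j)) (wes j)" if j: "j \<in> J" for j
    using core_piece.TP_subdiv[OF piece[OF j] l(1)[OF j]] by simp
  have UZ: "points (Z j) = points (U j)" "point_act (Z j) = point_act (U j)" "sverts (Z j) = sverts (U j)"
    "sedges (Z j) = sedges (U j)" "act (Z j) = act (U j)" "tdist (Z j) p q = tdist (U j) p q" if j: "j \<in> J" for j p q
    unfolding U_def l(2)[OF j] by ((subst Zj(1)[OF j], subst coarsen_update[OF j], simp) | simp)+
  have U_graph: "mgraph (grp CS j) (U j)" if j: "j \<in> J" for j using subdiv.U_graph[OF sd[OF j]] by (simp add: U_def)
  have Z_graph: "mgraph (grp CS j) (Z j)" if jj: "j \<in> idx CS" for j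
  proof -
    have j: "j \<in> J" using jj by simp
    interpret U: mgraph "grp CS j" "U j" by (rule U_graph[OF j])
    show ?thesis using Zj(2)[OF j] UZ(3-5)[OF j] U.grp U.act_closed U.act_one U.act_mult U.edge_card U.edge_verts U.act_edge
      U.edge_free U.conn by (intro mgraph.intro) (auto simp: equivariant_length_def)
  qed
  obtain f where f:
    "\<And>j. j \<in> idx CS \<Longrightarrow> 0 \<le> L'"
    "\<And>j p. j \<in> idx CS \<Longrightarrow> p \<in> points (Z j) \<Longrightarrow> f j p \<in> points (Z (nx j))"
    "\<And>j h p. j \<in> idx CS \<Longrightarrow> h \<in> carrier (grp CS j) \<Longrightarrow> p \<in> points (Z j) \<Longrightarrow>
      f j (point_act (Z j) h p) = point_act (Z (nx j)) (maps \<psi> j h) (f j p)"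
    "\<And>j p q. j \<in> idx CS \<Longrightarrow> p \<in> points (Z j) \<Longrightarrow> q \<in> points (Z j) \<Longrightarrow>
      tdist (Z (nx j)) (f j p) (f j q) \<le> L' * tdist (Z j) p q"
    using psi.displacement_lessD[OF L'(1) Z_graph] by blast
  have "\<exists>\<iota>. \<forall>j\<in>J. (\<forall>p\<in>points (U j). \<iota> j p \<in> points (tp j (l j))) \<and>
     (\<forall>h\<in>stb j. \<forall>p\<in>points (U j). \<iota> j (point_act (U j) h p) = point_act (tp j (l j)) h (\<iota> j p)) \<and>
     (\<forall>p\<in>points (U j). \<forall>q\<in>points (U j). tdist (tp j (l j)) (\<iota> j p) (\<iota> j q) \<le> (1 + \<epsilon>0) * tdist (U j) p q)"
  proof (rule bchoice, rule ballI)
    fix j assume j: "j \<in> J"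
    from subdiv.from_U[OF sd[OF j] \<epsilon>0(1)] obtain g where "\<And>p. p \<in> points (U j) \<Longrightarrow> g p \<in> points (tp j (l j))"
      "\<And>h p. h \<in> carrier (grp CS j) \<Longrightarrow> p \<in> points (U j) \<Longrightarrow> g (point_act (U j) h p) = point_act (tp j (l j)) h (g p)"
      "\<And>p q. p \<in> points (U j) \<Longrightarrow> q \<in> points (U j) \<Longrightarrow> tdist (tp j (l j)) (g p) (g q) \<le> (1 + \<epsilon>0) * tdist (U j) p q"
      unfolding U_def by blast
    thus "\<exists>g. (\<forall>p\<in>points (U j). g p \<in> points (tp j (l j))) \<and>
     (\<forall>h\<in>stb j. \<forall>p\<in>points (U j). g (point_act (U j) h p) = point_act (tp j (l j)) h (g p)) \<and>
     (\<forall>p\<in>points (U j). \<forall>q\<in>points (U j). tdist (tp j (l j)) (g p) (g q) \<le> (1 + \<epsilon>0) * tdist (U j) p q)"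
      by (intro exI[of _ g]) simp
  qed
  then obtain \<iota> where \<iota>: "\<forall>j\<in>J. (\<forall>p\<in>points (U j). \<iota> j p \<in> points (tp j (l j))) \<and>
     (\<forall>h\<in>stb j. \<forall>p\<in>points (U j). \<iota> j (point_act (U j) h p) = point_act (tp j (l j)) h (\<iota> j p)) \<and>
     (\<forall>p\<in>points (U j). \<forall>q\<in>points (U j). tdist (tp j (l j)) (\<iota> j p) (\<iota> j q) \<le> (1 + \<epsilon>0) * tdist (U j) p q)" by blast
  \<comment> \<open>From the subdivided piece to the coarse one, then the given map, then back to
    the subdivided next piece.\<close>
  define F where "F j v = \<iota> (nx j) (f j (subdiv.k (tp j (l j)) (wes j) v))" for j v
  show ?thesis
  proof (intro exI[of _ l] exI[of _ F] ballI conjI allI impI)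
    fix j assume j: "j \<in> J"
    have j': "nx j \<in> J" using \<psi>_perm[OF j] .
    have jj: "j \<in> idx CS" using j by simp
    interpret c: core_piece "Gj j" "X (fst j)" "A (fst j)" "snd j" by (rule piece[OF j])
    interpret s: subdiv "grp CS j" "tp j (l j)" "wes j" by (rule sd[OF j])
    interpret U': mgraph "grp CS (nx j)" "U (nx j)" by (rule U_graph[OF j'])
    interpret t': mtree "grp CS (nx j)" "tp (nx j) (l (nx j))" using core_piece.TP_tree[OF piece[OF j'] l(1)[OF j']] by simp
    show "plen j (l j)" by (rule l(1)[OF j])
    have k: "s.k v \<in> points (Z j)" if "v \<in> snd j" for v using s.k_points[of v] that UZ(1)[OF j] by (simp add: U_def)
    have fk: "f j (s.k v) \<in> points (U (nx j))" if "v \<in> snd j" for v using f(2)[OF jj k[OF that]] UZ(1)[OF j'] by simp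
    show Fp: "F j v \<in> points (tp (nx j) (l (nx j)))" if "v \<in> snd j" for v
      using \<iota> j' fk[OF that] unfolding F_def by blast
    show "F j (act (X (fst j)) h v) = point_act (tp (nx j) (l (nx j))) (maps \<psi> j h) (F j v)"
      if h: "h \<in> stb j" and v: "v \<in> snd j" for h v
    proof -
      have "s.k (act (X (fst j)) h v) = point_act (Z j) h (s.k v)"
        using s.k_act[of h v] h v UZ(2)[OF j] by (simp add: U_def)
      hence "f j (s.k (act (X (fst j)) h v)) = point_act (U (nx j)) (maps \<psi> j h) (f j (s.k v))"
        using f(3)[OF jj _ k[OF v], of h] h UZ(2)[OF j'] by simp
      thus ?thesis using \<iota> j' fk[OF v] \<psi>_stb[OF j h] unfolding F_def by simp
    qed
    fix u w assume e: "{u, w} \<in> CE (fst j)" "{u, w} \<subseteq> snd j"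
    hence uw: "u \<in> snd j" "w \<in> snd j" and eT: "{u, w} \<in> sedges (tp j (l j))" by auto
    have lp: "0 < l j {u, w}" using s.len_pos[OF eT] by simp
    have "tdist (tp (nx j) (l (nx j))) (F j u) (F j w) \<le> (1 + \<epsilon>0) * tdist (U (nx j)) (f j (s.k u)) (f j (s.k w))"
      using \<iota> j' fk[OF uw(1)] fk[OF uw(2)] unfolding F_def by blast
    also have "tdist (U (nx j)) (f j (s.k u)) (f j (s.k w)) \<le> L' * tdist (Z j) (s.k u) (s.k w)"
      using f(4)[OF jj k[OF uw(1)] k[OF uw(2)]] UZ(6)[OF j'] by simp
    also have "tdist (Z j) (s.k u) (s.k w) \<le> l j {u, w}" using s.k_edge[OF eT] UZ(6)[OF j] by (simp add: U_def)
    finally have "tdist (tp (nx j) (l (nx j))) (F j u) (F j w) \<le> (1 + \<epsilon>0) * L' * l j {u, w}"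
      using L'(3) \<epsilon>0(1) by (simp add: mult_left_mono mult.assoc)
    also have "\<dots> < L * l j {u, w}" using \<epsilon>0(2) lp by simp
    finally have "ch (sedges (tp (nx j) (l (nx j)))) (len (tp (nx j) (l (nx j)))) (F j u) (F j w) (L * l j {u, w})"
      using t'.tdist_lessD[OF Fp[OF uw(1)] Fp[OF uw(2)]] by blast
    thus "ch (sedges (tp (nx j) (l (nx j)))) (l (nx j)) (F j u) (F j w) (L * l j {u, w})"
      using core_piece.TP_sel(3)[OF piece[OF j']] by simp
  qed
qed

lemma Cr_sg: "i \<in> idx S \<Longrightarrow> sgtree (grp S i) (X i) (CrX i)"
  using sgtree.core_subgraph[OF ctree.axioms(1)[OF ct]] X_tree by (simp add: sgtree_def sgtree_axioms_def)

lemma rep_ex: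
  assumes i: "i \<in> idx S" and v: "v \<in> CV i"
  shows "\<exists>g\<in>Gc i. (i, act (X i) g ` component (CrX i) v) \<in> J"
proof -
  have "component (CrX i) v \<in> core_components S X A i" using v by (simp add: core_components_def Let_def)
  thus ?thesis using reps i unfolding core_representatives_def by blast
qed

lemma rep_unique:
  assumes P: "(i, P) \<in> J" and Q: "(i, act (X i) g ` P) \<in> J" and g: "g \<in> Gc i"
  shows "act (X i) g ` P = P"
proof -
  have i: "i \<in> idx S" using J_idx[OF P] by simp
  interpret c: core_piece "grp S i" "X i" "A i" P using piece[OF P] by simp
  have one: "act (X i) \<one>\<^bsub>grp S i\<^esub> ` P = P" using c.act_one c.P_sub by (auto simp: subset_iff image_iff)
  have "P \<in> core_components S X A i" using J_comp[OF P] by (simp add: core_components_def Let_def)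
  hence "\<exists>!Q. (i, Q) \<in> J \<and> (\<exists>h\<in>Gc i. act (X i) h ` P = Q)"
    using reps i unfolding core_representatives_def by blast
  thus ?thesis using P Q g one c.one_in by metis
qed

text \<open>Data on one piece per orbit spread over the whole preimage of the core by
  \<open>equivariant_choice\<close>, with the component as class. The conjugators \<open>kk\<close>
  make the prescribed maps compatible with the stabilisers.\<close>

lemma core_map:
  assumes less: "simplex_displacement CS \<psi> CF < ereal L" and Lpos: "0 < L"
  shows "\<exists>l F. \<forall>i\<in>idx S. (\<forall>e\<in>CE i. 0 < l i e \<and> (\<forall>h\<in>Gc i. l i (act (X i) h ` e) = l i e)) \<and>
    (\<forall>v\<in>CV i. F i v \<in> XP (\<sigma> i)) \<and>
    (\<forall>h\<in>Gc i. \<forall>v\<in>CV i. F i (act (X i) h v) = tw X i h (F i v)) \<and>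
    (\<forall>u w. {u, w} \<in> CE i \<longrightarrow> ch (CE (\<sigma> i)) (l (\<sigma> i)) (F i u) (F i w) (L * l i {u, w}))"
proof -
  obtain l F where lF: "\<forall>j\<in>J. plen j (l j) \<and>
    (\<forall>v\<in>snd j. F j v \<in> points (tp (nx j) (l (nx j)))) \<and>
    (\<forall>s\<in>stb j. \<forall>v\<in>snd j. F j (act (X (fst j)) s v) = point_act (tp (nx j) (l (nx j))) (maps \<psi> j s) (F j v)) \<and>
    (\<forall>u w. {u, w} \<in> CE (fst j) \<longrightarrow> {u, w} \<subseteq> snd j \<longrightarrow>
      ch (sedges (tp (nx j) (l (nx j)))) (l (nx j)) (F j u) (F j w) (L * l j {u, w}))"
    using core_pieces_map[OF less Lpos] by blast
  have pl: "plen j (l j)" if "j \<in> J" for j using lF that by blast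
  have F_tp: "F j v \<in> points (tp (nx j) (l (nx j)))" if "j \<in> J" "v \<in> snd j" for j v using lF that by blast
  have F_act: "F j (act (X (fst j)) s v) = point_act (tp (nx j) (l (nx j))) (maps \<psi> j s) (F j v)"
    if "j \<in> J" "s \<in> stb j" "v \<in> snd j" for j s v using lF that by blast
  have F_ch: "ch (sedges (tp (nx j) (l (nx j)))) (l (nx j)) (F j u) (F j w) (L * l j {u, w})"
    if "j \<in> J" "{u, w} \<in> CE (fst j)" "{u, w} \<subseteq> snd j" for j u w using lF that by blast
  have F_in: "F j v \<in> XP (\<sigma> (fst j))" if "j \<in> J" "v \<in> snd j" for j v
    using core_piece.TP_points_sub[OF piece[OF \<psi>_perm[OF that(1)]] F_tp[OF that]] \<psi>_fst[OF that(1)] by simp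
  have "\<forall>i\<in>idx S. \<exists>G. (\<forall>v\<in>CV i. G v \<in> XP (\<sigma> i)) \<and>
    (\<forall>h\<in>Gc i. \<forall>v\<in>CV i. G (act (X i) h v) = tw X i h (G v)) \<and>
    (\<forall>P. (i, P) \<in> J \<longrightarrow> (\<forall>v\<in>P. G v = point_act (X (\<sigma> i)) (kk (i, P)) (F (i, P) v)))"
  proof
    fix i assume i: "i \<in> idx S"
    interpret c: sgtree "grp S i" "X i" "CrX i" by (rule Cr_sg[OF i])
    interpret X': mgraph "grp S (\<sigma> i)" "X (\<sigma> i)" by (rule X_graph[OF perm[OF i]])
    let ?C = "component (CrX i)" and ?k = "\<lambda>g. (`) (act (X i) g)" and ?R = "{P. (i, P) \<in> J}"
      and ?F = "\<lambda>P v. point_act (X (\<sigma> i)) (kk (i, P)) (F (i, P) v)"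
    have vC: "v \<in> ?C v" for v by simp
    have "\<exists>G. (\<forall>v\<in>CV i. G v \<in> XP (\<sigma> i)) \<and>
      (\<forall>h\<in>Gc i. \<forall>v\<in>CV i. G (act (X i) h v) = tw X i h (G v)) \<and>
      (\<forall>v\<in>CV i. \<exists>g\<in>Gc i. ?k g (?C v) \<in> ?R \<and> (\<forall>y\<in>CV i. ?C y = ?k g (?C v) \<longrightarrow> G y = ?F (?C y) y))"
    proof (rule equivariant_choice[where V = "CV i" and Y = "XP (\<sigma> i)" and a = "act (X i)"
          and b = "\<lambda>g. tw X i g" and c = ?C and k = ?k and R = ?R and F = ?F, OF c.grp])
      show "act (X i) g v \<in> CV i" if "g \<in> Gc i" "v \<in> CV i" for g v
        using subgraph_act_vert[OF c.sub that] .
      show "act (X i) \<one>\<^bsub>grp S i\<^esub> v = v" if "v \<in> CV i" for v using c.act_one[OF c.A_vert[OF that]] .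
      show "act (X i) (g \<otimes>\<^bsub>grp S i\<^esub> h) v = act (X i) g (act (X i) h v)"
        if "g \<in> Gc i" "h \<in> Gc i" "v \<in> CV i" for g h v
        using c.act_mult[OF that(1,2) c.A_vert[OF that(3)]] .
      show "tw X i g p \<in> XP (\<sigma> i)" if "g \<in> Gc i" "p \<in> XP (\<sigma> i)" for g p
        using X'.point_act_closed[OF maps_in[OF i that(1)] that(2)] .
      show "tw X i \<one>\<^bsub>grp S i\<^esub> p = p" if "p \<in> XP (\<sigma> i)" for p
        using X'.point_act_one[OF that] maps_one[OF i] by simp
      show "tw X i (g \<otimes>\<^bsub>grp S i\<^esub> h) p = tw X i g (tw X i h p)"
        if "g \<in> Gc i" "h \<in> Gc i" "p \<in> XP (\<sigma> i)" for g h p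
        using X'.point_act_mult[OF maps_in[OF i that(1)] maps_in[OF i that(2)] that(3)] maps_mult[OF i that(1,2)] by simp
      show "?C (act (X i) g v) = ?k g (?C v)" if "g \<in> Gc i" "v \<in> CV i" for g v
        using c.comp_act[OF that(1) c.A_vert[OF that(2)]] by simp
      show "\<exists>g\<in>Gc i. ?k g (?C v) \<in> ?R" if "v \<in> CV i" for v using rep_ex[OF i that] by simp
      show "?F (?C v) v \<in> XP (\<sigma> i)" if "v \<in> CV i" "?C v \<in> ?R" for v
        using X'.point_act_closed[of "kk (i, ?C v)" "F (i, ?C v) v"] kk(1)[of "(i, ?C v)"] F_in[of "(i, ?C v)" v] that vC by simp
      show "?F (?C v) (act (X i) g v) = tw X i g (?F (?C v) v)"
        if "v \<in> CV i" "?C v \<in> ?R" "g \<in> Gc i" "?k g (?C v) = ?C v" for v g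
      proof -
        let ?j = "(i, ?C v)"
        have j: "?j \<in> J" using that by simp
        have g: "g \<in> stb ?j" using that by (simp add: set_stab_def)
        have k: "kk ?j \<in> Gc (\<sigma> i)" using kk(1)[OF j] by simp
        have m: "maps \<psi> ?j g \<in> Gc (\<sigma> i)"
          using \<psi>_stb[OF j g] \<psi>_fst[OF j] by (simp add: set_stab_def)
        have Fi: "F ?j v \<in> XP (\<sigma> i)" using F_in[OF j] vC by simp
        have "F ?j (act (X i) g v) = point_act (X (\<sigma> i)) (maps \<psi> ?j g) (F ?j v)"
          using F_act[OF j g] core_piece.TP_point_act[OF piece[OF \<psi>_perm[OF j]] pl[OF \<psi>_perm[OF j]] \<psi>_stb[OF j g] F_tp[OF j]] vC \<psi>_fst[OF j] by simp
        hence "?F (?C v) (act (X i) g v) = point_act (X (\<sigma> i)) (kk ?j \<otimes>\<^bsub>grp S (\<sigma> i)\<^esub> maps \<psi> ?j g) (F ?j v)"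
          using X'.point_act_mult[OF k m Fi] by simp
        also have "kk ?j \<otimes>\<^bsub>grp S (\<sigma> i)\<^esub> maps \<psi> ?j g = \<theta> i g \<otimes>\<^bsub>grp S (\<sigma> i)\<^esub> kk ?j" using kk_inv(2)[OF j g] by simp
        finally show ?thesis using X'.point_act_mult[OF maps_in[OF i that(3)] k Fi] by simp
      qed
    qed
    then obtain G where G: "\<forall>v\<in>CV i. G v \<in> XP (\<sigma> i)"
      "\<forall>h\<in>Gc i. \<forall>v\<in>CV i. G (act (X i) h v) = tw X i h (G v)"
      "\<forall>v\<in>CV i. \<exists>g\<in>Gc i. ?k g (?C v) \<in> ?R \<and> (\<forall>y\<in>CV i. ?C y = ?k g (?C v) \<longrightarrow> G y = ?F (?C y) y)"
      by (elim exE conjE)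
    have "G v = ?F P v" if P: "(i, P) \<in> J" and v: "v \<in> P" for P v
    proof -
      interpret p: core_piece "grp S i" "X i" "A i" P using piece[OF P] by simp
      have vv: "v \<in> CV i" using p.P_sub_Cr v by blast
      have Cv: "?C v = P" using p.P_of[OF v] .
      obtain g where g: "g \<in> Gc i" "?k g (?C v) \<in> ?R" "\<forall>y\<in>CV i. ?C y = ?k g (?C v) \<longrightarrow> G y = ?F (?C y) y"
        using bspec[OF G(3) vv] by blast
      have "?k g P = P" using rep_unique[OF P _ g(1)] g(2) Cv by simp
      thus ?thesis using g(3) vv Cv by simp
    qed
    thus "\<exists>G. (\<forall>v\<in>CV i. G v \<in> XP (\<sigma> i)) \<and>
      (\<forall>h\<in>Gc i. \<forall>v\<in>CV i. G (act (X i) h v) = tw X i h (G v)) \<and>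
      (\<forall>P. (i, P) \<in> J \<longrightarrow> (\<forall>v\<in>P. G v = ?F P v))" using G(1,2) by (intro exI[of _ G]) blast
  qed
  from bchoice[OF this] obtain G where G: "\<forall>i\<in>idx S. (\<forall>v\<in>CV i. G i v \<in> XP (\<sigma> i)) \<and>
    (\<forall>h\<in>Gc i. \<forall>v\<in>CV i. G i (act (X i) h v) = tw X i h (G i v)) \<and>
    (\<forall>P. (i, P) \<in> J \<longrightarrow> (\<forall>v\<in>P. G i v = point_act (X (\<sigma> i)) (kk (i, P)) (F (i, P) v)))" by blast
  \<comment> \<open>The edge lengths are spread in the same way, with the trivial action on the
    reals. The class of an edge is the component that contains it, written as a union over its
    ends.\<close>
  have "\<forall>i\<in>idx S. \<exists>m. (\<forall>h\<in>Gc i. \<forall>e\<in>CE i. m (act (X i) h ` e) = m e) \<and>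
    (\<forall>P. (i, P) \<in> J \<longrightarrow> (\<forall>e\<in>CE i. e \<subseteq> P \<longrightarrow> m e = l (i, P) e))"
  proof
    fix i assume i: "i \<in> idx S"
    interpret c: sgtree "grp S i" "X i" "CrX i" by (rule Cr_sg[OF i])
    let ?C = "\<lambda>e. \<Union>v\<in>e. component (CrX i) v" and ?k = "\<lambda>g. (`) (act (X i) g)" and ?R = "{P. (i, P) \<in> J}"
    have Ce: "?C e = component (CrX i) v \<and> v \<in> CV i \<and> e \<subseteq> ?C e" if e: "e \<in> CE i" and v: "v \<in> e" for e v
    proof -
      obtain a b where ab: "e = {a, b}" using c.edge_obtain[OF c.A_edge[OF e]] by metis
      have "component (CrX i) a = component (CrX i) b" using c.comp_edge_iff[OF c.A_edge] e ab by blast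
      hence "?C e = component (CrX i) v" using ab v by auto
      moreover have "v \<in> CV i" using c.sub e v unfolding subgraph_of_def by blast
      moreover have "e \<subseteq> ?C e" by auto
      ultimately show ?thesis by blast
    qed
    have ne: "\<exists>v. v \<in> e" if e: "e \<in> CE i" for e using c.edge_obtain[OF c.A_edge[OF e]] by (metis insertI1)
    have "\<exists>m. (\<forall>e\<in>CE i. m e \<in> (UNIV :: real set)) \<and>
      (\<forall>h\<in>Gc i. \<forall>e\<in>CE i. m (act (X i) h ` e) = m e) \<and>
      (\<forall>e\<in>CE i. \<exists>g\<in>Gc i. ?k g (?C e) \<in> ?R \<and> (\<forall>y\<in>CE i. ?C y = ?k g (?C e) \<longrightarrow> m y = l (i, ?C y) y))"
    proof (rule equivariant_choice[where V = "CE i" and Y = "UNIV" and a = ?k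
          and b = "\<lambda>_ y. y" and c = ?C and k = ?k and R = ?R and F = "\<lambda>P. l (i, P)", OF c.grp])
      show "act (X i) g ` e \<in> CE i" if "g \<in> Gc i" "e \<in> CE i" for g e using c.A_act[OF that] .
      show "act (X i) \<one>\<^bsub>grp S i\<^esub> ` e = e" if "e \<in> CE i" for e
        using c.act_one c.edge_verts[OF c.A_edge[OF that]] by (auto simp: subset_iff image_iff)
      show "act (X i) (g \<otimes>\<^bsub>grp S i\<^esub> h) ` e = act (X i) g ` act (X i) h ` e"
        if "g \<in> Gc i" "h \<in> Gc i" "e \<in> CE i" for g h e
        unfolding image_image by (rule image_cong) (use c.act_mult[OF that(1,2)] c.edge_verts[OF c.A_edge[OF that(3)]] in auto)
      show "?C (act (X i) g ` e) = act (X i) g ` ?C e" if "g \<in> Gc i" "e \<in> CE i" for g e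
        using c.comp_act[OF that(1)] c.edge_verts[OF c.A_edge[OF that(2)]] by (simp add: image_UN subset_iff)
      show "\<exists>g\<in>Gc i. act (X i) g ` ?C e \<in> ?R" if e: "e \<in> CE i" for e
      proof -
        obtain v where "v \<in> e" using ne[OF e] by blast
        thus ?thesis using Ce[OF e] rep_ex[OF i] by auto
      qed
      show "l (i, ?C e) (act (X i) g ` e) = l (i, ?C e) e"
        if "e \<in> CE i" "?C e \<in> ?R" "g \<in> Gc i" "act (X i) g ` ?C e = ?C e" for e g
      proof -
        have j: "(i, ?C e) \<in> J" using that by simp
        interpret p: core_piece "grp S i" "X i" "A i" "?C e" using piece[OF j] by simp
        have "e \<subseteq> ?C e" by auto
        thus ?thesis using pl[OF j] that by (simp add: p.piece_len_def set_stab_def)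
      qed
    qed auto
    then obtain m where m: "\<forall>h\<in>Gc i. \<forall>e\<in>CE i. m (act (X i) h ` e) = m e"
      "\<forall>e\<in>CE i. \<exists>g\<in>Gc i. ?k g (?C e) \<in> ?R \<and> (\<forall>y\<in>CE i. ?C y = ?k g (?C e) \<longrightarrow> m y = l (i, ?C y) y)"
      by (elim exE conjE)
    have "m e = l (i, P) e" if P: "(i, P) \<in> J" and e: "e \<in> CE i" "e \<subseteq> P" for P e
    proof -
      interpret p: core_piece "grp S i" "X i" "A i" P using piece[OF P] by simp
      obtain v where v: "v \<in> e" using ne[OF e(1)] by blast
      have Cv: "?C e = P" using Ce[OF e(1) v] p.P_of[of v] v e(2) by auto
      obtain g where g: "g \<in> Gc i" "?k g (?C e) \<in> ?R" "\<forall>y\<in>CE i. ?C y = ?k g (?C e) \<longrightarrow> m y = l (i, ?C y) y"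
        using bspec[OF m(2) e(1)] by blast
      have "?k g P = P" using rep_unique[OF P _ g(1)] g(2) Cv by simp
      thus ?thesis using g(3) e(1) Cv by simp
    qed
    thus "\<exists>m. (\<forall>h\<in>Gc i. \<forall>e\<in>CE i. m (act (X i) h ` e) = m e) \<and>
      (\<forall>P. (i, P) \<in> J \<longrightarrow> (\<forall>e\<in>CE i. e \<subseteq> P \<longrightarrow> m e = l (i, P) e))" using m(1) by (intro exI[of _ m]) blast
  qed
  from bchoice[OF this] obtain m where m: "\<forall>i\<in>idx S. (\<forall>h\<in>Gc i. \<forall>e\<in>CE i. m i (act (X i) h ` e) = m i e) \<and>
    (\<forall>P. (i, P) \<in> J \<longrightarrow> (\<forall>e\<in>CE i. e \<subseteq> P \<longrightarrow> m i e = l (i, P) e))" by blast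
  have m_act: "m i (act (X i) h ` e) = m i e" if "i \<in> idx S" "h \<in> Gc i" "e \<in> CE i" for i h e
    using m that by blast
  have m_eq: "m i e = l (i, P) e" if "(i, P) \<in> J" "e \<in> CE i" "e \<subseteq> P" for i P e
    using m that J_idx[OF that(1)] by auto
  have G_act: "G i (act (X i) h v) = tw X i h (G i v)" if "i \<in> idx S" "h \<in> Gc i" "v \<in> CV i" for i h v
    using G that by blast
  have G_in: "G i v \<in> XP (\<sigma> i)" if "i \<in> idx S" "v \<in> CV i" for i v using G that by blast
  have G_eq: "G i v = point_act (X (\<sigma> i)) (kk (i, P)) (F (i, P) v)" if "(i, P) \<in> J" "v \<in> P" for i P v
    using G that J_idx[OF that(1)] by auto
  \<comment> \<open>Every edge of the core has a translate in a representative piece, where its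
    length and the map are known explicitly.\<close>
  have to_rep: "\<exists>g P. g \<in> Gc i \<and> (i, P) \<in> J \<and> act (X i) g u \<in> P \<and> act (X i) g w \<in> P \<and>
      {act (X i) g u, act (X i) g w} \<in> CE i \<and> m i {u, w} = m i {act (X i) g u, act (X i) g w} \<and>
      u \<in> CV i \<and> w \<in> CV i"
    if i: "i \<in> idx S" and e: "{u, w} \<in> CE i" for i u w
  proof -
    interpret c: sgtree "grp S i" "X i" "CrX i" by (rule Cr_sg[OF i])
    have uw: "u \<in> CV i" "w \<in> CV i" using c.sub e unfolding subgraph_of_def by blast+
    obtain g where g: "g \<in> Gc i" "(i, act (X i) g ` component (CrX i) u) \<in> J" using rep_ex[OF i uw(1)] by blast
    have "w \<in> component (CrX i) u" using e by (simp add: r_into_rtrancl)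
    moreover have "u \<in> component (CrX i) u" by simp
    ultimately have "act (X i) g u \<in> act (X i) g ` component (CrX i) u" "act (X i) g w \<in> act (X i) g ` component (CrX i) u" by blast+
    moreover have "act (X i) g ` {u, w} \<in> CE i" using c.A_act[OF g(1) e] .
    moreover have "m i {u, w} = m i (act (X i) g ` {u, w})" using m_act[OF i g(1) e] by simp
    ultimately show ?thesis using g uw by (intro exI[of _ g] exI[of _ "act (X i) g ` component (CrX i) u"]) simp
  qed
  show ?thesis
  proof (intro exI[of _ m] exI[of _ G] ballI conjI allI impI)
    fix i assume i: "i \<in> idx S"
    interpret c: sgtree "grp S i" "X i" "CrX i" by (rule Cr_sg[OF i])
    interpret c': sgtree "grp S (\<sigma> i)" "X (\<sigma> i)" "CrX (\<sigma> i)" by (rule Cr_sg[OF perm[OF i]])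
    show "G i v \<in> XP (\<sigma> i)" if "v \<in> CV i" for v using G_in[OF i that] .
    show "G i (act (X i) h v) = tw X i h (G i v)" if "h \<in> Gc i" "v \<in> CV i" for h v
      using G_act[OF i that] .
    show "m i (act (X i) h ` e) = m i e" if "e \<in> CE i" "h \<in> Gc i" for h e using m_act[OF i that(2,1)] .
    show "0 < m i e" if e: "e \<in> CE i" for e
    proof -
      obtain a b where ab: "e = {a, b}" using c.edge_obtain[OF c.A_edge[OF e]] by metis
      obtain g P where g: "g \<in> Gc i" "(i, P) \<in> J" "act (X i) g a \<in> P" "act (X i) g b \<in> P"
        "{act (X i) g a, act (X i) g b} \<in> CE i" "m i {a, b} = m i {act (X i) g a, act (X i) g b}"
        using to_rep[OF i, of a b] e ab by blast
      interpret p: core_piece "grp S i" "X i" "A i" P using piece[OF g(2)] by simp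
      have "m i {act (X i) g a, act (X i) g b} = l (i, P) {act (X i) g a, act (X i) g b}" using m_eq[OF g(2,5)] g by simp
      thus ?thesis using pl[OF g(2)] g ab by (simp add: p.piece_len_def)
    qed
    fix u w assume e: "{u, w} \<in> CE i"
    obtain g P where g: "g \<in> Gc i" "(i, P) \<in> J" "act (X i) g u \<in> P" "act (X i) g w \<in> P"
      "{act (X i) g u, act (X i) g w} \<in> CE i" "m i {u, w} = m i {act (X i) g u, act (X i) g w}"
      "u \<in> CV i" "w \<in> CV i"
      using to_rep[OF i e] by blast
    let ?u = "act (X i) g u" and ?w = "act (X i) g w" and ?j = "(i, P)"
    have uw: "u \<in> XV i" "w \<in> XV i" using c.A_vert g by auto
    have j': "nx ?j \<in> J" using \<psi>_perm[OF g(2)] .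
    have fj': "fst (nx ?j) = \<sigma> i" using \<psi>_fst[OF g(2)] by simp
    interpret p': core_piece "grp S (\<sigma> i)" "X (\<sigma> i)" "A (\<sigma> i)" "snd (nx ?j)" using piece[OF j'] fj' by simp
    have k: "kk ?j \<in> Gc (\<sigma> i)" using kk(1)[OF g(2)] by simp
    \<comment> \<open>By equivariance \<open>G\<close> at \<open>u\<close> is the translate by
      \<open>h\<close> of \<open>F\<close> at the corresponding vertex of the representative, so a
      chain found there is carried over by \<open>h\<close>.\<close>
    define h where "h = inv\<^bsub>grp S (\<sigma> i)\<^esub> (\<theta> i g) \<otimes>\<^bsub>grp S (\<sigma> i)\<^esub> kk ?j"
    have tg: "\<theta> i g \<in> Gc (\<sigma> i)" using maps_in[OF i g(1)] .
    have h: "h \<in> Gc (\<sigma> i)" using c'.mult_in[OF c'.inv_in[OF tg] k] by (simp add: h_def)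
    have Fh: "G i v = push (act (X (\<sigma> i)) h) (F ?j (act (X i) g v))" if v: "v \<in> CV i" "act (X i) g v \<in> P" for v
    proof -
      have Fp: "F ?j (act (X i) g v) \<in> XP (\<sigma> i)" using F_in[OF g(2)] v by simp
      have "tw X i g (G i v) = point_act (X (\<sigma> i)) (kk ?j) (F ?j (act (X i) g v))"
        using G_act[OF i g(1) v(1)] G_eq[OF g(2) v(2)] by simp
      hence "G i v = point_act (X (\<sigma> i)) (inv\<^bsub>grp S (\<sigma> i)\<^esub> (\<theta> i g)) (point_act (X (\<sigma> i)) (kk ?j) (F ?j (act (X i) g v)))"
        using c'.point_act_inv[OF tg G_in[OF i v(1)]] by simp
      also have "\<dots> = point_act (X (\<sigma> i)) h (F ?j (act (X i) g v))"
        unfolding h_def using c'.point_act_mult[OF c'.inv_in[OF tg] k Fp] by simp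
      finally show ?thesis using c'.point_act_push[OF h Fp] by simp
    qed
    have s1: "sedges (tp (nx ?j) (l (nx ?j))) = {e \<in> CE (\<sigma> i). e \<subseteq> snd (nx ?j)}"
      using core_piece.TP_sel(2)[OF piece[OF j']] fj' by simp
    have jj: "(\<sigma> i, snd (nx ?j)) = nx ?j" using fj' by (metis prod.collapse)
    have "ch (sedges (tp (nx ?j) (l (nx ?j)))) (l (nx ?j)) (F ?j ?u) (F ?j ?w) (L * l ?j {?u, ?w})"
      using F_ch[OF g(2), of ?u ?w] g by simp
    hence "ch (CE (\<sigma> i)) (m (\<sigma> i)) (F ?j ?u) (F ?j ?w) (1 * (L * l ?j {?u, ?w}))"
    proof (rule ch_mono_len)
      show "m (\<sigma> i) e \<le> 1 * l (nx ?j) e" if "e \<in> sedges (tp (nx ?j) (l (nx ?j)))" for e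
        using m_eq[of "\<sigma> i" "snd (nx ?j)" e] that s1 jj j' by simp
    qed (use s1 in auto)
    hence "ch (CE (\<sigma> i)) (m (\<sigma> i)) (F ?j ?u) (F ?j ?w) (L * m i {u, w})"
      using m_eq[OF g(2,5)] g(3,4,6) by simp
    hence "ch (CE (\<sigma> i)) (m (\<sigma> i)) (push (act (X (\<sigma> i)) h) (F ?j ?u)) (push (act (X (\<sigma> i)) h) (F ?j ?w)) (1 * (L * m i {u, w}))"
    proof (rule ch_push)
      show "card e = 2" if "e \<in> CE (\<sigma> i)" for e using c'.edge_card[OF c'.A_edge[OF that]] .
      show pos: "0 \<le> m (\<sigma> i) e" if e: "e \<in> CE (\<sigma> i)" for e
      proof -
        obtain a b where ab: "e = {a, b}" using c'.edge_obtain[OF c'.A_edge[OF e]] by metis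
        obtain g P where g: "(\<sigma> i, P) \<in> J" "act (X (\<sigma> i)) g a \<in> P" "act (X (\<sigma> i)) g b \<in> P"
          "{act (X (\<sigma> i)) g a, act (X (\<sigma> i)) g b} \<in> CE (\<sigma> i)" "m (\<sigma> i) {a, b} = m (\<sigma> i) {act (X (\<sigma> i)) g a, act (X (\<sigma> i)) g b}"
          using to_rep[OF perm[OF i], of a b] e ab by blast
        interpret p: core_piece "grp S (\<sigma> i)" "X (\<sigma> i)" "A (\<sigma> i)" P using piece[OF g(1)] by simp
        have "m (\<sigma> i) {act (X (\<sigma> i)) g a, act (X (\<sigma> i)) g b} = l (\<sigma> i, P) {act (X (\<sigma> i)) g a, act (X (\<sigma> i)) g b}" using m_eq[OF g(1,4)] g by simp
        thus ?thesis using pl[OF g(1)] g ab by (simp add: p.piece_len_def less_imp_le)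
      qed
      show "{act (X (\<sigma> i)) h a, act (X (\<sigma> i)) h b} \<in> CE (\<sigma> i) \<and>
          m (\<sigma> i) {act (X (\<sigma> i)) h a, act (X (\<sigma> i)) h b} \<le> 1 * m (\<sigma> i) {a, b}" if "{a, b} \<in> CE (\<sigma> i)" for a b
        using c'.A_act[OF h that] m_act[OF perm[OF i] h that] by simp
    qed simp
    thus "ch (CE (\<sigma> i)) (m (\<sigma> i)) (G i u) (G i w) (L * m i {u, w})"
      using Fh[OF g(7,3)] Fh[OF g(8,4)] by simp
  qed
qed

text \<open>A heavy component of \<open>A\<close> meets the core in a subtree. The map of the core
  is composed with the projection onto this subtree, which contracts the edges of \<open>A\<close>
  outside the core and commutes with the group.\<close>

lemma chains_from_core:
  assumes less: "simplex_displacement CS \<psi> CF < ereal L" and Lpos: "0 < L"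
  shows "core_chains L"
proof -
  obtain m G where mG: "\<forall>i\<in>idx S. (\<forall>e\<in>CE i. 0 < m i e \<and> (\<forall>h\<in>Gc i. m i (act (X i) h ` e) = m i e)) \<and>
    (\<forall>v\<in>CV i. G i v \<in> XP (\<sigma> i)) \<and>
    (\<forall>h\<in>Gc i. \<forall>v\<in>CV i. G i (act (X i) h v) = tw X i h (G i v)) \<and>
    (\<forall>u w. {u, w} \<in> CE i \<longrightarrow> ch (CE (\<sigma> i)) (m (\<sigma> i)) (G i u) (G i w) (L * m i {u, w}))"
    using core_map[OF less Lpos] by blast
  obtain f where f: "f \<in> equivariant_maps S X (twist \<phi> X)" using inv by (auto simp: invariant_subgraph_def)
  have fp: "f i p \<in> XP (\<sigma> i)" if "i \<in> idx S" "p \<in> XP i" for i p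
    using f that by (auto simp: equivariant_maps_def twist_def)
  have fe: "f i (point_act (X i) h p) = tw X i h (f i p)"
    if "i \<in> idx S" "h \<in> Gc i" "p \<in> XP i" for i h p
    using f that by (auto simp: equivariant_maps_def twist_def)
  define W where "W i v = cp i v \<inter> CV i" for i v
  \<comment> \<open>The constant 1 is arbitrary: edges outside the core are contracted by the
    projection, so any positive invariant length serves.\<close>
  define l where "l i e = (if e \<in> CE i then m i e else 1)" for i e
  \<comment> \<open>A vertex outside \<open>A\<close> can still be a heavy vertex of the collapse,
    if its own stabiliser is non-trivial. It lies on no edge of \<open>A\<close>, so any equivariant
    value is allowed there.\<close>
  define F where "F i v = (if v \<in> VA i then G i (mtree.proj (X i) (W i v) v) else f i (vpoint v))" for i v
  have al: "alen l"
    unfolding alen_def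
  proof (intro ballI conjI)
    fix i e assume i: "i \<in> idx S" and e: "e \<in> EA i"
    interpret a: ctree "grp S i" "X i" "A i" by (rule ct[OF i])
    interpret c: sgtree "grp S i" "X i" "CrX i" by (rule Cr_sg[OF i])
    show "0 < l i e" using mG i by (simp add: l_def)
    show "l i (act (X i) h ` e) = l i e" if "h \<in> Gc i" for h
      using mG i c.A_act_iff[OF that a.A_edge[OF e]] that by (simp add: l_def)
  qed
  \<comment> \<open>Non-empty by \<open>core_exists\<close>, connected by
    \<open>core_connected\<close>.\<close>
  have Wc: "mtree.convex_verts (X i) (W i v)" if i: "i \<in> idx S" and v: "v \<in> VA i" and nl: "\<not> lt i (cp i v)" for i v
  proof -
    interpret a: ctree "grp S i" "X i" "A i" by (rule ct[OF i])
    interpret c: sgtree "grp S i" "X i" "CrX i" by (rule Cr_sg[OF i])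
    have vT: "v \<in> XV i" using a.A_vert[OF v] .
    obtain h where h: "h \<in> Gc i" "h \<noteq> \<one>\<^bsub>grp S i\<^esub>" "act (D i) h (cp i v) = cp i v"
      using nl by (auto simp: a.light_def D_def')
    have "cp i (act (X i) h v) = cp i v" using a.C_act[OF h(1) vT] h(3) by (simp add: D_def')
    hence "joined (EA i) v (act (X i) h v)" by (metis component_eq_iff)
    then obtain w where "w \<in> CV i" "joined (EA i) v w" using a.core_exists[OF v h(1,2)] by blast
    hence ne: "W i v \<noteq> {}" by (auto simp: W_def)
    have "joined {e \<in> XE i. e \<subseteq> W i v} u w" if u: "u \<in> W i v" and w: "w \<in> W i v" for u w
    proof -
      have "joined (EA i) u w" using u w unfolding W_def by (metis IntD1 adj_sym in_component rtrancl_trans)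
      hence "joined (CE i) u w" using a.core_connected[of u w] u w by (auto simp: W_def)
      thus ?thesis
      proof (induction rule: rtrancl_induct)
        case (step x y)
        have "joined (EA i) u x" using adj_mono[OF step(1) a.core_sub_A(2)] .
        moreover have xy: "{x, y} \<in> CE i" using step(2) by simp
        moreover have "{x, y} \<in> EA i" using xy a.core_sub_A(2) by blast
        ultimately have "x \<in> cp i v" "y \<in> cp i v" using u unfolding W_def
          by (auto intro: rtrancl_trans rtrancl_into_rtrancl)
        moreover have "x \<in> CV i" "y \<in> CV i" using c.sub xy unfolding subgraph_of_def by blast+
        ultimately have "(x, y) \<in> adj {e \<in> XE i. e \<subseteq> W i v}" using c.A_edge[OF xy] by (simp add: W_def)
        with step.IH show ?case by (rule rtrancl_into_rtrancl)
      qed simp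
    qed
    moreover have "W i v \<subseteq> XV i" using c.A_vert by (auto simp: W_def)
    ultimately show ?thesis using ne by (simp add: a.convex_verts_def)
  qed
  have W_act: "W i (act (X i) h v) = act (X i) h ` W i v" if i: "i \<in> idx S" and h: "h \<in> Gc i" and v: "v \<in> XV i" for i h v
  proof -
    interpret a: ctree "grp S i" "X i" "A i" by (rule ct[OF i])
    interpret c: sgtree "grp S i" "X i" "CrX i" by (rule Cr_sg[OF i])
    have 1: "act (X i) h w \<in> CV i \<longleftrightarrow> w \<in> CV i" if w: "w \<in> XV i" for w
      using subgraph_act_vert[OF c.sub h, of w] subgraph_act_vert[OF c.sub a.inv_in[OF h], of "act (X i) h w"] a.act_inv_act[OF h w] by auto
    show ?thesis unfolding W_def a.comp_act[OF h v, symmetric]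
    proof (intro subset_antisym subsetI)
      fix x assume "x \<in> act (X i) h ` cp i v \<inter> CV i"
      then obtain w where w: "w \<in> cp i v" "x = act (X i) h w" "x \<in> CV i" by blast
      thus "x \<in> act (X i) h ` (cp i v \<inter> CV i)" using 1[OF a.comp_verts[OF v w(1)]] by blast
    next
      fix x assume "x \<in> act (X i) h ` (cp i v \<inter> CV i)"
      thus "x \<in> act (X i) h ` cp i v \<inter> CV i" using subgraph_act_vert[OF c.sub h] by blast
    qed
  qed
  have pr: "mtree.proj (X i) (W i v) v \<in> CV i" if i: "i \<in> idx S" and v: "v \<in> VA i" "\<not> lt i (cp i v)" for i v
  proof -
    interpret a: ctree "grp S i" "X i" "A i" by (rule ct[OF i])
    show ?thesis using a.proj(1)[OF Wc[OF i v] a.A_vert[OF v(1)]] by (simp add: W_def)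
  qed
  show ?thesis
  proof (intro exI[of _ l] exI[of _ F] conjI ballI allI impI al)
    fix i v assume i: "i \<in> idx S" and v: "v \<in> XV i" and nl: "\<not> lt i (cp i v)"
    show "F i v \<in> XP (\<sigma> i)"
      using mG i pr[OF i _ nl] fp[OF i mgraph.vpoint_points[OF X_graph[OF i] v]] by (simp add: F_def)
  next
    fix i h v assume i: "i \<in> idx S" and h: "h \<in> Gc i" and v: "v \<in> XV i" and nl: "\<not> lt i (cp i v)"
    interpret a: ctree "grp S i" "X i" "A i" by (rule ct[OF i])
    have hA: "act (X i) h v \<in> VA i \<longleftrightarrow> v \<in> VA i"
      using subgraph_act_vert[OF a.sub h, of v] subgraph_act_vert[OF a.sub a.inv_in[OF h], of "act (X i) h v"] a.act_inv_act[OF h v] by auto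
    show "F i (act (X i) h v) = tw X i h (F i v)"
    proof (cases "v \<in> VA i")
      case True
      thus ?thesis using hA mG i h pr[OF i True nl] W_act[OF i h v] a.proj_act[OF Wc[OF i True nl] h v] by (simp add: F_def)
    next
      case False
      thus ?thesis using hA fe[OF i h a.vpoint_points[OF v]] a.point_act_vpoint[OF h v] by (simp add: F_def)
    qed
  next
    fix i u w assume i: "i \<in> idx S" and e: "{u, w} \<in> EA i" and nl: "\<not> lt i (cp i u)"
    interpret a: ctree "grp S i" "X i" "A i" by (rule ct[OF i])
    interpret a': ctree "grp S (\<sigma> i)" "X (\<sigma> i)" "A (\<sigma> i)" by (rule ct[OF perm[OF i]])
    have uw: "u \<in> VA i" "w \<in> VA i" using a.sub e unfolding subgraph_of_def by blast+
    have eq: "cp i u = cp i w" using a.comp_edge_iff[OF a.A_edge[OF e]] e by simp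
    hence Weq: "W i u = W i w" by (simp add: W_def)
    have lpos: "0 < l i {u, w}" using al i e by (simp add: alen_def)
    show "ch (EA (\<sigma> i)) (l (\<sigma> i)) (F i u) (F i w) (L * l i {u, w})"
      using a.proj_edge[OF Wc[OF i uw(1) nl] a.A_edge[OF e]]
    proof
      assume b: "u \<in> W i u \<and> w \<in> W i u"
      hence "u \<in> CV i" "w \<in> CV i" by (auto simp: W_def)
      hence "joined (CE i) u w" using a.core_connected e by (simp add: r_into_rtrancl)
      hence eC: "{u, w} \<in> CE i"
        using tree_edge_in[OF a.tree a.A_edge[OF e]] a.core_sub_A(2) a.A_edge by blast
      have "F i u = G i u" "F i w = G i w" using uw b Weq a.proj_id[OF Wc[OF i uw(1) nl]] by (auto simp: F_def)
      moreover have "ch (CE (\<sigma> i)) (m (\<sigma> i)) (G i u) (G i w) (L * m i {u, w})" using mG i eC by blast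
      hence "ch (EA (\<sigma> i)) (l (\<sigma> i)) (G i u) (G i w) (1 * (L * m i {u, w}))"
        by (rule ch_mono_len) (use a'.core_sub_A in \<open>auto simp: l_def\<close>)
      ultimately show ?thesis using eC by (simp add: l_def)
    next
      assume "a.proj (W i u) u = a.proj (W i u) w"
      hence "F i u = F i w" using uw Weq by (simp add: F_def)
      thus ?thesis using ch_refl[of "L * l i {u, w}"] Lpos lpos by simp
    qed
  qed
qed

end

section \<open>Cocompactness\<close>

lemma epath_reach: "epath E u p w \<Longrightarrow> x \<in> set p \<Longrightarrow> joined E u x"
proof (induction p arbitrary: u)
  case (Cons a p)
  show ?case
  proof (cases "x = u")
    case False
    hence x: "x \<in> set p" using Cons.prems by (auto simp: epath_def)
    then obtain b q where p: "p = b # q" by (cases p) auto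
    hence "epath E b p w" "{u, b} \<in> E" using Cons.prems by (auto simp: epath_def)
    thus ?thesis using Cons.IH x by (meson adj_iff converse_rtrancl_into_rtrancl)
  qed simp
qed (simp add: epath_def)

lemma finite_adj:
  assumes "joined E u w"
  shows "\<exists>F. finite F \<and> F \<subseteq> E \<and> joined F u w"
  using assms
proof (induction rule: rtrancl_induct)
  case (step y z)
  then obtain F where F: "finite F" "F \<subseteq> E" "joined F u y" by blast
  have "joined (insert {y, z} F) u y" using F(3) by (rule adj_mono) blast
  hence "joined (insert {y, z} F) u z" by (rule rtrancl_into_rtrancl) simp
  thus ?case using F step.hyps(2) by (intro exI[of _ "insert {y, z} F"]) simp
qed blast

context mtree
begin

definition sweep :: "'b set set \<Rightarrow> 'b set set" where
  "sweep E = {act T h ` e | h e. h \<in> carrier G \<and> e \<in> E}"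

lemma sweepI: "h \<in> carrier G \<Longrightarrow> e \<in> E \<Longrightarrow> act T h ` e \<in> sweep E"
  unfolding sweep_def by blast

lemma sweepE:
  assumes "d \<in> sweep E" obtains h e where "h \<in> carrier G" "e \<in> E" "d = act T h ` e"
  using assms unfolding sweep_def by blast

lemma sweep_act:
  assumes "E \<subseteq> ET" "h \<in> carrier G" "e \<in> sweep E"
  shows "act T h ` e \<in> sweep E"
proof -
  obtain g d where g: "g \<in> carrier G" "d \<in> E" "e = act T g ` d" using assms(3) by (rule sweepE)
  have "d \<subseteq> VT" using g(2) assms(1) edge_verts by blast
  hence "act T h ` e = act T (h \<otimes> g) ` d" unfolding g(3) image_image
    using act_mult[OF assms(2) g(1)] by (intro image_cong refl) (simp add: subset_iff)
  thus ?thesis using sweepI[OF mult_in[OF assms(2) g(1)] g(2)] by (simp only:)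
qed

lemma sweep_sub: "E \<subseteq> ET \<Longrightarrow> sweep E \<subseteq> ET"
  unfolding sweep_def using act_edge by blast

lemma sweep_ext: "E \<subseteq> ET \<Longrightarrow> E \<subseteq> sweep E"
proof
  fix e assume e: "E \<subseteq> ET" "e \<in> E"
  hence "e \<subseteq> VT" using edge_verts by blast
  hence "act T \<one> ` e = e" using act_one by force
  thus "e \<in> sweep E" using e(2) one_in unfolding sweep_def by blast
qed

text \<open>The part of the sweep that is joined to \<open>r\<close> is invariant and convex, hence
  by minimality contains all vertices. By the tree property every edge then belongs to the
  sweep.\<close>

lemma finite_orbits:
  assumes min: "minimal_tree G T" and E0: "finite E0" "E0 \<subseteq> ET" and r: "r \<in> VT"
    and gen: "\<And>h. h \<in> carrier G \<Longrightarrow> joined (sweep E0) r (act T h r)"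
  shows "\<exists>E0. finite E0 \<and> E0 \<subseteq> ET \<and> (\<forall>e\<in>ET. \<exists>h\<in>carrier G. \<exists>e0\<in>E0. e = act T h ` e0)"
    and "\<exists>V0. finite V0 \<and> V0 \<subseteq> VT \<and> (\<forall>v\<in>VT. \<exists>h\<in>carrier G. \<exists>v0\<in>V0. v = act T h v0)"
proof -
  let ?E = "sweep E0"
  have sub: "?E \<subseteq> ET" by (rule sweep_sub[OF E0(2)])
  define W where "W = {w. joined ?E r w}"
  have W_sub: "W \<subseteq> VT"
  proof
    fix w assume "w \<in> W"
    thus "w \<in> VT" unfolding W_def
      using adj_vertex_transfer[of r w ?E "VT"] r sub edge_ends by blast
  qed
  have W_act: "act T h w \<in> W" if "h \<in> carrier G" "w \<in> W" for h w
  proof -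
    have "joined ?E (act T h r) (act T h w)"
      using that(2) sweep_act[OF E0(2) that(1)] unfolding W_def by (intro act_adj[where E = ?E]) auto
    thus ?thesis using gen[OF that(1)] unfolding W_def by (auto intro: rtrancl_trans)
  qed
  have W_path: "\<exists>p. is_path T u p w \<and> set p \<subseteq> W" if "u \<in> W" "w \<in> W" for u w
  proof -
    have "joined ?E r u" "joined ?E r w" using that by (simp_all add: W_def)
    hence c: "joined ?E u w" using rtrancl_trans[OF adj_sym[of r u ?E]] by blast
    obtain p where p: "epath ?E u p w" using rtrancl_epath[OF c] by blast
    have pW: "set p \<subseteq> W"
      using epath_reach[OF p] that(1) unfolding W_def by (auto intro: rtrancl_trans)
    moreover have "epath ET u p w" using epath_mono[OF p sub] .
    ultimately show ?thesis using W_sub unfolding is_path_def epath_def by blast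
  qed
  have W: "W = VT"
  proof -
    have "r \<in> W" by (simp add: W_def)
    hence "W \<noteq> {}" by blast
    moreover have "\<forall>h\<in>carrier G. act T h ` W \<subseteq> W" using W_act by blast
    moreover have "\<forall>u\<in>W. \<forall>w\<in>W. \<exists>p. is_path T u p w \<and> set p \<subseteq> W" using W_path by blast
    ultimately show ?thesis using min W_sub unfolding minimal_tree_def by blast
  qed
  have edges: "e \<in> ?E" if e: "e \<in> ET" for e
  proof -
    obtain u w where uw: "e = {u, w}" "u \<in> W" "w \<in> W" using edge_obtain[OF e] W by metis
    have "joined ?E u w" using uw(2,3) rtrancl_trans[OF adj_sym[of r u ?E]] unfolding W_def by simp
    thus ?thesis using tree_edge_in[OF tree _ sub] e uw by blast
  qed
  show "\<exists>E0. finite E0 \<and> E0 \<subseteq> ET \<and> (\<forall>e\<in>ET. \<exists>h\<in>carrier G. \<exists>e0\<in>E0. e = act T h ` e0)"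
    using E0 sweepE[OF edges] by (intro exI[of _ E0]) metis
  have "\<exists>h\<in>carrier G. \<exists>v0\<in>insert r (\<Union>E0). v = act T h v0" if v: "v \<in> VT" for v
  proof -
    have "joined ?E r v" using v W unfolding W_def by blast
    thus ?thesis
    proof (cases rule: rtranclE)
      case base
      thus ?thesis using act_one[OF r] one_in by (metis insertI1)
    next
      case (step y)
      hence "{y, v} \<in> ?E" by simp
      then obtain h e where he: "h \<in> carrier G" "e \<in> E0" "{y, v} = act T h ` e" by (rule sweepE)
      have "v \<in> act T h ` e" unfolding he(3)[symmetric] by simp
      thus ?thesis using he by blast
    qed
  qed
  moreover have "finite (insert r (\<Union>E0))"
  proof -
    have "finite e" if "e \<in> E0" for e using that E0(2) edge_card card.infinite by fastforce
    thus ?thesis using E0(1) by simp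
  qed
  moreover have "insert r (\<Union>E0) \<subseteq> VT" using r E0(2) edge_verts by blast
  ultimately show "\<exists>V0. finite V0 \<and> V0 \<subseteq> VT \<and> (\<forall>v\<in>VT. \<exists>h\<in>carrier G. \<exists>v0\<in>V0. v = act T h v0)"
    by blast
qed

end

locale gog =
  fixes \<Gamma> :: "('a, 'b, 'g) graph_of_groups" and b :: 'a
  assumes fin: "connected_finite_gog \<Gamma>" and base: "b \<in> verts (ggraph \<Gamma>)"
begin

lemma bi: "bidirected_digraph (ggraph \<Gamma>) (grev \<Gamma>)" and fd: "fin_digraph (ggraph \<Gamma>)"
  and sc: "strongly_connected (ggraph \<Gamma>)" and vgroup: "v \<in> verts (ggraph \<Gamma>) \<Longrightarrow> group (vgroup \<Gamma> v)"
  using fin unfolding connected_finite_gog_def by auto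

lemma grev: "e \<in> arcs (ggraph \<Gamma>) \<Longrightarrow> grev \<Gamma> e \<in> arcs (ggraph \<Gamma>) \<and>
    tail (ggraph \<Gamma>) (grev \<Gamma> e) = head (ggraph \<Gamma>) e \<and> head (ggraph \<Gamma>) (grev \<Gamma> e) = tail (ggraph \<Gamma>) e"
  and grev_grev: "grev \<Gamma> (grev \<Gamma> e) = e"
  and arc_verts: "e \<in> arcs (ggraph \<Gamma>) \<Longrightarrow> tail (ggraph \<Gamma>) e \<in> verts (ggraph \<Gamma>) \<and> head (ggraph \<Gamma>) e \<in> verts (ggraph \<Gamma>)"
proof -
  interpret bidirected_digraph "ggraph \<Gamma>" "grev \<Gamma>" by (rule bi)
  show "grev \<Gamma> (grev \<Gamma> e) = e" by simp
  show "e \<in> arcs (ggraph \<Gamma>) \<Longrightarrow> grev \<Gamma> e \<in> arcs (ggraph \<Gamma>) \<and>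
    tail (ggraph \<Gamma>) (grev \<Gamma> e) = head (ggraph \<Gamma>) e \<and> head (ggraph \<Gamma>) (grev \<Gamma> e) = tail (ggraph \<Gamma>) e" by simp
  show "e \<in> arcs (ggraph \<Gamma>) \<Longrightarrow> tail (ggraph \<Gamma>) e \<in> verts (ggraph \<Gamma>) \<and> head (ggraph \<Gamma>) e \<in> verts (ggraph \<Gamma>)" by simp
qed

lemma gpath_start: "gpath \<Gamma> u xs w \<Longrightarrow> u \<in> verts (ggraph \<Gamma>)"
  using arc_verts by (cases "(\<Gamma>, u, xs, w)" rule: gpath.cases) auto

lemma gpath_append: "gpath \<Gamma> u (xs @ ys) w \<longleftrightarrow> (\<exists>v. gpath \<Gamma> u xs v \<and> gpath \<Gamma> v ys w)"
proof (induction xs arbitrary: u)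
  case Nil
  thus ?case using gpath_start by auto
next
  case (Cons a xs)
  thus ?case by (cases a) auto
qed

lemma gpath_end: "gpath \<Gamma> u xs w \<Longrightarrow> w \<in> verts (ggraph \<Gamma>)"
  by (metis append_Nil2 gpath.simps(1) gpath_append)

lemma gpath_inv: "gpath \<Gamma> u xs w \<Longrightarrow> gpath \<Gamma> w (gpath_inv \<Gamma> xs) u"
proof (induction xs arbitrary: u)
  case Nil
  thus ?case by (auto simp: gpath_inv_def)
next
  case (Cons a xs)
  show ?case
  proof (cases a)
    case (Elt v g)
    hence "gpath \<Gamma> u xs w" "v = u" "g \<in> carrier (vgroup \<Gamma> u)" "u \<in> verts (ggraph \<Gamma>)" using Cons.prems by auto
    thus ?thesis using Cons.IH[of u] Elt vgroup[of u] by (auto simp: gpath_inv_def gpath_append)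
  next
    case (Arc e)
    hence "e \<in> arcs (ggraph \<Gamma>)" "tail (ggraph \<Gamma>) e = u" "gpath \<Gamma> (head (ggraph \<Gamma>) e) xs w" using Cons.prems by auto
    thus ?thesis using Cons.IH Arc grev[of e] arc_verts[of e] by (auto simp: gpath_inv_def gpath_append)
  qed
qed

lemma gpath_inv_inv: "gpath \<Gamma> u xs w \<Longrightarrow> gpath_inv \<Gamma> (gpath_inv \<Gamma> xs) = xs"
proof (induction xs arbitrary: u)
  case (Cons a xs)
  show ?case
  proof (cases a)
    case (Elt v g)
    hence "gpath \<Gamma> u xs w" "v = u" "g \<in> carrier (vgroup \<Gamma> u)" "u \<in> verts (ggraph \<Gamma>)" using Cons.prems by auto
    thus ?thesis using Cons.IH[of u] Elt group.inv_inv[OF vgroup[of u]] by (simp add: gpath_inv_def rev_map[symmetric])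
  next
    case (Arc e)
    thus ?thesis using Cons grev_grev by (auto simp: gpath_inv_def rev_map[symmetric])
  qed
qed (simp add: gpath_inv_def)

lemma gpath_ex: "v \<in> verts (ggraph \<Gamma>) \<Longrightarrow> \<exists>p. gpath \<Gamma> b p v"
proof -
  assume "v \<in> verts (ggraph \<Gamma>)"
  hence "b \<rightarrow>\<^sup>*\<^bsub>ggraph \<Gamma>\<^esub> v" using sc base unfolding strongly_connected_def by blast
  interpret wf_digraph "ggraph \<Gamma>" by (rule bidirected_digraph.axioms(1)[OF bi])
  show ?thesis using \<open>b \<rightarrow>\<^sup>*\<^bsub>ggraph \<Gamma>\<^esub> v\<close>
  proof (induction rule: reachable_induct)
    case base
    thus ?case by (intro exI[of _ "[]"]) simp
  next
    case (step x y)
    then obtain p e where p: "gpath \<Gamma> b p x" and e: "e \<in> arcs (ggraph \<Gamma>)" "tail (ggraph \<Gamma>) e = x" "head (ggraph \<Gamma>) e = y"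
      by (auto elim: reachableE)
    hence "gpath \<Gamma> b (p @ [Arc e]) y" using arc_verts[OF e(1)] by (auto simp: gpath_append)
    thus ?case by blast
  qed
qed

abbreviation hom_eq :: "('a, 'b, 'g) letter list \<Rightarrow> ('a, 'b, 'g) letter list \<Rightarrow> bool" (infix \<open>\<sim>\<close> 50) where
  "xs \<sim> ys \<equiv> (xs, ys) \<in> ghomotopy \<Gamma> b"

lemma hom_move: "(xs, ys) \<in> gmoves \<Gamma> \<Longrightarrow> gpath \<Gamma> b xs b \<Longrightarrow> gpath \<Gamma> b ys b \<Longrightarrow> xs \<sim> ys"
  unfolding ghomotopy_def Let_def gloops_def by (intro r_into_rtrancl) blast

lemma hom_refl [simp]: "xs \<sim> xs" by (simp add: ghomotopy_def Let_def)

lemma hom_trans: "xs \<sim> ys \<Longrightarrow> ys \<sim> zs \<Longrightarrow> xs \<sim> zs" unfolding ghomotopy_def Let_def by (rule rtrancl_trans)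

lemma hom_sym: "xs \<sim> ys \<Longrightarrow> ys \<sim> xs"
proof -
  have "sym (let R = gmoves \<Gamma> \<inter> (gloops \<Gamma> b \<times> gloops \<Gamma> b) in R \<union> R\<inverse>)"
    unfolding Let_def by (rule sym_Un_converse)
  thus "xs \<sim> ys \<Longrightarrow> ys \<sim> xs" unfolding ghomotopy_def Let_def by (meson sym_rtrancl symD)
qed

lemma gmoves_context: "(xs, ys) \<in> gmoves \<Gamma> \<Longrightarrow> (us @ xs @ ws, us @ ys @ ws) \<in> gmoves \<Gamma>"
proof -
  assume "(xs, ys) \<in> gmoves \<Gamma>"
  then consider (one) v as bs where "xs = as @ [Elt v \<one>\<^bsub>vgroup \<Gamma> v\<^esub>] @ bs" "ys = as @ bs"
    | (mult) v g h as bs where "xs = as @ [Elt v g, Elt v h] @ bs" "ys = as @ [Elt v (g \<otimes>\<^bsub>vgroup \<Gamma> v\<^esub> h)] @ bs"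
    | (arc) e as bs where "xs = as @ [Arc e, Arc (grev \<Gamma> e)] @ bs" "ys = as @ bs"
    unfolding gmoves_def by blast
  thus ?thesis
  proof cases
    case one
    hence "us @ xs @ ws = (us @ as) @ [Elt v \<one>\<^bsub>vgroup \<Gamma> v\<^esub>] @ (bs @ ws)" "us @ ys @ ws = (us @ as) @ (bs @ ws)" by simp_all
    thus ?thesis unfolding gmoves_def by blast
  next
    case mult
    hence "us @ xs @ ws = (us @ as) @ [Elt v g, Elt v h] @ (bs @ ws)"
      "us @ ys @ ws = (us @ as) @ [Elt v (g \<otimes>\<^bsub>vgroup \<Gamma> v\<^esub> h)] @ (bs @ ws)" by simp_all
    thus ?thesis unfolding gmoves_def by blast
  next
    case arc
    hence "us @ xs @ ws = (us @ as) @ [Arc e, Arc (grev \<Gamma> e)] @ (bs @ ws)" "us @ ys @ ws = (us @ as) @ (bs @ ws)" by simp_all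
    thus ?thesis unfolding gmoves_def by blast
  qed
qed

lemma hom_context:
  assumes "xs \<sim> ys" "gpath \<Gamma> b us b" "gpath \<Gamma> b ws b"
  shows "us @ xs @ ws \<sim> us @ ys @ ws"
  using assms(1) unfolding ghomotopy_def Let_def
proof (induction rule: rtrancl_induct)
  case (step y z)
  have "(us @ y @ ws, us @ z @ ws) \<in> gmoves \<Gamma> \<inter> (gloops \<Gamma> b \<times> gloops \<Gamma> b) \<union> (gmoves \<Gamma> \<inter> (gloops \<Gamma> b \<times> gloops \<Gamma> b))\<inverse>"
    using step.hyps(2) assms(2,3) gmoves_context by (auto simp: gloops_def gpath_append)
  thus ?case using step.IH by (rule rtrancl_into_rtrancl[rotated])
qed simp

text \<open>The middle of the word is the inverse of the first letter of \<open>p\<close> followed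
  by that letter; moves remove this pair and leave the same situation for the rest of
  \<open>p\<close>. \<open>ghomotopy\<close> relates loops at \<open>b\<close> only, whence the
  outer paths \<open>xs\<close> and \<open>ys\<close>.\<close>

lemma hom_cancel:
  assumes "gpath \<Gamma> u p v" "gpath \<Gamma> b xs v" "gpath \<Gamma> v ys b"
  shows "xs @ gpath_inv \<Gamma> p @ p @ ys \<sim> xs @ ys"
  using assms(1)
proof (induction p arbitrary: u)
  case Nil
  thus ?case by (simp add: gpath_inv_def)
next
  case (Cons a p)
  define r where "r = xs @ gpath_inv \<Gamma> p"
  define t where "t = p @ ys"
  have eq: "xs @ gpath_inv \<Gamma> (a # p) @ (a # p) @ ys = r @ [inv_letter \<Gamma> a, a] @ t"
    by (simp add: r_def t_def gpath_inv_def)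
  have "\<exists>u'. gpath \<Gamma> u' p v \<and> r @ [inv_letter \<Gamma> a, a] @ t \<sim> r @ t"
  proof (cases a)
    case (Elt w g)
    hence p: "gpath \<Gamma> u p v" and g: "w = u" "g \<in> carrier (vgroup \<Gamma> u)" "u \<in> verts (ggraph \<Gamma>)" using Cons.prems by auto
    have r: "gpath \<Gamma> b r u" and t: "gpath \<Gamma> u t b"
      using gpath_inv[OF p] p assms(2,3) by (auto simp: gpath_append r_def t_def)
    interpret group "vgroup \<Gamma> u" by (rule vgroup[OF g(3)])
    let ?x = "[Elt u (inv\<^bsub>vgroup \<Gamma> u\<^esub> g), Elt u g]"
    have "r @ ?x @ t \<sim> r @ [Elt u (inv\<^bsub>vgroup \<Gamma> u\<^esub> g \<otimes>\<^bsub>vgroup \<Gamma> u\<^esub> g)] @ t"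
    proof (rule hom_move)
      show "(r @ ?x @ t, r @ [Elt u (inv\<^bsub>vgroup \<Gamma> u\<^esub> g \<otimes>\<^bsub>vgroup \<Gamma> u\<^esub> g)] @ t) \<in> gmoves \<Gamma>"
        unfolding gmoves_def by blast
    qed (use r t g in \<open>auto simp: gpath_append\<close>)
    also have "inv\<^bsub>vgroup \<Gamma> u\<^esub> g \<otimes>\<^bsub>vgroup \<Gamma> u\<^esub> g = \<one>\<^bsub>vgroup \<Gamma> u\<^esub>" using g(2) by simp
    finally have 1: "r @ ?x @ t \<sim> r @ [Elt u \<one>\<^bsub>vgroup \<Gamma> u\<^esub>] @ t" .
    have "r @ [Elt u \<one>\<^bsub>vgroup \<Gamma> u\<^esub>] @ t \<sim> r @ t"
    proof (rule hom_move)
      show "(r @ [Elt u \<one>\<^bsub>vgroup \<Gamma> u\<^esub>] @ t, r @ t) \<in> gmoves \<Gamma>" unfolding gmoves_def by blast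
    qed (use r t g in \<open>auto simp: gpath_append\<close>)
    hence "r @ ?x @ t \<sim> r @ t" using 1 hom_trans by blast
    thus ?thesis using p Elt g(1) by auto
  next
    case (Arc e)
    hence p: "gpath \<Gamma> (head (ggraph \<Gamma>) e) p v" and e: "e \<in> arcs (ggraph \<Gamma>)" "tail (ggraph \<Gamma>) e = u" using Cons.prems by auto
    have r: "gpath \<Gamma> b r (head (ggraph \<Gamma>) e)" and t: "gpath \<Gamma> (head (ggraph \<Gamma>) e) t b"
      using gpath_inv[OF p] p assms(2,3) by (auto simp: gpath_append r_def t_def)
    have "r @ [Arc (grev \<Gamma> e), Arc (grev \<Gamma> (grev \<Gamma> e))] @ t \<sim> r @ t"
    proof (rule hom_move)
      show "(r @ [Arc (grev \<Gamma> e), Arc (grev \<Gamma> (grev \<Gamma> e))] @ t, r @ t) \<in> gmoves \<Gamma>" unfolding gmoves_def by blast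
    qed (use r t grev[OF e(1)] e in \<open>auto simp: gpath_append grev_grev\<close>)
    thus ?thesis using p Arc by (auto simp: grev_grev)
  qed
  then obtain u' where u': "gpath \<Gamma> u' p v" "r @ [inv_letter \<Gamma> a, a] @ t \<sim> r @ t" by blast
  have "r @ t \<sim> xs @ ys" using Cons.IH[OF u'(1)] by (simp add: r_def t_def)
  thus ?case unfolding eq using u'(2) hom_trans by blast
qed

lemma hom_loop: "xs \<sim> ys \<Longrightarrow> gpath \<Gamma> b xs b \<Longrightarrow> gpath \<Gamma> b ys b"
  unfolding ghomotopy_def Let_def by (induction rule: rtrancl_induct) (auto simp: gloops_def)

abbreviation cls :: "('a, 'b, 'g) letter list \<Rightarrow> ('a, 'b, 'g) letter list set" where
  "cls xs \<equiv> ghomotopy \<Gamma> b `` {xs}"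

lemma cls_eqI: "xs \<sim> ys \<Longrightarrow> cls xs = cls ys"
  using hom_sym hom_trans by blast

lemma pi1_carrier: "carrier (pi1 \<Gamma> b) = cls ` {xs. gpath \<Gamma> b xs b}"
  by (auto simp: pi1_def quotient_def gloops_def)

lemma pi1_one: "\<one>\<^bsub>pi1 \<Gamma> b\<^esub> = cls []" by (simp add: pi1_def)

lemma pi1_mult:
  assumes "gpath \<Gamma> b xs b" "gpath \<Gamma> b ys b"
  shows "cls xs \<otimes>\<^bsub>pi1 \<Gamma> b\<^esub> cls ys = cls (xs @ ys)"
proof -
  have "cls (p @ q) = cls (xs @ ys)" if "xs \<sim> p" "ys \<sim> q" for p q
  proof -
    have nil: "gpath \<Gamma> b [] b" using base by simp
    have "xs @ ys \<sim> p @ ys" using hom_context[OF that(1) nil assms(2)] by simp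
    moreover have "p @ ys \<sim> p @ q" using hom_context[OF that(2) hom_loop[OF that(1) assms(1)] nil] by simp
    ultimately show ?thesis using hom_trans cls_eqI by metis
  qed
  hence "(\<Union>p\<in>cls xs. \<Union>q\<in>cls ys. cls (p @ q)) = cls (xs @ ys)"
    using hom_refl by blast
  thus ?thesis by (simp add: pi1_def)
qed

lemma pi1_in: "gpath \<Gamma> b xs b \<Longrightarrow> cls xs \<in> carrier (pi1 \<Gamma> b)"
  by (auto simp: pi1_carrier)

text \<open>
  Finitely many walks from a vertex \<open>r\<close>, to fixed vertices of the vertex groups and to the translates of
  \<open>r\<close> under loops through the arcs, sweep out an invariant subtree, because these elements generate
  the fundamental group.
\<close>

lemma cocompact:
  fixes T :: "(('a, 'b, 'g) letter list set, 'v) mtree"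
  assumes min: "minimal_tree (pi1 \<Gamma> b) T"
    and ell: "\<And>p v. gpath \<Gamma> b p v \<Longrightarrow> carrier (vgroup \<Gamma> v) \<noteq> {\<one>\<^bsub>vgroup \<Gamma> v\<^esub>} \<Longrightarrow>
      \<exists>x\<in>sverts T. \<forall>h\<in>vertex_subgroup \<Gamma> b p v. act T h x = x"
  shows "\<exists>E0. finite E0 \<and> E0 \<subseteq> sedges T \<and> (\<forall>e\<in>sedges T. \<exists>h\<in>carrier (pi1 \<Gamma> b). \<exists>e0\<in>E0. e = act T h ` e0)"
    and "\<exists>V0. finite V0 \<and> V0 \<subseteq> sverts T \<and> (\<forall>v\<in>sverts T. \<exists>h\<in>carrier (pi1 \<Gamma> b). \<exists>v0\<in>V0. v = act T h v0)"
proof -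
  let ?G = "pi1 \<Gamma> b" and ?V = "verts (ggraph \<Gamma>)" and ?A = "arcs (ggraph \<Gamma>)"
  have mt: "metric_tree ?G T" by (rule conjunct1[OF min[unfolded minimal_tree_def]])
  interpret T: mtree ?G T by (rule metric_tree_mtree[OF mt])
  obtain r where r: "r \<in> sverts T"
    using conjunct1[OF conjunct1[OF mt[unfolded metric_tree_def], unfolded simplicial_tree_def]] by blast
  \<comment> \<open>With the empty path at the base point, \<open>gen\<close> below speaks about
    every loop when \<open>v = b\<close>.\<close>
  have "\<exists>q. gpath \<Gamma> b q v \<and> (v = b \<longrightarrow> q = [])" if "v \<in> ?V" for v
    using gpath_ex[OF that] base by (cases "v = b") auto
  hence "\<exists>p. \<forall>v\<in>?V. gpath \<Gamma> b (p v) v \<and> (v = b \<longrightarrow> p v = [])" by (intro bchoice) blast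
  then obtain p where p: "\<And>v. v \<in> ?V \<Longrightarrow> gpath \<Gamma> b (p v) v" and pb: "p b = []" using base by blast
  let ?nt = "\<lambda>v. v \<in> ?V \<and> carrier (vgroup \<Gamma> v) \<noteq> {\<one>\<^bsub>vgroup \<Gamma> v\<^esub>}"
  have "\<exists>x. \<forall>v\<in>{v. ?nt v}. x v \<in> sverts T \<and> (\<forall>h\<in>vertex_subgroup \<Gamma> b (p v) v. act T h (x v) = x v)"
    using ell p by (intro bchoice) blast
  then obtain x where x: "\<And>v. ?nt v \<Longrightarrow> x v \<in> sverts T"
    "\<And>v h. ?nt v \<Longrightarrow> h \<in> vertex_subgroup \<Gamma> b (p v) v \<Longrightarrow> act T h (x v) = x v" by blast
  define s where "s e = p (tail (ggraph \<Gamma>) e) @ [Arc e] @ gpath_inv \<Gamma> (p (head (ggraph \<Gamma>) e))" for e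
  have s: "gpath \<Gamma> b (s e) b" if "e \<in> ?A" for e
    using p gpath_inv arc_verts[OF that] that unfolding s_def by (auto simp: gpath_append)
  have "\<exists>F. \<forall>v\<in>{v. ?nt v}. finite (F v) \<and> F v \<subseteq> sedges T \<and> joined (F v) r (x v)"
    using finite_adj[OF T.conn[OF r x(1)]] by (intro bchoice) blast
  then obtain F where F: "\<And>v. ?nt v \<Longrightarrow> finite (F v) \<and> F v \<subseteq> sedges T \<and> joined (F v) r (x v)" by blast
  have "\<exists>D. \<forall>e\<in>?A. finite (D e) \<and> D e \<subseteq> sedges T \<and> joined (D e) r (act T (cls (s e)) r)"
    using finite_adj[OF T.conn[OF r T.act_closed[OF pi1_in[OF s] r]]] by (intro bchoice) blast
  then obtain D where D: "\<And>e. e \<in> ?A \<Longrightarrow> finite (D e) \<and> D e \<subseteq> sedges T \<and> joined (D e) r (act T (cls (s e)) r)" by blast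
  define E0 where "E0 = (\<Union>v\<in>{v. ?nt v}. F v) \<union> (\<Union>e\<in>?A. D e)"
  have finV: "finite ?V" "finite ?A"
    using fin_digraph.finite_verts[OF fd] fin_digraph.finite_arcs[OF fd] by auto
  have E0: "finite E0" "E0 \<subseteq> sedges T" using finV F D unfolding E0_def by auto
  let ?E = "T.sweep E0"
  have ext: "E0 \<subseteq> ?E" by (rule T.sweep_ext[OF E0(2)])
  have move: "joined ?E (act T h u) (act T h w)" if "joined ?E u w" "h \<in> carrier ?G" for h u w
    using T.act_adj[OF that(1)] T.sweep_act[OF E0(2) that(2)] by blast
  define good where "good h \<longleftrightarrow> joined ?E r (act T h r)" for h
  have good_mult: "good (g \<otimes>\<^bsub>?G\<^esub> h)" if "good g" "good h" "g \<in> carrier ?G" "h \<in> carrier ?G" for g h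
  proof -
    have "joined ?E (act T g r) (act T (g \<otimes>\<^bsub>?G\<^esub> h) r)"
      using move[OF that(2)[unfolded good_def] that(3)] T.act_mult[OF that(3,4) r] by simp
    thus ?thesis using that(1) unfolding good_def by (auto intro: rtrancl_trans)
  qed
  have good_arc: "good (cls (s e))" if "e \<in> ?A" for e
  proof -
    have "D e \<subseteq> ?E" using that ext unfolding E0_def by blast
    thus ?thesis using D[OF that] unfolding good_def by (blast intro: adj_mono)
  qed
  \<comment> \<open>\<open>h\<close> fixes \<open>x v\<close>, so a walk from \<open>r\<close> to
    \<open>x v\<close> and the translate of this walk run backwards lead from \<open>r\<close> to
    its image.\<close>
  have good_elt: "good h" if v: "?nt v" and h: "h \<in> vertex_subgroup \<Gamma> b (p v) v" "h \<in> carrier ?G" for h v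
  proof -
    have "F v \<subseteq> ?E" using v ext unfolding E0_def by blast
    hence c: "joined ?E r (x v)" using F[OF v] by (blast intro: adj_mono)
    have "joined ?E (act T h r) (x v)" using move[OF c h(2)] x(2)[OF v h(1)] by simp
    thus ?thesis using c adj_sym rtrancl_trans unfolding good_def by metis
  qed
  \<comment> \<open>A path is closed up by the chosen path of its end. Appending a letter then
    multiplies by the class of a generator: a loop through an arc or an element of a vertex
    group.\<close>
  have gen: "good (cls (xs @ gpath_inv \<Gamma> (p v)))" if "gpath \<Gamma> b xs v" for xs v
    using that
  proof (induction xs arbitrary: v rule: rev_induct)
    case Nil
    hence "v = b" by simp
    thus ?case using pb T.act_one[OF r] unfolding good_def by (simp add: gpath_inv_def pi1_one)
  next
    case (snoc a xs)
    then obtain u where u: "gpath \<Gamma> b xs u" and a: "gpath \<Gamma> u [a] v" by (auto simp: gpath_append)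
    have uV: "u \<in> ?V" "v \<in> ?V" using gpath_end[OF u] gpath_end[OF a] .
    have l1: "gpath \<Gamma> b (xs @ gpath_inv \<Gamma> (p u)) b" using u gpath_inv[OF p[OF uV(1)]] by (auto simp: gpath_append)
    have l2: "gpath \<Gamma> b (p u @ [a] @ gpath_inv \<Gamma> (p v)) b"
      unfolding gpath_append using a gpath_inv[OF p[OF uV(2)]] p[OF uV(1)] by blast
    have "gpath \<Gamma> u ([a] @ gpath_inv \<Gamma> (p v)) b" unfolding gpath_append using a gpath_inv[OF p[OF uV(2)]] by blast
    hence "cls (xs @ gpath_inv \<Gamma> (p u) @ p u @ [a] @ gpath_inv \<Gamma> (p v)) = cls (xs @ [a] @ gpath_inv \<Gamma> (p v))"
      by (intro cls_eqI hom_cancel[OF p[OF uV(1)] u])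
    hence split: "cls ((xs @ [a]) @ gpath_inv \<Gamma> (p v)) =
        cls (xs @ gpath_inv \<Gamma> (p u)) \<otimes>\<^bsub>?G\<^esub> cls (p u @ [a] @ gpath_inv \<Gamma> (p v))"
      using pi1_mult[OF l1 l2] by simp
    have "good (cls (p u @ [a] @ gpath_inv \<Gamma> (p v)))"
    proof (cases a)
      case (Arc e)
      hence "e \<in> ?A" "u = tail (ggraph \<Gamma>) e" "v = head (ggraph \<Gamma>) e" using a by auto
      thus ?thesis using good_arc[of e] Arc unfolding s_def by simp
    next
      case (Elt w g)
      hence w: "w = u" "v = u" "g \<in> carrier (vgroup \<Gamma> u)" using a by auto
      show ?thesis
      proof (cases "?nt u")
        case True
        have "cls (p u @ [a] @ gpath_inv \<Gamma> (p v)) \<in> vertex_subgroup \<Gamma> b (p u) u"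
          using w Elt unfolding vertex_subgroup_def by blast
        thus ?thesis using good_elt[OF True] pi1_in[OF l2] by blast
      next
        case False
        hence g: "g = \<one>\<^bsub>vgroup \<Gamma> u\<^esub>" using w uV by auto
        have l3: "gpath \<Gamma> b (p u @ gpath_inv \<Gamma> (p u)) b" using p[OF uV(1)] gpath_inv by (auto simp: gpath_append)
        have "cls (p u @ [a] @ gpath_inv \<Gamma> (p v)) = cls (p u @ gpath_inv \<Gamma> (p u))"
        proof (rule cls_eqI, rule hom_move[OF _ l2 l3])
          show "(p u @ [a] @ gpath_inv \<Gamma> (p v), p u @ gpath_inv \<Gamma> (p u)) \<in> gmoves \<Gamma>"
            unfolding gmoves_def Elt w g by blast
        qed
        also have "\<dots> = cls []" using hom_cancel[OF gpath_inv[OF p[OF uV(1)]], of "[]" "[]"] base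
          by (intro cls_eqI) (simp add: gpath_inv_inv[OF p[OF uV(1)]])
        finally show ?thesis using T.act_one[OF r] unfolding good_def by (simp add: pi1_one)
      qed
    qed
    thus ?case unfolding split using good_mult snoc.IH[OF u] pi1_in[OF l1] pi1_in[OF l2] by blast
  qed
  have "good h" if h: "h \<in> carrier ?G" for h
  proof -
    obtain xs where xs: "h = cls xs" "gpath \<Gamma> b xs b" using h by (auto simp: pi1_carrier)
    thus ?thesis using gen[OF xs(2)] pb by (simp add: gpath_inv_def)
  qed
  hence "\<And>h. h \<in> carrier ?G \<Longrightarrow> joined ?E r (act T h r)" by (simp add: good_def)
  thus "\<exists>E0. finite E0 \<and> E0 \<subseteq> sedges T \<and> (\<forall>e\<in>sedges T. \<exists>h\<in>carrier ?G. \<exists>e0\<in>E0. e = act T h ` e0)"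
    and "\<exists>V0. finite V0 \<and> V0 \<subseteq> sverts T \<and> (\<forall>v\<in>sverts T. \<exists>h\<in>carrier ?G. \<exists>v0\<in>V0. v = act T h v0)"
    using T.finite_orbits[OF min E0 r] by blast+
qed

end

section \<open>Jumping\<close>

text \<open>If the stabiliser of \<open>v\<close> is the conjugate of \<open>V\<close> by
  \<open>h\<close>, then \<open>V\<close> fixes the translate of \<open>v\<close> by the inverse of
  \<open>h\<close>.\<close>

lemma (in mgraph) conjugate_stab_fixes:
  assumes v: "v \<in> sverts T" and conj: "conjugate_subgroup G (vstab G T v) V" and V: "V \<subseteq> carrier G"
  shows "\<exists>x\<in>sverts T. \<forall>k\<in>V. act T k x = x"
proof -
  obtain h where h: "h \<in> carrier G" "vstab G T v = (\<lambda>x. h \<otimes> x \<otimes> inv h) ` V"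
    using conj unfolding conjugate_subgroup_def by blast
  have "act T k (act T (inv h) v) = act T (inv h) v" if k: "k \<in> V" for k
  proof -
    have kc: "k \<in> carrier G" using k V by blast
    have "h \<otimes> k \<otimes> inv h \<in> vstab G T v" using h(2) k by blast
    hence "act T (h \<otimes> k \<otimes> inv h) v = v" by (simp add: stabilizer_def)
    hence "act T h (act T k (act T (inv h) v)) = v" using h(1) kc v by (simp add: act_mult act_closed)
    hence "act T (inv h) (act T h (act T k (act T (inv h) v))) = act T (inv h) v" by simp
    thus ?thesis using act_inv_act[OF h(1)] h(1) kc v by (simp add: act_closed)
  qed
  thus ?thesis using act_closed[OF inv_in[OF h(1)] v] by blast
qed

lemma outer_space_cocompact:
  fixes X :: "('i, ('a, 'b, 'g) letter list set, 'v) forest"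
  assumes sys: "gog_system I \<Gamma> b" and S: "S = gog_splitting I \<Gamma> b" and X: "X \<in> outer_space S" and i: "i \<in> idx S"
  shows "\<exists>E0. finite E0 \<and> E0 \<subseteq> sedges (X i) \<and>
      (\<forall>e\<in>sedges (X i). \<exists>h\<in>carrier (grp S i). \<exists>e0\<in>E0. e = act (X i) h ` e0)"
    and "\<exists>V0. finite V0 \<and> V0 \<subseteq> sverts (X i) \<and>
      (\<forall>v\<in>sverts (X i). \<exists>h\<in>carrier (grp S i). \<exists>v0\<in>V0. v = act (X i) h v0)"
proof -
  have iI: "i \<in> I" and grp: "grp S i = pi1 (\<Gamma> i) (b i)" using i by (simp_all add: S gog_splitting_def)
  interpret gog "\<Gamma> i" "b i"
    by (rule gog.intro) (use sys iI in \<open>auto simp: gog_system_def\<close>)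
  have min': "minimal_tree (grp S i) (X i)"
    and vg: "\<And>V. V \<in> vgrps S i \<Longrightarrow> \<exists>v\<in>sverts (X i).
      {w \<in> sverts (X i). conjugate_subgroup (grp S i) (vstab (grp S i) (X i) w) V} = vorbit (grp S i) (X i) v"
    using X i unfolding outer_space_def by blast+
  note min = min'[unfolded grp]
  interpret T: mtree "grp S i" "X i"
    unfolding grp by (rule metric_tree_mtree[OF conjunct1[OF min[unfolded minimal_tree_def]]])
  have ell: "\<exists>x\<in>sverts (X i). \<forall>h\<in>vertex_subgroup (\<Gamma> i) (b i) p v. act (X i) h x = x"
    if p: "gpath (\<Gamma> i) (b i) p v" and nt: "carrier (vgroup (\<Gamma> i) v) \<noteq> {\<one>\<^bsub>vgroup (\<Gamma> i) v\<^esub>}" for p v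
  proof -
    let ?V = "vertex_subgroup (\<Gamma> i) (b i) p v"
    have "?V \<in> vgrps S i" using p nt unfolding S gog_splitting_def by auto
    then obtain x where x: "x \<in> sverts (X i)"
      "{w \<in> sverts (X i). conjugate_subgroup (grp S i) (vstab (grp S i) (X i) w) ?V} = vorbit (grp S i) (X i) x"
      using vg by blast
    have "x \<in> vorbit (grp S i) (X i) x" using T.act_one[OF x(1)] T.one_in
      unfolding orbit_def mem_Collect_eq by metis
    hence "conjugate_subgroup (grp S i) (vstab (grp S i) (X i) x) ?V" using x(2) by blast
    moreover have "?V \<subseteq> carrier (grp S i)"
      using pi1_in p gpath_inv[OF p] gpath_end[OF p] unfolding grp vertex_subgroup_def by (auto simp: gpath_append)
    ultimately show ?thesis using T.conjugate_stab_fixes[OF x(1)] by blast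
  qed
  show "\<exists>E0. finite E0 \<and> E0 \<subseteq> sedges (X i) \<and>
      (\<forall>e\<in>sedges (X i). \<exists>h\<in>carrier (grp S i). \<exists>e0\<in>E0. e = act (X i) h ` e0)"
    unfolding grp by (rule cocompact(1)[OF min ell])
  show "\<exists>V0. finite V0 \<and> V0 \<subseteq> sverts (X i) \<and>
      (\<forall>v\<in>sverts (X i). \<exists>h\<in>carrier (grp S i). \<exists>v0\<in>V0. v = act (X i) h v0)"
    unfolding grp by (rule cocompact(2)[OF min ell])
qed

section \<open>Points of the closed simplex\<close>

locale simplex_system = aut_system S \<phi> for S :: "('i, 'h) splitting" and \<phi> +
  fixes X :: "('i, 'h, 'v) forest"
  assumes fin_idx: "finite (idx S)"
    and graph: "i \<in> idx S \<Longrightarrow> mtree (grp S i) (X i)"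
    and orbits: "i \<in> idx S \<Longrightarrow> \<exists>E0. finite E0 \<and> E0 \<subseteq> sedges (X i) \<and>
      (\<forall>e\<in>sedges (X i). \<exists>h\<in>carrier (grp S i). \<exists>e0\<in>E0. e = act (X i) h ` e0)"
begin

lemma X_simplex: "X \<in> open_simplex S X"
  using mgraph.len_pos[OF mtree.axioms(1)[OF graph]] mgraph.len_act[OF mtree.axioms(1)[OF graph]]
  unfolding open_simplex_def equivariant_length_def by simp

lemma simplex_eq:
  assumes "Y \<in> open_simplex S X" shows "open_simplex S Y = open_simplex S X"
proof -
  have Y: "Y i = (X i)\<lparr>len := len (Y i)\<rparr>" if "i \<in> idx S" for i using assms that unfolding open_simplex_def by blast
  have "(Z i = (Y i)\<lparr>len := len (Z i)\<rparr>) = (Z i = (X i)\<lparr>len := len (Z i)\<rparr>)" if "i \<in> idx S" for Z :: "('i, 'h, 'v) forest" and i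
    by (subst Y[OF that]) simp
  thus ?thesis unfolding open_simplex_def by simp
qed

lemma simplex_sel:
  assumes "Y \<in> open_simplex S X" "i \<in> idx S"
  shows "sverts (Y i) = sverts (X i)" "sedges (Y i) = sedges (X i)" "act (Y i) = act (X i)" "mtree (grp S i) (Y i)"
proof -
  have Y: "Y i = (X i)\<lparr>len := len (Y i)\<rparr>" "equivariant_length (grp S i) (Y i)"
    using assms unfolding open_simplex_def by blast+
  show "sverts (Y i) = sverts (X i)" "sedges (Y i) = sedges (X i)" "act (Y i) = act (X i)" by (subst Y(1), simp)+
  show "mtree (grp S i) (Y i)" by (subst Y(1), rule mtree_len[OF graph[OF assms(2)]]) (use Y in simp)
qed

lemma collapse_system:
  assumes Y: "Y \<in> open_simplex S X" and A: "proper_subgraph S X A"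
    and bord: "collapse Y A \<in> bordification S" and inv: "invariant_subgraph S \<phi> Y A"
  shows "collapse_system S \<phi> Y A"
proof (intro collapse_system.intro aut_system_axioms collapse_system_axioms.intro)
  show "finite (idx S)" by (rule fin_idx)
  show "idx S \<noteq> {}" using A unfolding proper_subgraph_def by blast
  show "invariant_subgraph S \<phi> Y A" by (rule inv)
  fix i assume i: "i \<in> idx S"
  note sel = simplex_sel[OF Y i]
  have "subgraph_of (grp S i) (X i) (A i)" using A i unfolding proper_subgraph_def by blast
  hence sub: "subgraph_of (grp S i) (Y i) (A i)" unfolding subgraph_of_def sel .
  have "minimal_tree (grp S i) (collapse Y A i)" using bord i unfolding bordification_def by blast
  hence "metric_tree (grp S i) (collapse_tree (Y i) (A i))" unfolding minimal_tree_def collapse_def by blast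
  thus "ctree (grp S i) (Y i) (A i)"
    using sub sel(4) metric_tree_mtree by (intro ctree.intro sgtree.intro sgtree_axioms.intro ctree_axioms.intro)
  show "\<exists>E0. finite E0 \<and> E0 \<subseteq> sedges (Y i) \<and>
      (\<forall>e\<in>sedges (Y i). \<exists>h\<in>Gc i. \<exists>e0\<in>E0. e = act (Y i) h ` e0)"
    unfolding sel by (rule orbits[OF i])
qed

lemma tendsto_collapse:
  assumes Y: "Y \<in> open_simplex S X" and A: "proper_subgraph S X A"
    and Q: "\<forall>i\<in>idx S. \<forall>e\<in>sedges (Y i). (\<lambda>n. len (Q n i) e) \<longlonglongrightarrow> (if e \<in> sedges (A i) then 0 else len (Y i) e)"
  shows "simplex_tendsto S X Q (collapse Y A)"
  using assms simplex_sel(2)[OF Y] unfolding simplex_tendsto_def by metis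

text \<open>A point of the closed simplex is \<open>Y/A\<close> for some \<open>Y\<close> in the
  simplex, which need not be \<open>X\<close>; but \<open>Y\<close> spans the same simplex, so the
  construction is run from \<open>Y\<close>. If the value at the point is at least the infimum,
  nearly optimal points of the simplex provide the maps of \<open>A\<close>.\<close>

lemma not_jumped_invariant:
  assumes Y: "Y \<in> open_simplex S X" and A: "proper_subgraph S X A"
    and bord: "collapse Y A \<in> bordification S" and inv: "invariant_subgraph S \<phi> Y A"
    and le: "simplex_displacement S \<phi> X \<le> displacement S \<phi> (collapse Y A)"
  shows "not_jumped S \<phi> X (collapse Y A)"
proof -
  interpret C: collapse_system S \<phi> Y A by (rule collapse_system[OF Y A bord inv])
  have "closure_displacement S \<phi> X (collapse Y A) = displacement S \<phi> (collapse Y A)"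
    using Y A inv unfolding closure_displacement_def by auto
  moreover obtain Q where Q: "\<And>n. Q n \<in> open_simplex S Y"
    "\<forall>i\<in>idx S. \<forall>e\<in>sedges (Y i). (\<lambda>n. len (Q n i) e) \<longlonglongrightarrow> (if e \<in> sedges (A i) then 0 else len (Y i) e)"
    "(\<lambda>n. displacement S \<phi> (Q n)) \<longlonglongrightarrow> displacement S \<phi> (collapse Y A)"
  proof (rule exE[OF C.converging_sequence])
    fix L assume "displacement S \<phi> (collapse Y A) < ereal L"
    hence "simplex_displacement S \<phi> X < ereal L" using le by (rule le_less_trans[rotated])
    then obtain Z where Z: "Z \<in> open_simplex S Y" "displacement S \<phi> Z < ereal L"
      unfolding simplex_displacement_def INF_less_iff simplex_eq[OF Y] by blast
    show "C.core_chains L"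
      by (rule C.chains_from_simplex[OF Z])
  qed (elim conjE, blast)
  ultimately show ?thesis using tendsto_collapse[OF Y A Q(2)] unfolding not_jumped_def simplex_eq[OF Y] by metis
qed

text \<open>This covers boundary points whose value is infinite for lack of an invariant subgraph.
  If the infimum is infinite too, the displacement is infinite on the whole simplex and every
  sequence that shrinks \<open>A\<close> will do.\<close>

lemma not_jumped_infinite:
  assumes Y: "Y \<in> open_simplex S X" and A: "proper_subgraph S X A"
    and inf: "simplex_displacement S \<phi> X = \<infinity>" "closure_displacement S \<phi> X (collapse Y A) = \<infinity>"
  shows "not_jumped S \<phi> X (collapse Y A)"
proof -
  define Q where "Q n i = (X i)\<lparr>len := \<lambda>e. if e \<in> sedges (A i) then len (Y i) e / real (Suc n) else len (Y i) e\<rparr>" for n i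
  have Q: "Q n \<in> open_simplex S X" for n
    unfolding open_simplex_def mem_Collect_eq
  proof (intro ballI conjI)
    fix i assume i: "i \<in> idx S"
    show "Q n i = (X i)\<lparr>len := len (Q n i)\<rparr>" by (simp add: Q_def)
    interpret sgtree "grp S i" "X i" "A i"
      using graph[OF i] A i unfolding proper_subgraph_def by (intro sgtree.intro sgtree_axioms.intro) blast+
    interpret Y: mtree "grp S i" "Y i" by (rule simplex_sel(4)[OF Y i])
    show "equivariant_length (grp S i) (Q n i)"
      using Y.len_pos Y.len_act A_act_iff unfolding equivariant_length_def Q_def simplex_sel[OF Y i] by simp
  qed
  have "(\<lambda>n. len (Q n i) e) \<longlonglongrightarrow> (if e \<in> sedges (A i) then 0 else len (Y i) e)" for i e
    using LIMSEQ_Suc[OF lim_const_over_n[of "len (Y i) e"]] by (simp add: Q_def)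
  hence "simplex_tendsto S X Q (collapse Y A)" by (intro tendsto_collapse[OF Y A]) blast
  moreover
  have "displacement S \<phi> (Q n) = \<infinity>" for n
    using inf(1) INF_lower[OF Q[of n], of "displacement S \<phi>"] unfolding simplex_displacement_def by simp
  hence "(\<lambda>n. displacement S \<phi> (Q n)) \<longlonglongrightarrow> \<infinity>" by simp
  ultimately show ?thesis using Q unfolding not_jumped_def inf(2) by blast
qed

end

theorem theorem5p14:
  fixes I :: "'i set"
    and \<Gamma> :: "'i \<Rightarrow> ('a, 'b, 'g) graph_of_groups"
    and b :: "'i \<Rightarrow> 'a"
    and S :: "('i, ('a, 'b, 'g) letter list set) splitting"
    and \<phi> :: "('i, ('a, 'b, 'g) letter list set) system_map"
    and X :: "('i, ('a, 'b, 'g) letter list set, 'v) forest"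
    and A :: "'i \<Rightarrow> 'v sgraph"
    and J :: "('i \<times> 'v set) set"
    and \<psi> :: "('i \<times> 'v set, ('a, 'b, 'g) letter list set) system_map"
    and Xinf :: "('i, ('a, 'b, 'g) letter list set, 'v set) forest"
    and lam_C lam_D lam_inf :: ereal
  assumes "gog_system I \<Gamma> b"
    and "S = gog_splitting I \<Gamma> b"
    and "\<phi> \<in> Aut S"
    and "X \<in> outer_space S"
    and "proper_subgraph S X A"
    and "invariant_subgraph S \<phi> X A"
    and "Xinf = collapse X A"
    and "Xinf \<in> simplex_boundary S X"
    and "core_representatives S X A J"
    and "induced_on_core S \<phi> X J \<psi>"
    and "lam_C = simplex_displacement (core_splitting S X J) \<psi> (core_forest S X A J)"
    and "lam_D = simplex_displacement S \<phi> X"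
    and "lam_inf = closure_displacement S \<phi> X Xinf"
  shows "lam_C \<le> lam_D \<and>
    (not_jumped S \<phi> X Xinf \<longleftrightarrow> lam_inf \<ge> lam_D) \<and>
    (lam_inf \<ge> lam_D \<longleftrightarrow> lam_inf \<ge> lam_C) \<and>
    lam_inf \<notin> {lam_C<..<lam_D} \<and>
    (\<forall>P\<in>simplex_closure S X. closure_displacement S \<phi> X P = lam_D \<longrightarrow> not_jumped S \<phi> X P)"
proof -
  have tree: "mtree (grp S i) (X i)" if "i \<in> idx S" for i
  proof (rule metric_tree_mtree)
    show "metric_tree (grp S i) (X i)" using assms(4) that unfolding outer_space_def minimal_tree_def by blast
  qed
  interpret s: simplex_system S \<phi> X
  proof (intro simplex_system.intro aut_system.intro simplex_system_axioms.intro)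
    show "finite (idx S)" using assms(1,2) by (simp add: gog_system_def gog_splitting_def)
    fix i assume i: "i \<in> idx S"
    show "mtree (grp S i) (X i)" by (rule tree[OF i])
    show "group (grp S i)" using mgraph.grp[OF mtree.axioms(1)[OF tree[OF i]]] .
    have "bij_betw (perm \<phi>) (idx S) (idx S)" and iso: "maps \<phi> i \<in> iso (grp S i) (grp S (perm \<phi> i))"
      using assms(3) i unfolding Aut_def by blast+
    thus "perm \<phi> i \<in> idx S" using i bij_betwE by blast
    show "maps \<phi> i \<in> hom (grp S i) (grp S (perm \<phi> i))" "inj_on (maps \<phi> i) (carrier (grp S i))"
      using iso by (auto simp: iso_def bij_betw_def)
    show "\<exists>E0. finite E0 \<and> E0 \<subseteq> sedges (X i) \<and>
        (\<forall>e\<in>sedges (X i). \<exists>h\<in>carrier (grp S i). \<exists>e0\<in>E0. e = act (X i) h ` e0)"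
      by (rule outer_space_cocompact(1)[OF assms(1,2,4) i])
  qed
  have out: "Xinf \<notin> outer_space S" and bord: "collapse X A \<in> bordification S"
    using assms(7,8) unfolding simplex_boundary_def simplex_closure_def by auto
  interpret c: core_system S \<phi> X A J \<psi>
  proof (intro core_system.intro core_system_axioms.intro)
    show "collapse_system S \<phi> X A" by (rule s.collapse_system[OF s.X_simplex assms(5) bord assms(6)])
  qed (rule assms(9) assms(10) outer_space_cocompact(2)[OF assms(1,2,4)]; assumption?)+
  have inf: "lam_inf = displacement S \<phi> (collapse X A)"
    using s.X_simplex assms(5,6) unfolding assms(13,7) closure_displacement_def by auto
  have CD: "lam_C \<le> lam_D" unfolding assms(11,12) by (rule c.core_displacement_le)
  \<comment> \<open>The circle of equivalences: (1) gives (2) because displacements in the simplex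
    are bounded below by the infimum, (2) gives (3) by \<open>CD\<close>, and (3) gives (1) by the
    sequence built from maps of the core.\<close>
  have 12: "lam_D \<le> lam_inf" if nj: "not_jumped S \<phi> X Xinf"
  proof -
    obtain Q where Q: "\<And>n. Q n \<in> open_simplex S X" "(\<lambda>n. displacement S \<phi> (Q n)) \<longlonglongrightarrow> lam_inf"
      using nj out unfolding not_jumped_def assms(13) by blast
    have "\<forall>\<^sub>F n in sequentially. lam_D \<le> displacement S \<phi> (Q n)"
      unfolding assms(12) simplex_displacement_def by (intro always_eventually allI INF_lower Q(1))
    thus ?thesis using tendsto_lowerbound[OF Q(2)] by simp
  qed
  have 31: "not_jumped S \<phi> X Xinf" if le: "lam_C \<le> lam_inf"
  proof -
    obtain Q where Q: "\<And>n. Q n \<in> open_simplex S X"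
      "\<forall>i\<in>idx S. \<forall>e\<in>sedges (X i). (\<lambda>n. len (Q n i) e) \<longlonglongrightarrow> (if e \<in> sedges (A i) then 0 else len (X i) e)"
      "(\<lambda>n. displacement S \<phi> (Q n)) \<longlonglongrightarrow> displacement S \<phi> (collapse X A)"
    proof (rule exE[OF c.converging_sequence])
      fix L assume L: "displacement S \<phi> (collapse X A) < ereal L"
      hence "simplex_displacement (core_splitting S X J) \<psi> (core_forest S X A J) < ereal L"
        using le unfolding inf assms(11) by (rule le_less_trans[rotated])
      \<comment> \<open>\<open>L\<close> lies strictly above a displacement, and displacements are
        non-negative.\<close>
      moreover have "0 < L"
        using L c.displacement_nonneg[OF c.D_graph] by (metis ereal_less(2) le_less_trans)
      ultimately show "c.core_chains L"
        by (rule c.chains_from_core)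
    qed (elim conjE, blast)
    thus ?thesis
      using s.tendsto_collapse[OF s.X_simplex assms(5) Q(2)] unfolding not_jumped_def assms(13)[symmetric] inf unfolding assms(7) by blast
  qed
  \<comment> \<open>Three kinds of points: those of outer space, by convention; those with an
    invariant representative, by the criterion just used for simplices; the others, where the value
    is infinite.\<close>
  have last: "not_jumped S \<phi> X P" if P: "P \<in> simplex_closure S X" and eq: "closure_displacement S \<phi> X P = lam_D" for P
  proof (cases "P \<in> outer_space S")
    case True
    thus ?thesis by (simp add: not_jumped_def)
  next
    case False
    have Pb: "P \<in> bordification S" using P unfolding simplex_closure_def by blast
    show ?thesis
    proof (cases "\<exists>Y\<in>open_simplex S X. \<exists>A. proper_subgraph S X A \<and> P = collapse Y A \<and> invariant_subgraph S \<phi> Y A")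
      case True
      then obtain Y A' where Y: "Y \<in> open_simplex S X" "proper_subgraph S X A'" "P = collapse Y A'"
        "invariant_subgraph S \<phi> Y A'" by blast
      have "closure_displacement S \<phi> X P = displacement S \<phi> P" unfolding closure_displacement_def using True by simp
      hence "simplex_displacement S \<phi> X \<le> displacement S \<phi> (collapse Y A')" using eq Y(3) assms(12) by simp
      thus ?thesis using s.not_jumped_invariant[OF Y(1,2) _ Y(4)] Pb Y(3) by simp
    next
      case no: False
      obtain Y A' where Y: "Y \<in> open_simplex S X" "proper_subgraph S X A'" "P = collapse Y A'"
        using P unfolding simplex_closure_def by blast
      have "closure_displacement S \<phi> X P = \<infinity>" unfolding closure_displacement_def by (rule if_not_P) (use no False in blast)
      thus ?thesis using s.not_jumped_infinite[OF Y(1,2)] eq Y(3) assms(12) by simp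
    qed
  qed
  show ?thesis using CD 12 31 last by (auto dest: order_trans)
qed

end
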